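(* Let $G$ be a locally compact group. The following are equivalent: (i) $G$ is amenable; (ii) $\mathcal{E}_r(G)=\mathcal{E}(G)$; (iii) $1\in\mathcal{E}_r(G)$; (iv) $\mathrm{M}(G^{\mathcal{E}_r}\setminus\{0\})\cong\mathcal{E}_r(G)^*$ and $\mathrm{M}(G^{\mathcal{E}})\cong\mathcal{E}(G)^*$ are isomorphic dual Banach algebras; (v) $\mathrm{M}(G^{\mathcal{E}_r}\setminus\{0\})\cong\mathcal{E}_r(G)^*$ admits a weak* continuous character; (vi) $\sigma\leq_{we}\lambda$ for some $\sigma\in\hat{G}_F$; (vii) $\pi\leq_{we}\lambda$ for every continuous unitary representation $\pi$ of $G$. If we further assume that $\hat{G}_F\setminus\{1\}\neq\varnothing$, then (i)–(vii) are equivalent to each of: (viii) $(\sigma,G^\sigma)\leq(\varepsilon_{\mathcal{E}_r},G^{\mathcal{E}_r})$ for some $\sigma\in\hat{G}_F\setminus\{1\}$; (ix) $(\pi,G^\pi)\leq(\varepsilon_{\mathcal{E}_r},G^{\mathcal{E}_r})$ for every continuous unitary representation $\pi$ of $G$; (x) $(\varepsilon_{\mathcal{E}_r},G^{\mathcal{E}_r})\cong(\varepsilon_{\mathcal{E}},G^{\mathcal{E}})$.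
   Context: For a continuous unitary representation $\pi$ of $G$ on $\mathcal{H}_\pi$ let $F_\pi=\mathrm{span}\{\langle\pi(\cdot)\xi|\eta\rangle:\xi,\eta\in\mathcal{H}_\pi\}$. The Fourier–Stieltjes algebra is $\mathrm{B}(G)=\bigcup_\pi F_\pi$ (union over all continuous unitary representations), identified with the dual $\mathrm{C}^*(G)^*$ of the full group C*-algebra. $\mathrm{B}_\pi$ denotes the weak* closure of $F_\pi$ in $\mathrm{B}(G)$. The weak $\pi$-Eberlein algebra $\mathcal{EB}(\pi)$ is the uniform closure of the algebra of functions generated by $\mathrm{B}_\pi+\overline{\mathrm{B}_\pi}$ (bar on the space meaning complex conjugates). Write $\sigma\leq_{we}\pi$ (weak Eberlein containment) if $F_\sigma\subset\mathcal{EB}(\pi)$. $\lambda$ is the left regular representation of $G$ on $L^2(G)$, and $\mathrm{B}_r(G)=\mathrm{B}_\lambda$. The Eberlein algebra $\mathcal{E}(G)$ is the uniform closure of $\mathrm{B}(G)$ in the continuous bounded functions $\mathcal{CB}(G)$, and the reduced Eberlein algebra $\mathcal{E}_r(G)$ is the uniform closure of $\mathrm{B}_r(G)$. $1$ denotes both the constant function and the trivial representation. $\hat{G}_F$ is the set of (equivalence classes of) finite-dimensional irreducible continuous unitary representations of $G$. For $\mathcal{X}=\mathcal{E}(G)$ or $\mathcal{E}_r(G)$, let $\varepsilon_{\mathcal{X}}:G\to\mathcal{X}^*$ be evaluation and $G^{\mathcal{X}}=\overline{\varepsilon_{\mathcal{X}}(G)}^{w^*}$; write $(\varepsilon_{\mathcal{E}},G^{\mathcal{E}})$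 and $(\varepsilon_{\mathcal{E}_r},G^{\mathcal{E}_r})$ for the resulting pairs. $\mathcal{X}$ is a C*-subalgebra of $\mathcal{CB}(G)$ with $\mathcal{X}=\mathcal{C}_0(G^{\mathcal{X}}\setminus\{0\})\circ\varepsilon_{\mathcal{X}}$, so $\mathcal{X}^*\cong\mathrm{M}(G^{\mathcal{X}}\setminus\{0\})$ (finite regular Borel measures); for $\mathcal{E}(G)\ni1$ one has $0\notin G^{\mathcal{E}}$. The product on $\mathcal{X}^*$ is the (Arens) product $m\square n(f)=m(n\cdot f)$, where $n\cdot f(s)=n(f\cdot s)$, $f\cdot s(t)=f(st)$; it makes $\mathcal{X}^*$ a dual Banach algebra (separately weak* continuous product), the product corresponding to convolution of measures, and $G^{\mathcal{X}}$ is a compact semitopological semigroup. Isomorphism of dual Banach algebras means an algebra isomorphism that is a weak*-weak* homeomorphism; a character is a non-zero multiplicative linear functional. For a continuous unitary representation $\pi$, $G^\pi=\overline{\pi(G)}^{w^*}\subset\mathcal{B}(\mathcal{H}_\pi)$, and $(\pi,G^\pi)$ is a semitopological compactification of $G$. For compactifications $(\delta,S),(\epsilon,T)$ of $G$ (continuous homomorphisms of $G$ with dense range into compact semitopological semigroups), $(\delta,S)\leq(\epsilon,T)$ means there is a continuous homomorphism $\theta:T\to S$ with $\theta\circ\epsilon=\delta$; $(\delta,S)\cong(\epsilon,T)$ means that such $\theta$ exists and is an isomorphism (equivalently, both $\leq$ and $\geq$ hold). *)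

theory Defs
  imports "HOL-Analysis.Analysis"
begin

text \<open>
  A topological group is a type of class \<^class>\<open>topological_group_add\<close>.  It is written
  additively, as in the library, but it is \<^emph>\<open>not\<close> assumed to be commutative:
  \<open>s + t\<close> stands for the product \<open>st\<close>, \<open>- s\<close> for the inverse, \<open>0\<close> for the neutral element.
\<close>

section \<open>Haar measure and amenability\<close>

text \<open>Radon in the usual convention: outer regular on Borel sets, inner regular on open sets.\<close>

definition left_haar_measure :: "'g::{topological_group_add,t2_space} measure \<Rightarrow> bool" where
  "left_haar_measure \<mu> \<longleftrightarrow>
     sets \<mu> = sets borel \<and>
     emeasure \<mu> UNIV \<noteq> 0 \<and>
     (\<forall>K. compact K \<longrightarrow> emeasure \<mu> K < \<infinity>) \<and>
     (\<forall>A\<in>sets borel. emeasure \<mu> A = (INF U\<in>{U. open U \<and> A \<subseteq> U}. emeasure \<mu> U)) \<and>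
     (\<forall>U. open U \<longrightarrow> emeasure \<mu> U = (SUP K\<in>{K. compact K \<and> K \<subseteq> U}. emeasure \<mu> K)) \<and>
     (\<forall>s. \<forall>A\<in>sets borel. emeasure \<mu> ((\<lambda>t. s + t) ` A) = emeasure \<mu> A)"

definition locally_null :: "'g::t2_space measure \<Rightarrow> 'g set \<Rightarrow> bool" where
  "locally_null \<mu> A \<longleftrightarrow>
     A \<in> sets borel \<and> (\<forall>K. compact K \<longrightarrow> emeasure \<mu> (A \<inter> K) = 0)"

definition bounded_borel :: "('g::topological_space \<Rightarrow> complex) set" where
  "bounded_borel = {f. f \<in> borel_measurable borel \<and> bounded (range f)}"

text \<open>
  A left invariant mean on \<open>L\<^sup>\<infinity>(G)\<close> (bounded Borel functions modulo locally null sets): a linear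
  functional with \<open>m(1) = 1 = \<parallel>m\<parallel>\<close>.  The third condition says \<open>\<bar>m f\<bar> \<le> \<parallel>f\<parallel>\<^sub>\<infinity>\<close> for the essential
  supremum norm; with linearity it makes \<open>m\<close> well defined on classes.
\<close>

definition left_invariant_mean ::
    "'g::{topological_group_add,t2_space} measure \<Rightarrow> (('g \<Rightarrow> complex) \<Rightarrow> complex) \<Rightarrow> bool" where
  "left_invariant_mean \<mu> m \<longleftrightarrow>
     (\<forall>f\<in>bounded_borel. \<forall>g\<in>bounded_borel. \<forall>a b. m (\<lambda>t. a * f t + b * g t) = a * m f + b * m g) \<and>
     m (\<lambda>t. 1) = 1 \<and>
     (\<forall>f\<in>bounded_borel. \<forall>c. locally_null \<mu> {t. cmod (f t) > c} \<longrightarrow> cmod (m f) \<le> c) \<and>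
     (\<forall>f\<in>bounded_borel. \<forall>s. m (\<lambda>t. f (- s + t)) = m f)"

definition amenable :: "'g::{topological_group_add,t2_space} measure \<Rightarrow> bool" where
  "amenable \<mu> \<longleftrightarrow> (\<exists>m. left_invariant_mean \<mu> m)"

section \<open>Complex Hilbert spaces\<close>

text \<open>Hilbert spaces are carried by sets, so that one can quantify over them.\<close>

record 'h hspace =
  hcarrier :: "'h set"
  hzero :: 'h
  hadd :: "'h \<Rightarrow> 'h \<Rightarrow> 'h"
  hscale :: "complex \<Rightarrow> 'h \<Rightarrow> 'h"
  hinner :: "'h \<Rightarrow> 'h \<Rightarrow> complex"

definition hnorm :: "'h hspace \<Rightarrow> 'h \<Rightarrow> real" where
  "hnorm H x = sqrt (Re (hinner H x x))"

text \<open>The library's metric spaces require symmetry also off the carrier, hence the guard.\<close>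

definition hdist :: "'h hspace \<Rightarrow> 'h \<Rightarrow> 'h \<Rightarrow> real" where
  "hdist H x y =
     (if x \<in> hcarrier H \<and> y \<in> hcarrier H then hnorm H (hadd H x (hscale H (- 1) y)) else 0)"

definition htopology :: "'h hspace \<Rightarrow> 'h topology" where
  "htopology H = Metric_space.mtopology (hcarrier H) (hdist H)"

locale hilbert_space =
  fixes H :: "'h hspace"
  assumes zero_closed: "hzero H \<in> hcarrier H"
    and add_closed: "\<lbrakk>x \<in> hcarrier H; y \<in> hcarrier H\<rbrakk> \<Longrightarrow> hadd H x y \<in> hcarrier H"
    and scale_closed: "x \<in> hcarrier H \<Longrightarrow> hscale H a x \<in> hcarrier H"
    and add_assoc: "\<lbrakk>x \<in> hcarrier H; y \<in> hcarrier H; z \<in> hcarrier H\<rbrakk>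
          \<Longrightarrow> hadd H (hadd H x y) z = hadd H x (hadd H y z)"
    and add_commute: "\<lbrakk>x \<in> hcarrier H; y \<in> hcarrier H\<rbrakk> \<Longrightarrow> hadd H x y = hadd H y x"
    and add_zero: "x \<in> hcarrier H \<Longrightarrow> hadd H (hzero H) x = x"
    and add_neg: "x \<in> hcarrier H \<Longrightarrow> hadd H x (hscale H (- 1) x) = hzero H"
    and scale_one: "x \<in> hcarrier H \<Longrightarrow> hscale H 1 x = x"
    and scale_scale: "x \<in> hcarrier H \<Longrightarrow> hscale H a (hscale H b x) = hscale H (a * b) x"
    and scale_add_left: "x \<in> hcarrier H \<Longrightarrow>
          hscale H (a + b) x = hadd H (hscale H a x) (hscale H b x)"
    and scale_add_right: "\<lbrakk>x \<in> hcarrier H; y \<in> hcarrier H\<rbrakk> \<Longrightarrow>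
          hscale H a (hadd H x y) = hadd H (hscale H a x) (hscale H a y)"
    and inner_add: "\<lbrakk>x \<in> hcarrier H; y \<in> hcarrier H; z \<in> hcarrier H\<rbrakk>
          \<Longrightarrow> hinner H (hadd H x y) z = hinner H x z + hinner H y z"
    and inner_scale: "\<lbrakk>x \<in> hcarrier H; y \<in> hcarrier H\<rbrakk>
          \<Longrightarrow> hinner H (hscale H a x) y = a * hinner H x y"
    and inner_cnj: "\<lbrakk>x \<in> hcarrier H; y \<in> hcarrier H\<rbrakk> \<Longrightarrow> hinner H y x = cnj (hinner H x y)"
    and inner_nonneg: "x \<in> hcarrier H \<Longrightarrow> 0 \<le> Re (hinner H x x)"
    and inner_definite: "\<lbrakk>x \<in> hcarrier H; hinner H x x = 0\<rbrakk> \<Longrightarrow> x = hzero H"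
    and complete: "Metric_space.mcomplete (hcarrier H) (hdist H)"

definition hlinear :: "'h hspace \<Rightarrow> 'k hspace \<Rightarrow> ('h \<Rightarrow> 'k) \<Rightarrow> bool" where
  "hlinear H K T \<longleftrightarrow>
     (\<forall>x\<in>hcarrier H. T x \<in> hcarrier K) \<and>
     (\<forall>x\<in>hcarrier H. \<forall>y\<in>hcarrier H. T (hadd H x y) = hadd K (T x) (T y)) \<and>
     (\<forall>x\<in>hcarrier H. \<forall>a. T (hscale H a x) = hscale K a (T x))"

definition hunitary :: "'h hspace \<Rightarrow> 'k hspace \<Rightarrow> ('h \<Rightarrow> 'k) \<Rightarrow> bool" where
  "hunitary H K U \<longleftrightarrow>
     hlinear H K U \<and> U ` hcarrier H = hcarrier K \<and>
     (\<forall>x\<in>hcarrier H. \<forall>y\<in>hcarrier H. hinner K (U x) (U y) = hinner H x y)"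

definition hsubspace :: "'h hspace \<Rightarrow> 'h set \<Rightarrow> bool" where
  "hsubspace H V \<longleftrightarrow>
     V \<subseteq> hcarrier H \<and> hzero H \<in> V \<and>
     (\<forall>x\<in>V. \<forall>y\<in>V. hadd H x y \<in> V) \<and> (\<forall>x\<in>V. \<forall>a. hscale H a x \<in> V)"

definition hfinite_dim :: "'h hspace \<Rightarrow> bool" where
  "hfinite_dim H \<longleftrightarrow>
     (\<exists>B. finite B \<and> B \<subseteq> hcarrier H \<and> hsubspace H hull B = hcarrier H)"

section \<open>Continuous unitary representations\<close>

definition unitary_rep ::
    "'h hspace \<Rightarrow> ('g::{topological_group_add,t2_space} \<Rightarrow> 'h \<Rightarrow> 'h) \<Rightarrow> bool" where
  "unitary_rep H \<pi> \<longleftrightarrow>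
     hilbert_space H \<and>
     (\<forall>s. hunitary H H (\<pi> s)) \<and>
     (\<forall>s t. \<forall>x\<in>hcarrier H. \<pi> (s + t) x = \<pi> s (\<pi> t x)) \<and>
     (\<forall>x\<in>hcarrier H. continuous_map euclidean (htopology H) (\<lambda>s. \<pi> s x))"

definition irreducible_rep ::
    "'h hspace \<Rightarrow> ('g::{topological_group_add,t2_space} \<Rightarrow> 'h \<Rightarrow> 'h) \<Rightarrow> bool" where
  "irreducible_rep H \<pi> \<longleftrightarrow>
     unitary_rep H \<pi> \<and> hcarrier H \<noteq> {hzero H} \<and>
     (\<forall>V. hsubspace H V \<and> closedin (htopology H) V \<and> (\<forall>s. \<pi> s ` V \<subseteq> V)
        \<longrightarrow> V = {hzero H} \<or> V = hcarrier H)"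

definition rep_equiv ::
    "'h hspace \<Rightarrow> ('g \<Rightarrow> 'h \<Rightarrow> 'h) \<Rightarrow> 'k hspace \<Rightarrow> ('g \<Rightarrow> 'k \<Rightarrow> 'k) \<Rightarrow> bool" where
  "rep_equiv H \<pi> K \<rho> \<longleftrightarrow>
     (\<exists>U. hunitary H K U \<and> (\<forall>s. \<forall>x\<in>hcarrier H. U (\<pi> s x) = \<rho> s (U x)))"

definition complex_hspace :: "complex hspace" where
  "complex_hspace = \<lparr>hcarrier = UNIV, hzero = 0, hadd = (+), hscale = (*), hinner = (\<lambda>z w. z * cnj w)\<rparr>"

definition trivial_rep :: "'g \<Rightarrow> complex \<Rightarrow> complex" where
  "trivial_rep s z = z"

text \<open>
  The set \<open>\<hat>G\<^sub>F\<close> is rendered by the representations themselves rather than by their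
  equivalence classes; every notion applied to it is invariant under unitary equivalence.
\<close>

definition fd_irreps :: "('h hspace \<times> ('g::{topological_group_add,t2_space} \<Rightarrow> 'h \<Rightarrow> 'h)) set" where
  "fd_irreps = {(H, \<sigma>). irreducible_rep H \<sigma> \<and> hfinite_dim H}"

definition fd_irreps_nontriv ::
    "('h hspace \<times> ('g::{topological_group_add,t2_space} \<Rightarrow> 'h \<Rightarrow> 'h)) set" where
  "fd_irreps_nontriv =
     {(H, \<sigma>). (H, \<sigma>) \<in> fd_irreps \<and> \<not> rep_equiv H \<sigma> complex_hspace trivial_rep}"

subsection \<open>The left regular representation\<close>

definition l2_class :: "'g measure \<Rightarrow> ('g \<Rightarrow> complex) \<Rightarrow> ('g \<Rightarrow> complex) set" where
  "l2_class \<mu> f = {g \<in> borel_measurable \<mu>. AE t in \<mu>. f t = g t}"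

text \<open>
  The operations below act on almost-everywhere classes; the unions range over representatives
  and are independent of them.
\<close>

definition L2 :: "'g measure \<Rightarrow> ('g \<Rightarrow> complex) set hspace" where
  "L2 \<mu> = \<lparr>
     hcarrier = {l2_class \<mu> f | f. f \<in> borel_measurable \<mu> \<and> integrable \<mu> (\<lambda>t. (cmod (f t))\<^sup>2)},
     hzero = l2_class \<mu> (\<lambda>t. 0),
     hadd = (\<lambda>A B. \<Union>f\<in>A. \<Union>g\<in>B. l2_class \<mu> (\<lambda>t. f t + g t)),
     hscale = (\<lambda>a A. \<Union>f\<in>A. l2_class \<mu> (\<lambda>t. a * f t)),
     hinner = (\<lambda>A B. the_elem (\<Union>f\<in>A. \<Union>g\<in>B. {LINT t|\<mu>. f t * cnj (g t)}))\<rparr>"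

definition left_regular ::
    "'g::group_add measure \<Rightarrow> 'g \<Rightarrow> ('g \<Rightarrow> complex) set \<Rightarrow> ('g \<Rightarrow> complex) set" where
  "left_regular \<mu> s A = (\<Union>f\<in>A. l2_class \<mu> (\<lambda>t. f (- s + t)))"

section \<open>The Fourier--Stieltjes algebra and weak* closures\<close>

definition cspan :: "('g \<Rightarrow> complex) set \<Rightarrow> ('g \<Rightarrow> complex) set" where
  "cspan S = {\<lambda>t. \<Sum>u\<in>A. c u * u t | A c. finite A \<and> A \<subseteq> S}"

definition coefficient :: "'h hspace \<Rightarrow> ('g \<Rightarrow> 'h \<Rightarrow> 'h) \<Rightarrow> 'h \<Rightarrow> 'h \<Rightarrow> 'g \<Rightarrow> complex" where
  "coefficient H \<pi> x y = (\<lambda>s. hinner H (\<pi> s x) y)"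

definition F_space :: "'h hspace \<Rightarrow> ('g \<Rightarrow> 'h \<Rightarrow> 'h) \<Rightarrow> ('g \<Rightarrow> complex) set" where
  "F_space H \<pi> = cspan {coefficient H \<pi> x y | x y. x \<in> hcarrier H \<and> y \<in> hcarrier H}"

text \<open>
  HOL cannot quantify over all Hilbert spaces at once.  In the definitions of \<open>B(G)\<close> and of the
  norm of \<open>C*(G)\<close> it suffices to let the Hilbert spaces be carried by sets of functions
  \<open>G \<rightarrow> \<complex>\<close>: a cyclic representation with cyclic vector \<open>\<xi>\<close> can be transported along the injective
  map \<open>\<eta> \<mapsto> (s \<mapsto> \<langle>\<eta>|\<pi>(s)\<xi>\<rangle>)\<close>; every element of any \<open>F\<^sub>\<pi>\<close> is a coefficient of a cyclic
  representation (a subrepresentation of a multiple of \<open>\<pi>\<close>), and the norm \<open>\<parallel>\<pi>(f)\<parallel>\<close> is the supremum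
  of its values over the cyclic subrepresentations of \<open>\<pi>\<close>.
\<close>

definition fourier_stieltjes :: "('g::{topological_group_add,t2_space} \<Rightarrow> complex) set" where
  "fourier_stieltjes =
     (\<Union>(H, \<pi>)\<in>{(H :: ('g \<Rightarrow> complex) hspace, \<pi>). unitary_rep H \<pi>}. F_space H \<pi>)"

text \<open>
  The full C*-norm \<open>\<parallel>f\<parallel> = sup\<^sub>\<pi> \<parallel>\<pi>(f)\<parallel>\<close> on \<open>L\<^sup>1(G)\<close>, where
  \<open>\<langle>\<pi>(f)\<xi>|\<eta>\<rangle> = \<integral> f(s) \<langle>\<pi>(s)\<xi>|\<eta>\<rangle> ds\<close>.
\<close>

definition cstar_norm ::
    "'g::{topological_group_add,t2_space} measure \<Rightarrow> ('g \<Rightarrow> complex) \<Rightarrow> real" where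
  "cstar_norm \<mu> f =
     Sup {cmod (LINT s|\<mu>. f s * coefficient H \<pi> x y s) | (H :: ('g \<Rightarrow> complex) hspace) \<pi> x y.
            unitary_rep H \<pi> \<and> x \<in> hcarrier H \<and> y \<in> hcarrier H \<and> hnorm H x \<le> 1 \<and> hnorm H y \<le> 1}"

text \<open>
  \<open>C*(G)\<close> is the completion of \<open>L\<^sup>1(G)\<close> in this norm; its elements are represented by Cauchy
  sequences.
\<close>

definition full_cstar ::
    "'g::{topological_group_add,t2_space} measure \<Rightarrow> (nat \<Rightarrow> 'g \<Rightarrow> complex) set" where
  "full_cstar \<mu> =
     {f. (\<forall>n. integrable \<mu> (f n)) \<and>
         (\<forall>e>0. \<exists>N. \<forall>m\<ge>N. \<forall>n\<ge>N. cstar_norm \<mu> (\<lambda>s. f m s - f n s) < e)}"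

text \<open>The duality \<open>B(G) = C*(G)*\<close>, extending \<open>(f, u) \<mapsto> \<integral> f u\<close> from \<open>L\<^sup>1(G)\<close> by continuity.\<close>

definition cstar_pairing ::
    "'g measure \<Rightarrow> (nat \<Rightarrow> 'g \<Rightarrow> complex) \<Rightarrow> ('g \<Rightarrow> complex) \<Rightarrow> complex" where
  "cstar_pairing \<mu> f u = lim (\<lambda>n. LINT s|\<mu>. f n s * u s)"

definition initial_topology :: "'a set \<Rightarrow> ('a \<Rightarrow> complex) set \<Rightarrow> 'a topology" where
  "initial_topology X \<Phi> =
     topology_generated_by (insert X {{x \<in> X. \<phi> x \<in> U} | \<phi> U. \<phi> \<in> \<Phi> \<and> open U})"

definition B_weak_star ::
    "'g::{topological_group_add,t2_space} measure \<Rightarrow> ('g \<Rightarrow> complex) topology" where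
  "B_weak_star \<mu> = initial_topology fourier_stieltjes (cstar_pairing \<mu> ` full_cstar \<mu>)"

definition B_space ::
    "'g::{topological_group_add,t2_space} measure \<Rightarrow> 'h hspace \<Rightarrow> ('g \<Rightarrow> 'h \<Rightarrow> 'h)
      \<Rightarrow> ('g \<Rightarrow> complex) set" where
  "B_space \<mu> H \<pi> = B_weak_star \<mu> closure_of F_space H \<pi>"

section \<open>Eberlein algebras\<close>

definition fun_subalgebra :: "('g \<Rightarrow> complex) set \<Rightarrow> bool" where
  "fun_subalgebra A \<longleftrightarrow>
     (\<lambda>t. 0) \<in> A \<and>
     (\<forall>f\<in>A. \<forall>g\<in>A. (\<lambda>t. f t + g t) \<in> A \<and> (\<lambda>t. f t * g t) \<in> A) \<and>
     (\<forall>f\<in>A. \<forall>a. (\<lambda>t. a * f t) \<in> A)"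

definition uniform_closure :: "('g \<Rightarrow> complex) set \<Rightarrow> ('g \<Rightarrow> complex) set" where
  "uniform_closure A =
     {f. \<exists>g :: nat \<Rightarrow> 'g \<Rightarrow> complex. (\<forall>n. g n \<in> A) \<and> uniform_limit UNIV g f sequentially}"

definition weak_eberlein ::
    "'g::{topological_group_add,t2_space} measure \<Rightarrow> 'h hspace \<Rightarrow> ('g \<Rightarrow> 'h \<Rightarrow> 'h)
      \<Rightarrow> ('g \<Rightarrow> complex) set" where
  "weak_eberlein \<mu> H \<pi> = uniform_closure
     (fun_subalgebra hull {\<lambda>t. u t + cnj (v t) | u v. u \<in> B_space \<mu> H \<pi> \<and> v \<in> B_space \<mu> H \<pi>})"

definition we_contained ::
    "'g::{topological_group_add,t2_space} measure \<Rightarrow> 'h hspace \<Rightarrow> ('g \<Rightarrow> 'h \<Rightarrow> 'h)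
      \<Rightarrow> 'k hspace \<Rightarrow> ('g \<Rightarrow> 'k \<Rightarrow> 'k) \<Rightarrow> bool" where
  "we_contained \<mu> H \<sigma> K \<pi> \<longleftrightarrow> F_space H \<sigma> \<subseteq> weak_eberlein \<mu> K \<pi>"

definition eberlein :: "('g::{topological_group_add,t2_space} \<Rightarrow> complex) set" where
  "eberlein = uniform_closure fourier_stieltjes"

definition reduced_eberlein ::
    "'g::{topological_group_add,t2_space} measure \<Rightarrow> ('g \<Rightarrow> complex) set" where
  "reduced_eberlein \<mu> = uniform_closure (B_space \<mu> (L2 \<mu>) (left_regular \<mu>))"

section \<open>Dual Banach algebras of function algebras\<close>

text \<open>
  The dual of a space \<open>X\<close> of bounded functions with the uniform norm; functionals are made
  extensional so that equality is equality on \<open>X\<close>.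
\<close>

definition dual_space :: "('g \<Rightarrow> complex) set \<Rightarrow> (('g \<Rightarrow> complex) \<Rightarrow> complex) set" where
  "dual_space X =
     {m \<in> extensional X.
        (\<forall>f\<in>X. \<forall>g\<in>X. \<forall>a b. m (\<lambda>t. a * f t + b * g t) = a * m f + b * m g) \<and>
        (\<exists>C. \<forall>f\<in>X. cmod (m f) \<le> C * (SUP t. cmod (f t)))}"

definition dual_weak_star :: "('g \<Rightarrow> complex) set \<Rightarrow> (('g \<Rightarrow> complex) \<Rightarrow> complex) topology" where
  "dual_weak_star X = initial_topology (dual_space X) {\<lambda>m. m f | f. f \<in> X}"

definition dual_lincomb ::
    "('g \<Rightarrow> complex) set \<Rightarrow> complex \<Rightarrow> (('g \<Rightarrow> complex) \<Rightarrow> complex)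
      \<Rightarrow> complex \<Rightarrow> (('g \<Rightarrow> complex) \<Rightarrow> complex) \<Rightarrow> ('g \<Rightarrow> complex) \<Rightarrow> complex" where
  "dual_lincomb X a m b n = restrict (\<lambda>f. a * m f + b * n f) X"

text \<open>\<open>(m \<box> n)(f) = m(n \<cdot> f)\<close> with \<open>(n \<cdot> f)(s) = n(f \<cdot> s)\<close> and \<open>(f \<cdot> s)(t) = f(st)\<close>.\<close>

definition arens ::
    "('g::plus \<Rightarrow> complex) set \<Rightarrow> (('g \<Rightarrow> complex) \<Rightarrow> complex) \<Rightarrow> (('g \<Rightarrow> complex) \<Rightarrow> complex)
      \<Rightarrow> ('g \<Rightarrow> complex) \<Rightarrow> complex" where
  "arens X m n = restrict (\<lambda>f. m (\<lambda>s. n (\<lambda>t. f (s + t)))) X"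

definition dual_algebra_iso ::
    "('g::plus \<Rightarrow> complex) set \<Rightarrow> ('g \<Rightarrow> complex) set \<Rightarrow> bool" where
  "dual_algebra_iso X Y \<longleftrightarrow>
     (\<exists>\<Phi>. bij_betw \<Phi> (dual_space X) (dual_space Y) \<and>
          (\<forall>m\<in>dual_space X. \<forall>n\<in>dual_space X. \<forall>a b.
             \<Phi> (dual_lincomb X a m b n) = dual_lincomb Y a (\<Phi> m) b (\<Phi> n)) \<and>
          (\<forall>m\<in>dual_space X. \<forall>n\<in>dual_space X. \<Phi> (arens X m n) = arens Y (\<Phi> m) (\<Phi> n)) \<and>
          homeomorphic_map (dual_weak_star X) (dual_weak_star Y) \<Phi>)"

definition dual_character ::
    "('g::plus \<Rightarrow> complex) set \<Rightarrow> ((('g \<Rightarrow> complex) \<Rightarrow> complex) \<Rightarrow> complex) \<Rightarrow> bool" where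
  "dual_character X \<omega> \<longleftrightarrow>
     (\<forall>m\<in>dual_space X. \<forall>n\<in>dual_space X. \<forall>a b. \<omega> (dual_lincomb X a m b n) = a * \<omega> m + b * \<omega> n) \<and>
     (\<forall>m\<in>dual_space X. \<forall>n\<in>dual_space X. \<omega> (arens X m n) = \<omega> m * \<omega> n) \<and>
     (\<exists>m\<in>dual_space X. \<omega> m \<noteq> 0)"

section \<open>Semitopological compactifications\<close>

record ('g, 's) compactification =
  cp_map :: "'g \<Rightarrow> 's"
  cp_top :: "'s topology"
  cp_mult :: "'s \<Rightarrow> 's \<Rightarrow> 's"

definition cp_hom ::
    "('g, 't) compactification \<Rightarrow> ('g, 's) compactification \<Rightarrow> ('t \<Rightarrow> 's) \<Rightarrow> bool" where
  "cp_hom T S \<theta> \<longleftrightarrow>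
     continuous_map (cp_top T) (cp_top S) \<theta> \<and>
     (\<forall>x\<in>topspace (cp_top T). \<forall>y\<in>topspace (cp_top T).
        \<theta> (cp_mult T x y) = cp_mult S (\<theta> x) (\<theta> y)) \<and>
     (\<forall>s. \<theta> (cp_map T s) = cp_map S s)"

definition cp_le :: "('g, 's) compactification \<Rightarrow> ('g, 't) compactification \<Rightarrow> bool" where
  "cp_le S T \<longleftrightarrow> (\<exists>\<theta>. cp_hom T S \<theta>)"

definition cp_iso :: "('g, 's) compactification \<Rightarrow> ('g, 't) compactification \<Rightarrow> bool" where
  "cp_iso S T \<longleftrightarrow> (\<exists>\<theta>. cp_hom T S \<theta> \<and> homeomorphic_map (cp_top T) (cp_top S) \<theta>)"

definition evaluation :: "('g \<Rightarrow> complex) set \<Rightarrow> 'g \<Rightarrow> ('g \<Rightarrow> complex) \<Rightarrow> complex" where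
  "evaluation X s = restrict (\<lambda>f. f s) X"

definition evaluation_compactification ::
    "('g::plus \<Rightarrow> complex) set \<Rightarrow> ('g, ('g \<Rightarrow> complex) \<Rightarrow> complex) compactification" where
  "evaluation_compactification X = \<lparr>
     cp_map = evaluation X,
     cp_top = subtopology (dual_weak_star X) (dual_weak_star X closure_of range (evaluation X)),
     cp_mult = arens X\<rparr>"

definition bounded_ops :: "'h hspace \<Rightarrow> ('h \<Rightarrow> 'h) set" where
  "bounded_ops H =
     {T \<in> extensional (hcarrier H).
        hlinear H H T \<and> (\<exists>C. \<forall>x\<in>hcarrier H. hnorm H (T x) \<le> C * hnorm H x)}"

text \<open>
  The weak* topology of \<open>B(H)\<close> as the dual of the trace class operators: the functionals are
  \<open>T \<mapsto> \<Sum>\<^sub>n \<langle>T\<xi>\<^sub>n|\<eta>\<^sub>n\<rangle>\<close> with \<open>\<Sum>\<^sub>n \<parallel>\<xi>\<^sub>n\<parallel>\<^sup>2 < \<infinity>\<close> and \<open>\<Sum>\<^sub>n \<parallel>\<eta>\<^sub>n\<parallel>\<^sup>2 < \<infinity>\<close>.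
\<close>

definition ops_weak_star :: "'h hspace \<Rightarrow> ('h \<Rightarrow> 'h) topology" where
  "ops_weak_star H = initial_topology (bounded_ops H)
     {\<lambda>T. \<Sum>n. hinner H (T (x n)) (y n) | (x :: nat \<Rightarrow> 'h) (y :: nat \<Rightarrow> 'h).
        range x \<subseteq> hcarrier H \<and> range y \<subseteq> hcarrier H \<and>
        summable (\<lambda>n. (hnorm H (x n))\<^sup>2) \<and> summable (\<lambda>n. (hnorm H (y n))\<^sup>2)}"

definition rep_compactification ::
    "'h hspace \<Rightarrow> ('g \<Rightarrow> 'h \<Rightarrow> 'h) \<Rightarrow> ('g, 'h \<Rightarrow> 'h) compactification" where
  "rep_compactification H \<pi> = (let \<pi>' = (\<lambda>s. restrict (\<pi> s) (hcarrier H)) in \<lparr>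
     cp_map = \<pi>',
     cp_top = subtopology (ops_weak_star H) (ops_weak_star H closure_of range \<pi>'),
     cp_mult = compose (hcarrier H)\<rparr>)"

end

theory Submission
 imports Defs
begin

text \<open>
  Everything is reduced to \<open>1 \<in> B\<^sub>r(G)\<close>.  By Fell's absorption principle \<open>B\<^sub>r(G)\<close> is an ideal of \<open>B(G)\<close>,
  so this means \<open>B\<^sub>r(G) = B(G)\<close>.  If \<open>1 \<in> \<E>\<^sub>r(G)\<close>, some \<open>u \<in> B\<^sub>r(G)\<close> is uniformly close to \<open>1\<close>, and the
  element of minimal norm in the convex hull of an orbit turns \<open>u\<close> into a constant.

  If \<open>1 \<in> B\<^sub>r(G)\<close>, functional calculus for averages of translations yields almost invariant vectors in
  \<open>L\<^sup>2(G)\<close>, and a cluster point of their vector states is an invariant mean.  Conversely, if \<open>1 \<notin> B\<^sub>r(G)\<close>,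
  some convolution operator \<open>N\<close> with a nonnegative kernel of integral \<open>1\<close> has norm below \<open>\<theta> < 1\<close>.  Then
  \<open>\<Sum> \<theta>\<^sup>-\<^sup>n N\<^sup>n y\<close> is strictly \<open>N\<close>-superharmonic; its logarithm \<open>l\<close> has bounded coboundary over an open
  subgroup, and \<open>N l \<le> l + ln \<theta>\<close> contradicts the antisymmetry in \<open>s\<close> of the mean of \<open>l(s \<cdot>) - l\<close>.

  A weak* continuous character of \<open>\<E>\<^sub>r(G)*\<close> is evaluation at a unimodular \<open>f \<in> \<E>\<^sub>r(G)\<close>, and \<open>1 = f cnj(f)\<close>.
  If \<open>0 \<notin> G\<^sup>\<E>\<^sup>r\<close>, compactness gives a sum \<open>\<Sum> \<bar>u\<^sub>i\<bar>\<^sup>2\<close> in \<open>\<E>\<^sub>r(G)\<close> bounded below; if \<open>0 \<in> G\<^sup>\<E>\<^sup>r\<close>, a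
  morphism onto \<open>G\<^sup>\<sigma>\<close> sends \<open>0\<close> to an isometry fixed by \<open>\<sigma>(G)\<close>, so that \<open>\<sigma>\<close> is trivial.
\<close>

text \<open>Two closures must be kept apart. \<open>Br\<close> is a weak* closure and closed in the
  norm of B(G), while \<open>Er\<close> is a uniform closure. A function of \<open>Br\<close> that
  is uniformly near 1 need not be near 1 in the norm of B(G); the orbit argument closes this gap.
  Weak* closures are handled as annihilators of the kernel of \<lambda> in C*(G), so that membership
  in \<open>Br\<close> becomes a norm estimate on integrable functions. Coefficients are replaced by
  functions dominated by a positive definite function, a condition on finite sums that is stable
  under sums, products and translations without direct sums or tensor products. Haar measure need
  not be sigma-finite, so integrals are exchanged only for continuous functions of compact support.
  An invariant mean applies only to bounded functions. The superharmonic series may be infinite at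
  many points and its logarithm is unbounded, but the differences of the logarithm along the
  subgroup are bounded, and their means are odd in the translation. As N averages over quotients of
  two independent points of equal law, they cancel in the mean of N l - l.\<close>

type_synonym 'g fn = "'g => complex"

abbreviation "cont \<equiv> continuous_on UNIV"
abbreviation "Meas \<equiv> borel_measurable borel"
abbreviation "BG \<equiv> fourier_stieltjes"

section \<open>Null double sequences\<close>

text \<open>One form for the Cauchy conditions in the seminorm of a carrier set, in the C*-norm and
  in the scalars, so that estimates pass between them by linear domination.\<close>

definition small :: "(nat => nat => real) => bool" where
 "small d \<longleftrightarrow> (ALL e>0. EX N. ALL m>=N. ALL n>=N. d m n < e)"

lemma small_le:
 assumes "small f" "small g" "0 <= A" "0 <= B" and le: "!!m n. h m n <= A * f m n + B * g m n"
 shows "small h"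
 unfolding small_def
proof (intro allI impI)
 fix e :: real assume e: "e > 0"
 have *: "EX N. ALL m>=N. ALL n>=N. C * d m n < e / 2" if d: "small d" "0 <= C" for d C
 proof -
  have C: "C + 1 > 0" using d(2) by simp
  have "e / 2 / (C + 1) > 0" using e C by simp
  then obtain N where N: "ALL m>=N. ALL n>=N. d m n < e / 2 / (C + 1)" using d(1) unfolding small_def by meson
  have "C * d m n < e / 2" if "m >= N" "n >= N" for m n
  proof -
   have "C * d m n <= C * (e / 2 / (C + 1))" using N that d(2) by (intro mult_left_mono) (auto simp: less_imp_le)
   also have "... < e / 2" using C e by (simp add: field_simps)
   finally show ?thesis .
  qed
  thus ?thesis by blast
 qed
 obtain N M where "ALL m>=N. ALL n>=N. A * f m n < e / 2" "ALL m>=M. ALL n>=M. B * g m n < e / 2"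
  using *[OF assms(1,3)] *[OF assms(2,4)] by blast
 thus "EX N. ALL m>=N. ALL n>=N. h m n < e" using le
  by (intro exI[of _ "max N M"]) (smt (verit, best) field_sum_of_halves max.bounded_iff)
qed

lemma small_le1: "small f ==> 0 <= A ==> (!!m n. h m n <= A * f m n) ==> small h"
 by (rule small_le[of f f A 0 h]) auto

lemma small_inverse_Suc: "small (%m n. 1 / real (Suc m) + 1 / real (Suc n))"
 unfolding small_def
proof (intro allI impI)
 fix e :: real assume "e > 0"
 then obtain N where N: "1 / real (Suc N) < e / 2" using nat_approx_posE half_gt_zero by blast
 have *: "1 / real (Suc m) <= 1 / real (Suc N)" if "m >= N" for m using that by (simp add: field_simps)
 have "1 / real (Suc m) + 1 / real (Suc n) < e" if "m >= N" "n >= N" for m n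
  using add_mono[OF *[OF that(1)] *[OF that(2)]] N by linarith
 thus "EX N. ALL m>=N. ALL n>=N. 1 / real (Suc m) + 1 / real (Suc n) < e" by blast
qed

lemma small_power2D: "small (%m n. (d m n)^2) ==> small d"
 unfolding small_def by (metis less_imp_le power_less_imp_less_base zero_less_power)

lemma small_Cauchy: "small (%m n. norm (s m - s n)) ==> Cauchy s" for s :: "nat => 'a::real_normed_vector"
 by (rule CauchyI) (simp add: small_def)

lemma tendsto_if_norm_le:
 fixes f :: "'a => 'b::real_normed_vector"
 assumes "(g \<longlongrightarrow> 0) F" "!!x. norm (f x - l) <= g x"
 shows "(f \<longlongrightarrow> l) F"
 by (rule LIM_zero_cancel, rule Lim_null_comparison[OF always_eventually assms(1)]) (use assms(2) in blast)

lemma le_if_le_add_mult: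
 fixes x y C :: real
 assumes "!!e. e > 0 ==> x <= y + C * e"
 shows "x <= y"
proof (rule field_le_epsilon)
 fix d :: real assume d: "d > 0"
 have p: "\<bar>C\<bar> + 1 > 0" by simp
 have "C * (d / (\<bar>C\<bar> + 1)) <= (\<bar>C\<bar> + 1) * (d / (\<bar>C\<bar> + 1))" using d p by (intro mult_right_mono) auto
 also have "... = d" using p by simp
 finally show "x <= y + d" using assms[OF divide_pos_pos[OF d p]] by linarith
qed

lemma tendsto_inverse_Suc: "(%n. 1 / real (Suc n)) \<longlonglongrightarrow> 0"
 using LIMSEQ_inverse_real_of_nat by (simp add: inverse_eq_divide)

section \<open>Initial topologies and annihilators\<close>

lemma topspace_initial_topology [simp]: "topspace (initial_topology X Phi) = X"
 unfolding initial_topology_def topology_generated_by_topspace by auto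

lemma openin_initial_topology:
 assumes "phi : Phi" "open U"
 shows "openin (initial_topology X Phi) {x : X. phi x : U}"
 unfolding initial_topology_def by (rule topology_generated_by_Basis) (use assms in blast)

lemma openin_initial_topology_nhd:
 assumes "finite F" "F \<subseteq> Phi"
 shows "openin (initial_topology X Phi) {v : X. ALL phi:F. cmod (phi v - phi u) < e}"
 using assms
proof (induction F)
 case empty
 have "openin (initial_topology X Phi) (topspace (initial_topology X Phi))" by (rule openin_topspace)
 thus ?case by simp
next
 case (insert psi F)
 have "openin (initial_topology X Phi) {x : X. psi x : ball (psi u) e}"
  by (rule openin_initial_topology) (use insert in auto)
 moreover have "{v : X. ALL phi:insert psi F. cmod (phi v - phi u) < e}
  = {v : X. ALL phi:F. cmod (phi v - phi u) < e} \<inter> {x : X. psi x : ball (psi u) e}"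
  by (auto simp: dist_norm norm_minus_commute)
 ultimately show ?case using insert by auto
qed

lemma initial_topology_nhdE:
 assumes "openin (initial_topology X Phi) T" "u : T"
 obtains F e where "finite F" "F \<subseteq> Phi" "e > 0" "{v : X. ALL phi:F. cmod (phi v - phi u) < e} \<subseteq> T"
proof -
 have "generate_topology_on (insert X {{x : X. phi x : U} | phi U. phi : Phi & open U}) T"
  using assms(1) unfolding initial_topology_def openin_topology_generated_by_iff .
 hence "u : T --> (EX F e. finite F & F \<subseteq> Phi & e > 0 &
   {v : X. ALL phi:F. cmod (phi v - phi u) < e} \<subseteq> T)"
 proof (induction rule: generate_topology_on.induct)
  case Empty
  thus ?case by simp
 next
  case (Int a b)
  show ?case
  proof
   assume "u : a \<inter> b"
   then obtain F e G d where *: "finite F" "F \<subseteq> Phi" "e > 0" "{v : X. ALL phi:F. cmod (phi v - phi u) < e} \<subseteq> a"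
    "finite G" "G \<subseteq> Phi" "d > 0" "{v : X. ALL phi:G. cmod (phi v - phi u) < d} \<subseteq> b"
    using Int by blast
   thus "EX F e. finite F & F \<subseteq> Phi & e > 0 & {v : X. ALL phi:F. cmod (phi v - phi u) < e} \<subseteq> a \<inter> b"
    by (intro exI[of _ "F \<union> G"] exI[of _ "min e d"]) auto
  qed
 next
  case (UN K)
  show ?case
  proof
   assume "u : \<Union>K"
   then obtain k where k: "k : K" "u : k" by blast
   from UN[OF k(1)] k(2) obtain F e where "finite F" "F \<subseteq> Phi" "e > 0"
    "{v : X. ALL phi:F. cmod (phi v - phi u) < e} \<subseteq> k" by blast
   with k show "EX F e. finite F & F \<subseteq> Phi & e > 0 & {v : X. ALL phi:F. cmod (phi v - phi u) < e} \<subseteq> \<Union>K"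
    by blast
  qed
 next
  case (Basis s)
  show ?case
  proof
   assume u: "u : s"
   show "EX F e. finite F & F \<subseteq> Phi & e > 0 & {v : X. ALL phi:F. cmod (phi v - phi u) < e} \<subseteq> s"
   proof (cases "s = X")
    case True
    thus ?thesis by (intro exI[of _ "{}"] exI[of _ 1]) auto
   next
    case False
    then obtain phi U where s: "s = {x : X. phi x : U}" "phi : Phi" "open U"
     using Basis by blast
    then obtain e where "e > 0" "ball (phi u) e \<subseteq> U"
     using u openE by blast
    thus ?thesis
     using s by (intro exI[of _ "{phi}"] exI[of _ e]) (auto simp: dist_norm norm_minus_commute subset_iff)
   qed
  qed
 qed
 with assms(2) that show ?thesis by blast
qed

lemma in_closure_of_initial_topology:
 "u : initial_topology X Phi closure_of S \<longleftrightarrow>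
  u : X & (ALL F e. finite F & F \<subseteq> Phi & e > 0 --> (EX v:S \<inter> X. ALL phi:F. cmod (phi v - phi u) < e))"
 (is "?L \<longleftrightarrow> ?R")
proof
 assume L: ?L
 show ?R
 proof (intro conjI allI impI)
  show u: "u : X" using L by (simp add: in_closure_of)
  fix F and e :: real assume F: "finite F & F \<subseteq> Phi & e > 0"
  let ?T = "{v : X. ALL phi:F. cmod (phi v - phi u) < e}"
  have T: "openin (initial_topology X Phi) ?T" "u : ?T"
   using F u openin_initial_topology_nhd by auto
  obtain v where "v : S" "v : ?T"
   using L[unfolded in_closure_of, THEN conjunct2, rule_format, OF conjI[OF T(2) T(1)]] by (elim exE conjE)
  thus "EX v:S \<inter> X. ALL phi:F. cmod (phi v - phi u) < e" by auto
 qed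
next
 assume R: ?R
 show ?L unfolding in_closure_of
 proof (intro conjI allI impI)
  show "u : topspace (initial_topology X Phi)" using R by simp
  fix T assume T: "u : T & openin (initial_topology X Phi) T"
  obtain F e where Fe: "finite F" "F \<subseteq> Phi" "e > 0" and sub: "{v : X. ALL phi:F. cmod (phi v - phi u) < e} \<subseteq> T"
   using T by (auto elim: initial_topology_nhdE)
  then obtain v where "v : S \<inter> X" "ALL phi:F. cmod (phi v - phi u) < e"
   using R by (auto dest!: spec[of _ F] spec[of _ e])
  thus "EX y. y : S & y : T" using sub by (intro exI[of _ v]) auto
 qed
qed

lemma continuous_map_initial_topology:
 assumes "phi : Phi"
 shows "continuous_map (initial_topology X Phi) euclidean phi"
 unfolding continuous_map_def using openin_initial_topology[OF assms] by auto

lemma continuous_map_into_initial_topology: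
 assumes "!!x. x : topspace Z ==> f x : X"
  and "!!phi. phi : Phi ==> continuous_map Z euclidean (%x. phi (f x))"
 shows "continuous_map Z (initial_topology X Phi) f"
 unfolding initial_topology_def
proof (rule continuous_on_generated_topo)
 fix U assume "U : insert X {{x : X. phi x : U} | phi U. phi : Phi & open U}"
 then consider "U = X" | phi V where "U = {x : X. phi x : V}" "phi : Phi" "open V" by blast
 thus "openin Z (f -` U \<inter> topspace Z)"
 proof cases
  case 1
  hence "f -` U \<inter> topspace Z = topspace Z" using assms(1) by auto
  thus ?thesis by simp
 next
  case 2
  hence "f -` U \<inter> topspace Z = {x : topspace Z. phi (f x) : V}" using assms(1) by auto
  thus ?thesis using assms(2)[OF 2(2)] 2(3) by (simp add: continuous_map_def)
 qed
next
 show "f ` topspace Z \<subseteq> \<Union> (insert X {{x : X. phi x : U} | phi U. phi : Phi & open U})"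
  using assms(1) by auto
qed

text \<open>Here \<open>L a x b y\<close> stands for \<open>a x + b y\<close>; no vector space axioms are needed.\<close>

lemma functional_in_span:
 fixes L :: "complex => 'v => complex => 'v => 'v" and psi :: "'v => complex"
 assumes "finite F"
  and "!!x y a b. x : S ==> y : S ==> L a x b y : S"
  and "!!phi x y a b. phi : insert psi F ==> x : S ==> y : S ==> phi (L a x b y) = a * phi x + b * phi y"
  and "!!x. x : S ==> (!!phi. phi : F ==> phi x = 0) ==> psi x = 0"
 shows "EX c. ALL x:S. psi x = (SUM phi:F. c phi * phi x)"
 using assms
proof (induction F arbitrary: S)
 case empty
 thus ?case by auto
next
 case (insert phi0 F)
 note lin = insert.prems(2)
 let ?S = "{x : S. phi0 x = 0}"
 have "EX c. ALL x:?S. psi x = (SUM phi:F. c phi * phi x)"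
 proof (rule insert.IH)
  show "L a x b y : ?S" if "x : ?S" "y : ?S" for x y a b
   using that insert.prems(1) lin[of phi0 x y a b] by auto
  show "phi (L a x b y) = a * phi x + b * phi y" if "phi : insert psi F" "x : ?S" "y : ?S" for phi x y a b
   using that lin by auto
  show "psi x = 0" if "x : ?S" "!!phi. phi : F ==> phi x = 0" for x
   using that insert.prems(3) by auto
 qed
 then obtain c where c: "!!x. x : S ==> phi0 x = 0 ==> psi x = (SUM phi:F. c phi * phi x)" by blast
 have sum_eq: "(SUM phi:F. (c(phi0 := k)) phi * phi x) = (SUM phi:F. c phi * phi x)" for k x
  by (rule sum.cong) (use insert.hyps(2) in auto)
 show ?case
 proof (cases "ALL x:S. phi0 x = 0")
  case True
  show ?thesis
   by (rule exI[of _ "c(phi0 := 0)"]) (use True c sum_eq insert.hyps in "auto")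
 next
  case False
  then obtain x1 where x1: "x1 : S" "phi0 x1 ~= 0" by blast
  \<comment> \<open>Since \<open>phi0 x0 = 1\<close>, the map
    \<open>x \<mapsto> L 1 x (- phi0 x) x0\<close> projects \<open>S\<close> to the kernel of
    \<open>phi0\<close>, where the induction hypothesis applies. The coefficient \<open>d\<close> of
    \<open>phi0\<close> is what is left over at \<open>x0\<close>.\<close>
  define x0 where "x0 = L (1 / phi0 x1) x1 0 x1"
  have x0: "x0 : S" "phi0 x0 = 1"
   using x1 insert.prems(1) lin[of phi0 x1 x1 "1 / phi0 x1" 0] by (auto simp: x0_def)
  define d where "d = psi x0 - (SUM phi:F. c phi * phi x0)"
  have "psi x = (SUM phi:insert phi0 F. (c(phi0 := d)) phi * phi x)" if x: "x : S" for x
  proof -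
   let ?z = "L 1 x (- phi0 x) x0"
   have z: "?z : S" using insert.prems(1) x x0 by blast
   have e: "phi ?z = phi x - phi0 x * phi x0" if "phi : insert psi (insert phi0 F)" for phi
    using lin[OF that x x0(1), of 1 "- phi0 x"] by simp
   have "phi0 ?z = 0" using e[of phi0] x0 by simp
   from c[OF z this] have "psi x - phi0 x * psi x0 = (SUM phi:F. c phi * (phi x - phi0 x * phi x0))"
    using e by (simp cong: sum.cong)
   also have "... = (SUM phi:F. c phi * phi x) - phi0 x * (SUM phi:F. c phi * phi x0)"
    by (simp add: sum_distrib_left sum_subtractf algebra_simps)
   finally show ?thesis
    using insert.hyps sum_eq by (simp add: d_def algebra_simps)
  qed
  thus ?thesis by blast
 qed
qed

text \<open>Only finitely many coordinates matter. A solution \<open>v0\<close> for \<open>F\<close>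
  is corrected along a vector that \<open>F\<close> kills and \<open>phi0\<close> does not; if there
  is none, \<open>phi0\<close> is a combination of \<open>F\<close> on \<open>S\<close>, and by
  hypothesis the same relation holds at \<open>u\<close>.\<close>

lemma functionals_match:
 fixes L :: "complex => 'v => complex => 'v => 'v" and F :: "('v => complex) set"
 assumes "finite F" and S: "S ~= {}"
  and L: "!!x y a b. x : S ==> y : S ==> L a x b y : S"
  and "!!phi x y a b. phi : F ==> x : S ==> y : S ==> phi (L a x b y) = a * phi x + b * phi y"
  and "!!c. (!!x. x : S ==> (SUM phi:F. c phi * phi x) = 0) ==> (SUM phi:F. c phi * phi u) = 0"
 shows "EX v:S. ALL phi:F. phi v = phi u"
 using assms(1,4,5)
proof (induction F)
 case empty
 thus ?case using S by auto
next
 case (insert phi0 F)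
 note lin = insert.prems(1) and van = insert.prems(2)
 have sum_eq: "(SUM phi:insert phi0 F. (c(phi0 := k)) phi * phi x) = k * phi0 x + (SUM phi:F. c phi * phi x)" for c k x
 proof -
  have "(SUM phi:F. (c(phi0 := k)) phi * phi x) = (SUM phi:F. c phi * phi x)"
   by (rule sum.cong) (use insert.hyps(2) in auto)
  thus ?thesis using insert.hyps by simp
 qed
 have "EX v:S. ALL phi:F. phi v = phi u"
 proof (rule insert.IH)
  show "phi (L a x b y) = a * phi x + b * phi y" if "phi : F" "x : S" "y : S" for phi x y a b
   using lin that by auto
  show "(SUM phi:F. c phi * phi u) = 0" if "!!x. x : S ==> (SUM phi:F. c phi * phi x) = 0" for c
   using van[of "c(phi0 := 0)"] that by (simp only: sum_eq) simp
 qed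
 then obtain v0 where v0: "v0 : S" "!!phi. phi : F ==> phi v0 = phi u" by blast
 show ?case
 proof (cases "EX w:S. (ALL phi:F. phi w = 0) & phi0 w ~= 0")
  case True
  then obtain w where w: "w : S" "!!phi. phi : F ==> phi w = 0" "phi0 w ~= 0" by blast
  define k where "k = (phi0 u - phi0 v0) / phi0 w"
  have "phi (L 1 v0 k w) = phi u" if "phi : insert phi0 F" for phi
   using lin[OF that v0(1) w(1), of 1 k] that v0(2)[of phi] w(2)[of phi] w(3)
   by (cases "phi = phi0") (auto simp: k_def)
  thus ?thesis using L v0 w by blast
 next
  case False
  have "EX c. ALL x:S. phi0 x = (SUM phi:F. c phi * phi x)"
   by (rule functional_in_span[where L = L]) (use insert.hyps L lin False in auto)
  then obtain c where c: "!!x. x : S ==> phi0 x = (SUM phi:F. c phi * phi x)" by blast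
  have "(SUM phi:insert phi0 F. (c(phi0 := -1)) phi * phi u) = 0"
   by (rule van) (simp only: sum_eq c, simp)
  hence "phi0 u = (SUM phi:F. c phi * phi u)" by (simp only: sum_eq)  simp
  also have "... = (SUM phi:F. c phi * phi v0)" by (rule sum.cong) (auto simp: v0)
  also have "... = phi0 v0" using c v0 by simp
  finally show ?thesis using v0 by auto
 qed
qed

text \<open>The bipolar theorem for a subspace. A basic neighbourhood sees finitely many
  functionals, and on those a point killed by the annihilator of \<open>S\<close> can even be
  matched exactly. Used with \<open>Phi\<close> coming from C*(G), it turns a weak* closure into a
  system of equations.\<close>

lemma closure_of_eq_annihilator:
 fixes L :: "complex => 'v => complex => 'v => 'v" and Phi :: "('v => complex) set"
 assumes S: "S ~= {}" "S \<subseteq> X"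
  and L: "!!x y a b. x : S ==> y : S ==> L a x b y : S"
  and lin: "!!phi x y a b. phi : Phi ==> x : S ==> y : S ==> phi (L a x b y) = a * phi x + b * phi y"
  and zero: "EX theta:Phi. ALL x:X. theta x = 0"
  and comb: "!!phi psi a. phi : Phi ==> psi : Phi ==> EX theta:Phi. ALL x:X. theta x = a * phi x + psi x"
 shows "u : initial_topology X Phi closure_of S \<longleftrightarrow>
  u : X & (ALL theta:Phi. (ALL v:S. theta v = 0) --> theta u = 0)" (is "?L \<longleftrightarrow> ?R")
proof
 assume L: ?L
 have "theta u = 0" if "theta : Phi" "ALL v:S. theta v = 0" for theta
 proof (rule ccontr)
  assume "theta u ~= 0"
  hence "cmod (theta u) > 0" by simp
  hence "finite {theta} & {theta} \<subseteq> Phi & cmod (theta u) > 0" using that(1) by simp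
  from L[unfolded in_closure_of_initial_topology, THEN conjunct2, rule_format, OF this]
  show False using that(2) by (auto simp: norm_minus_commute)
 qed
 thus ?R using L by (simp add: in_closure_of)
next
 assume R: ?R
 have fc: "EX theta:Phi. ALL x:X. theta x = (SUM phi:F. c phi * phi x)" if "finite F" "F \<subseteq> Phi" for F c
  using that
 proof (induction F)
  case empty
  thus ?case using zero by simp
 next
  case (insert phi F)
  then obtain psi where "psi : Phi" "ALL x:X. psi x = (SUM phi:F. c phi * phi x)" by auto
  with comb[of phi psi "c phi"] insert show ?case by fastforce
 qed
 have "EX v:S. ALL phi:F. phi v = phi u" if F: "finite F" "F \<subseteq> Phi" for F
 proof (rule functionals_match[OF F(1) S(1) L])
  show "phi (L a x b y) = a * phi x + b * phi y" if "phi : F" "x : S" "y : S" for phi x y a b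
   using lin that F by blast
  show "(SUM phi:F. c phi * phi u) = 0" if van: "!!x. x : S ==> (SUM phi:F. c phi * phi x) = 0" for c
  proof -
   obtain theta where theta: "theta : Phi" "!!x. x : X ==> theta x = (SUM phi:F. c phi * phi x)" using fc[OF F] by metis
   hence "ALL v:S. theta v = 0" using van S(2) by auto
   thus ?thesis using R theta by auto
  qed
 qed
 note match = this
 show ?L
  unfolding in_closure_of_initial_topology
 proof (intro conjI allI impI)
  show "u : X" using R by simp
  fix F and e :: real assume F: "finite F & F \<subseteq> Phi & e > 0"
  then obtain v where "v : S" "ALL phi:F. phi v = phi u" using match[of F] by auto
  thus "EX v:S \<inter> X. ALL phi:F. cmod (phi v - phi u) < e"
   using F S(2) by (intro bexI[of _ v]) auto
 qed
qed

section \<open>Semi-inner product spaces\<close>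

lemma cmod_square_le_if_quadratic_nonneg:
 assumes "A >= 0" "B >= 0" and q: "!!alpha. A + 2 * Re (alpha * z) + (cmod alpha)^2 * B >= 0"
 shows "(cmod z)^2 <= A * B"
proof (cases "B = 0")
 case True
 show ?thesis
 proof (rule ccontr)
  assume "~ ?thesis"
  hence z: "(cmod z)^2 > 0" using True by simp
  \<comment> \<open>With this \<open>t\<close> the quadratic expression equals
    \<open>A - (A + 1) = - 1\<close>.\<close>
  define t where "t = (A + 1) / (2 * (cmod z)^2)"
  have "A + 2 * Re (- of_real t * cnj z * z) >= 0" using q[of "- of_real t * cnj z"] True by simp
  moreover have "Re (- of_real t * cnj z * z) = - t * (cmod z)^2"
   by (simp add: cmod_power2) (simp add: algebra_simps power2_eq_square)
  moreover have "2 * (t * (cmod z)^2) = A + 1" using z by (simp add: t_def)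
  ultimately show False by simp
 qed
next
 case False
 hence B: "B > 0" using assms by simp
 have "0 <= A + 2 * Re (- of_real (1 / B) * cnj z * z) + (cmod (- of_real (1 / B) * cnj z))^2 * B"
  using q[of "- of_real (1 / B) * cnj z"] .
 moreover have "Re (- of_real (1 / B) * cnj z * z) = - (1 / B) * (cmod z)^2"
  by (simp add: cmod_power2) (simp add: algebra_simps power2_eq_square add_divide_distrib)
 moreover have "(cmod (- of_real (1 / B) * cnj z))^2 * B = (cmod z)^2 / B"
  using B by (simp add: norm_mult norm_divide power_mult_distrib power2_eq_square)
 ultimately have "0 <= A + 2 * (- (1 / B) * (cmod z)^2) + (cmod z)^2 / B" by argo
 hence "0 <= A - (cmod z)^2 / B" by simp
 thus ?thesis using B by (simp add: field_simps)
qed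

abbreviation hdiff :: "'h hspace => 'h => 'h => 'h" where
 "hdiff H x y \<equiv> hadd H x (hscale H (- 1) y)"

text \<open>Neither definiteness nor completeness is asked for. Lists under a positive definite
  function, square integrable functions before passing to classes, and even a space with the zero
  form are instances, and the estimates below are shared by all of them.\<close>

locale semi_inner =
 fixes H :: "'h hspace"
 assumes add_closed: "[|x : hcarrier H; y : hcarrier H|] ==> hadd H x y : hcarrier H"
  and scale_closed: "x : hcarrier H ==> hscale H a x : hcarrier H"
  and inner_add: "[|x : hcarrier H; y : hcarrier H; z : hcarrier H|]
     ==> hinner H (hadd H x y) z = hinner H x z + hinner H y z"
  and inner_scale: "[|x : hcarrier H; y : hcarrier H|]
     ==> hinner H (hscale H a x) y = a * hinner H x y"
  and inner_cnj: "[|x : hcarrier H; y : hcarrier H|] ==> hinner H y x = cnj (hinner H x y)"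
  and inner_nonneg: "x : hcarrier H ==> 0 <= Re (hinner H x x)"
begin

abbreviation "car \<equiv> hcarrier H"
abbreviation "inn \<equiv> hinner H"
abbreviation "hn \<equiv> hnorm H"
abbreviation "dif \<equiv> hdiff H"

lemma inner_add_right:
 "[|x : car; y : car; z : car|]
  ==> inn z (hadd H x y) = inn z x + inn z y"
 using inner_cnj[of "hadd H x y" z] inner_cnj[of x z] inner_cnj[of y z] add_closed[of x y]
  inner_add[of x y z] by simp

lemma inner_scale_right:
 "[|x : car; y : car|] ==> inn y (hscale H a x) = cnj a * inn y x"
 using inner_cnj[of "hscale H a x" y] inner_cnj[of x y] scale_closed[of x a] inner_scale[of x y a]
 by simp

lemmas inner_simps = add_closed scale_closed inner_add inner_scale inner_add_right inner_scale_right

lemma inner_self: "x : car ==> inn x x = complex_of_real ((hn x)^2)"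
 using inner_cnj[of x x] inner_nonneg[of x] unfolding hnorm_def
 by (simp add: complex_eq_iff)

lemma Re_inner_self: "x : car ==> Re (inn x x) = (hn x)^2"
 using inner_self[of x] by simp

lemma hnorm_nonneg: "x : car ==> 0 <= hn x"
 using inner_nonneg unfolding hnorm_def by simp

lemma hnorm_add_square:
 assumes "x : car" "y : car"
 shows "(hn (hadd H x y))^2 = (hn x)^2 + 2 * Re (inn x y) + (hn y)^2"
 using assms inner_cnj[OF assms] by (simp add: Re_inner_self[symmetric] inner_simps)

lemma hnorm_scale: "x : car ==> hn (hscale H a x) = cmod a * hn x"
proof -
 assume x: "x : car"
 have "(hn (hscale H a x))^2 = (cmod a * hn x)^2"
  using x by (simp add: Re_inner_self[symmetric] inner_simps power_mult_distrib)
   (simp add: inner_self cmod_power2, simp add: algebra_simps power2_eq_square)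
 thus ?thesis using x by (simp add: hnorm_nonneg scale_closed)
qed

lemma Cauchy_Schwarz:
 assumes x: "x : car" and y: "y : car"
 shows "cmod (inn x y) <= hn x * hn y"
proof -
 have "(cmod (inn y x))^2 <= (hn x)^2 * (hn y)^2"
 proof (rule cmod_square_le_if_quadratic_nonneg)
  fix alpha
  have "0 <= (hn (hadd H x (hscale H alpha y)))^2" by simp
  also have "... = (hn x)^2 + 2 * Re (alpha * inn y x) + (cmod alpha)^2 * (hn y)^2"
   using x y inner_cnj[OF x y]
   by (subst hnorm_add_square) (auto simp: inner_simps hnorm_scale power_mult_distrib)
  finally show "0 <= (hn x)^2 + 2 * Re (alpha * inn y x) + (cmod alpha)^2 * (hn y)^2" .
 qed auto
 hence "(cmod (inn x y))^2 <= (hn x * hn y)^2"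
  using inner_cnj[OF x y] by (simp add: power_mult_distrib)
 thus ?thesis using x y hnorm_nonneg by (simp add: power2_le_iff_abs_le)
qed

lemma hnorm_triangle:
 assumes "x : car" "y : car"
 shows "hn (hadd H x y) <= hn x + hn y"
proof -
 have "Re (inn x y) <= hn x * hn y"
  using Cauchy_Schwarz[OF assms] complex_Re_le_cmod order_trans by blast
 hence "(hn (hadd H x y))^2 <= (hn x + hn y)^2"
  unfolding hnorm_add_square[OF assms] by (simp add: power2_sum)
 thus ?thesis using assms hnorm_nonneg by (meson add_nonneg_nonneg power2_le_imp_le)
qed

lemma hnorm_diff_commute:
 assumes "x : car" "y : car"
 shows "hn (dif x y) = hn (dif y x)"
 unfolding hnorm_def using assms by (simp add: inner_simps)

lemma hnorm_diff_triangle: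
 assumes "x : car" "y : car" "z : car"
 shows "hn (dif x z) <= hn (dif x y) + hn (dif y z)"
proof -
 have "hn (dif x z) = hn (hadd H (dif x y) (dif y z))"
  unfolding hnorm_def using assms by (simp add: inner_simps)
 thus ?thesis using hnorm_triangle[of "dif x y" "dif y z"] assms by (simp add: inner_simps)
qed

lemma hnorm_le_add_diff:
 assumes "x : car" "y : car"
 shows "hn x <= hn y + hn (dif x y)"
proof -
 have "hn x = hn (hadd H y (dif x y))"
  unfolding hnorm_def using assms by (simp add: inner_simps)
 thus ?thesis using hnorm_triangle[of y "dif x y"] assms by (simp add: inner_simps)
qed

lemma inner_diff_le:
 assumes "x : car" "y : car" "z : car"
 shows "cmod (inn z x - inn z y) <= hn z * hn (dif x y)"
proof -
 have "inn z x - inn z y = inn z (dif x y)"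
  using assms by (simp add: inner_simps)
 thus ?thesis using Cauchy_Schwarz[of z "dif x y"] assms by (simp add: inner_simps)
qed

lemma inner_diff2_le:
 assumes "x : car" "y : car" "x' : car" "y' : car"
 shows "cmod (inn x y - inn x' y') <=
  hn (dif x x') * hn y + hn x' * hn (dif y y')"
proof -
 have eq: "inn x y - inn x' y' = inn (dif x x') y + inn x' (dif y y')"
  using assms by (simp add: inner_simps)
 have 1: "cmod (inn (dif x x') y) <= hn (dif x x') * hn y"
  by (rule Cauchy_Schwarz) (use assms in "auto simp: inner_simps")
 have 2: "cmod (inn x' (dif y y')) <= hn x' * hn (dif y y')"
  by (rule Cauchy_Schwarz) (use assms in "auto simp: inner_simps")
 show ?thesis unfolding eq by (rule order_trans[OF norm_triangle_ineq add_mono[OF 1 2]])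
qed

definition hCauchy :: "(nat => 'h) => bool" where
 "hCauchy s \<longleftrightarrow> range s \<subseteq> car & small (%m n. hn (dif (s m) (s n)))"

lemma hCauchyD: "hCauchy s ==> s n : car" "hCauchy s ==> small (%m n. hn (dif (s m) (s n)))"
 by (auto simp: hCauchy_def)

lemma hCauchyI:
 assumes "!!n. s n : car" "small f" "small g" "0 <= A" "0 <= B" "!!m n. hn (dif (s m) (s n)) <= A * f m n + B * g m n"
 shows "hCauchy s"
 using small_le[OF assms(2-6)] assms(1) by (auto simp: hCauchy_def)

lemma hCauchy_bounded:
 assumes r: "hCauchy r"
 shows "EX B>0. ALL n. hn (r n) <= B"
proof -
 note c = hCauchyD(1)[OF r]
 have "norm (hn (r m) - hn (r n)) <= 1 * hn (dif (r m) (r n))" for m n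
  using hnorm_le_add_diff[OF c c, of m n] hnorm_le_add_diff[OF c c, of n m] hnorm_diff_commute[OF c c, of n m]
  by simp
 from small_Cauchy[OF small_le1[OF hCauchyD(2)[OF r] zero_le_one this]] have "Cauchy (%n. hn (r n))" .
 thus ?thesis using Cauchy_Bseq BseqD by (metis abs_le_D1 real_norm_def)
qed

lemma hCauchy_add:
 assumes s: "hCauchy s" and t: "hCauchy t"
 shows "hCauchy (%n. hadd H (s n) (t n))"
proof (rule hCauchyI[OF _ hCauchyD(2)[OF s] hCauchyD(2)[OF t] zero_le_one zero_le_one])
 note c = hCauchyD(1)[OF s] hCauchyD(1)[OF t]
 show "hadd H (s n) (t n) : car" for n using c add_closed by auto
 fix m n
 have "hn (dif (hadd H (s m) (t m)) (hadd H (s n) (t n))) = hn (hadd H (dif (s m) (s n)) (dif (t m) (t n)))"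
  unfolding hnorm_def using c by (simp add: inner_simps algebra_simps)
 also have "... <= hn (dif (s m) (s n)) + hn (dif (t m) (t n))"
  by (rule hnorm_triangle) (use c in "auto simp: inner_simps")
 finally show "hn (dif (hadd H (s m) (t m)) (hadd H (s n) (t n))) <=
   1 * hn (dif (s m) (s n)) + 1 * hn (dif (t m) (t n))" by simp
qed

lemma hCauchy_scale:
 assumes s: "hCauchy s"
 shows "hCauchy (%n. hscale H a (s n))"
proof (rule hCauchyI[OF _ hCauchyD(2)[OF s] hCauchyD(2)[OF s] norm_ge_zero order_refl])
 note c = hCauchyD(1)[OF s]
 show "hscale H a (s n) : car" for n using c scale_closed by auto
 fix m n
 have "hn (dif (hscale H a (s m)) (hscale H a (s n))) = hn (hscale H a (dif (s m) (s n)))"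
  unfolding hnorm_def using c by (simp add: inner_simps algebra_simps)
 thus "hn (dif (hscale H a (s m)) (hscale H a (s n))) <= cmod a * hn (dif (s m) (s n)) + 0 * hn (dif (s m) (s n))"
  using hnorm_scale[of "dif (s m) (s n)"] c by (simp add: inner_simps)
qed

lemma hCauchy_const: "x : car ==> hCauchy (%_. x)"
 by (auto simp: hCauchy_def small_def hnorm_def inner_simps)

lemma hCauchy_inner_convergent:
 assumes s: "hCauchy s" and t: "hCauchy t"
 shows "convergent (%n. inn (s n) (t n))"
proof -
 note c = hCauchyD(1)[OF s] hCauchyD(1)[OF t]
 obtain B where B: "B > 0" "!!n. hn (s n) <= B" using hCauchy_bounded[OF s] by blast
 obtain C where C: "C > 0" "!!n. hn (t n) <= C" using hCauchy_bounded[OF t] by blast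
 have "small (%m n. norm (inn (s m) (t m) - inn (s n) (t n)))"
 proof (rule small_le[OF hCauchyD(2)[OF s] hCauchyD(2)[OF t] less_imp_le[OF C(1)] less_imp_le[OF B(1)]])
  fix m n
  have "cmod (inn (s m) (t m) - inn (s n) (t n)) <= hn (dif (s m) (s n)) * hn (t m) + hn (s n) * hn (dif (t m) (t n))"
   by (rule inner_diff2_le) (rule c)+
  also have "... <= hn (dif (s m) (s n)) * C + B * hn (dif (t m) (t n))"
   by (intro add_mono mult_left_mono mult_right_mono B C hnorm_nonneg inner_simps c)
  finally show "norm (inn (s m) (t m) - inn (s n) (t n)) <= C * hn (dif (s m) (s n)) + B * hn (dif (t m) (t n))"
   by (simp add: mult.commute)
 qed
 thus ?thesis by (intro Cauchy_convergent small_Cauchy)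
qed

text \<open>The parallelogram argument: a functional that gains a quarter of the squared distance at
  midpoints has almost minimisers that are close to each other. It serves the representation of
  functionals and the vector of minimal norm in a convex set.\<close>

lemma minimizing_sequence:
 assumes C: "C \<subseteq> car" "C ~= {}" "!!x y. x : C ==> y : C ==> hscale H (1/2) (hadd H x y) : C"
  and bb: "bdd_below (J ` C)"
  and J: "!!x y. x : C ==> y : C ==>
   (hn (dif x y))^2 / 2 <= J x + J y - 2 * J (hscale H (1/2) (hadd H x y))"
 shows "EX s. range s \<subseteq> C & hCauchy s & (ALL n. ALL x:C. J (s n) <= J x + 1 / real (Suc n))"
proof -
 have "EX y:C. J y < (INF x\<in>C. J x) + 1 / real (Suc n)" for n
  using cINF_less_iff[OF C(2) bb, of "(INF x\<in>C. J x) + 1 / real (Suc n)"] by auto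
 then obtain s where s: "!!n. s n : C" "!!n. J (s n) < (INF x\<in>C. J x) + 1 / real (Suc n)" by metis
 have near: "J (s n) <= J x + 1 / real (Suc n)" if "x : C" for n x
  using s(2)[of n] cINF_lower[OF bb that] by linarith
 have "(hn (dif (s m) (s n)))^2 <= 2 * (1 / real (Suc m) + 1 / real (Suc n))" for m n
  using J[OF s(1) s(1), of m n] near[OF C(3)[OF s(1) s(1)], of m m n] near[OF C(3)[OF s(1) s(1)], of n m n] by simp
 from small_power2D[OF small_le1[OF small_inverse_Suc _ this]] have "hCauchy s"
  using s(1) C(1) by (auto simp: hCauchy_def)
 thus ?thesis using s near by blast
qed

lemma hnorm_midpoint:
 assumes "x : car" "y : car"
 shows "(hn (dif x y))^2 / 2 =
  (hn x)^2 + (hn y)^2 - 2 * (hn (hscale H (1/2) (hadd H x y)))^2"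
proof -
 have "Re (inn y x) = Re (inn x y)" using inner_cnj[OF assms] by simp
 thus ?thesis using assms by (simp add: Re_inner_self[symmetric] inner_simps field_simps)
qed

text \<open>Without completeness \<open>phi\<close> is represented in the limit only. The sequence
  almost minimises \<open>J x = \<parallel>x\<parallel>^2 - 2 Re (phi x)\<close>; comparing
  \<open>s n\<close> with \<open>s n + alpha x\<close> for all complex \<open>alpha\<close> bounds
  \<open>(cmod (inn x (s n) - phi x))^2\<close> by the error times \<open>(hn x)^2\<close>.\<close>

lemma Riesz_sequence:
 assumes ne: "car ~= {}"
  and add: "!!x y. x : car ==> y : car ==> phi (hadd H x y) = phi x + phi y"
  and scale: "!!x a. x : car ==> phi (hscale H a x) = a * phi x"
  and bd: "!!x. x : car ==> cmod (phi x) <= K * hn x"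
 shows "EX s. hCauchy s & (ALL x:car. (%n. inn x (s n)) \<longlonglongrightarrow> phi x)"
proof -
 define J where "J x = (hn x)^2 - 2 * Re (phi x)" for x
 have "EX s. range s \<subseteq> car & hCauchy s & (ALL n. ALL x:car. J (s n) <= J x + 1 / real (Suc n))"
 proof (rule minimizing_sequence[OF _ ne])
  show "bdd_below (J ` car)"
  proof (rule bdd_belowI)
   fix j assume "j : J ` car"
   then obtain x where x: "x : car" "j = J x" by blast
   have "Re (phi x) <= K * hn x" using bd[OF x(1)] complex_Re_le_cmod order_trans by blast
   moreover have "(hn x)^2 - 2 * (K * hn x) + K^2 = (hn x - K)^2" by (simp add: power2_diff)
   moreover have "(hn x - K)^2 >= 0" by simp
   ultimately show "- (K^2) <= j" unfolding x(2) J_def by linarith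
  qed
  show "(hn (dif x y))^2 / 2 <= J x + J y - 2 * J (hscale H (1/2) (hadd H x y))"
   if "x : car" "y : car" for x y
  proof -
   have "Re (phi (hscale H (1/2) (hadd H x y))) = (Re (phi x) + Re (phi y)) / 2"
    unfolding scale[OF add_closed[OF that], of "1/2"] add[OF that] by simp
   thus ?thesis using hnorm_midpoint[OF that] by (simp add: J_def)
  qed
 qed (auto simp: inner_simps)
 then obtain s where s: "hCauchy s" and near: "!!n x. x : car ==> J (s n) <= J x + 1 / real (Suc n)"
  by blast
 have sc: "s n : car" for n using s unfolding hCauchy_def by auto
 have "(%n. inn x (s n)) \<longlonglongrightarrow> phi x" if x: "x : car" for x
 proof -
  have est: "(cmod (inn x (s n) - phi x))^2 <= 1 / real (Suc n) * (hn x)^2" for n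
  proof (rule cmod_square_le_if_quadratic_nonneg)
   fix alpha
   have "J (s n) <= J (hadd H (s n) (hscale H alpha x)) + 1 / real (Suc n)"
    by (rule near) (use sc x in "auto simp: inner_simps")
   moreover have "Re (inn (s n) (hscale H alpha x)) = Re (alpha * inn x (s n))"
    using x sc inner_cnj[OF x sc[of n]] by (simp add: inner_simps)
   hence "J (hadd H (s n) (hscale H alpha x)) = J (s n) + (cmod alpha)^2 * (hn x)^2 + 2 * Re (alpha * (inn x (s n) - phi x))"
    unfolding J_def using x sc add[OF sc[of n] scale_closed[OF x, of alpha]] scale[OF x, of alpha]
    by (subst hnorm_add_square) (auto simp: inner_simps hnorm_scale power_mult_distrib algebra_simps)
   ultimately show "0 <= 1 / real (Suc n) + 2 * Re (alpha * (inn x (s n) - phi x)) + (cmod alpha)^2 * (hn x)^2" by simp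
  qed auto
  have "(%n. (cmod (inn x (s n) - phi x))^2) \<longlonglongrightarrow> 0"
   by (rule tendsto_if_norm_le[OF tendsto_mult_left_zero[OF tendsto_inverse_Suc]]) (use est in auto)
  hence "(%n. cmod (inn x (s n) - phi x)) \<longlonglongrightarrow> 0"
   by (simp add: power_tendsto_0_iff)
  thus ?thesis by (rule LIM_zero_cancel[OF tendsto_norm_zero_cancel])
 qed
 with s show ?thesis by blast
qed

text \<open>Subtraction of the orthogonal projection onto the span of \<open>E\<close>. The residual
  is described by its inner products because vectors are determined only up to null vectors; the
  last clause is Pythagoras, which contains Bessel's inequality.\<close>

lemma orthonormal_residual:
 assumes E: "finite E" "E \<subseteq> car" "!!e f. e : E ==> f : E ==> inn e f = (if e = f then 1 else 0)" and b: "b : car"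
 shows "EX r:car. (ALL z:car. inn r z = inn b z - (SUM e:E. inn b e * inn e z)) & (ALL e:E. inn r e = 0) &
  (hn r)^2 + (SUM e:E. (cmod (inn b e))^2) = (hn b)^2"
proof -
 have "EX r:car. ALL z:car. inn r z = inn b z - (SUM e:G. inn b e * inn e z)" if "finite G" "G \<subseteq> car" for G
  using that
 proof (induction G)
  case empty
  thus ?case using b by auto
 next
  case (insert g G)
  then obtain r where r: "r : car" "!!z. z : car ==> inn r z = inn b z - (SUM e:G. inn b e * inn e z)" by auto
  show ?case
   by (rule bexI[of _ "hadd H r (hscale H (- inn b g) g)"]) (use insert r in "auto simp: inner_simps")
 qed
 then obtain r where r: "r : car" "!!z. z : car ==> inn r z = inn b z - (SUM e:E. inn b e * inn e z)"
  using E(1,2) by meson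
 have re: "inn r e = 0" if e: "e : E" for e
 proof -
  have "(SUM f:E. inn b f * inn f e) = (SUM f:E. if f = e then inn b f else 0)"
   by (rule sum.cong) (use E(3) e in auto)
  also have "... = inn b e" using E(1) e by simp
  finally show ?thesis using r(2)[of e] E(2) e by auto
 qed
 have c: "inn e z = cnj (inn z e)" if "e : E" "z : car" for e z using inner_cnj[OF that(2), of e] that E(2) by auto
 have "inn r r = inn b r" using r(2)[OF r(1)] c[OF _ r(1)] re by simp
 hence "inn r r = cnj (inn r b)" using inner_cnj[OF r(1) b] by simp
 also have "inn r b = inn b b - (SUM e:E. inn b e * cnj (inn b e))" using r(2)[OF b] c[OF _ b] by simp
 finally have "complex_of_real ((hn r)^2 + (SUM e:E. (cmod (inn b e))^2)) = of_real ((hn b)^2)"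
  unfolding inner_self[OF r(1)] inner_self[OF b] by (simp add: complex_norm_square[symmetric] del: of_real_power)
 hence "(hn r)^2 + (SUM e:E. (cmod (inn b e))^2) = (hn b)^2" by (simp only: of_real_eq_iff)
 with r re show ?thesis by blast
qed

text \<open>Gram-Schmidt up to null vectors: a residual of seminorm 0 adds no basis vector, as it is
  invisible to every test vector \<open>z\<close>.\<close>

lemma finite_orthonormal:
 assumes "finite B" "B \<subseteq> car"
 shows "EX E. finite E & E \<subseteq> car & (ALL e:E. ALL f:E. inn e f = (if e = f then 1 else 0)) &
  (ALL b:B. ALL z:car. inn b z = (SUM e:E. inn b e * inn e z))"
 using assms
proof (induction B)
 case empty
 thus ?case by (intro exI[of _ "{}"]) auto
next
 case (insert b B)
 then obtain E where E: "finite E" "E \<subseteq> car"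
  "!!e f. e : E ==> f : E ==> inn e f = (if e = f then 1 else 0)"
  "!!b z. b : B ==> z : car ==> inn b z = (SUM e:E. inn b e * inn e z)"
  by (metis insert_subset)
 have b: "b : car" and Bc: "B \<subseteq> car" using insert.prems by auto
 obtain r where r: "r : car" "!!z. z : car ==> inn r z = inn b z - (SUM e:E. inn b e * inn e z)"
  "!!e. e : E ==> inn r e = 0"
  using orthonormal_residual[OF E(1-3) b] by blast
 show ?case
 proof (cases "hn r = 0")
  case True
  have "inn b z = (SUM e:E. inn b e * inn e z)" if z: "z : car" for z
   using Cauchy_Schwarz[OF r(1) z] r(2)[OF z] True by simp
  hence "ALL x:insert b B. ALL z:car. inn x z = (SUM e:E. inn x e * inn e z)"
   using E(4) by blast
  thus ?thesis by (intro exI[of _ E] conjI ballI) (use E(1-3) in auto)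
 next
  case False
  define n where "n = hn r"
  define e0 where "e0 = hscale H (of_real (1 / n)) r"
  have n: "n > 0" using False hnorm_nonneg[OF r(1)] by (simp add: n_def)
  have e0: "e0 : car" using r(1) by (simp add: e0_def inner_simps)
  have e0e: "inn e0 e = 0" "inn e e0 = 0" if "e : E" for e
  proof -
   have ec: "e : car" using E that by auto
   show "inn e0 e = 0" using r(3)[OF that] r(1) ec by (simp add: e0_def inner_simps)
   thus "inn e e0 = 0" using inner_cnj[OF e0 ec] by simp
  qed
  have "inn r r = of_real (n^2)" using inner_self[OF r(1)] by (simp add: n_def)
  hence e00: "inn e0 e0 = 1"
   using r(1) n by (simp add: e0_def inner_scale inner_scale_right scale_closed power2_eq_square)
  have "e0 ~: E" using e0e(1)[of e0] e00 by auto
  have ob: "inn x z = (SUM e:insert e0 E. inn x e * inn e z)"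
   if x: "x : insert b B" and z: "z : car" for x z
  proof (cases "x = b")
   case True
   have "inn r e0 = inn b e0" using r(2)[OF e0] e0e(2) by (simp add: sum.neutral)
   hence "inn b e0 = of_real n"
    using n r(1) by (simp add: e0_def inner_simps inner_self n_def[symmetric] power2_eq_square)
   hence "inn b e0 * inn e0 z = inn r z"
    using n r(1) z by (simp add: e0_def inner_simps)
   thus ?thesis using True r(2)[OF z] \<open>e0 ~: E\<close> E(1) by simp
  next
   case False
   hence xB: "x : B" using x by simp
   have "inn x e0 = 0" using E(4)[OF xB e0] e0e(2) by (simp add: sum.neutral)
   thus ?thesis unfolding sum.insert[OF E(1) \<open>e0 ~: E\<close>] using E(4)[OF xB z] by simp
  qed
  show ?thesis
  proof (intro exI[of _ "insert e0 E"] conjI ballI)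
   show "finite (insert e0 E)" "insert e0 E \<subseteq> car" using E e0 by auto
   show "inn e f = (if e = f then 1 else 0)" if "e : insert e0 E" "f : insert e0 E" for e f
    using that E(3) e0e e00 \<open>e0 ~: E\<close> by (cases "e = e0"; cases "f = e0") auto
  qed (use ob in blast)
 qed
qed

lemma sum_cmod_inner_square:
 assumes "E \<subseteq> car" "b : car"
  and "!!z. z : car ==> inn b z = (SUM e:E. inn b e * inn e z)"
 shows "(SUM e:E. (cmod (inn b e))^2) = (hn b)^2"
proof -
 have "complex_of_real ((hn b)^2) = (SUM e:E. inn b e * inn e b)"
  using assms inner_self by metis
 also have "... = (SUM e:E. of_real ((cmod (inn b e))^2))"
 proof (rule sum.cong)
  fix e assume "e : E"
  hence "inn e b = cnj (inn b e)" using assms inner_cnj by blast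
  thus "inn b e * inn e b = of_real ((cmod (inn b e))^2)"
   by (simp add: complex_norm_square del: of_real_power)
 qed simp
 also have "... = complex_of_real (SUM e:E. (cmod (inn b e))^2)" by (simp only: of_real_sum)
 finally show ?thesis by (simp only: of_real_eq_iff)
qed

lemma Metric_space_hdistI:
 assumes sep: "!!x y. x : car ==> y : car ==> hn (dif x y) = 0 ==> x = y"
 shows "Metric_space (car) (hdist H)"
proof
 show "0 <= hdist H x y" for x y
  by (auto simp: hdist_def inner_simps intro: hnorm_nonneg)
 show "hdist H x y = hdist H y x" for x y
  by (auto simp: hdist_def hnorm_diff_commute)
 show "(hdist H x y = 0) = (x = y)" if "x : car" "y : car" for x y
 proof
  assume "hdist H x y = 0"
  thus "x = y" using that sep by (auto simp: hdist_def)
 next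
  assume "x = y"
  thus "hdist H x y = 0" using that by (simp add: hdist_def hnorm_def inner_simps)
 qed
 show "hdist H x z <= hdist H x y + hdist H y z"
  if "x : car" "y : car" "z : car" for x y z
  using that by (simp add: hdist_def hnorm_diff_triangle)
qed

lemma mcomplete_hdistI:
 assumes sep: "!!x y. x : car ==> y : car ==> hn (dif x y) = 0 ==> x = y"
  and lim: "!!s. hCauchy s ==> EX y:car. (%n. hn (dif (s n) y)) \<longlonglongrightarrow> 0"
 shows "Metric_space.mcomplete (car) (hdist H)"
proof -
 interpret M: Metric_space "car" "hdist H" by (rule Metric_space_hdistI[OF sep])
 show ?thesis unfolding M.mcomplete_def
 proof (intro allI impI)
  fix s assume s: "M.MCauchy s"
  hence sc: "s n : car" for n unfolding M.MCauchy_def by auto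
  have "hCauchy s"
   using s sc unfolding M.MCauchy_def hCauchy_def small_def hdist_def by auto
  then obtain y where y: "y : car" "(%n. hn (dif (s n) y)) \<longlonglongrightarrow> 0" using lim by blast
  have "EX N. ALL n>=N. s n : car & hdist H (s n) y < e" if "e > 0" for e
   using order_tendstoD(2)[OF y(2) that] sc y(1) by (auto simp: eventually_sequentially hdist_def)
  hence "limitin M.mtopology s y sequentially"
   using y(1) unfolding M.limit_metric_sequentially by blast
  thus "EX x. limitin M.mtopology s x sequentially" by blast
 qed
qed

end

section \<open>Hilbert spaces\<close>

sublocale hilbert_space \<subseteq> semi_inner
 by unfold_locales (fact add_closed scale_closed inner_add inner_scale inner_cnj inner_nonneg)+

context hilbert_space
begin

lemma hnorm_eq_0: "x : car ==> hn x = 0 ==> x = hzero H"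
 using inner_definite inner_self by simp

lemma hdiff_eq_0:
 assumes "x : car" "y : car" "dif x y = hzero H"
 shows "x = y"
proof -
 let ?n = "hscale H (- 1) y"
 have n: "?n : car" using assms scale_closed by blast
 have "x = hadd H x (hadd H y ?n)"
  using add_neg[OF assms(2)] add_commute[OF assms(1) zero_closed] add_zero[OF assms(1)] by simp
 also have "... = hadd H (dif x y) y"
  using add_commute[OF assms(2) n] add_assoc[OF assms(1) n assms(2)] by simp
 also have "... = y" using assms add_zero by simp
 finally show ?thesis .
qed

lemma eq_if_inner_eq:
 assumes "x : car" "y : car" "!!z. z : car ==> inn x z = inn y z"
 shows "x = y"
proof (rule hdiff_eq_0[OF assms(1,2)], rule inner_definite)
 show "dif x y : car" using assms by (simp add: inner_simps)
 thus "inn (dif x y) (dif x y) = 0"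
  using assms(1,2) assms(3)[of x] assms(3)[of y] by (simp add: inner_simps)
qed

lemma Metric_space_hdist: "Metric_space (car) (hdist H)"
proof (rule Metric_space_hdistI)
 fix x y assume xy: "x : car" "y : car" and "hn (dif x y) = 0"
 hence "dif x y = hzero H" by (intro hnorm_eq_0) (auto simp: inner_simps)
 thus "x = y" by (rule hdiff_eq_0[OF xy])
qed

lemma hCauchy_converges:
 assumes "hCauchy s"
 shows "EX y:car. (%n. hn (dif (s n) y)) \<longlonglongrightarrow> 0"
proof -
 interpret M: Metric_space "car" "hdist H" by (rule Metric_space_hdist)
 have sc: "s n : car" for n using assms unfolding hCauchy_def by auto
 have "M.MCauchy s"
  using assms sc unfolding M.MCauchy_def hCauchy_def small_def hdist_def by auto
 then obtain y where "limitin M.mtopology s y sequentially"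
  using complete unfolding M.mcomplete_def by blast
 hence y: "y : car" "!!e. e > 0 ==> EX N. ALL n>=N. s n : car & hdist H (s n) y < e"
  unfolding M.limit_metric_sequentially by auto
 have "(%n. hn (dif (s n) y)) \<longlonglongrightarrow> 0"
 proof (rule LIMSEQ_I)
  fix e :: real assume "e > 0"
  then obtain N where "ALL n>=N. hdist H (s n) y < e" using y(2) by blast
  thus "EX no. ALL n>=no. norm (hn (dif (s n) y) - 0) < e"
   using sc y(1) hnorm_nonneg by (intro exI[of _ N]) (auto simp: hdist_def inner_simps)
 qed
 thus ?thesis using y by blast
qed

lemma inner_tendsto:
 assumes "!!n. s n : car" "y : car" "x : car" "(%n. hn (dif (s n) y)) \<longlonglongrightarrow> 0"
 shows "(%n. inn x (s n)) \<longlonglongrightarrow> inn x y"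
 by (rule tendsto_if_norm_le[OF tendsto_mult_right_zero[OF assms(4)]]) (use inner_diff_le assms in blast)

lemma Riesz:
 assumes add: "!!x y. x : car ==> y : car ==> phi (hadd H x y) = phi x + phi y"
  and scale: "!!x a. x : car ==> phi (hscale H a x) = a * phi x"
  and bd: "!!x. x : car ==> cmod (phi x) <= K * hn x"
 shows "EX y:car. ALL x:car. phi x = inn x y"
proof -
 obtain s where s: "hCauchy s" "!!x. x : car ==> (%n. inn x (s n)) \<longlonglongrightarrow> phi x"
  using Riesz_sequence[of phi K] zero_closed assms by blast
 obtain y where y: "y : car" "(%n. hn (dif (s n) y)) \<longlonglongrightarrow> 0"
  using hCauchy_converges[OF s(1)] by blast
 have "phi x = inn x y" if "x : car" for x
 proof (rule LIMSEQ_unique[OF s(2)[OF that]])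
  show "(%n. inn x (s n)) \<longlonglongrightarrow> inn x y"
   by (rule inner_tendsto[OF _ y(1) that y(2)]) (use s(1) in "auto simp: hCauchy_def")
 qed
 with y show ?thesis by blast
qed

lemma continuous_map_htopology:
 assumes f: "!!x. x : topspace X ==> f x : car"
 shows "continuous_map X (htopology H) f \<longleftrightarrow> (ALL x:topspace X. ALL e>0. EX U. openin X U & x : U &
  (ALL y:U. hn (dif (f y) (f x)) < e))"
proof -
 interpret M: Metric_space "car" "hdist H" by (rule Metric_space_hdist)
 have "f y : M.mball (f x) e \<longleftrightarrow> hn (dif (f y) (f x)) < e" if "x : topspace X" "y : topspace X" for x y e
  using f[OF that(1)] f[OF that(2)] hnorm_diff_commute by (simp add: M.in_mball hdist_def)
 thus ?thesis unfolding htopology_def M.continuous_map_to_metric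
  by (intro ball_cong all_cong ex_cong conj_cong refl) (metis openin_subset subsetD)
qed

end

section \<open>Borel partitions of compact sets\<close>

text \<open>A finite subcover is made disjoint along an enumeration \<open>f\<close>: a point
  belongs to the first member that contains it. Functions of two variables become finite sums of
  products over such a partition.\<close>

lemma compact_Borel_partition:
 fixes K :: "'a::t2_space set"
 assumes K: "compact K" and V: "!!x. x : K ==> open (V x)" "!!x. x : K ==> x : V x"
 obtains S E where "finite S" "S \<subseteq> K" "!!x. x : S ==> E x : sets borel" "!!x. x : S ==> E x \<subseteq> V x"
  "disjoint_family_on E S" "(\<Union>x\<in>S. E x) = K"
proof -
 obtain S where S: "S \<subseteq> K" "finite S" "K \<subseteq> (\<Union>x\<in>S. V x)"
  by (rule compactE_image[OF K, of K V]) (use V in auto)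
 obtain f :: "'a => nat" where f: "inj_on f S" using finite_imp_inj_to_nat_seg[OF S(2)] by blast
 define E where "E x = K \<inter> V x - (\<Union>y\<in>{y : S. f y < f x}. V y)" for x
 have "t : (\<Union>x\<in>S. E x)" if t: "t : K" for t
 proof -
  obtain x0 where "x0 : S & t : V x0" using S t by blast
  from ex_has_least_nat[of "%x. x : S & t : V x", OF this, of f]
  obtain x where x: "x : S" "t : V x" "ALL y. y : S & t : V y --> f x <= f y" by blast
  hence "t : E x" using t unfolding E_def by (metis (mono_tags, lifting) DiffI IntI UN_E leD mem_Collect_eq)
  thus ?thesis using x(1) by blast
 qed
 hence "(\<Union>x\<in>S. E x) = K" by (auto simp: E_def)
 moreover have "E x \<inter> E y = {}" if "x : S" "y : S" "x ~= y" for x y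
 proof -
  have "f x < f y \<or> f y < f x" using inj_onD[OF f, of x y] that by linarith
  thus ?thesis using that by (auto simp: E_def)
 qed
 moreover have "E x : sets borel" if "x : S" for x
  unfolding E_def using S V K that by (intro sets.Diff sets.Int sets.finite_UN borel_compact borel_open) auto
 ultimately show ?thesis by (intro that[OF S(2,1), of E]) (auto simp: E_def disjoint_family_on_def)
qed

section \<open>Integration against a Haar measure\<close>

locale haar =
 fixes \<mu> :: "'g::{topological_group_add,t2_space} measure"
 assumes loc_compact: "locally_compact_space (euclidean :: 'g topology)"
  and haar: "left_haar_measure \<mu>"
begin

abbreviation Lint (binder "LI " 10) where "Lint f \<equiv> integral\<^sup>L \<mu> f"
abbreviation "intg \<equiv> integrable \<mu>"
abbreviation "cnorm \<equiv> cstar_norm \<mu>"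
abbreviation "pair \<equiv> cstar_pairing \<mu>"
abbreviation "CstG \<equiv> full_cstar \<mu>"

lemma sets_haar [simp, measurable_cong]: "sets \<mu> = sets borel"
 using haar by (simp add: left_haar_measure_def)

lemma space_haar [simp]: "space \<mu> = UNIV"
 using sets_eq_imp_space_eq[OF sets_haar] by simp

lemma borel_measurable_haar [simp]: "borel_measurable \<mu> = Meas"
 by (rule measurable_cong_sets) auto

lemma emeasure_compact: "compact K ==> emeasure \<mu> K < \<infinity>"
 using haar by (simp add: left_haar_measure_def)

lemma emeasure_translate: "A : sets borel ==> emeasure \<mu> ((%t. s + t) ` A) = emeasure \<mu> A"
 using haar by (simp add: left_haar_measure_def)

lemma continuous_translate: "cont (%t::'g. s + t)"
 by (intro continuous_intros)

lemma measurable_translate: "(%t::'g. s + t) : Meas"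
 by (rule borel_measurable_continuous_onI[OF continuous_translate])

lemma distr_translate: "distr \<mu> \<mu> (%t. s + t) = \<mu>"
proof (rule measure_eqI)
 fix A assume "A : sets (distr \<mu> \<mu> (%t. s + t))"
 hence A: "A : sets borel" by simp
 have *: "(%t. s + t) -` A = (%t. - s + t) ` A"
 proof (intro set_eqI iffI)
  fix x assume "x : (%t. s + t) -` A"
  thus "x : (%t. - s + t) ` A" by (intro image_eqI[of _ _ "s + x"]) (auto simp: add.assoc[symmetric])
 qed (auto simp: add.assoc[symmetric])
 have "(%t. s + t) : measurable \<mu> \<mu>"
  using measurable_translate[of s] by (simp cong: measurable_cong_sets)
 thus "emeasure (distr \<mu> \<mu> (%t. s + t)) A = emeasure \<mu> A"
  using A emeasure_translate[OF A, of "- s"] by (simp add: emeasure_distr *)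
qed simp

lemma measurable_translate_haar: "(%t. s + t) : measurable \<mu> \<mu>"
 using measurable_translate[of s] by (simp cong: measurable_cong_sets)

lemma integral_translate:
 fixes f :: "'g => 'b::{banach, second_countable_topology}"
 assumes "f : Meas"
 shows "(LI t. f (s + t)) = (LI t. f t)"
 using integral_distr[OF measurable_translate_haar[of s], of f] assms by (simp add: distr_translate)

lemma integrable_translate:
 fixes f :: "'g => 'b::{banach, second_countable_topology}"
 assumes "intg f"
 shows "intg (%t. f (s + t))"
 using integrable_distr[OF measurable_translate_haar[of s], of f] assms by (simp add: distr_translate)

lemma integral_translate':
 fixes f :: "'g => 'b::{banach, second_countable_topology}"
 assumes "f : Meas"
 shows "(LI t. f (- s + t)) = (LI t. f t)"
 using integral_translate[OF assms, of "- s"] by simp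

lemma measurable_comp_translate:
 fixes f :: "'g => 'b::topological_space"
 shows "f : Meas ==> (%t. f (s + t)) : Meas"
 by (rule measurable_compose[OF measurable_translate])

lemma emeasure_outer:
 assumes "A : sets borel"
 shows "emeasure \<mu> A = (INF U\<in>{U. open U & A \<subseteq> U}. emeasure \<mu> U)"
 using haar[unfolded left_haar_measure_def] assms by blast

lemma emeasure_inner:
 assumes "open U"
 shows "emeasure \<mu> U = (SUP K\<in>{K. compact K & K \<subseteq> U}. emeasure \<mu> K)"
 using haar[unfolded left_haar_measure_def] assms by blast

lemma ex_compact_pos: "EX K. compact K & emeasure \<mu> K > 0"
proof (rule ccontr)
 assume "~ ?thesis"
 hence "emeasure \<mu> UNIV <= 0"
  unfolding emeasure_inner[OF open_UNIV] by (intro SUP_least) (auto simp: not_gr_zero)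
 thus False using haar by (simp add: left_haar_measure_def)
qed

lemma open_translate: "open U ==> open ((%t::'g. s + t) ` U)"
proof -
 assume U: "open U"
 have "(%t. s + t) ` U = (%t. - s + t) -` U"
 proof (intro set_eqI iffI)
  fix x assume "x : (%t. - s + t) -` U"
  thus "x : (%t. s + t) ` U" by (intro image_eqI[of _ _ "- s + x"]) (auto simp: add.assoc[symmetric])
 qed (auto simp: add.assoc[symmetric])
 thus ?thesis using U continuous_translate by (simp add: open_vimage)
qed

text \<open>A compact set of positive measure is covered by finitely many left translates of
  \<open>U\<close>, all of the measure of \<open>U\<close>.\<close>

lemma emeasure_open_pos:
 assumes "open U" "U ~= {}"
 shows "emeasure \<mu> U > 0"
proof (rule ccontr)
 assume "~ ?thesis"
 hence U0: "emeasure \<mu> U = 0" by simp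
 obtain u where u: "u : U" using assms by blast
 obtain K where K: "compact K" "emeasure \<mu> K > 0" using ex_compact_pos by blast
 let ?V = "%x. (%t. (x - u) + t) ` U"
 obtain S where S: "S \<subseteq> K" "finite S" "K \<subseteq> (\<Union>x\<in>S. ?V x)"
 proof (rule compactE_image[OF K(1), of K ?V])
  show "K \<subseteq> (\<Union>x\<in>K. ?V x)"
  proof
   fix x assume "x : K"
   moreover have "x = (x - u) + u" by simp
   ultimately show "x : (\<Union>x\<in>K. ?V x)" using u by blast
  qed
 qed (use open_translate assms in auto)
 have "emeasure \<mu> K <= emeasure \<mu> (\<Union>x\<in>S. ?V x)"
  by (rule emeasure_mono) (use S open_translate assms in "auto intro!: borel_open")
 also have "... <= (SUM x:S. emeasure \<mu> (?V x))"
  by (rule emeasure_subadditive_finite) (use S open_translate assms in "auto intro!: borel_open")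
 also have "... = 0" using emeasure_translate[of U] U0 assms by simp
 finally show False using K by simp
qed

section \<open>Continuous functions of compact support\<close>

definition Cc :: "('g => 'b::real_normed_vector) => bool" where
 "Cc f \<longleftrightarrow> cont f & (EX K. compact K & (ALL t. t ~: K --> f t = 0))"

lemma Cc_continuous: "Cc f ==> cont f"
 by (simp add: Cc_def)

lemma CcE:
 assumes "Cc f"
 obtains K where "compact K" "!!t. t ~: K ==> f t = 0"
 using assms by (auto simp: Cc_def)

lemma CcI: "cont f ==> compact K ==> (!!t. t ~: K ==> f t = 0) ==> Cc f"
 by (auto simp: Cc_def)

lemma Cc_measurable: "Cc f ==> f : Meas"
 by (simp add: Cc_def borel_measurable_continuous_onI)

lemma Cc_bounded:
 assumes "Cc f"
 obtains B where "B > 0" "!!t. norm (f t) <= B"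
proof -
 obtain K where K: "compact K" "!!t. t ~: K ==> f t = 0" by (rule CcE[OF assms]) blast
 have "bounded (f ` K)"
  by (rule compact_imp_bounded, rule compact_continuous_image[OF _ K(1)])
   (use Cc_continuous[OF assms] in "auto intro: continuous_on_subset")
 then obtain B where B: "B > 0" "!!t. t : K ==> norm (f t) <= B" by (auto simp: bounded_pos)
 hence "norm (f t) <= B" for t using K(2)[of t] B by (cases "t : K") auto
 with B that show ?thesis by blast
qed

lemma integrable_if_bounded_compact_support:
 fixes f :: "'g => 'b::{banach, second_countable_topology}"
 assumes "f : Meas" "compact K" "!!t. t ~: K ==> f t = 0" "!!t. norm (f t) <= B"
 shows "intg f"
proof (rule Bochner_Integration.integrable_bound)
 show "intg (%t. indicator K t *\<^sub>R B)"
  using emeasure_compact[OF assms(2)] borel_compact[OF assms(2)] by simp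
 show "f : borel_measurable \<mu>" using assms by simp
 show "AE t in \<mu>. norm (f t) <= norm (indicator K t *\<^sub>R B)"
  using assms(3) assms(4) order_trans[OF norm_ge_zero assms(4)]
  by (intro AE_I2) (auto simp: indicator_def intro: order_trans[OF assms(4)])
qed

lemma Cc_integrable:
 fixes f :: "'g => 'b::{banach, second_countable_topology}"
 assumes "Cc f"
 shows "intg f"
proof -
 obtain K where K: "compact K" "!!t. t ~: K ==> f t = 0" by (rule CcE[OF assms]) blast
 obtain B where B: "B > 0" "!!t. norm (f t) <= B" using Cc_bounded[OF assms] by blast
 show ?thesis
  by (rule integrable_if_bounded_compact_support[OF Cc_measurable[OF assms] K B(2)])
qed

lemma Cc_mult_left:
 fixes f g :: "'g => 'b::real_normed_algebra"
 assumes "Cc f" "cont g"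
 shows "Cc (%t. f t * g t)"
 using assms unfolding Cc_def by (auto intro!: continuous_intros)

lemma Cc_mult_right:
 fixes f g :: "'g => 'b::real_normed_algebra"
 assumes "Cc f" "cont g"
 shows "Cc (%t. g t * f t)"
 using assms unfolding Cc_def by (auto intro!: continuous_intros)

lemma Cc_add:
 assumes "Cc f" "Cc g"
 shows "Cc (%t. f t + g t)"
proof -
 obtain K where K: "compact K" "!!t. t ~: K ==> f t = 0" by (rule CcE[OF assms(1)]) blast
 obtain L where L: "compact L" "!!t. t ~: L ==> g t = 0" by (rule CcE[OF assms(2)]) blast
 show ?thesis
  by (rule CcI[of _ "K \<union> L"])
   (use K L assms Cc_continuous in "auto intro!: continuous_intros compact_Un")
qed

lemma Cc_compose:
 assumes "Cc f" "cont h" "h 0 = 0"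
 shows "Cc (%t. h (f t))"
proof -
 obtain K where K: "compact K" "!!t. t ~: K ==> f t = 0" by (rule CcE[OF assms(1)]) blast
 show ?thesis
  by (rule CcI[OF _ K(1)])
   (use K assms Cc_continuous[OF assms(1)] in "auto intro!: continuous_on_compose2[of UNIV h]")
qed

lemma compact_translate: "compact K ==> compact ((%t::'g. s + t) ` K)"
 by (rule compact_continuous_image) (auto intro!: continuous_intros)

lemma Cc_translate:
 assumes "Cc f"
 shows "Cc (%t. f (s + t))"
proof -
 obtain K where K: "compact K" "!!t. t ~: K ==> f t = 0" by (rule CcE[OF assms(1)]) blast
 show ?thesis
 proof (rule CcI)
  show "cont (%t. f (s + t))"
   by (rule continuous_on_compose2[OF Cc_continuous[OF assms]]) (auto intro!: continuous_intros)
  show "compact ((%t. - s + t) ` K)" using compact_translate[OF K(1)] .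
  show "f (s + t) = 0" if "t ~: (%t. - s + t) ` K" for t
  proof (rule K(2))
   show "s + t ~: K"
   proof
    assume "s + t : K"
    moreover have "t = - s + (s + t)" by (simp add: add.assoc[symmetric])
    ultimately show False using that by blast
   qed
  qed
 qed
qed

lemma Urysohn_Cc:
 assumes "compact K" "open U" "K \<subseteq> U"
 obtains k :: "'g => real" where "Cc k" "!!t. 0 <= k t" "!!t. k t <= 1" "!!t. t : K ==> k t = 1"
  "!!t. t ~: U ==> k t = 0"
proof -
 let ?E = "euclidean :: 'g topology"
 have H: "Hausdorff_space ?E"
  by (simp add: Hausdorff_space_def disjnt_def) (metis hausdorff)
 have "EX V C. openin ?E V & compactin ?E C & closedin ?E C & K \<subseteq> V & V \<subseteq> C"
  using locally_compact_space_compact_closed_compact[of ?E] H loc_compact assms(1) by simp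
 then obtain V C where V: "open V" "compact C" "closed C" "K \<subseteq> V" "V \<subseteq> C" by auto
 have cr: "completely_regular_space ?E"
  using locally_compact_regular_imp_completely_regular_space[OF loc_compact] H by simp
 \<comment> \<open>Shrinking \<open>U\<close> by \<open>V\<close>, which lies in the compact set
   \<open>C\<close>, makes the separating function vanish outside \<open>C\<close>.\<close>
 have "closedin ?E (- (U \<inter> V))" using open_Int[OF assms(2) V(1)] by (simp add: closed_def)
 moreover have "disjnt K (- (U \<inter> V))" using assms V by (auto simp: disjnt_def)
 ultimately obtain f where f: "continuous_map ?E (top_of_set {0..1::real}) f" "f ` K \<subseteq> {1}" "f ` (- (U \<inter> V)) \<subseteq> {0}"
  using Urysohn_completely_regular_compact_closed[of 0 1 ?E K "- (U \<inter> V)"] cr assms(1)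
  by (metis compactin_euclidean_iff zero_le_one)
 have fc: "cont f" "!!t. f t : {0..1}"
  using f(1) by (auto simp: continuous_map_in_subtopology)
 show ?thesis
 proof (rule that[of f])
  show "Cc f"
  proof (rule CcI[OF fc(1) V(2)])
   fix t assume "t ~: C"
   hence "t : - (U \<inter> V)" using V by auto
   thus "f t = 0" using f(3) by blast
  qed
 qed (use fc(2) f in "auto simp: image_subset_iff")
qed

lemma integral_pos:
 fixes f :: "'g => real"
 assumes "cont f" "intg f" "!!t. 0 <= f t" "0 < f x"
 shows "0 < (LI t. f t)"
proof -
 let ?U = "f -` {f x / 2 <..}"
 have U: "open ?U" using assms(1) by (simp add: open_vimage)
 have "x : ?U" using assms(4) by simp
 hence pos: "emeasure \<mu> ?U > 0" using emeasure_open_pos[OF U] by blast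
 have "(LI t. f t) ~= 0"
 proof
  assume "(LI t. f t) = 0"
  hence "AE t in \<mu>. f t = 0" using integral_nonneg_eq_0_iff_AE[OF assms(2)] assms(3) by simp
  hence "AE t in \<mu>. t ~: ?U" by (rule AE_mp) (use assms(4) in auto)
  hence "emeasure \<mu> ?U = 0" using U by (subst (asm) AE_iff_measurable[of ?U]) auto
  thus False using pos by simp
 qed
 moreover have "0 <= (LI t. f t)" using assms(3) by simp
 ultimately show ?thesis by simp
qed

section \<open>Parameter integrals and the exchange of integrals\<close>

lemma near_on_compact:
 fixes Psi :: "'a::topological_space => 'b::topological_space => 'c::real_normed_vector"
 assumes "cont (%p. Psi (fst p) (snd p))" "compact K" "e > 0"
 obtains V where "open V" "s : V" "!!r t. r : V ==> t : K ==> norm (Psi r t - Psi s t) <= e"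
proof -
 have c: "continuous_on (UNIV \<times> K) (%p. Psi (fst p) (snd p))"
  by (rule continuous_on_subset[OF assms(1)]) simp
 obtain V where "s : V" "open V" "ALL r:V \<inter> UNIV. ALL t:K. dist (Psi (fst (r, t)) (snd (r, t))) (Psi (fst (s, t)) (snd (s, t))) <= e"
  using continuous_on_prod_compactE[OF c assms(2) UNIV_I assms(3)] .
 thus ?thesis by (intro that[of V]) (auto simp: dist_norm)
qed

lemma continuous_slice:
 assumes "cont (%p. Psi (fst p) (snd p))"
 shows "cont (Psi s)" and "cont (%s. Psi s t)"
proof -
 have "cont (%t. Psi (fst (s, t)) (snd (s, t)))"
  by (rule continuous_on_compose2[OF assms]) (auto intro!: continuous_intros)
 thus "cont (Psi s)" by simp
 have "cont (%s. Psi (fst (s, t)) (snd (s, t)))"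
  by (rule continuous_on_compose2[OF assms]) (auto intro!: continuous_intros)
 thus "cont (%s. Psi s t)" by simp
qed

lemma norm_integral_le_on_compact:
 fixes f :: "'g => 'b::{banach, second_countable_topology}"
 assumes "intg f" "compact K" "!!t. t ~: K ==> f t = 0" "!!t. t : K ==> norm (f t) <= e"
 shows "norm (LI t. f t) <= e * measure \<mu> K"
proof -
 have K: "K : sets \<mu>" "emeasure \<mu> K < \<infinity>" using borel_compact[OF assms(2)] emeasure_compact[OF assms(2)] by auto
 have "norm (LI t. f t) <= (LI t. norm (f t))" by (rule integral_norm_bound)
 also have "... <= (LI t. indicator K t *\<^sub>R e)"
 proof (rule integral_mono)
  show "intg (%t. indicator K t *\<^sub>R e)" using K by simp
  show "norm (f t) <= indicator K t *\<^sub>R e" for t using assms by (cases "t : K") auto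
 qed (use assms in auto)
 also have "... = e * measure \<mu> K" using K by simp
 finally show ?thesis .
qed

lemma continuous_integral:
 fixes Psi :: "'a::topological_space => 'g => 'b::{banach, second_countable_topology}"
 assumes c: "cont (%p. Psi (fst p) (snd p))" and K: "compact K" "!!s t. t ~: K ==> Psi s t = 0"
 shows "cont (%s. LI t. Psi s t)"
 unfolding continuous_on_def
proof
 fix s
 have int: "intg (Psi s)" for s
  by (rule Cc_integrable, rule CcI[OF continuous_slice(1)[OF c] K])
 show "((%s. LI t. Psi s t) \<longlongrightarrow> (LI t. Psi s t)) (at s within UNIV)"
 proof (rule tendstoI)
  fix e :: real assume e: "e > 0"
  define d where "d = e / (2 * (measure \<mu> K + 1))"
  have M: "measure \<mu> K >= 0" by simp
  have d: "d > 0" unfolding d_def using e M by (intro divide_pos_pos mult_pos_pos add_nonneg_pos) auto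
  obtain V where V: "open V" "s : V" "!!r t. r : V ==> t : K ==> norm (Psi r t - Psi s t) <= d"
   using near_on_compact[OF c K(1) d, of s] by metis
  have "dist (LI t. Psi r t) (LI t. Psi s t) < e" if "r : V" for r
  proof -
   have "norm (LI t. Psi r t - Psi s t) <= d * measure \<mu> K"
    by (rule norm_integral_le_on_compact[OF _ K(1)]) (use int K V that in auto)
   also have "... <= d * (measure \<mu> K + 1)" using d by simp
   also have "... = e / 2" using add_nonneg_pos[OF M zero_less_one] by (simp add: d_def divide_eq_eq)
   finally show ?thesis using int e by (simp add: dist_norm)
  qed
  thus "\<forall>\<^sub>F r in at s. dist (LI t. Psi r t) (LI t. Psi s t) < e"
   using V by (auto simp: eventually_at_topological)
 qed
qed

text \<open>Product measures are avoided because \<mu> may fail to be sigma-finite. On a Borel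
  partition of \<open>K\<close>, \<open>Psi\<close> is within \<open>e\<close> of the sum
  \<open>Theta\<close> of products \<open>indicator (E x) s * Psi x t\<close>, for which the
  exchange is linearity; both iterated integrals move by at most a multiple of
  \<open>e\<close>.\<close>

lemma Fubini_Cc:
 fixes Psi :: "'g => 'g => real"
 assumes c: "cont (%p. Psi (fst p) (snd p))"
  and K: "compact K" "!!s t. s ~: K ==> Psi s t = 0"
  and L: "compact L" "!!s t. t ~: L ==> Psi s t = 0"
 shows "(LI s. LI t. Psi s t) = (LI t. LI s. Psi s t)"
proof -
 have c': "cont (%p. Psi (snd p) (fst p))"
 proof -
  have "cont (%p. Psi (fst (prod.swap p)) (snd (prod.swap p)))"
   by (rule continuous_on_compose2[OF c]) (auto intro!: continuous_intros continuous_on_swap)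
  thus ?thesis by simp
 qed
 have int1: "intg (Psi s)" for s
  by (rule Cc_integrable, rule CcI[OF continuous_slice(1)[OF c] L])
 have int2: "intg (%s. Psi s t)" for t
  by (rule Cc_integrable, rule CcI[OF continuous_slice(2)[OF c] K])
 have z: "Psi s = (%_. 0)" if "s ~: K" for s using K(2)[OF that] by auto
 have "(LI t. Psi s t) = 0" if "s ~: K" for s unfolding z[OF that] by simp
 hence I1: "intg (%s. LI t. Psi s t)"
  by (intro Cc_integrable CcI[OF continuous_integral[OF c L] K(1)])
 have "(LI s. Psi s t) = 0" if "t ~: L" for t using L(2)[OF that] by simp
 hence I2: "intg (%t. LI s. Psi s t)"
  by (intro Cc_integrable CcI[OF continuous_integral[OF c' K] L(1)])
 define M where "M = measure \<mu> K * measure \<mu> L"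
 have est: "\<bar>(LI s. LI t. Psi s t) - (LI t. LI s. Psi s t)\<bar> <= 2 * M * e" if e: "e > 0" for e
 proof -
  have "EX V. open V & s : V & (ALL r:V. ALL t:L. norm (Psi r t - Psi s t) <= e)" for s
   using near_on_compact[OF c L(1) e, of s] by metis
  then obtain V where V: "!!s. open (V s)" "!!s. s : V s" "!!s r t. r : V s ==> t : L ==> norm (Psi r t - Psi s t) <= e"
   by metis
  obtain S E where S: "finite S" "S \<subseteq> K" and E: "!!x. x : S ==> E x : sets borel" "!!x. x : S ==> E x \<subseteq> V x"
   "disjoint_family_on E S" "(\<Union>x\<in>S. E x) = K"
   using compact_Borel_partition[OF K(1), of V] V by metis
  define Theta where "Theta s t = (SUM x:S. indicator (E x) s * Psi x t)" for s t
  have Eint: "intg (indicator (E x) :: 'g => real)" if "x : S" for x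
   by (rule integrable_if_bounded_compact_support[OF _ K(1), of _ 1]) (use that E in "auto simp: indicator_def")
  have ThetaK: "Theta s t = 0" if "s ~: K" for s t
   unfolding Theta_def using that E(4) by (intro sum.neutral) (auto simp: indicator_def)
  have ThetaL: "Theta s t = 0" if "t ~: L" for s t
   unfolding Theta_def using that L by (intro sum.neutral) auto
  have near: "\<bar>Psi s t - Theta s t\<bar> <= e" if st: "s : K" "t : L" for s t
  proof -
   obtain x where x: "x : S" "s : E x" using st(1) E(4) by blast
   have "Theta s t = (SUM y:S. if y = x then Psi x t else 0)"
    unfolding Theta_def
   proof (rule sum.cong)
    fix y assume "y : S"
    thus "indicator (E y) s * Psi y t = (if y = x then Psi x t else 0)"
     using x E(3) by (cases "y = x") (auto simp: indicator_def disjoint_family_on_def)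
   qed simp
   also have "... = Psi x t" using x S by simp
   finally show ?thesis using V(3)[of s x t] E(2)[OF x(1)] x st by auto
  qed
  have T1: "(LI t. Theta s t) = (SUM x:S. indicator (E x) s * (LI t. Psi x t))" for s
   unfolding Theta_def using int1 by (subst Bochner_Integration.integral_sum) auto
  have T2: "(LI s. Theta s t) = (SUM x:S. (LI s. indicator (E x) s) * Psi x t)" for t
   unfolding Theta_def using Eint by (subst Bochner_Integration.integral_sum) auto
  have Theta1: "intg (Theta s)" "intg (%s. Theta s t)" for s t
   unfolding Theta_def using int1 Eint by auto
  have J1: "intg (%s. LI t. Theta s t)" "intg (%t. LI s. Theta s t)"
   unfolding T1 T2 using Eint int1 by auto
  have same: "(LI s. LI t. Theta s t) = (LI t. LI s. Theta s t)"
   unfolding T1 T2 using Eint int1 by (subst (1 2) Bochner_Integration.integral_sum) auto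
  have b1: "norm (LI t. Psi s t - Theta s t) <= e * measure \<mu> L" if "s : K" for s
   by (rule norm_integral_le_on_compact[OF _ L(1)]) (use int1 Theta1 L ThetaL near that in auto)
  have b2: "norm (LI s. Psi s t - Theta s t) <= e * measure \<mu> K" if "t : L" for t
   by (rule norm_integral_le_on_compact[OF _ K(1)]) (use int2 Theta1 K ThetaK near that in auto)
  have "norm (LI s. (LI t. Psi s t) - (LI t. Theta s t)) <= (e * measure \<mu> L) * measure \<mu> K"
   by (rule norm_integral_le_on_compact[OF _ K(1)]) (use I1 J1 K ThetaK b1 int1 Theta1 in auto)
  hence d1: "\<bar>(LI s. LI t. Psi s t) - (LI s. LI t. Theta s t)\<bar> <= M * e"
   using I1 J1 by (simp add: M_def mult_ac)
  have "norm (LI t. (LI s. Psi s t) - (LI s. Theta s t)) <= (e * measure \<mu> K) * measure \<mu> L"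
   by (rule norm_integral_le_on_compact[OF _ L(1)]) (use I2 J1 L ThetaL b2 int2 Theta1 in auto)
  hence d2: "\<bar>(LI t. LI s. Psi s t) - (LI t. LI s. Theta s t)\<bar> <= M * e"
   using I2 J1 by (simp add: M_def mult_ac)
  show ?thesis using d1 d2 same by linarith
 qed
 have "\<bar>(LI s. LI t. Psi s t) - (LI t. LI s. Psi s t)\<bar> <= 0"
  by (rule le_if_le_add_mult[where C = "2 * M"]) (use est in simp)
 thus ?thesis by simp
qed

text \<open>Inner regularity is given on open sets, so \<open>A\<close> is first enlarged to
  \<open>U\<close>, and the compact \<open>K\<close> exhausts \<open>U\<close> rather than
  \<open>A\<close>. The error is bounded by the two defects of \<open>A\<close> and \<open>K\<close>
  in \<open>U\<close>.\<close>

lemma indicator_approx_Cc: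
 assumes A: "A : sets borel" "emeasure \<mu> A < \<infinity>" and e: "e > 0"
 obtains k :: "'g => real" where "Cc k" "(LI t. \<bar>indicator A t - k t\<bar>) < e"
proof -
 have eA: "emeasure \<mu> A = ennreal (measure \<mu> A)"
  using A(2) by (intro emeasure_eq_ennreal_measure) auto
 have "emeasure \<mu> A < ennreal (measure \<mu> A + e/3)" unfolding eA using e by (intro ennreal_lessI add_nonneg_pos) auto
 then obtain U where U: "open U" "A \<subseteq> U" and Uless: "emeasure \<mu> U < ennreal (measure \<mu> A + e/3)"
  unfolding emeasure_outer[OF A(1)] INF_less_iff by auto
 have Ufin: "emeasure \<mu> U < \<infinity>"
  using order.strict_trans[OF Uless ennreal_less_top] by simp
 have eU: "emeasure \<mu> U = ennreal (measure \<mu> U)"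
  using Ufin by (intro emeasure_eq_ennreal_measure) auto
 have mU1: "measure \<mu> U < measure \<mu> A + e/3"
  using Uless unfolding eU by (simp add: ennreal_less_iff del: ennreal_plus)
 obtain K where K: "compact K" "K \<subseteq> U" "measure \<mu> U < measure \<mu> K + e/3"
 proof (cases "measure \<mu> U < e/3")
  case True
  thus ?thesis using that[of "{}"] by simp
 next
  case False
  hence "ennreal (measure \<mu> U - e/3) < emeasure \<mu> U"
   unfolding eU using e by (intro ennreal_lessI) auto
  then obtain K where K: "compact K" "K \<subseteq> U" "ennreal (measure \<mu> U - e/3) < emeasure \<mu> K"
   unfolding emeasure_inner[OF U(1)] less_SUP_iff by auto
  have "emeasure \<mu> K = ennreal (measure \<mu> K)"
   using emeasure_compact[OF K(1)] by (intro emeasure_eq_ennreal_measure) auto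
  hence "measure \<mu> U - e/3 < measure \<mu> K" using K(3) False by (simp add: ennreal_less_iff)
  with K that show ?thesis by simp
 qed
 obtain k :: "'g => real" where k: "Cc k" "!!t. 0 <= k t" "!!t. k t <= 1" "!!t. t : K ==> k t = 1" "!!t. t ~: U ==> k t = 0"
  using Urysohn_Cc[OF K(1) U(1) K(2)] by blast
 have s: "U : sets \<mu>" "K : sets \<mu>" "A : sets \<mu>" using U A borel_compact[OF K(1)] by auto
 have fin: "emeasure \<mu> K < \<infinity>" using emeasure_compact[OF K(1)] .
 have "(LI t. \<bar>indicator A t - k t\<bar>) <=
   (LI t. (indicator U t - indicator A t) + (indicator U t - indicator K t))"
 proof (rule integral_mono)
  show "intg (%t. \<bar>indicator A t - k t\<bar>)"
   using s A Cc_integrable[OF k(1)] by auto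
  show "intg (%t. (indicator U t - indicator A t) + (indicator U t - indicator K t :: real))"
   using s A Ufin fin by auto
  show "\<bar>indicator A t - k t\<bar> <= (indicator U t - indicator A t) + (indicator U t - indicator K t)" for t
   using k(2)[of t] k(3)[of t] k(4)[of t] k(5)[of t] U(2) K(2) by (auto simp: indicator_def)
 qed
 also have "... = (measure \<mu> U - measure \<mu> A) + (measure \<mu> U - measure \<mu> K)"
  using s A Ufin fin by simp
 also have "... < e" using mU1 K(3) e by linarith
 finally show ?thesis using that[OF k(1)] by blast
qed

lemma Cc_dense_L1:
 fixes f :: "'g fn"
 assumes "intg f" "e > 0"
 shows "EX k. Cc k & (LI t. cmod (f t - k t)) < e"
 using assms
proof (induction arbitrary: e rule: integrable_induct)
 case (base A c)
 show ?case
 proof (cases "c = 0")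
  case True
  have "Cc (%t::'g. 0::complex)" by (rule CcI[of _ "{}"]) auto
  thus ?thesis using True base by (intro exI[of _ "%t. 0"]) auto
 next
  case False
  then obtain k :: "'g => real" where k: "Cc k" "(LI t. \<bar>indicator A t - k t\<bar>) < e / cmod c"
   using indicator_approx_Cc[of A "e / cmod c"] base by auto
  have "Cc (%t. of_real (k t) * c)" by (rule Cc_compose[OF k(1)]) (auto intro!: continuous_intros)
  moreover have "cmod (indicator A t *\<^sub>R c - of_real (k t) * c) = cmod c * \<bar>indicator A t - k t\<bar>" for t
  proof -
   have "indicator A t *\<^sub>R c - of_real (k t) * c = of_real (indicator A t - k t) * c"
    by (simp add: scaleR_conv_of_real algebra_simps)
   thus ?thesis by (simp add: norm_mult mult.commute del: of_real_diff)
  qed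
  moreover have "cmod c * (LI t. \<bar>indicator A t - k t\<bar>) < e" using k(2) False by (simp add: field_simps)
  ultimately show ?thesis by (intro exI[of _ "%t. of_real (k t) * c"]) simp
 qed
next
 case (add f g)
 obtain k where k: "Cc k" "(LI t. cmod (f t - k t)) < e/2" using add.IH(1)[of "e/2"] add by auto
 obtain l where l: "Cc l" "(LI t. cmod (g t - l t)) < e/2" using add.IH(2)[of "e/2"] add by auto
 have i: "intg (%t. cmod (f t - k t))" "intg (%t. cmod (g t - l t))"
  using add Cc_integrable[OF k(1)] Cc_integrable[OF l(1)] by auto
 have "(LI t. cmod (f t + g t - (k t + l t))) <= (LI t. cmod (f t - k t) + cmod (g t - l t))"
  using i add Cc_integrable[OF k(1)] Cc_integrable[OF l(1)]
  by (intro integral_mono) (auto simp: add_diff_add norm_triangle_ineq)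
 also have "... < e" using i k l by simp
 finally show ?case using Cc_add[OF k(1) l(1)] by blast
next
 case (lim f s)
 have "(%i. LI t. cmod (f t - s i t)) \<longlonglongrightarrow> (LI t. 0)"
 proof (rule integral_dominated_convergence[where w = "%t. 3 * cmod (f t)"])
  show "AE t in \<mu>. (%i. cmod (f t - s i t)) \<longlonglongrightarrow> 0"
  proof (rule AE_I2)
   fix t
   have "(%i. cmod (f t - s i t)) \<longlonglongrightarrow> cmod (f t - f t)"
    by (intro tendsto_intros) (use lim in auto)
   thus "(%i. cmod (f t - s i t)) \<longlonglongrightarrow> 0" by simp
  qed
  show "AE t in \<mu>. norm (cmod (f t - s i t)) <= 3 * cmod (f t)" for i
  proof (rule AE_I2)
   fix t assume "t : space \<mu>"
   thus "norm (cmod (f t - s i t)) <= 3 * cmod (f t)"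
    using lim.hyps(3)[of t i] norm_triangle_ineq4[of "f t" "s i t"] by simp
  qed
 qed (use lim in auto)
 then obtain i where i: "(LI t. cmod (f t - s i t)) < e/2"
  using lim.prems order_tendstoD(2)[of _ 0 sequentially "e/2"] by (auto simp: eventually_sequentially)
 obtain k where k: "Cc k" "(LI t. cmod (s i t - k t)) < e/2" using lim.IH[of "e/2" i] lim.prems by auto
 have ii: "intg (%t. cmod (f t - s i t))" "intg (%t. cmod (s i t - k t))"
  using lim Cc_integrable[OF k(1)] by auto
 have "(LI t. cmod (f t - k t)) <= (LI t. cmod (f t - s i t) + cmod (s i t - k t))"
 proof (rule integral_mono)
  show "cmod (f t - k t) <= cmod (f t - s i t) + cmod (s i t - k t)" for t
   using norm_triangle_ineq[of "f t - s i t" "s i t - k t"] by simp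
 qed (use ii lim Cc_integrable[OF k(1)] in auto)
 also have "... < e" using ii k i by simp
 finally show ?case using k(1) by blast
qed

definition sq_int :: "'g fn => bool" where
 "sq_int g \<longleftrightarrow> g : Meas & intg (%t. (cmod (g t))^2)"

lemma Cc_sq_int: "Cc k ==> sq_int k"
proof -
 assume k: "Cc k"
 have "Cc (%t. (cmod (k t))^2)"
  by (rule Cc_compose[OF k]) (auto intro!: continuous_intros)
 thus ?thesis using Cc_integrable Cc_measurable[OF k] by (simp add: sq_int_def)
qed

lemma cmod_add_square_le: "(cmod (a + b))^2 <= 2 * (cmod a)^2 + 2 * (cmod b)^2"
proof -
 have "(cmod (a + b))^2 <= (cmod a + cmod b)^2" by (intro power_mono norm_triangle_ineq) auto
 also have "... <= 2 * (cmod a)^2 + 2 * (cmod b)^2"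
  using sum_squares_bound[of "cmod a" "cmod b"] by (simp add: power2_sum)
 finally show ?thesis .
qed

lemma sq_int_add:
 assumes "sq_int f" "sq_int g"
 shows "sq_int (%t. f t + g t)"
 unfolding sq_int_def
proof
 show m: "(%t. f t + g t) : Meas" using assms by (auto simp: sq_int_def)
 show "intg (%t. (cmod (f t + g t))^2)"
 proof (rule Bochner_Integration.integrable_bound)
  show "intg (%t. 2 * (cmod (f t))^2 + 2 * (cmod (g t))^2)" using assms by (auto simp: sq_int_def)
  show "AE t in \<mu>. norm ((cmod (f t + g t))^2) <= norm (2 * (cmod (f t))^2 + 2 * (cmod (g t))^2)"
   using cmod_add_square_le by (intro AE_I2) auto
 qed (use m in auto)
qed

lemma sq_int_scale: "sq_int f ==> sq_int (%t. a * f t)"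
 by (auto simp: sq_int_def norm_mult power_mult_distrib)

lemma sq_int_translate: "sq_int f ==> sq_int (%t. f (s + t))"
 using integrable_translate[of "%t. (cmod (f t))^2" s]
 by (auto simp: sq_int_def intro: measurable_comp_translate)

lemma measurable_cnj [measurable]: "f : borel_measurable M ==> (%t. cnj (f t)) : borel_measurable M"
 by (rule borel_measurable_continuous_on[of cnj]) (auto intro!: continuous_intros)

lemma sq_int_cnj: "sq_int f ==> sq_int (%t. cnj (f t))"
 by (auto simp: sq_int_def)

lemma sq_int_mult_integrable:
 assumes "sq_int f" "sq_int g"
 shows "intg (%t. f t * cnj (g t))"
proof (rule Bochner_Integration.integrable_bound)
 show "intg (%t. (cmod (f t))^2 + (cmod (g t))^2)" using assms by (auto simp: sq_int_def)
 show "(%t. f t * cnj (g t)) : borel_measurable \<mu>" using assms by (auto simp: sq_int_def)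
 have "cmod (f t) * cmod (g t) <= (cmod (f t))^2 + (cmod (g t))^2" for t
  using sum_squares_bound[of "cmod (f t)" "cmod (g t)"] zero_le_power2[of "cmod (f t)"] zero_le_power2[of "cmod (g t)"]
   mult_nonneg_nonneg[OF norm_ge_zero[of "f t"] norm_ge_zero[of "g t"]] by linarith
 thus "AE t in \<mu>. norm (f t * cnj (g t)) <= norm ((cmod (f t))^2 + (cmod (g t))^2)"
  by (intro AE_I2) (auto simp: norm_mult)
qed

text \<open>The map \<open>a \<mapsto> \<bar>a\<bar> a\<close> is strongly monotone. Its difference
  paired with \<open>a - b\<close> exceeds
  \<open>(\<bar>a\<bar> + \<bar>b\<bar>) \<bar>a - b\<bar>^2 / 2\<close> by \<open>(\<bar>a\<bar> +
  \<bar>b\<bar>) (\<bar>a\<bar> - \<bar>b\<bar>)^2 / 2\<close>; Cauchy-Schwarz and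
  \<open>\<bar>a - b\<bar> <= \<bar>a\<bar> + \<bar>b\<bar>\<close> finish.\<close>

lemma norm_diff_square_le:
 fixes a b :: "'a::real_inner"
 shows "(norm (a - b))^2 <= 2 * norm (norm a *\<^sub>R a - norm b *\<^sub>R b)"
proof (cases "a = b")
 case False
 let ?p = "norm a" and ?q = "norm b" and ?d = "norm (a - b)" and ?n = "norm (norm a *\<^sub>R a - norm b *\<^sub>R b)"
 have d: "?d > 0" using False by simp
 have d2: "?d^2 = ?p^2 + ?q^2 - 2 * (a \<bullet> b)"
  and n: "(?p *\<^sub>R a - ?q *\<^sub>R b) \<bullet> (a - b) = ?p * ?p^2 + ?q * ?q^2 - (?p + ?q) * (a \<bullet> b)"
  by (simp_all add: power2_norm_eq_inner inner_diff_left inner_diff_right inner_commute[of b a] algebra_simps)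
 have "0 <= (?p + ?q) * (?p - ?q)^2" by simp
 hence "(?p + ?q) * ?d^2 <= 2 * ((?p *\<^sub>R a - ?q *\<^sub>R b) \<bullet> (a - b))"
  unfolding d2 n by (simp add: power2_eq_square algebra_simps)
 also have "... <= 2 * (?n * ?d)" by (intro mult_left_mono norm_cauchy_schwarz) simp
 finally have "(?p + ?q) * ?d <= 2 * ?n" using d by (simp add: power2_eq_square)
 moreover have "?d * ?d <= (?p + ?q) * ?d" by (intro mult_right_mono norm_triangle_ineq4) simp
 ultimately show ?thesis by (simp add: power2_eq_square)
qed simp

text \<open>\<open>z \<mapsto> z / sqrt \<bar>z\<bar>\<close> is Hoelder continuous of exponent 1/2 and inverts \<open>g \<mapsto> \<bar>g\<bar> g\<close>, which maps \<open>L\<^sup>2\<close> to \<open>L\<^sup>1\<close>.\<close>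

lemma Cc_dense_L2:
 assumes g: "sq_int g" and e: "e > 0"
 shows "EX k. Cc k & (LI t. (cmod (g t - k t))^2) < e"
proof -
 define r where "r z = (1 / sqrt (cmod z)) *\<^sub>R z" for z :: complex
 have r: "cmod (r z) *\<^sub>R r z = z" for z by (simp add: r_def real_div_sqrt)
 have h: "(cmod (a - r z))^2 <= 2 * cmod (cmod a *\<^sub>R a - z)" for a z using norm_diff_square_le[of a "r z"] by (simp add: r)
 have "cont r" unfolding continuous_on_def
 proof
  fix w
  have "((%z. sqrt (2 * cmod (z - w))) \<longlongrightarrow> sqrt (2 * cmod (w - w))) (at w within UNIV)" by (intro tendsto_intros)
  hence z: "((%z. sqrt (2 * cmod (z - w))) \<longlongrightarrow> 0) (at w within UNIV)" by simp
  have "norm (r z - r w) <= sqrt (2 * cmod (z - w))" for z using h[of "r z" w] by (simp add: r real_le_rsqrt)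
  from tendsto_if_norm_le[OF z this] show "(r \<longlongrightarrow> r w) (at w within UNIV)" .
 qed
 have m: "g : Meas" "intg (%t. (cmod (g t))^2)" using g by (auto simp: sq_int_def)
 have f: "intg (%t. cmod (g t) *\<^sub>R g t)"
  by (rule Bochner_Integration.integrable_bound[OF m(2)]) (use m(1) in "auto simp: power2_eq_square")
 obtain k where k: "Cc k" "(LI t. cmod (cmod (g t) *\<^sub>R g t - k t)) < e / 2" using Cc_dense_L1[OF f, of "e / 2"] e by auto
 have l: "Cc (%t. r (k t))" by (rule Cc_compose[OF k(1) \<open>cont r\<close>]) (simp add: r_def)
 have "(LI t. (cmod (g t - r (k t)))^2) <= (LI t. 2 * cmod (cmod (g t) *\<^sub>R g t - k t))"
 proof (rule integral_mono[OF _ _ h])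
  show "intg (%t. (cmod (g t - r (k t)))^2)"
   using sq_int_add[OF g sq_int_scale[OF Cc_sq_int[OF l], of "-1"]] by (simp add: sq_int_def)
 qed (use f Cc_integrable[OF k(1)] in auto)
 thus ?thesis using k(2) l by (intro exI[of _ "%t. r (k t)"]) simp
qed

end

section \<open>Positive definite functions\<close>

text \<open>
 A list of pairs \<open>(a, s)\<close> stands for the finitely supported function \<open>\<Sum> a \<delta>\<^sub>s\<close>.
\<close>

definition lin :: "'g fn => (complex \<times> 'g) list => complex" where
 "lin u c = (\<Sum>(a, s)\<leftarrow>c. a * u s)"

definition ip :: "('g::group_add => complex) => (complex \<times> 'g) list => (complex \<times> 'g) list => complex" where
 "ip p c d = (\<Sum>(a, s)\<leftarrow>c. \<Sum>(b, t)\<leftarrow>d. a * cnj b * p (- t + s))"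

definition posdef :: "('g::group_add => complex) => bool" where
 "posdef p \<longleftrightarrow> (ALL s. p (- s) = cnj (p s)) & (ALL c. 0 <= Re (ip p c c))"

definition list_space :: "('g::group_add => complex) => (complex \<times> 'g) list hspace" where
 "list_space p = \<lparr>hcarrier = UNIV, hzero = [], hadd = (@), hscale = (%a. map (%(b, s). (a * b, s))), hinner = ip p\<rparr>"

lemma lin_simps [simp]: "lin u [] = 0" "lin u ((a, s) # c) = a * u s + lin u c"
 "lin u (c @ d) = lin u c + lin u d"
 by (simp_all add: lin_def)

lemma lin_scale [simp]: "lin u (map (%(b, s). (a * b, s)) c) = a * lin u c"
 by (induction c) (auto simp: algebra_simps)

lemma ip_Nil [simp]: "ip p [] d = 0" "ip p c [] = 0"
 by (simp add: ip_def) (induction c; auto simp: ip_def)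

lemma ip_Cons_left: "ip p ((a, s) # c) d = a * (\<Sum>(b, t)\<leftarrow>d. cnj b * p (- t + s)) + ip p c d"
proof -
 have "(\<Sum>(b, t)\<leftarrow>d. a * cnj b * p (- t + s)) = a * (\<Sum>(b, t)\<leftarrow>d. cnj b * p (- t + s))"
  by (induction d) (auto simp: algebra_simps)
 thus ?thesis by (simp add: ip_def)
qed

lemma ip_Cons_right: "ip p c ((b, t) # d) = cnj b * (\<Sum>(a, s)\<leftarrow>c. a * p (- t + s)) + ip p c d"
 by (induction c) (auto simp: ip_def case_prod_beta algebra_simps)

lemma ip_append_left [simp]: "ip p (c @ c') d = ip p c d + ip p c' d"
 by (simp add: ip_def)

lemma ip_scale_left [simp]: "ip p (map (%(b, s). (a * b, s)) c) d = a * ip p c d"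
 by (induction c) (auto simp: ip_Cons_left algebra_simps)

lemma ip_commute:
 assumes "!!s. p (- s) = cnj (p s)"
 shows "ip p d c = cnj (ip p c d)"
proof (induction c)
 case (Cons x c)
 obtain a s where x: "x = (a, s)" by force
 have "(\<Sum>(b, t)\<leftarrow>d. b * p (- s + t)) = cnj (\<Sum>(b, t)\<leftarrow>d. cnj b * p (- t + s))"
 proof (induction d)
  case (Cons y d)
  have "p (- s + t) = cnj (p (- t + s))" for t using assms[of "- t + s"] by (simp add: minus_add)
  thus ?case using Cons by (auto simp: case_prod_beta)
 qed simp
 thus ?case using Cons by (simp add: x ip_Cons_left ip_Cons_right)
qed simp

lemma semi_inner_list_space:
 assumes "posdef p"
 shows "semi_inner (list_space p)"
proof
 show "hinner (list_space p) y x = cnj (hinner (list_space p) x y)" for x y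
  using assms by (simp add: list_space_def posdef_def) (rule ip_commute, blast)
 show "0 <= Re (hinner (list_space p) x x)" for x
  using assms by (simp add: list_space_def posdef_def)
qed (simp_all add: list_space_def)

lemma hnorm_list_space_square: "posdef p ==> (hnorm (list_space p) c)^2 = Re (ip p c c)"
 by (simp add: hnorm_def list_space_def posdef_def)

text \<open>The functional \<open>lin u\<close> has norm at most \<open>C\<close> in the seminorm of
  \<open>p\<close>. Equivalently, \<open>u\<close> is a coefficient of the cyclic representation of
  \<open>p\<close> between the cyclic vector and a vector of norm at most \<open>C\<close>, but no
  Hilbert space occurs in the condition.\<close>

definition dominated :: "('g::group_add => complex) => 'g fn => real => bool" where
 "dominated u p C \<longleftrightarrow> 0 <= C & (ALL c. (cmod (lin u c))^2 <= C^2 * Re (ip p c c))"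

subsection \<open>Coefficients of unitary representations are dominated by positive definite functions\<close>

text \<open>Unitarity is imposed on inner products alone. The left translations qualify on functions
  themselves, before almost-everywhere classes are formed, and on integrable functions with the zero
  form.\<close>

locale semi_rep = semi_inner H for H :: "'h hspace" +
 fixes \<pi> :: "'g::group_add => 'h => 'h"
 assumes rep_closed: "x : car ==> \<pi> s x : car"
  and rep_inner_rep: "x : car ==> y : car ==> inn (\<pi> s x) (\<pi> t y) = inn (\<pi> (- t + s) x) y"
  and rep_zero_inner: "x : car ==> y : car ==> inn (\<pi> 0 x) y = inn x y"
begin

abbreviation "cf \<equiv> coefficient H \<pi>"

text \<open>The vector \<open>hscale H 0 x\<close> replaces the zero vector, about which
  \<open>semi_inner\<close> says nothing.\<close>

primrec lincomb :: "'h => (complex \<times> 'g) list => 'h" where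
 "lincomb x [] = hscale H 0 x"
| "lincomb x (p # c) = hadd H (hscale H (fst p) (\<pi> (snd p) x)) (lincomb x c)"

lemma lincomb_closed: "x : car ==> lincomb x c : car"
 by (induction c) (auto simp: inner_simps rep_closed)

lemma inner_lincomb:
 assumes "x : car" "y : car"
 shows "inn (lincomb x c) y = lin (cf x y) c"
 using assms
 by (induction c) (auto simp: inner_simps rep_closed lincomb_closed coefficient_def)

lemma inner_lincomb_lincomb:
 assumes x: "x : car"
 shows "inn (lincomb x c) (lincomb x d) = ip (cf x x) c d"
proof (induction c)
 case (Cons y c)
 obtain a s where y: "y = (a, s)" by force
 have "inn (\<pi> s x) (lincomb x d) = (\<Sum>(b, t)\<leftarrow>d. cnj b * cf x x (- t + s))"
 proof (induction d)
  case (Cons z d)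
  with Cons show ?case
   using x by (auto simp: inner_simps rep_closed lincomb_closed case_prod_beta rep_inner_rep coefficient_def)
 qed (use x in "simp add: inner_simps rep_closed")
 thus ?case using x Cons by (simp add: y ip_Cons_left inner_simps rep_closed lincomb_closed)
qed (use x in "simp add: inner_simps lincomb_closed")

lemma posdef_coefficient:
 assumes x: "x : car"
 shows "posdef (cf x x)"
 unfolding posdef_def
proof (intro conjI allI)
 show "cf x x (- s) = cnj (cf x x s)" for s
  using rep_inner_rep[OF x x, of 0 s] rep_zero_inner[OF x rep_closed[OF x], of s] inner_cnj[OF rep_closed[OF x] x, of s]
  by (simp add: coefficient_def)
 show "0 <= Re (ip (cf x x) c c)" for c
  using inner_nonneg[OF lincomb_closed[OF x]] by (simp add: inner_lincomb_lincomb[OF x])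
qed

lemma dominated_coefficient:
 assumes x: "x : car" and y: "y : car"
 shows "dominated (cf x y) (cf x x) (hn y)"
 unfolding dominated_def
proof (intro conjI allI)
 show "0 <= hn y" by (rule hnorm_nonneg[OF y])
 fix c
 have "(cmod (lin (cf x y) c))^2 <= (hn (lincomb x c) * hn y)^2"
  using Cauchy_Schwarz[OF lincomb_closed[OF x] y] by (simp add: inner_lincomb[OF x y] power_mono)
 also have "... = (hn y)^2 * Re (ip (cf x x) c c)"
  using Re_inner_self[OF lincomb_closed[OF x, of c]] by (simp add: inner_lincomb_lincomb[OF x] power_mult_distrib)
 finally show "(cmod (lin (cf x y) c))^2 <= (hn y)^2 * Re (ip (cf x x) c c)" .
qed

end

locale urep =
 fixes H :: "'h hspace" and \<pi> :: "'g::{topological_group_add,t2_space} => 'h => 'h"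
 assumes urep: "unitary_rep H \<pi>"

sublocale urep \<subseteq> hilbert_space H
 using urep by (simp add: unitary_rep_def)

context urep
begin

lemma urep_closed: "x : car ==> \<pi> s x : car"
 using urep by (auto simp: unitary_rep_def hunitary_def hlinear_def)

lemma rep_add: "x : car ==> y : car ==> \<pi> s (hadd H x y) = hadd H (\<pi> s x) (\<pi> s y)"
 using urep by (auto simp: unitary_rep_def hunitary_def hlinear_def)

lemma rep_scale: "x : car ==> \<pi> s (hscale H a x) = hscale H a (\<pi> s x)"
 using urep by (auto simp: unitary_rep_def hunitary_def hlinear_def)

lemma rep_inner: "x : car ==> y : car ==> inn (\<pi> s x) (\<pi> s y) = inn x y"
 using urep by (auto simp: unitary_rep_def hunitary_def)

lemma rep_surj: "z : car ==> EX w:car. \<pi> s w = z"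
proof -
 assume "z : car"
 moreover have "\<pi> s ` car = car" using urep by (simp add: unitary_rep_def hunitary_def)
 ultimately show ?thesis by (metis imageE)
qed

lemma rep_mult: "x : car ==> \<pi> (s + t) x = \<pi> s (\<pi> t x)"
 using urep by (simp add: unitary_rep_def)

lemma rep_norm: "x : car ==> hn (\<pi> s x) = hn x"
 by (simp add: hnorm_def rep_inner)

text \<open>The definition of \<open>unitary_rep\<close> demands multiplicativity only; that the
  neutral element acts trivially follows because an idempotent surjective isometry is the
  identity.\<close>

lemma rep_zero: "x : car ==> \<pi> 0 x = x"
proof (rule eq_if_inner_eq)
 assume x: "x : car"
 thus "\<pi> 0 x : car" "x : car" by (auto simp: urep_closed)
 fix z assume "z : car"
 then obtain w where w: "w : car" "\<pi> 0 w = z" using rep_surj by blast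
 have "inn x z = inn (\<pi> 0 x) (\<pi> 0 (\<pi> 0 w))"
  using rep_inner[OF x urep_closed[OF w(1)], of 0 0] w by simp
 also have "\<pi> 0 (\<pi> 0 w) = z" using rep_mult[OF w(1), of 0 0] w by simp
 finally show "inn (\<pi> 0 x) z = inn x z" ..
qed

lemma rep_inverse: "x : car ==> \<pi> (- s) (\<pi> s x) = x" "x : car ==> \<pi> s (\<pi> (- s) x) = x"
 using rep_mult[of x "- s" s] rep_mult[of x s "- s"] rep_zero by auto

lemma rep_adjoint:
 assumes "x : car" "y : car"
 shows "inn (\<pi> s x) y = inn x (\<pi> (- s) y)"
 using rep_inner[OF assms(1) urep_closed[OF assms(2)], of s "- s"] rep_inverse(2)[OF assms(2), of s] by simp

end

sublocale urep \<subseteq> semi_rep H \<pi>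
proof
 fix x y s t assume xy: "x : hcarrier H" "y : hcarrier H"
 show "hinner H (\<pi> s x) (\<pi> t y) = hinner H (\<pi> (- t + s) x) y"
  using rep_adjoint[OF urep_closed[OF xy(1)] xy(2), of "- t" s] xy by (simp add: rep_mult)
 show "hinner H (\<pi> 0 x) y = hinner H x y" using xy by (simp add: rep_zero)
qed (rule urep_closed)

context urep
begin

lemma rep_continuous:
 assumes "x : car" "e > 0"
 obtains V where "open V" "s : V" "!!t. t : V ==> hn (dif (\<pi> t x) (\<pi> s x)) < e"
proof -
 have "continuous_map euclidean (htopology H) (%s. \<pi> s x)"
  using urep assms by (simp add: unitary_rep_def)
 hence "ALL s:topspace euclidean. ALL e>0. EX U. openin euclidean U & s : U & (ALL t:U. hn (dif (\<pi> t x) (\<pi> s x)) < e)"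
  using rep_closed[OF assms(1)] by (subst (asm) continuous_map_htopology) auto
 thus ?thesis using that assms(2) by (metis UNIV_I open_openin topspace_euclidean)
qed

lemma continuous_coefficient:
 assumes x: "x : car" and y: "y : car"
 shows "cont (cf x y)"
 unfolding continuous_on_def
proof
 fix s
 show "(cf x y \<longlongrightarrow> cf x y s) (at s within UNIV)"
 proof (rule tendstoI)
  fix e :: real assume e: "e > 0"
  have p: "hn y + 1 > 0" using hnorm_nonneg[OF y] by simp
  obtain V where V: "open V" "s : V" "!!t. t : V ==> hn (dif (\<pi> t x) (\<pi> s x)) < e / (hn y + 1)"
   using rep_continuous[OF x, of "e / (hn y + 1)" s] e p by (metis divide_pos_pos)
  have "dist (cf x y t) (cf x y s) < e" if "t : V" for t
  proof -
   let ?d = "dif (\<pi> t x) (\<pi> s x)"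
   have d: "?d : car" using x by (simp add: inner_simps rep_closed)
   have "cf x y t - cf x y s = inn ?d y"
    using x y by (simp add: coefficient_def inner_simps rep_closed)
   hence "dist (cf x y t) (cf x y s) <= hn ?d * hn y"
    using Cauchy_Schwarz[OF d y] by (simp add: dist_norm)
   also have "... <= hn ?d * (hn y + 1)" using hnorm_nonneg[OF d] by (simp add: mult_left_mono)
   also have "... < e" using V(3)[OF that] p by (simp add: pos_less_divide_eq)
   finally show ?thesis .
  qed
  thus "\<forall>\<^sub>F t in at s within UNIV. dist (cf x y t) (cf x y s) < e"
   using V by (auto simp: eventually_at_topological)
 qed
qed

lemma coefficient_zero: "x : car ==> Re (cf x x 0) = (hn x)^2"
 by (simp add: coefficient_def rep_zero Re_inner_self)

end

subsection \<open>The Hilbert space of a positive definite function\<close>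

text \<open>
 The completion of \<^const>\<open>list_space\<close>, realised by the functions \<open>t \<mapsto> \<langle>\<xi>|\<delta>\<^sub>t\<rangle>\<close>: its elements are
 the pointwise limits of Cauchy sequences of finitely supported functions.
\<close>

locale posdef_function =
 fixes p :: "'g::{topological_group_add,t2_space} => complex"
 assumes posdef: "posdef p" and cont: "cont p"
begin

sublocale L: semi_inner "list_space p"
 by (rule semi_inner_list_space[OF posdef])

abbreviation "nrm \<equiv> hnorm (list_space p)"
abbreviation "ldiff \<equiv> hdiff (list_space p)"
abbreviation "lscale a \<equiv> map (%(b, s). (a * b, s))"

lemma list_space_sel [simp]: "hcarrier (list_space p) = UNIV" "hinner (list_space p) = ip p"
  "hadd (list_space p) = (@)" "hscale (list_space p) = (%a. lscale a)"
 by (simp_all add: list_space_def)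

definition kf :: "(complex \<times> 'g) list => 'g fn" where
 "kf c t = ip p c [(1, t)]"

lemma kf_eq: "kf c t = lin (%s. p (- t + s)) c"
 by (simp add: kf_def ip_def lin_def case_prod_beta)

lemma kf_simps [simp]: "kf (c @ d) t = kf c t + kf d t" "kf (lscale a c) t = a * kf c t"
 by (simp_all add: kf_def)

lemma ip_eq_kf: "ip p c d = (\<Sum>(b, t)\<leftarrow>d. cnj b * kf c t)"
proof (induction d)
 case (Cons y d)
 thus ?case by (cases y) (simp add: ip_Cons_right kf_eq lin_def)
qed simp

definition approx :: "'g fn => (nat => (complex \<times> 'g) list) => bool" where
 "approx w c \<longleftrightarrow> L.hCauchy c & (ALL t. (%n. kf (c n) t) \<longlonglongrightarrow> w t)"

lemma approx_kf: "approx (kf c) (%_. c)"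
 using L.hCauchy_const[of c] by (simp add: approx_def)

lemma approx_add: "approx w c ==> approx v d ==> approx (%t. w t + v t) (%n. c n @ d n)"
 using L.hCauchy_add[of c d] by (auto simp: approx_def intro: tendsto_add)

lemma approx_scale: "approx w c ==> approx (%t. a * w t) (%n. lscale a (c n))"
 using L.hCauchy_scale[of c a] by (auto simp: approx_def intro!: tendsto_intros)

lemma approx_diff: "approx w c ==> approx v d ==> approx (%t. w t - v t) (%n. ldiff (c n) (d n))"
 using approx_add[OF _ approx_scale[of v d "-1"], of w c] by simp

text \<open>The reason why vectors may be realised as functions: a Cauchy sequence that tends to 0
  against every \<open>\<delta>\<^sub>t\<close> tends to 0 in norm. Split
  \<open>\<parallel>c n\<parallel>^2\<close> as the product of \<open>c n\<close> with a fixed late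
  \<open>c N\<close>, which tends to 0, plus its product with \<open>c n - c N\<close>, which is
  small.\<close>

lemma approx_zero_nrm:
 assumes "approx (%_. 0) c"
 shows "(%n. nrm (c n)) \<longlonglongrightarrow> 0"
proof -
 have c: "L.hCauchy c" and k: "!!t. (%n. kf (c n) t) \<longlonglongrightarrow> 0" using assms by (auto simp: approx_def)
 have ipd: "(%n. ip p (c n) d) \<longlonglongrightarrow> 0" for d
 proof (induction d)
  case (Cons y d)
  obtain b t where "y = (b, t)" by force
  thus ?case unfolding ip_eq_kf using tendsto_add[OF tendsto_mult_right_zero[OF k[of t], of "cnj b"] Cons]
   by (simp add: ip_eq_kf)
 qed simp
 obtain B where B: "B > 0" "!!n. nrm (c n) <= B" using L.hCauchy_bounded[OF c] by blast
 have "(%n. (nrm (c n))^2) \<longlonglongrightarrow> 0"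
 proof (rule LIMSEQ_I)
  fix e :: real assume e: "e > 0"
  hence "e / (2 * B) > 0" using B by simp
  then obtain N where N: "!!m n. m >= N ==> n >= N ==> nrm (ldiff (c m) (c n)) < e / (2 * B)"
   using L.hCauchyD(2)[OF c] unfolding small_def by meson
  obtain M where M: "!!n. n >= M ==> cmod (ip p (c n) (c N)) < e / 2"
   using LIMSEQ_D[OF ipd[of "c N"], of "e/2"] e by auto
  have "norm ((nrm (c n))^2 - 0) < e" if n: "n >= max M N" for n
  proof -
   have "(nrm (c n))^2 = Re (ip p (c n) (c n))" using posdef by (rule hnorm_list_space_square)
   also have "... <= cmod (ip p (c n) (c n))" by (rule complex_Re_le_cmod)
   also have "... <= cmod (ip p (c n) (c N)) + cmod (ip p (c n) (c n) - ip p (c n) (c N))"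
    using norm_triangle_ineq[of "ip p (c n) (c N)" "ip p (c n) (c n) - ip p (c n) (c N)"] by simp
   also have "... <= cmod (ip p (c n) (c N)) + nrm (c n) * nrm (ldiff (c n) (c N))"
    using L.inner_diff_le[of "c n" "c N" "c n"] by simp
   also have "... <= cmod (ip p (c n) (c N)) + B * nrm (ldiff (c n) (c N))"
    using B L.hnorm_nonneg[of "ldiff (c n) (c N)"] by (simp add: mult_right_mono)
   also have "... < e / 2 + B * (e / (2 * B))"
    using M[of n] N[of n N] n B by (intro add_strict_mono mult_strict_left_mono) auto
   also have "... = e" using B by simp
   finally show ?thesis by simp
  qed
  thus "EX no. ALL n>=no. norm ((nrm (c n))^2 - 0) < e" by blast
 qed
 thus ?thesis by (simp add: power_tendsto_0_iff)
qed

definition ap :: "'g fn => nat => (complex \<times> 'g) list" where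
 "ap w = (SOME c. approx w c)"

definition hsp :: "'g fn hspace" where
 "hsp = \<lparr>hcarrier = {w. EX c. approx w c}, hzero = (%_. 0), hadd = (%w v t. w t + v t),
  hscale = (%a w t. a * w t), hinner = (%w v. lim (%n. ip p (ap w n) (ap v n)))\<rparr>"

abbreviation "hcar \<equiv> hcarrier hsp"
abbreviation "hinn \<equiv> hinner hsp"
abbreviation "hnm \<equiv> hnorm hsp"
abbreviation "hdf \<equiv> hdiff hsp"

lemma hsp_sel [simp]: "hadd hsp w v = (%t. w t + v t)" "hscale hsp a w = (%t. a * w t)" "hzero hsp = (%_. 0)"
 by (simp_all add: hsp_def)

lemma hspI: "approx w c ==> w : hcar"
 by (auto simp: hsp_def)

lemma hsp_carrier: "w : hcar \<longleftrightarrow> (EX c. approx w c)"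
 by (auto simp: hsp_def)

text \<open>The inner product of \<open>hsp\<close> is computed from one chosen sequence per
  function; by \<open>approx_zero_nrm\<close> any other representing sequence gives the same
  limit.\<close>

lemma approx_inner:
 assumes w: "approx w c" and v: "approx v d"
 shows "(%n. ip p (c n) (d n)) \<longlonglongrightarrow> hinn w v"
proof -
 have aw: "approx w (ap w)" and av: "approx v (ap v)"
  unfolding ap_def using someI[of "approx w" c] someI[of "approx v" d] w v by auto
 have conv: "(%n. ip p (ap w n) (ap v n)) \<longlonglongrightarrow> hinn w v"
  using L.hCauchy_inner_convergent[of "ap w" "ap v"] aw av
  by (simp add: hsp_def approx_def convergent_LIMSEQ_iff)
 have z: "(%n. nrm (ldiff (c n) (ap w n))) \<longlonglongrightarrow> 0" "(%n. nrm (ldiff (d n) (ap v n))) \<longlonglongrightarrow> 0"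
  using approx_zero_nrm[of "%n. ldiff (c n) (ap w n)"] approx_zero_nrm[of "%n. ldiff (d n) (ap v n)"]
   approx_diff[OF w aw] approx_diff[OF v av] by simp_all
 obtain B where B: "B > 0" "!!n. nrm (d n) <= B" using L.hCauchy_bounded[of d] v by (auto simp: approx_def)
 obtain C where C: "C > 0" "!!n. nrm (ap w n) <= C" using L.hCauchy_bounded[of "ap w"] aw by (auto simp: approx_def)
 have zz: "(%n. nrm (ldiff (c n) (ap w n)) * B + C * nrm (ldiff (d n) (ap v n))) \<longlonglongrightarrow> 0"
  using tendsto_add[OF tendsto_mult_left_zero[OF z(1), of B] tendsto_mult_right_zero[OF z(2), of C]] by simp
 have "(%n. ip p (c n) (d n) - ip p (ap w n) (ap v n)) \<longlonglongrightarrow> 0"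
 proof (rule tendsto_if_norm_le[OF zz])
  fix n
  have "cmod (ip p (c n) (d n) - ip p (ap w n) (ap v n)) <=
    nrm (ldiff (c n) (ap w n)) * nrm (d n) + nrm (ap w n) * nrm (ldiff (d n) (ap v n))"
   using L.inner_diff2_le[of "c n" "d n" "ap w n" "ap v n"] by simp
  also have "... <= nrm (ldiff (c n) (ap w n)) * B + C * nrm (ldiff (d n) (ap v n))"
   by (intro add_mono mult_left_mono mult_right_mono B C L.hnorm_nonneg) auto
  finally show "norm (ip p (c n) (d n) - ip p (ap w n) (ap v n) - 0) <= nrm (ldiff (c n) (ap w n)) * B + C * nrm (ldiff (d n) (ap v n))"
   by simp
 qed
 from tendsto_add[OF this conv] show ?thesis by simp
qed

lemma semi_inner_hsp: "semi_inner hsp"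
proof
 fix x y z a assume x: "x : hcar" and y: "y : hcar"
 obtain c d where c: "approx x c" and d: "approx y d" using x y by (auto simp: hsp_carrier)
 show "hadd hsp x y : hcar" using hspI[OF approx_add[OF c d]] by simp
 show "hinn (hscale hsp a x) y = a * hinn x y"
 proof (rule LIMSEQ_unique)
  show "(%n. a * ip p (c n) (d n)) \<longlonglongrightarrow> hinn (hscale hsp a x) y"
   using approx_inner[OF approx_scale[OF c] d] by simp
  show "(%n. a * ip p (c n) (d n)) \<longlonglongrightarrow> a * hinn x y"
   by (intro tendsto_intros approx_inner[OF c d])
 qed
 show "hinn y x = cnj (hinn x y)"
 proof (rule LIMSEQ_unique)
  show "(%n. ip p (d n) (c n)) \<longlonglongrightarrow> hinn y x" by (rule approx_inner[OF d c])
  have "ip p (d n) (c n) = cnj (ip p (c n) (d n))" for n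
   using posdef by (intro ip_commute) (simp add: posdef_def)
  thus "(%n. ip p (d n) (c n)) \<longlonglongrightarrow> cnj (hinn x y)"
   using tendsto_cnj[OF approx_inner[OF c d]] by simp
 qed
 assume z: "z : hcar"
 obtain e where e: "approx z e" using z by (auto simp: hsp_carrier)
 show "hinn (hadd hsp x y) z = hinn x z + hinn y z"
 proof (rule LIMSEQ_unique)
  show "(%n. ip p (c n) (e n) + ip p (d n) (e n)) \<longlonglongrightarrow> hinn (hadd hsp x y) z"
   using approx_inner[OF approx_add[OF c d] e] by simp
  show "(%n. ip p (c n) (e n) + ip p (d n) (e n)) \<longlonglongrightarrow> hinn x z + hinn y z"
   by (intro tendsto_intros approx_inner c d e)
 qed
next
 fix x a assume "x : hcar"
 then obtain c where c: "approx x c" by (auto simp: hsp_carrier)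
 show "hscale hsp a x : hcar" using hspI[OF approx_scale[OF c]] by simp
 have "0 <= Re (ip p (c n) (c n))" for n using posdef by (simp add: posdef_def)
 thus "0 <= Re (hinn x x)"
  using LIMSEQ_le_const[OF tendsto_Re[OF approx_inner[OF c c]]] by blast
qed

sublocale H: semi_inner hsp by (rule semi_inner_hsp)

lemma approx_hnorm: "approx w c ==> (%n. nrm (c n)) \<longlonglongrightarrow> hnm w"
proof -
 assume w: "approx w c"
 have "(%n. sqrt (Re (ip p (c n) (c n)))) \<longlonglongrightarrow> sqrt (Re (hinn w w))"
  by (intro tendsto_intros approx_inner[OF w w])
 thus ?thesis by (simp add: hnorm_def)
qed

lemma kf_closed: "kf c : hcar"
 by (rule hspI[OF approx_kf])

lemma hdiff_hsp: "hdf w v = (%t. w t - v t)"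
 by simp

lemma inner_kf_kf: "hinn (kf c) (kf d) = ip p c d"
 by (rule LIMSEQ_unique[OF approx_inner[OF approx_kf approx_kf]]) auto

lemma hnorm_kf: "hnm (kf c) = nrm c"
 by (simp add: hnorm_def inner_kf_kf)

lemma hnorm_kf_diff: "hnm (hdf (kf c) (kf d)) = nrm (ldiff c d)"
proof -
 have "hdf (kf c) (kf d) = kf (ldiff c d)"
  by (rule ext) (simp only: hsp_sel list_space_sel kf_simps)
 thus ?thesis by (simp only: hnorm_kf)
qed

lemma approx_hnorm_diff:
 assumes w: "approx w c"
 shows "(%n. hnm (hdf w (kf (c n)))) \<longlonglongrightarrow> 0"
proof (rule LIMSEQ_I)
 fix e :: real assume e: "e > 0"
 hence "e / 2 > 0" by simp
 then obtain N where N: "!!m n. m >= N ==> n >= N ==> nrm (ldiff (c m) (c n)) < e / 2"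
  using w unfolding approx_def L.hCauchy_def small_def by meson
 have "norm (hnm (hdf w (kf (c n))) - 0) < e" if n: "n >= N" for n
 proof -
  have "approx (hdf w (kf (c n))) (%m. ldiff (c m) (c n))"
   unfolding hdiff_hsp by (rule approx_diff[OF w approx_kf])
  from approx_hnorm[OF this] have "hnm (hdf w (kf (c n))) <= e / 2"
   by (rule LIMSEQ_le_const2) (use N n in "auto intro!: exI[of _ N] less_imp_le")
  moreover have "hdf w (kf (c n)) : hcar"
   using hspI[OF w] kf_closed by (intro H.add_closed H.scale_closed)
  hence "0 <= hnm (hdf w (kf (c n)))" by (rule H.hnorm_nonneg)
  ultimately show ?thesis using e by simp
 qed
 thus "EX no. ALL n>=no. norm (hnm (hdf w (kf (c n))) - 0) < e" by blast
qed

lemma inner_kf: "w : hcar ==> hinn w (kf [(1, t)]) = w t"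
proof -
 assume "w : hcar"
 then obtain c where c: "approx w c" by (auto simp: hsp_carrier)
 show ?thesis
 proof (rule LIMSEQ_unique[OF approx_inner[OF c approx_kf]])
  show "(%n. ip p (c n) [(1, t)]) \<longlonglongrightarrow> w t" using c by (simp add: approx_def kf_def)
 qed
qed

lemma hsp_hnorm_zero: "w : hcar ==> hnm w = 0 ==> w = (%_. 0)"
proof
 fix t assume w: "w : hcar" "hnm w = 0"
 show "w t = 0" using H.Cauchy_Schwarz[OF w(1) kf_closed[of "[(1, t)]"]] inner_kf[OF w(1), of t] w(2) by simp
qed

lemma hsp_dense:
 assumes "w : hcar" "e > 0"
 obtains c where "hnm (hdf w (kf c)) < e"
proof -
 obtain c where "approx w c" using assms by (auto simp: hsp_carrier)
 thus ?thesis using order_tendstoD(2)[OF approx_hnorm_diff assms(2)] that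
  by (auto simp: eventually_sequentially)
qed

text \<open>A diagonal choice: each \<open>s n\<close> is replaced by a list within
  \<open>1 / Suc n\<close>. The lists form a Cauchy sequence, and their pointwise limit is the limit
  of \<open>s\<close>.\<close>

lemma hsp_complete:
 assumes s: "H.hCauchy s"
 shows "EX y:hcar. (%n. hnm (hdf (s n) y)) \<longlonglongrightarrow> 0"
proof -
 note sc = H.hCauchyD(1)[OF s]
 have "EX c. hnm (hdf (s n) (kf c)) < 1 / real (Suc n)" for n
  using hsp_dense[OF sc[of n], of "1 / real (Suc n)"] by (metis of_nat_0_less_iff zero_less_Suc zero_less_divide_1_iff)
 then obtain c where c: "!!n. hnm (hdf (s n) (kf (c n))) < 1 / real (Suc n)" by metis
 have cc: "L.hCauchy c"
 proof (rule L.hCauchyI[OF _ H.hCauchyD(2)[OF s] small_inverse_Suc zero_le_one zero_le_one])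
  fix m n
  have "nrm (ldiff (c m) (c n)) = hnm (hdf (kf (c m)) (kf (c n)))" by (rule hnorm_kf_diff[symmetric])
  moreover have "hnm (hdf (kf (c m)) (kf (c n))) <= hnm (hdf (kf (c m)) (s m)) + hnm (hdf (s m) (kf (c n)))"
   by (rule H.hnorm_diff_triangle[OF kf_closed sc kf_closed])
  moreover have "hnm (hdf (s m) (kf (c n))) <= hnm (hdf (s m) (s n)) + hnm (hdf (s n) (kf (c n)))"
   by (rule H.hnorm_diff_triangle[OF sc sc kf_closed])
  ultimately show "nrm (ldiff (c m) (c n)) <= 1 * hnm (hdf (s m) (s n)) + 1 * (1 / real (Suc m) + 1 / real (Suc n))"
   using c[of m] c[of n] H.hnorm_diff_commute[OF kf_closed sc, of "c m" m] unfolding mult_1 by linarith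
 qed simp
 have "convergent (%n. ip p (c n) [(1, t)])" for t
  using L.hCauchy_inner_convergent[OF cc L.hCauchy_const[of "[(1, t)]"]] by simp
 then obtain w where w: "!!t. (%n. kf (c n) t) \<longlonglongrightarrow> w t"
  unfolding kf_def convergent_def by metis
 have ap: "approx w c" using cc w by (simp add: approx_def)
 have z: "(%n. 1 / real (Suc n) + hnm (hdf w (kf (c n)))) \<longlonglongrightarrow> 0"
  using tendsto_add[OF tendsto_inverse_Suc approx_hnorm_diff[OF ap]] by simp
 have "norm (hnm (hdf (s n) w) - 0) <= 1 / real (Suc n) + hnm (hdf w (kf (c n)))" for n
  using H.hnorm_diff_triangle[OF sc[of n] kf_closed[of "c n"] hspI[OF ap]] c[of n]
   H.hnorm_diff_commute[OF kf_closed[of "c n"] hspI[OF ap]] H.hnorm_nonneg[OF H.add_closed[OF sc[of n] H.scale_closed[OF hspI[OF ap]]], of "-1"]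
  by (simp del: hsp_sel of_nat_Suc)
 from tendsto_if_norm_le[OF z this] hspI[OF ap] show ?thesis by blast
qed

lemma hilbert_space_hsp: "hilbert_space hsp"
proof
 show "hzero hsp : hcar" using hspI[OF approx_kf[of "[]"]] by (simp add: kf_eq[abs_def])
 show "Metric_space.mcomplete (hcar) (hdist hsp)"
 proof (rule H.mcomplete_hdistI[OF _ hsp_complete])
  fix x y assume xy: "x : hcar" "y : hcar" "hnm (hdf x y) = 0"
  hence "hdf x y = (%_. 0)" by (intro hsp_hnorm_zero H.add_closed H.scale_closed)
  thus "x = y" by (auto simp: fun_eq_iff)
 qed
 show "x = hzero hsp" if "x : hcar" "hinn x x = 0" for x
  using hsp_hnorm_zero[OF that(1)] that(2) by (simp add: hnorm_def)
qed (fact H.add_closed H.scale_closed H.inner_add H.inner_scale H.inner_cnj H.inner_nonneg |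
  simp add: fun_eq_iff algebra_simps)+

definition shift :: "'g => (complex \<times> 'g) list => (complex \<times> 'g) list" where
 "shift r = map (%(a, s). (a, r + s))"

lemma shift_simps [simp]: "shift r [] = []" "shift r ((a, s) # c) = (a, r + s) # shift r c"
  "shift r (c @ d) = shift r c @ shift r d"
 by (simp_all add: shift_def)

lemma shift_scale [simp]: "shift r (lscale a c) = lscale a (shift r c)"
 by (simp add: shift_def case_prod_beta)

lemma kf_shift: "kf (shift r c) t = kf c (- r + t)"
 by (induction c) (auto simp: kf_eq minus_add add.assoc)

lemma ip_shift: "ip p (shift r c) (shift r d) = ip p c d"
proof (induction d)
 case (Cons y d)
 obtain b t where y: "y = (b, t)" by force
 have "kf (shift r c) (r + t) = kf c t" by (simp add: kf_shift add.assoc[symmetric])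
 thus ?case using Cons by (simp add: y ip_eq_kf)
qed simp

lemma nrm_shift: "nrm (shift r c) = nrm c"
 by (simp add: hnorm_def ip_shift)

definition tr :: "'g => 'g fn => 'g fn" where
 "tr r w = (%t. w (- r + t))"

lemma approx_tr:
 assumes "approx w c"
 shows "approx (tr r w) (%n. shift r (c n))"
proof -
 have "ldiff (shift r (c m)) (shift r (c n)) = shift r (ldiff (c m) (c n))" for m n
  by (simp only: list_space_sel shift_simps shift_scale)
 thus ?thesis
  using assms by (auto simp: approx_def L.hCauchy_def small_def tr_def kf_shift nrm_shift simp del: shift_simps shift_scale)
qed

lemma tr_kf: "tr r (kf c) = kf (shift r c)"
 by (auto simp: tr_def kf_shift)

lemma tr_inner:
 assumes "x : hcar" "y : hcar"
 shows "hinn (tr r x) (tr r y) = hinn x y"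
proof -
 obtain c d where c: "approx x c" and d: "approx y d" using assms by (auto simp: hsp_carrier)
 show ?thesis
  using LIMSEQ_unique[OF approx_inner[OF approx_tr[OF c] approx_tr[OF d]], of r] approx_inner[OF c d]
  by (simp add: ip_shift)
qed

lemma tr_closed: "x : hcar ==> tr r x : hcar"
 by (auto simp: hsp_carrier intro: approx_tr)

lemma tr_norm: "x : hcar ==> hnm (tr r x) = hnm x"
 by (simp add: hnorm_def tr_inner)

lemma continuous_ip_shift: "cont (%s. ip p (shift s c) d)"
proof -
 have k: "cont (%s. kf (shift s c) t)" for t
 proof (induction c)
  case (Cons y c)
  obtain a r where y: "y = (a, r)" by force
  have "cont (%s. p (- t + (s + r)))"
   by (rule continuous_on_compose2[OF cont]) (auto intro!: continuous_intros)
  thus ?case using Cons by (simp add: y kf_eq continuous_intros)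
 qed (simp add: kf_eq)
 show ?thesis
 proof (induction d)
  case (Cons y d)
  thus ?case using k by (cases y) (simp add: ip_eq_kf continuous_intros)
 qed simp
qed

text \<open>On lists the squared distance between two shifts is \<open>2 Re (ip p c c)\<close> minus
  twice the real part of a continuous function of the shift. Density carries this over, the
  translations being isometric.\<close>

lemma tr_continuous:
 assumes w: "w : hcar" and e: "e > 0"
 shows "EX V. open V & s : V & (ALL r:V. hnm (hdf (tr r w) (tr s w)) < e)"
proof -
 have "e / 4 > 0" using e by simp
 then obtain c where c: "hnm (hdf w (kf c)) < e / 4" using hsp_dense[OF w] by metis
 define h where "h r = 2 * Re (ip p c c) - 2 * Re (ip p (shift r c) (shift s c))" for r
 have hn: "(nrm (ldiff (shift r c) (shift s c)))^2 = h r" for r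
 proof -
  have "Re (ip p (shift s c) (shift r c)) = Re (ip p (shift r c) (shift s c))"
   using L.inner_cnj[of "shift r c" "shift s c"] by simp
  thus ?thesis
   using L.hnorm_add_square[of "shift r c" "lscale (-1) (shift s c)"]
    L.inner_scale_right[of "shift s c" "shift r c" "-1"] L.hnorm_scale[of "shift s c" "-1"]
    hnorm_list_space_square[OF posdef, of "shift r c"] hnorm_list_space_square[OF posdef, of "shift s c"]
   by (simp add: h_def ip_shift)
 qed
 have "cont h" unfolding h_def by (intro continuous_intros continuous_ip_shift)
 hence "open (h -` {..< (e/2)^2})" by (simp add: open_vimage)
 moreover have "h s = 0" by (simp add: h_def ip_shift)
 moreover have "hnm (hdf (tr r w) (tr s w)) < e" if "h r < (e/2)^2" for r
 proof -
  have n: "nrm (ldiff (shift r c) (shift s c)) < e / 2"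
   using that[folded hn] by (rule power2_less_imp_less) (use e in simp)
  have d: "hnm (hdf (tr q w) (tr q (kf c))) < e / 4" for q
  proof -
   have "hdf (tr q w) (tr q (kf c)) = tr q (hdf w (kf c))" by (simp add: tr_def)
   thus ?thesis using tr_norm[of "hdf w (kf c)" q] c w kf_closed
    by (simp only: H.add_closed H.scale_closed)
  qed
  have "hnm (hdf (tr r w) (tr s w)) <= hnm (hdf (tr r w) (tr r (kf c)))
    + hnm (hdf (tr r (kf c)) (tr s w))"
   by (rule H.hnorm_diff_triangle) (intro tr_closed w kf_closed)+
  also have "hnm (hdf (tr r (kf c)) (tr s w)) <= hnm (hdf (tr r (kf c)) (tr s (kf c)))
    + hnm (hdf (tr s (kf c)) (tr s w))"
   by (rule H.hnorm_diff_triangle) (intro tr_closed w kf_closed)+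
  also have "hnm (hdf (tr r (kf c)) (tr s (kf c))) = nrm (ldiff (shift r c) (shift s c))"
   unfolding tr_kf by (rule hnorm_kf_diff)
  also have "hnm (hdf (tr s (kf c)) (tr s w)) = hnm (hdf (tr s w) (tr s (kf c)))"
   by (rule H.hnorm_diff_commute) (intro tr_closed w kf_closed)+
  finally show ?thesis using n d[of r] d[of s] by linarith
 qed
 ultimately show ?thesis using e by (intro exI[of _ "h -` {..< (e/2)^2}"]) auto
qed

lemma unitary_rep_hsp: "unitary_rep hsp tr"
 unfolding unitary_rep_def
proof (intro conjI allI ballI)
 interpret HH: hilbert_space hsp by (rule hilbert_space_hsp)
 show "hilbert_space hsp" by (rule hilbert_space_hsp)
 show "hunitary hsp hsp (tr s)" for s
  unfolding hunitary_def
 proof (intro conjI ballI)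
  show "hlinear hsp hsp (tr s)" by (auto simp: hlinear_def tr_closed) (auto simp: tr_def)
  show "tr s ` hcar = hcar"
  proof
   show "hcar \<subseteq> tr s ` hcar"
   proof
    fix w assume "w : hcar"
    moreover have "w = tr s (tr (- s) w)" by (simp add: tr_def add.assoc[symmetric])
    ultimately show "w : tr s ` hcar" using tr_closed by blast
   qed
  qed (auto simp: tr_closed)
 qed (rule tr_inner)
 show "tr (s + t) x = tr s (tr t x)" for s t x by (simp only: tr_def minus_add add.assoc)
 show "continuous_map euclidean (htopology hsp) (%s. tr s x)" if "x : hcar" for x
  using tr_continuous[OF that] tr_closed[OF that]
  by (subst HH.continuous_map_htopology) (auto simp: open_openin[symmetric] simp del: hsp_sel)
qed

text \<open>Riesz for \<open>lin u\<close> on lists. The representing vector is the complex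
  conjugate of \<open>u\<close>, since a vector is the function of its products with the
  \<open>\<delta>\<^sub>t\<close>, while the coefficient has the vector on the right.\<close>

lemma dominated_is_coefficient:
 assumes "dominated u p C"
 shows "EX y:hcar. hnm y <= C & coefficient hsp tr (kf [(1, 0)]) y = u"
proof -
 have C: "C >= 0" and dom: "!!c. cmod (lin u c) <= C * nrm c"
 proof -
  show C: "C >= 0" using assms by (simp add: dominated_def)
  fix c
  have "(cmod (lin u c))^2 <= (C * nrm c)^2"
   using assms by (simp add: dominated_def power_mult_distrib hnorm_list_space_square[OF posdef])
  thus "cmod (lin u c) <= C * nrm c"
   by (rule power2_le_imp_le) (simp add: C L.hnorm_nonneg)
 qed
 have "EX s. L.hCauchy s & (ALL x:hcarrier (list_space p). (%n. hinner (list_space p) x (s n)) \<longlonglongrightarrow> lin u x)"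
  by (rule L.Riesz_sequence[where K = C]) (auto simp: dom)
 then obtain s where s: "L.hCauchy s" "!!x. (%n. ip p x (s n)) \<longlonglongrightarrow> lin u x" by auto
 define y where "y t = cnj (u t)" for t
 have ap: "approx y s" unfolding approx_def
 proof (intro conjI allI s(1))
  fix t
  have "kf (s n) t = cnj (ip p [(1, t)] (s n))" for n
   unfolding kf_def using posdef by (intro ip_commute) (simp add: posdef_def)
  thus "(%n. kf (s n) t) \<longlonglongrightarrow> y t"
   using tendsto_cnj[OF s(2)[of "[(1, t)]"]] by (simp add: y_def)
 qed
 have yc: "y : hcar" by (rule hspI[OF ap])
 \<comment> \<open>The bound on \<open>lin u\<close> is tested on the very sequence that represents
   \<open>y\<close>.\<close>
 have "(hnm y)^2 <= C * hnm y"
 proof (rule LIMSEQ_le)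
  have "hinn (kf (s m)) y = lin u (s m)" for m
   by (rule LIMSEQ_unique[OF approx_inner[OF approx_kf ap] s(2)])
  hence b: "cmod (hinn (kf (s m)) y) <= C * nrm (s m)" for m using dom by simp
  have "norm (hinn y (kf (s m)) - hinn y y) <= hnm y * hnm (hdf y (kf (s m)))" for m
   by (metis H.inner_diff_le[OF yc kf_closed yc] norm_minus_commute)
  from tendsto_if_norm_le[OF tendsto_mult_right_zero[OF approx_hnorm_diff[OF ap]] this]
  have "(%m. hinn y (kf (s m))) \<longlonglongrightarrow> hinn y y" .
  hence "(%m. hinn (kf (s m)) y) \<longlonglongrightarrow> hinn y y"
   using tendsto_cnj H.inner_cnj[OF yc kf_closed] H.inner_cnj[OF yc yc] by fastforce
  from tendsto_norm[OF this] show "(%m. cmod (hinn (kf (s m)) y)) \<longlonglongrightarrow> (hnm y)^2"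
   using H.inner_self[OF yc] by (simp add: norm_power)
  show "(%m. C * nrm (s m)) \<longlonglongrightarrow> C * hnm y" by (intro tendsto_intros approx_hnorm[OF ap])
  show "EX N. ALL n>=N. cmod (hinn (kf (s n)) y) <= C * nrm (s n)" using b by blast
 qed
 hence "hnm y <= C"
  using H.hnorm_nonneg[OF yc] C by (cases "hnm y = 0") (auto simp: power2_eq_square)
 moreover have "coefficient hsp tr (kf [(1, 0)]) y t = u t" for t
  using inner_kf[OF yc, of t] H.inner_cnj[OF yc kf_closed, of "[(1, t)]"]
  by (simp add: coefficient_def tr_kf y_def)
 ultimately show ?thesis using yc by blast
qed

lemma hnorm_cyclic: "(hnm (kf [(1, 0)]))^2 = Re (p 0)"
 using hnorm_list_space_square[OF posdef, of "[(1, 0)]"] by (simp add: hnorm_kf ip_def)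

end

subsection \<open>Closure properties of domination\<close>

lemma ip_add: "ip (%s. p s + q s) c d = ip p c d + ip q c d"
proof -
 have *: "(\<Sum>(b, t)\<leftarrow>d. cnj b * (p (- t + s) + q (- t + s))) =
  (\<Sum>(b, t)\<leftarrow>d. cnj b * p (- t + s)) + (\<Sum>(b, t)\<leftarrow>d. cnj b * q (- t + s))" for s
  by (induction d) (auto simp: algebra_simps)
 show ?thesis
 proof (induction c)
  case (Cons x c)
  thus ?case by (cases x) (simp only: ip_Cons_left *, simp add: algebra_simps)
 qed simp
qed

lemma ip_const_mult: "ip (%s. a * p s) c d = a * ip p c d"
proof -
 have *: "(\<Sum>(b, t)\<leftarrow>d. cnj b * (a * p (- t + s))) = a * (\<Sum>(b, t)\<leftarrow>d. cnj b * p (- t + s))" for s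
  by (induction d) (auto simp: algebra_simps)
 show ?thesis
 proof (induction c)
  case (Cons x c)
  thus ?case by (cases x) (simp only: ip_Cons_left *, simp add: algebra_simps)
 qed simp
qed

lemma lin_add: "lin (%s. u s + v s) c = lin u c + lin v c"
 by (induction c) (auto simp: algebra_simps)

lemma lin_const_mult: "lin (%s. a * u s) c = a * lin u c"
 by (induction c) (auto simp: algebra_simps)

lemma lin_zero: "lin (%_. 0) c = 0"
 by (induction c) auto

lemma posdef_add: "posdef p ==> posdef q ==> posdef (%s. p s + q s)"
 by (simp add: posdef_def ip_add)

lemma posdef_scale: "posdef p ==> 0 <= r ==> posdef (%s. of_real r * p s)"
 by (simp add: posdef_def ip_const_mult)

lemma posdef_zero_nonneg:
 assumes "posdef p"
 shows "0 <= Re (p 0)"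
 using assms[unfolded posdef_def, THEN conjunct2, rule_format, of "[(1, 0)]"] by (simp add: ip_def)

lemma dominated_add:
 assumes "posdef p" "posdef q" "dominated u p C" "dominated v q D"
 shows "dominated (%s. u s + v s) (%s. p s + q s) (C + D)"
 unfolding dominated_def
proof (intro conjI allI)
 have nn: "C >= 0" "D >= 0" using assms by (auto simp: dominated_def)
 thus "0 <= C + D" by simp
 fix c
 let ?P = "Re (ip p c c)" and ?Q = "Re (ip q c c)"
 have PQ: "?P >= 0" "?Q >= 0" using assms by (auto simp: posdef_def)
 have "(cmod (lin u c))^2 <= (C * sqrt (?P + ?Q))^2"
  using assms(3) PQ nn by (simp add: dominated_def power_mult_distrib) (smt (verit, best) mult_left_mono zero_le_power2)
 hence 1: "cmod (lin u c) <= C * sqrt (?P + ?Q)" by (rule power2_le_imp_le) (use nn PQ in simp)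
 have "(cmod (lin v c))^2 <= (D * sqrt (?P + ?Q))^2"
  using assms(4) PQ nn by (simp add: dominated_def power_mult_distrib) (smt (verit, best) mult_left_mono zero_le_power2)
 hence 2: "cmod (lin v c) <= D * sqrt (?P + ?Q)" by (rule power2_le_imp_le) (use nn PQ in simp)
 have "cmod (lin (%s. u s + v s) c) <= (C + D) * sqrt (?P + ?Q)"
  unfolding lin_add using norm_triangle_ineq[of "lin u c" "lin v c"] 1 2 by (simp add: algebra_simps)
 hence "(cmod (lin (%s. u s + v s) c))^2 <= ((C + D) * sqrt (?P + ?Q))^2" by (rule power_mono) simp
 thus "(cmod (lin (%s. u s + v s) c))^2 <= (C + D)^2 * Re (ip (%s. p s + q s) c c)"
  using PQ by (simp add: power_mult_distrib ip_add)
qed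

lemma dominated_scale:
 assumes "dominated u p C"
 shows "dominated (%s. a * u s) p (cmod a * C)"
 using assms unfolding dominated_def
 by (auto simp: lin_const_mult norm_mult power_mult_distrib mult.assoc intro!: mult_left_mono)

lemma dominated_mono: "posdef p ==> dominated u p C ==> C <= D ==> dominated u p D"
 unfolding dominated_def posdef_def by (meson order_trans mult_right_mono power_mono)

lemma dominated_bound:
 assumes "dominated u p C"
 shows "cmod (u s) <= C * sqrt (Re (p 0))"
proof -
 have C: "0 <= C" and "(cmod (lin u [(1, s)]))^2 <= C^2 * Re (ip p [(1, s)] [(1, s)])"
  using assms unfolding dominated_def by blast+
 hence "(cmod (u s))^2 <= C^2 * Re (p 0)" by (simp add: ip_def)
 hence "sqrt ((cmod (u s))^2) <= sqrt (C^2 * Re (p 0))" by (rule real_sqrt_le_mono)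
 thus ?thesis using C by (simp add: real_sqrt_mult)
qed

text \<open>Domination tested on the difference of two point masses \<open>s\<close> and
  \<open>t\<close> bounds \<open>cmod (u s - u t)\<close> by a continuous function that vanishes at
  \<open>s = t\<close>.\<close>

lemma dominated_continuous:
 fixes p :: "'g::{topological_group_add,t2_space} => complex"
 assumes "posdef p" "cont p" "dominated u p C"
 shows "cont u"
 unfolding continuous_on_def
proof
 fix t
 define h where "h s = C^2 * (2 * Re (p 0) - Re (p (- t + s)) - Re (p (- s + t)))" for s
 have est: "(cmod (u s - u t))^2 <= h s" for s
 proof -
  have "(cmod (lin u [(1, s), (-1, t)]))^2 <= C^2 * Re (ip p [(1, s), (-1, t)] [(1, s), (-1, t)])"
   using assms(3) by (simp only: dominated_def)
  thus ?thesis by (simp add: ip_def h_def algebra_simps)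
 qed
 have "cont h" unfolding h_def
  by (intro continuous_intros continuous_on_compose2[OF assms(2)]) auto
 hence "(h \<longlongrightarrow> h t) (at t within UNIV)" by (simp add: continuous_on_def)
 moreover have "h t = 0" by (simp add: h_def)
 ultimately have h0: "(h \<longlongrightarrow> 0) (at t within UNIV)" by simp
 have "((%s. (cmod (u s - u t))^2) \<longlongrightarrow> 0) (at t within UNIV)"
  by (rule tendsto_sandwich[where f = "%_. 0", OF _ _ _ h0]) (use est in auto)
 hence "((%s. cmod (u s - u t)) \<longlongrightarrow> 0) (at t within UNIV)" by (simp add: power_tendsto_0_iff)
 thus "(u \<longlongrightarrow> u t) (at t within UNIV)" by (rule LIM_zero_cancel[OF tendsto_norm_zero_cancel])
qed

lemma dominated_left_translate:
 assumes "dominated u p C"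
 shows "dominated (%s. u (r + s)) p C"
proof -
 let ?m = "map (%(a, s). (a, r + s))"
 have l: "lin (%s. u (r + s)) c = lin u (?m c)" for c by (induction c) auto
 have "(\<Sum>(b, t)\<leftarrow>?m d. cnj b * p (- t + (r + s))) = (\<Sum>(b, t)\<leftarrow>d. cnj b * p (- t + s))" for d s
 proof (induction d)
  case (Cons y d)
  have "- (r + t) + (r + s) = - t + s" for t by (simp only: minus_add add.assoc minus_add_cancel)
  with Cons show ?case by (auto simp: case_prod_beta)
 qed simp
 hence i: "ip p (?m c) (?m d) = ip p c d" for c d
  by (induction c) (auto simp: ip_Cons_left)
 show ?thesis using assms unfolding dominated_def l by (metis i)
qed

text \<open>Right translation of the point masses changes the form: \<open>- t + s\<close> becomes
  its conjugate by \<open>r\<close>. Left translation leaves the form alone, which is why only here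
  a new dominating function appears.\<close>

lemma dominated_right_translate:
 assumes "posdef p" "dominated u p C"
 shows "dominated (%s. u (s + r)) (%s. p (- r + s + r)) C" "posdef (%s. p (- r + s + r))"
proof -
 let ?m = "map (%(a, s). (a, s + r))"
 have l: "lin (%s. u (s + r)) c = lin u (?m c)" for c by (induction c) auto
 have "(\<Sum>(b, t)\<leftarrow>?m d. cnj b * p (- t + (s + r))) = (\<Sum>(b, t)\<leftarrow>d. cnj b * p (- r + (- t + s) + r))" for d s
 proof (induction d)
  case (Cons y d)
  have "- (t + r) + (s + r) = - r + (- t + s) + r" for t by (simp only: minus_add add.assoc)
  with Cons show ?case by (auto simp: case_prod_beta)
 qed simp
 hence i: "ip p (?m c) (?m d) = ip (%s. p (- r + s + r)) c d" for c d
  by (induction c) (auto simp: ip_Cons_left)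
 show "dominated (%s. u (s + r)) (%s. p (- r + s + r)) C"
  using assms(2) unfolding dominated_def l i[symmetric] by blast
 have "p (- r + (- s) + r) = cnj (p (- r + s + r))" for s
 proof -
  have "- r + (- s) + r = - (- r + s + r)" by (simp only: minus_add minus_minus add.assoc)
  thus ?thesis using assms(1) by (simp only: posdef_def)
 qed
 thus "posdef (%s. p (- r + s + r))"
  using assms(1) unfolding posdef_def i[symmetric] by blast
qed

lemma dominated_cnj:
 assumes "posdef p" "dominated u p C"
 shows "dominated (%s. cnj (u s)) (%s. cnj (p s)) C" "posdef (%s. cnj (p s))"
proof -
 let ?m = "map (%(a, s). (cnj a, s))"
 have l: "lin (%s. cnj (u s)) c = cnj (lin u (?m c))" for c by (induction c) auto
 have "(\<Sum>(b, t)\<leftarrow>d. cnj b * cnj (p (- t + s))) = cnj (\<Sum>(b, t)\<leftarrow>?m d. cnj b * p (- t + s))" for d s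
  by (induction d) auto
 hence i: "ip (%s. cnj (p s)) c d = cnj (ip p (?m c) (?m d))" for c d
  by (induction c) (auto simp: ip_Cons_left)
 show "dominated (%s. cnj (u s)) (%s. cnj (p s)) C"
  using assms(2) unfolding dominated_def l i by simp
 show "posdef (%s. cnj (p s))" using assms(1) unfolding posdef_def i by simp
qed

text \<open>The form of a unitary character has rank one:
  \<open>ip kappa c d = lin kappa c * cnj (lin kappa d)\<close>.\<close>

lemma character_dominated:
 fixes kappa :: "'g::group_add => complex"
 assumes "!!s t. kappa (s + t) = kappa s * kappa t" "!!s. cmod (kappa s) = 1"
 shows "posdef kappa" "dominated kappa kappa 1"
proof -
 have z: "kappa 0 = 1" using assms(1)[of 0 0] assms(2)[of 0] by (metis mult_cancel_right1 norm_zero zero_neq_one add_0)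
 have n: "kappa (- s) = cnj (kappa s)" for s
 proof -
  have "kappa (- s) * kappa s = 1" using assms(1)[of "- s" s] z by simp
  moreover have "cnj (kappa s) * kappa s = 1" using assms(2)[of s] complex_norm_square[of "kappa s"] by (simp add: mult.commute)
  ultimately show ?thesis by (metis mult_cancel_right zero_neq_one mult_zero_right)
 qed
 have "(\<Sum>(b, t)\<leftarrow>d. cnj b * kappa (- t + s)) = kappa s * cnj (lin kappa d)" for d s
  by (induction d) (auto simp: assms(1) n algebra_simps)
 hence "ip kappa c d = lin kappa c * cnj (lin kappa d)" for c d
  by (induction c) (auto simp: ip_Cons_left algebra_simps)
 hence i: "ip kappa c c = of_real ((cmod (lin kappa c))^2)" for c
  by (simp only: complex_norm_square)
 show "posdef kappa" using n by (simp add: posdef_def i)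
 show "dominated kappa kappa 1" by (simp add: dominated_def i)
qed

text \<open>Schur's product theorem, with the rank one decomposition read off an orthonormal basis.\<close>

lemma (in urep) dominated_mult:
 assumes x: "x : car" and y: "y : car" and q: "posdef q" and w: "dominated w q D"
 defines "u \<equiv> cf x y" and "p \<equiv> cf x x"
 shows "dominated (%s. u s * w s) (%s. p s * q s) (hn y * D)" "posdef (%s. p s * q s)"
proof -
 have D: "D >= 0" using w by (simp add: dominated_def)
 have main: "0 <= Re (ip (%s. p s * q s) c c) &
   (cmod (lin (%s. u s * w s) c))^2 <= (hn y * D)^2 * Re (ip (%s. p s * q s) c c)" for c
 proof -
  let ?B = "insert y ((%(a, s). \<pi> s x) ` set c)"
  have B: "finite ?B" "?B \<subseteq> car" using x y by (auto simp: rep_closed)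
  obtain E where E: "finite E" "E \<subseteq> car"
   and ex: "ALL b:?B. ALL z:car. inn b z = (SUM e:E. inn b e * inn e z)"
   using finite_orthonormal[OF B] by auto
  \<comment> \<open>\<open>m e c\<close> is \<open>c\<close> with each coefficient multiplied by the
    \<open>e\<close>-th coordinate of \<open>\<pi> s x\<close>. In these terms the form of the
    product is the sum over \<open>e\<close> of the form of \<open>q\<close> at
    \<open>m e c\<close>, hence nonnegative.\<close>
  define m where "m e = map (%(a, s). (a * inn (\<pi> s x) e, s))" for e
  have expand: "inn (\<pi> s x) z = (SUM e:E. inn (\<pi> s x) e * inn e z)"
   if "(a, s) : set c" "z : car" for a s z
   by (rule ex[rule_format]) (use that in force)+
  have pe: "p (- t + s) = (SUM e:E. inn (\<pi> s x) e * cnj (inn (\<pi> t x) e))" if "(a, s) : set c" for a s t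
  proof -
   have "p (- t + s) = inn (\<pi> s x) (\<pi> t x)"
    using rep_adjoint[OF rep_closed[OF x] x, of "- t" s] x by (simp add: p_def coefficient_def rep_mult)
   also have "... = (SUM e:E. inn (\<pi> s x) e * inn e (\<pi> t x))"
    by (rule expand[OF that rep_closed[OF x]])
   also have "... = (SUM e:E. inn (\<pi> s x) e * cnj (inn (\<pi> t x) e))"
    by (rule sum.cong) (use E in \<open>auto intro!: arg_cong2[where f = "(*)"] inner_cnj rep_closed x\<close>)
   finally show ?thesis .
  qed
  have ipm: "ip (%s. p s * q s) c' d = (SUM e:E. ip q (m e c') (m e d))" if "set c' \<subseteq> set c" for c' d
   using that
  proof (induction c')
   case (Cons z c')
   obtain a s where z: "z = (a, s)" by force
   have "(\<Sum>(b, t)\<leftarrow>d. cnj b * (p (- t + s) * q (- t + s))) =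
     (SUM e:E. inn (\<pi> s x) e * (\<Sum>(b, t)\<leftarrow>m e d. cnj b * q (- t + s)))"
   proof (induction d)
    case (Cons y d)
    obtain b t where y: "y = (b, t)" by force
    show ?case using Cons pe[of a s t] Cons.IH \<open>set (z # c') \<subseteq> set c\<close>
     by (simp add: y z m_def sum_distrib_left sum_distrib_right distrib_left sum.distrib algebra_simps)
   qed (simp add: m_def)
   moreover have "ip q (m e (z # c')) (m e d) =
     a * (inn (\<pi> s x) e * (\<Sum>(b, t)\<leftarrow>m e d. cnj b * q (- t + s))) + ip q (m e c') (m e d)" for e
    by (simp add: z m_def ip_Cons_left mult.assoc)
   ultimately show ?case
    using Cons by (simp add: z ip_Cons_left sum.distrib sum_distrib_left)
  qed (simp add: m_def)
  have nonneg: "0 <= Re (ip q d d)" for d using q by (simp add: posdef_def)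
  have ipc: "Re (ip (%s. p s * q s) c c) = (SUM e:E. Re (ip q (m e c) (m e c)))"
   using ipm[of c c] by simp
  have linm: "lin (%s. u s * w s) c' = (SUM e:E. inn e y * lin w (m e c'))" if "set c' \<subseteq> set c" for c'
   using that
  proof (induction c')
   case (Cons z c')
   obtain a s where z: "z = (a, s)" by force
   have "u s = (SUM e:E. inn (\<pi> s x) e * inn e y)"
    unfolding u_def coefficient_def by (rule expand[of a, OF _ y]) (use Cons.prems z in auto)
   thus ?case using Cons
    by (simp add: z m_def sum_distrib_left sum_distrib_right distrib_left sum.distrib mult_ac)
  qed (simp add: m_def)
  have ey: "(SUM e:E. (cmod (inn e y))^2) = (hn y)^2"
  proof -
   have "(SUM e:E. (cmod (inn y e))^2) = (hn y)^2"
    by (rule sum_cmod_inner_square[OF E(2) y]) (use ex in simp)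
   moreover have "cmod (inn e y) = cmod (inn y e)" if "e : E" for e
   proof -
    have "e : car" using that E by auto
    from inner_cnj[OF this y] show ?thesis by simp
   qed
   ultimately show ?thesis by (simp cong: sum.cong)
  qed
  have "cmod (lin (%s. u s * w s) c) <= (SUM e:E. cmod (inn e y) * cmod (lin w (m e c)))"
   unfolding linm[OF subset_refl] by (rule order_trans[OF norm_sum]) (simp add: norm_mult)
  hence "(cmod (lin (%s. u s * w s) c))^2 <= (SUM e:E. cmod (inn e y) * cmod (lin w (m e c)))^2"
   by (rule power_mono) simp
  also have "... <= (SUM e:E. (cmod (inn e y))^2) * (SUM e:E. (cmod (lin w (m e c)))^2)"
   by (rule Cauchy_Schwarz_ineq_sum)
  also have "... <= (hn y)^2 * (SUM e:E. D^2 * Re (ip q (m e c) (m e c)))"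
   unfolding ey using w by (intro mult_left_mono sum_mono) (auto simp: dominated_def)
  also have "... = (hn y * D)^2 * Re (ip (%s. p s * q s) c c)"
   by (simp add: ipc sum_distrib_left power_mult_distrib mult.assoc)
  finally show ?thesis using nonneg by (simp add: ipc sum_nonneg)
 qed
 show "dominated (%s. u s * w s) (%s. p s * q s) (hn y * D)"
  unfolding dominated_def using main D hnorm_nonneg[OF y] by simp
 have "p (- s) = cnj (p s)" "q (- s) = cnj (q s)" for s
  using posdef_coefficient[OF x] q by (auto simp: posdef_def p_def)
 thus "posdef (%s. p s * q s)" unfolding posdef_def using main by simp
qed

section \<open>The Fourier--Stieltjes algebra\<close>

text \<open>The unit ball of \<open>B(G)\<close> as the dual of the C*-algebra.\<close>

definition coef_ball :: "('g::{topological_group_add,t2_space} => complex) set" where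
 "coef_ball = {u. EX p. posdef p & cont p & Re (p 0) <= 1 & dominated u p 1}"

lemma coef_ballI: "posdef p ==> cont p ==> Re (p 0) <= 1 ==> dominated u p 1 ==> u : coef_ball"
 by (auto simp: coef_ball_def)

lemma coef_ball_bound: "u : coef_ball ==> cmod (u s) <= 1"
proof -
 assume "u : coef_ball"
 then obtain p where p: "posdef p" "Re (p 0) <= 1" "dominated u p 1" by (auto simp: coef_ball_def)
 have "cmod (u s) <= sqrt (Re (p 0))" using dominated_bound[OF p(3), of s] by simp
 also have "... <= 1" using p by simp
 finally show ?thesis .
qed

lemma coef_ball_continuous: "u : coef_ball ==> cont u"
 by (auto simp: coef_ball_def intro: dominated_continuous)

lemma coef_ball_coefficient:
 fixes u :: "'g::{topological_group_add,t2_space} => complex"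
 assumes "u : coef_ball"
 obtains H :: "'g fn hspace" and \<pi> x y
 where "unitary_rep H \<pi>" "x : hcarrier H" "y : hcarrier H" "hnorm H x <= 1" "hnorm H y <= 1"
  "u = coefficient H \<pi> x y"
proof -
 obtain p where p: "posdef p" "cont p" "Re (p 0) <= 1" "dominated u p 1"
  using assms by (auto simp: coef_ball_def)
 interpret posdef_function p by standard (rule p)+
 obtain y where y: "y : hcarrier hsp" "hnorm hsp y <= 1" "coefficient hsp tr (kf [(1, 0)]) y = u"
  using dominated_is_coefficient[OF p(4)] by blast
 have "(hnorm hsp (kf [(1, 0)]))^2 <= 1^2" using hnorm_cyclic p(3) by simp
 hence "hnorm hsp (kf [(1, 0)]) <= 1" by (rule power2_le_imp_le) simp
 with y show ?thesis by (intro that[OF unitary_rep_hsp kf_closed y(1)]) auto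
qed

lemma (in urep) coefficient_in_coef_ball:
 assumes "x : car" "y : car" "hn x <= 1" "hn y <= 1"
 shows "cf x y : coef_ball"
proof (rule coef_ballI[OF posdef_coefficient[OF assms(1)] continuous_coefficient[OF assms(1,1)]])
 show "Re (cf x x 0) <= 1"
  unfolding coefficient_zero[OF assms(1)] using hnorm_nonneg[OF assms(1)] assms(3) by (simp add: power_le_one)
 show "dominated (cf x y) (cf x x) 1"
  by (rule dominated_mono[OF posdef_coefficient dominated_coefficient]) (use assms in auto)
qed

lemma coef_ball_mult:
 assumes u: "u : coef_ball" and w: "w : coef_ball"
 shows "(%s. u s * w s) : coef_ball"
proof -
 obtain H :: "('a => complex) hspace" and \<pi> x y where r: "unitary_rep H \<pi>" "x : hcarrier H" "y : hcarrier H"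
  "hnorm H x <= 1" "hnorm H y <= 1" "u = coefficient H \<pi> x y" using coef_ball_coefficient[OF u] .
 interpret urep H \<pi> by standard (rule r)
 obtain q where q: "posdef q" "cont q" "Re (q 0) <= 1" "dominated w q 1"
  using w by (auto simp: coef_ball_def)
 let ?p = "cf x x"
 note dm = dominated_mult[OF r(2,3) q(1,4)]
 show ?thesis
 proof (rule coef_ballI[OF dm(2)])
  show "cont (%s. ?p s * q s)"
   by (intro continuous_intros continuous_coefficient r q)
  have "?p 0 = of_real ((hn x)^2)" using r by (simp add: coefficient_def rep_zero inner_self)
  hence "Re (?p 0 * q 0) = (hn x)^2 * Re (q 0)" by simp
  also have "... <= 1"
   using q(3) posdef_zero_nonneg[OF q(1)] r(4) hnorm_nonneg[OF r(2)] by (simp add: mult_le_one power_le_one)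
  finally show "Re (?p 0 * q 0) <= 1" .
  show "dominated (%s. u s * w s) (%s. ?p s * q s) 1"
   by (rule dominated_mono[OF dm(2) dm(1)[folded r(6)]]) (use r in simp)
 qed
qed

lemma coef_ball_cnj: "u : coef_ball ==> (%s. cnj (u s)) : coef_ball"
proof -
 assume "u : coef_ball"
 then obtain p where p: "posdef p" "cont p" "Re (p 0) <= 1" "dominated u p 1" by (auto simp: coef_ball_def)
 show ?thesis
  by (rule coef_ballI[OF dominated_cnj(2)[OF p(1,4)] _ _ dominated_cnj(1)[OF p(1,4)]])
   (use p in "auto intro!: continuous_intros")
qed

lemma coef_ball_left_translate: "u : coef_ball ==> (%s. u (r + s)) : coef_ball"
 unfolding coef_ball_def using dominated_left_translate by blast

lemma coef_ball_right_translate: "u : coef_ball ==> (%s. u (s + r)) : coef_ball"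
proof -
 assume "u : coef_ball"
 then obtain p where p: "posdef p" "cont p" "Re (p 0) <= 1" "dominated u p 1" by (auto simp: coef_ball_def)
 show ?thesis
 proof (rule coef_ballI[OF dominated_right_translate(2)[OF p(1,4)] _ _ dominated_right_translate(1)[OF p(1,4)]])
  show "cont (%s. p (- r + s + r))"
   by (rule continuous_on_compose2[OF p(2)]) (auto intro!: continuous_intros)
 qed (use p in auto)
qed

lemma coef_ball_character:
 assumes "!!s t. kappa (s + t) = kappa s * kappa t" "!!s. cmod (kappa s) = 1" "cont kappa"
 shows "kappa : coef_ball"
 by (rule coef_ballI[OF character_dominated(1)[OF assms(1,2)] assms(3) _ character_dominated(2)[OF assms(1,2)]])
  (use complex_Re_le_cmod[of "kappa 0"] assms(2)[of 0] in auto)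

lemma one_in_coef_ball: "(%_. 1) : coef_ball"
 by (rule coef_ball_character) auto

lemma cspan_single: "u : S ==> u : cspan S"
 unfolding cspan_def by (rule CollectI, rule exI[of _ "{u}"], rule exI[of _ "%_. 1"]) simp

lemma dominated_in_coef_ball:
 assumes p: "posdef p" "cont p" and u: "dominated u p C"
 shows "EX K>0. (%s. of_real (1 / K) * u s) : coef_ball"
proof -
 \<comment> \<open>The summands 1 in \<open>P\<close> and \<open>K\<close> keep the divisors
   positive even when \<open>p 0 = 0\<close> or \<open>C = 0\<close>.\<close>
 define P where "P = Re (p 0) + 1"
 define K where "K = sqrt ((C^2 + 1) * P)"
 have P: "P > 0" using posdef_zero_nonneg[OF p(1)] by (simp add: P_def)
 have C2: "C^2 + 1 > 0" by (rule add_nonneg_pos) auto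
 have K: "K > 0" "K^2 = (C^2 + 1) * P" using P C2 by (auto simp: K_def)
 let ?p = "%s. of_real (1 / P) * p s"
 have "(%s. of_real (1 / K) * u s) : coef_ball"
 proof (rule coef_ballI)
  show "posdef ?p" by (rule posdef_scale[OF p(1)]) (use P in simp)
  show "cont ?p" by (intro continuous_intros p)
  show "Re (?p 0) <= 1" using P by (simp add: P_def field_simps)
  have "(cmod (lin (%s. of_real (1 / K) * u s) c))^2 <= Re (ip ?p c c)" for c
  proof -
   have nn: "Re (ip p c c) >= 0" using p by (simp add: posdef_def)
   have "(cmod (lin u c))^2 <= C^2 * Re (ip p c c)" using u by (simp add: dominated_def)
   also have "... <= (C^2 + 1) * Re (ip p c c)" using nn by (intro mult_right_mono) auto
   finally have "(cmod (lin u c))^2 / K^2 <= ((C^2 + 1) * Re (ip p c c)) / K^2" by (rule divide_right_mono) simp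
   also have "... = Re (ip p c c) / P" unfolding K(2) using C2 by simp
   finally show ?thesis
    unfolding lin_const_mult ip_const_mult using K(1) by (simp add: norm_mult norm_divide power_divide)
  qed
  thus "dominated (%s. of_real (1 / K) * u s) ?p 1" by (simp add: dominated_def)
 qed
 with K show ?thesis by blast
qed

lemma cspan_induct [consumes 1]:
 assumes u: "u : cspan S" and P: "P (%_. 0)" "!!v w c. v : S ==> P w ==> P (%t. c * v t + w t)"
 shows "P u"
proof -
 obtain A c where A: "finite A" "A \<subseteq> S" "u = (%t. SUM v:A. c v * v t)" using u by (auto simp: cspan_def)
 from A(1,2) show ?thesis unfolding A(3)
  by (induction A) (use P in simp_all)
qed

lemma F_space_dominated:
 assumes "unitary_rep H \<pi>" "u : F_space H \<pi>"
 shows "EX p C. posdef p & cont p & dominated u p C"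
proof -
 interpret urep H \<pi> by standard (rule assms)
 from assms(2) show ?thesis unfolding F_space_def
 proof (induction rule: cspan_induct)
  case 1
  show ?case
   by (rule exI[of _ "%_. 1"], rule exI[of _ 0])
    (use character_dominated(1)[of "%_::'b. 1"] in "auto simp: dominated_def lin_zero")
 next
  case (2 v w c)
  then obtain p C x y where p: "posdef p" "cont p" "dominated w p C" and xy: "x : car" "y : car" "v = cf x y" by auto
  let ?q = "cf x x"
  have "dominated (%t. c * v t + w t) (%s. ?q s + p s) (cmod c * hn y + C)"
   by (rule dominated_add[OF posdef_coefficient[OF xy(1)] p(1) _ p(3)])
    (unfold xy(3), rule dominated_scale, rule dominated_coefficient[OF xy(1,2)])
  moreover have "posdef (%s. ?q s + p s)" by (rule posdef_add[OF posdef_coefficient[OF xy(1)] p(1)])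
  moreover have "cont (%s. ?q s + p s)" by (intro continuous_intros continuous_coefficient xy p)
  ultimately show ?case by blast
 qed
qed

lemma coef_ball_subset_BG: "u : coef_ball ==> (%s. a * u s) : BG"
proof -
 assume "u : coef_ball"
 then obtain H :: "('a => complex) hspace" and \<pi> x y where r: "unitary_rep H \<pi>" "x : hcarrier H" "y : hcarrier H"
  "u = coefficient H \<pi> x y" using coef_ball_coefficient by metis
 interpret urep H \<pi> by standard (rule r)
 have "(%s. a * u s) = cf (hscale H a x) y"
  using r by (auto simp: coefficient_def rep_scale inner_simps rep_closed)
 hence "(%s. a * u s) : F_space H \<pi>"
  unfolding F_space_def using r scale_closed[OF r(2), of a] by (intro cspan_single) blast
 thus ?thesis unfolding fourier_stieltjes_def using r(1) by blast
qed

text \<open>The working description of B(G). Representations on any carrier type lead to dominated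
  functions, and dominated functions are coefficients on a space of functions on G, so the choice of
  carriers in the definition loses nothing.\<close>

lemma BG_iff_dominated:
 "u : BG \<longleftrightarrow> (EX p C. posdef p & cont p & dominated u p C)"
proof
 assume "u : BG"
 thus "EX p C. posdef p & cont p & dominated u p C"
  unfolding fourier_stieltjes_def using F_space_dominated by fastforce
next
 assume "EX p C. posdef p & cont p & dominated u p C"
 then obtain K where "K > 0" "(%s. of_real (1 / K) * u s) : coef_ball" using dominated_in_coef_ball by blast
 from coef_ball_subset_BG[OF this(2), of "of_real K"] this(1)
 show "u : BG" by (simp add: mult.assoc[symmetric])
qed

lemma BGE:
 assumes "u : BG"
 obtains K v where "K > 0" "v : coef_ball" "u = (%s. of_real K * v s)"
proof -
 obtain K where K: "K > 0" "(%s. of_real (1 / K) * u s) : coef_ball"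
  using assms dominated_in_coef_ball unfolding BG_iff_dominated by blast
 show ?thesis by (rule that[OF K]) (use K(1) in "simp add: mult.assoc[symmetric]")
qed

lemma F_space_subset_BG: "unitary_rep H \<pi> ==> F_space H \<pi> \<subseteq> BG"
 using F_space_dominated by (auto simp: BG_iff_dominated)

lemma BG_add: "u : BG ==> v : BG ==> (%s. u s + v s) : BG"
 unfolding BG_iff_dominated
 by (elim exE conjE, rule exI, rule exI, intro conjI, erule (1) posdef_add)
  (auto intro!: continuous_intros dominated_add)

lemma BG_scale: "u : BG ==> (%s. a * u s) : BG"
 unfolding BG_iff_dominated using dominated_scale by blast

lemma BG_continuous: "u : BG ==> cont u"
 unfolding BG_iff_dominated using dominated_continuous by blast

lemma BG_bounded: "u : BG ==> EX B. ALL s. cmod (u s) <= B"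
 unfolding BG_iff_dominated using dominated_bound by blast

lemma BG_lift:
 assumes u: "u : BG" and T: "!!v. v : coef_ball ==> T v : coef_ball"
  and TK: "!!v K. T (%s. of_real K * v s) = (%s. of_real K * T v s)"
 shows "T u : BG"
proof -
 obtain K v where K: "v : coef_ball" "u = (%s. of_real K * v s)" using BGE[OF u] by metis
 show ?thesis unfolding K(2) TK by (rule coef_ball_subset_BG[OF T[OF K(1)]])
qed

lemma BG_cnj: "u : BG ==> (%s. cnj (u s)) : BG"
 by (rule BG_lift[where T = "%u s. cnj (u s)"]) (auto intro: coef_ball_cnj)

lemma BG_left_translate: "u : BG ==> (%s. u (r + s)) : BG"
 by (rule BG_lift[where T = "%u s. u (r + s)"]) (auto intro: coef_ball_left_translate)

lemma BG_right_translate: "u : BG ==> (%s. u (s + r)) : BG"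
 by (rule BG_lift[where T = "%u s. u (s + r)"]) (auto intro: coef_ball_right_translate)

lemma BG_mult:
 assumes "u : BG" "w : BG"
 shows "(%s. u s * w s) : BG"
proof -
 obtain K v where K: "v : coef_ball" "u = (%s. of_real K * v s)" using BGE[OF assms(1)] by metis
 obtain L z where L: "z : coef_ball" "w = (%s. of_real L * z s)" using BGE[OF assms(2)] by metis
 have "(%s. u s * w s) = (%s. (of_real K * of_real L) * (v s * z s))" unfolding K L by (auto simp: mult_ac)
 thus ?thesis using coef_ball_subset_BG[OF coef_ball_mult[OF K(1) L(1)]] by simp
qed

lemma const_in_BG: "(%_. a) : BG"
 using coef_ball_subset_BG[OF one_in_coef_ball, of a] by simp

section \<open>The C*-norm and the duality with the Fourier--Stieltjes algebra\<close>

context haar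
begin

lemma integrable_mult_continuous:
 fixes f u :: "'g fn"
 assumes f: "intg f" and u: "cont u" "!!s. cmod (u s) <= B"
 shows "intg (%s. f s * u s)"
proof (rule Bochner_Integration.integrable_bound)
 show "intg (%s. B * cmod (f s))" using f by auto
 show "(%s. f s * u s) : borel_measurable \<mu>"
  using f borel_measurable_continuous_onI[OF u(1)] by auto
 have "0 <= B" using order_trans[OF norm_ge_zero u(2)] .
 thus "AE s in \<mu>. norm (f s * u s) <= norm (B * cmod (f s))"
  using mult_right_mono[OF u(2) norm_ge_zero[of "f _"]] by (intro AE_I2) (simp add: norm_mult mult.commute)
qed

lemma cmod_integral_mult_le:
 fixes f u :: "'g fn"
 assumes f: "intg f" and u: "cont u" "!!s. cmod (u s) <= B"
 shows "cmod (LI s. f s * u s) <= B * (LI s. cmod (f s))"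
proof -
 have "cmod (LI s. f s * u s) <= (LI s. cmod (f s * u s))" by (rule integral_norm_bound)
 also have "... <= (LI s. B * cmod (f s))"
 proof (rule integral_mono)
  show "intg (%s. cmod (f s * u s))" using integrable_mult_continuous[OF f u] by auto
  show "intg (%s. B * cmod (f s))" using f by auto
  show "cmod (f s * u s) <= B * cmod (f s)" for s
   using mult_right_mono[OF u(2)[of s] norm_ge_zero[of "f s"]] by (simp add: norm_mult mult.commute)
 qed
 finally show ?thesis by simp
qed

lemma integrable_mult_BG:
 assumes "intg f" "u : BG"
 shows "intg (%s. f s * u s)"
proof -
 obtain B where "!!s. cmod (u s) <= B" using BG_bounded[OF assms(2)] by blast
 with integrable_mult_continuous[OF assms(1) BG_continuous[OF assms(2)]] show ?thesis by blast
qed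

lemma coef_ball_in_BG: "u : coef_ball ==> u : BG"
 using coef_ball_subset_BG[of u 1] by simp

text \<open>Coefficients of pairs of vectors from unit balls are exactly \<open>coef_ball\<close>,
  by the construction of the cyclic representation; norm estimates below need closure properties of
  \<open>coef_ball\<close> and no representations.\<close>

lemma cstar_norm_eq: "cnorm f = (SUP u\<in>coef_ball. cmod (LI s. f s * u s))"
proof -
 have "{cmod (LI s. f s * coefficient H \<pi> x y s) | (H :: 'g fn hspace) \<pi> x y.
      unitary_rep H \<pi> & x : hcarrier H & y : hcarrier H & hnorm H x <= 1 & hnorm H y <= 1}
   = (%u. cmod (LI s. f s * u s)) ` coef_ball" (is "?L = ?R")
 proof
  show "?L \<subseteq> ?R" using urep.coefficient_in_coef_ball by (fastforce simp: urep_def)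
  show "?R \<subseteq> ?L"
  proof
   fix z assume "z : ?R"
   then obtain u where u: "u : coef_ball" "z = cmod (LI s. f s * u s)" by blast
   obtain H :: "'g fn hspace" and \<pi> x y where "unitary_rep H \<pi>" "x : hcarrier H" "y : hcarrier H"
    "hnorm H x <= 1" "hnorm H y <= 1" "u = coefficient H \<pi> x y" using coef_ball_coefficient[OF u(1)] .
   with u(2) show "z : ?L" by blast
  qed
 qed
 thus ?thesis unfolding cstar_norm_def by simp
qed

lemma cstar_norm_ge:
 assumes f: "intg f" and u: "u : coef_ball"
 shows "cmod (LI s. f s * u s) <= cnorm f"
 unfolding cstar_norm_eq
proof (rule cSUP_upper[OF u])
 show "bdd_above ((%u. cmod (LI s. f s * u s)) ` coef_ball)"
 proof (rule bdd_aboveI2)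
  fix v :: "'g fn" assume v: "v : coef_ball"
  show "cmod (LI s. f s * v s) <= 1 * (LI s. cmod (f s))"
   by (rule cmod_integral_mult_le[OF f coef_ball_continuous[OF v] coef_ball_bound[OF v]])
 qed
qed

lemma cstar_norm_le:
 assumes "!!u. u : coef_ball ==> cmod (LI s. f s * u s) <= c"
 shows "cnorm f <= c"
 unfolding cstar_norm_eq by (rule cSUP_least) (use one_in_coef_ball assms in auto)

lemma cstar_norm_nonneg: "intg f ==> 0 <= cnorm f"
 using cstar_norm_ge[OF _ one_in_coef_ball] norm_ge_zero order_trans by blast

lemma cstar_norm_le_L1: "intg f ==> cnorm f <= (LI s. cmod (f s))"
proof (rule cstar_norm_le)
 fix u :: "'g fn" assume f: "intg f" and u: "u : coef_ball"
 show "cmod (LI s. f s * u s) <= (LI s. cmod (f s))"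
  using cmod_integral_mult_le[OF f coef_ball_continuous[OF u] coef_ball_bound[OF u]] by simp
qed

lemma cstar_norm_combination:
 assumes f: "intg f" and g: "intg g"
 shows "cnorm (%s. a * f s + g s) <= cmod a * cnorm f + cnorm g"
proof (rule cstar_norm_le)
 fix u :: "'g fn" assume u: "u : coef_ball"
 note fu = integrable_mult_BG[OF f coef_ball_in_BG[OF u]]
 note gu = integrable_mult_BG[OF g coef_ball_in_BG[OF u]]
 have "(LI s. (a * f s + g s) * u s) = a * (LI s. f s * u s) + (LI s. g s * u s)"
  using fu gu by (simp add: distrib_right mult.assoc)
 also have "cmod ... <= cmod a * cmod (LI s. f s * u s) + cmod (LI s. g s * u s)"
  using norm_triangle_ineq by (simp add: norm_mult[symmetric])
 also have "... <= cmod a * cnorm f + cnorm g"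
  by (intro add_mono mult_left_mono cstar_norm_ge f g u) auto
 finally show "cmod (LI s. (a * f s + g s) * u s) <= cmod a * cnorm f + cnorm g" .
qed

lemma cmod_integral_mult_BG:
 assumes "u : BG"
 obtains K where "K > 0" "!!f. intg f ==> cmod (LI s. f s * u s) <= K * cnorm f"
proof -
 obtain K v where K: "K > 0" "v : coef_ball" "u = (%s. of_real K * v s)" using BGE[OF assms] .
 have "cmod (LI s. f s * u s) <= K * cnorm f" if "intg f" for f
 proof -
  have "(LI s. f s * u s) = of_real K * (LI s. f s * v s)"
   unfolding K(3) by (simp add: mult.left_commute)
  thus ?thesis using cstar_norm_ge[OF that K(2)] K(1) by (simp add: norm_mult)
 qed
 with K(1) that show ?thesis by blast
qed

lemma full_cstarD:
 assumes "phi : CstG"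
 shows "intg (phi n)" and "small (%m n. cnorm (%s. phi m s - phi n s))"
 using assms by (auto simp: full_cstar_def small_def)

lemma full_cstarI:
 assumes "!!n. intg (phi n)" "small f" "small g" "0 <= A" "0 <= B"
  "!!m n. cnorm (%s. phi m s - phi n s) <= A * f m n + B * g m n"
 shows "phi : CstG"
 using small_le[OF assms(2-6)] assms(1) by (simp add: full_cstar_def small_def)

lemma full_cstar_map:
 assumes phi: "phi : CstG" and i: "!!f. intg f ==> intg (T f)"
  and d: "!!f g. T (%s. f s - g s) = (%s. T f s - T g s)"
  and b: "0 <= K" "!!f. intg f ==> cnorm (T f) <= K * cnorm f"
 shows "(%n. T (phi n)) : CstG"
proof (rule full_cstarI[OF _ full_cstarD(2)[OF phi] full_cstarD(2)[OF phi] b(1) order_refl])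
 show "intg (T (phi n))" for n using full_cstarD(1)[OF phi] i by blast
 show "cnorm (%s. T (phi m) s - T (phi n) s) <= K * cnorm (%s. phi m s - phi n s) + 0 * cnorm (%s. phi m s - phi n s)" for m n
  unfolding d[symmetric] using b(2)[of "%s. phi m s - phi n s"] full_cstarD(1)[OF phi] by simp
qed

lemma pairing_tendsto:
 assumes phi: "phi : CstG" and u: "u : BG"
 shows "(%n. LI s. phi n s * u s) \<longlonglongrightarrow> pair phi u"
proof -
 note i = full_cstarD(1)[OF phi]
 obtain K where K: "K > 0" "!!f. intg f ==> cmod (LI s. f s * u s) <= K * cnorm f"
  by (rule cmod_integral_mult_BG[OF u]) blast
 have "norm ((LI s. phi m s * u s) - (LI s. phi n s * u s)) <= K * cnorm (%s. phi m s - phi n s)" for m n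
  using K(2)[of "%s. phi m s - phi n s"] integrable_mult_BG[OF i u] i by (simp add: left_diff_distrib)
 from small_Cauchy[OF small_le1[OF full_cstarD(2)[OF phi] less_imp_le[OF K(1)] this]]
 show ?thesis unfolding cstar_pairing_def by (simp add: Cauchy_convergent_iff convergent_LIMSEQ_iff)
qed

lemma pairing_eqI:
 assumes "phi : CstG" "u : BG" "(%n. LI s. phi n s * u s) \<longlonglongrightarrow> L"
 shows "pair phi u = L"
 using LIMSEQ_unique[OF pairing_tendsto[OF assms(1,2)] assms(3)] .

lemma pairing_lincomb:
 assumes phi: "phi : CstG" and u: "u : BG" and v: "v : BG"
 shows "pair phi (%s. a * u s + b * v s) = a * pair phi u + b * pair phi v"
proof (rule pairing_eqI[OF phi])
 show "(%s. a * u s + b * v s) : BG"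
  by (intro BG_add BG_scale u v)
 have "(LI s. phi n s * (a * u s + b * v s)) = a * (LI s. phi n s * u s) + b * (LI s. phi n s * v s)" for n
  using integrable_mult_BG[OF full_cstarD(1)[OF phi] u] integrable_mult_BG[OF full_cstarD(1)[OF phi] v]
  by (simp add: distrib_left mult.left_commute)
 thus "(%n. LI s. phi n s * (a * u s + b * v s)) \<longlonglongrightarrow> a * pair phi u + b * pair phi v"
  by (simp only:) (intro tendsto_intros pairing_tendsto phi u v)
qed

lemma full_cstar_combination:
 assumes phi: "phi : CstG" and psi: "psi : CstG"
 shows "(%n s. a * phi n s + psi n s) : CstG"
  and "u : BG ==>
   pair (%n s. a * phi n s + psi n s) u = a * pair phi u + pair psi u"
proof -
 note i = full_cstarD(1)[OF phi] full_cstarD(1)[OF psi]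
 show *: "(%n s. a * phi n s + psi n s) : CstG"
 proof (rule full_cstarI[OF _ full_cstarD(2)[OF phi] full_cstarD(2)[OF psi] norm_ge_zero zero_le_one])
  show "intg (%s. a * phi n s + psi n s)" for n using i by auto
  fix m n
  have "(%s. a * phi m s + psi m s - (a * phi n s + psi n s)) = (%s. a * (phi m s - phi n s) + (psi m s - psi n s))"
   by (simp add: algebra_simps)
  thus "cnorm (%s. a * phi m s + psi m s - (a * phi n s + psi n s)) <=
    cmod a * cnorm (%s. phi m s - phi n s) + 1 * cnorm (%s. psi m s - psi n s)"
   using cstar_norm_combination[of "%s. phi m s - phi n s" "%s. psi m s - psi n s" a] i by simp
 qed
 assume u: "u : BG"
 show "pair (%n s. a * phi n s + psi n s) u = a * pair phi u + pair psi u"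
 proof (rule pairing_eqI[OF * u])
  have "(LI s. (a * phi n s + psi n s) * u s) = a * (LI s. phi n s * u s) + (LI s. psi n s * u s)" for n
   using integrable_mult_BG[OF i(1) u] integrable_mult_BG[OF i(2) u]
   by (simp add: distrib_right mult.assoc)
  thus "(%n. LI s. (a * phi n s + psi n s) * u s) \<longlonglongrightarrow> a * pair phi u + pair psi u"
   by (simp only:) (intro tendsto_intros pairing_tendsto phi psi u)
 qed
qed

lemma zero_in_full_cstar: "(%n s. 0) : CstG" "pair (%n s. 0) u = 0"
 by (auto simp: full_cstar_def cstar_norm_eq cstar_pairing_def image_constant_conv one_in_coef_ball)
  (use one_in_coef_ball in blast)?

text \<open>The preadjoint of multiplication by \<open>u\<close> on B(G). It is bounded for the
  C*-norm because products of elements of \<open>coef_ball\<close> stay in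
  \<open>coef_ball\<close>.\<close>

lemma full_cstar_mult:
 assumes phi: "phi : CstG" and u: "u : BG"
 shows "(%n s. phi n s * u s) : CstG"
  and "w : BG ==> pair (%n s. phi n s * u s) w = pair phi (%s. u s * w s)"
proof -
 obtain K v where K: "K > 0" "v : coef_ball" "u = (%s. of_real K * v s)" using BGE[OF u] .
 show "(%n s. phi n s * u s) : CstG"
 proof (rule full_cstar_map[OF phi _ _ less_imp_le[OF K(1)]])
  fix f :: "'g fn" assume f: "intg f"
  show "intg (%s. f s * u s)" by (rule integrable_mult_BG[OF f u])
  show "cnorm (%s. f s * u s) <= K * cnorm f"
  proof (rule cstar_norm_le)
   fix z :: "'g fn" assume z: "z : coef_ball"
   have "(LI s. f s * u s * z s) = of_real K * (LI s. f s * (v s * z s))"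
    unfolding K(3) integral_mult_right_zero[symmetric] by (simp add: mult_ac)
   thus "cmod (LI s. f s * u s * z s) <= K * cnorm f"
    using cstar_norm_ge[OF f coef_ball_mult[OF K(2) z]] K(1) by (simp add: norm_mult)
  qed
 qed (simp add: left_diff_distrib)
 show "w : BG ==> pair (%n s. phi n s * u s) w = pair phi (%s. u s * w s)"
  by (simp add: cstar_pairing_def mult.assoc)
qed

lemma full_cstar_cnj:
 assumes phi: "phi : CstG"
 shows "(%n s. cnj (phi n s)) : CstG"
  and "w : BG ==> pair (%n s. cnj (phi n s)) w = cnj (pair phi (%s. cnj (w s)))"
proof -
 have c: "(LI s. cnj (f s) * z s) = cnj (LI s. f s * cnj (z s))" for f z :: "'g fn"
 proof -
  have "(LI s. cnj (f s) * z s) = (LI s. cnj (f s * cnj (z s)))" by simp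
  also have "... = cnj (LI s. f s * cnj (z s))" by (rule Bochner_Integration.integral_cnj)
  finally show ?thesis .
 qed
 show *: "(%n s. cnj (phi n s)) : CstG"
 proof (rule full_cstar_map[OF phi _ _ zero_le_one])
  fix f :: "'g fn" assume f: "intg f"
  show "intg (%s. cnj (f s))" using f by simp
  show "cnorm (%s. cnj (f s)) <= 1 * cnorm f"
   by (rule cstar_norm_le) (use cstar_norm_ge[OF f coef_ball_cnj] in "simp add: c")
 qed simp
 assume w: "w : BG"
 show "pair (%n s. cnj (phi n s)) w = cnj (pair phi (%s. cnj (w s)))"
  by (rule pairing_eqI[OF * w]) (use tendsto_cnj[OF pairing_tendsto[OF phi BG_cnj[OF w]]] in "simp add: c")
qed

lemma full_cstar_translate:
 assumes phi: "phi : CstG"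
 shows "(%n s. phi n (- r + s)) : CstG"
  and "w : BG ==> pair (%n s. phi n (- r + s)) w = pair phi (%s. w (r + s))"
proof -
 have c: "(LI s. f (- r + s) * z s) = (LI s. f s * z (r + s))"
  if "intg f" "cont z" for f z :: "'g fn"
 proof -
  have "(%s. f s * z (r + s)) : Meas"
   using that measurable_comp_translate[OF borel_measurable_continuous_onI[OF that(2)], of r] by auto
  from integral_translate[OF this, of "- r"] show ?thesis by simp
 qed
 show *: "(%n s. phi n (- r + s)) : CstG"
 proof (rule full_cstar_map[OF phi _ _ zero_le_one])
  fix f :: "'g fn" assume f: "intg f"
  show "intg (%s. f (- r + s))" by (rule integrable_translate[OF f])
  show "cnorm (%s. f (- r + s)) <= 1 * cnorm f"
   by (rule cstar_norm_le) (use cstar_norm_ge[OF f coef_ball_left_translate] in "simp add: c[OF f coef_ball_continuous]")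
 qed simp
 show "w : BG ==> pair (%n s. phi n (- r + s)) w = pair phi (%s. w (r + s))"
  by (simp add: cstar_pairing_def c[OF full_cstarD(1)[OF phi] BG_continuous])
qed

text \<open>Right translation changes Haar integrals by a modular factor that is established on
  \<open>Cc\<close> only; this supplies representing sequences in that domain.\<close>

lemma full_cstar_approx_Cc:
 assumes phi: "phi : CstG"
 obtains psi where "psi : CstG" "!!n. Cc (psi n)"
  "!!u. u : BG ==> pair psi u = pair phi u"
proof -
 note i = full_cstarD(1)[OF phi]
 have "EX k. Cc k & (LI t. cmod (phi n t - k t)) < 1 / real (Suc n)" for n
  by (rule Cc_dense_L1[OF i]) simp
 then obtain psi where psi: "!!n. Cc (psi n)" "!!n. (LI t. cmod (phi n t - psi n t)) < 1 / real (Suc n)" by metis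
 note j = Cc_integrable[OF psi(1)]
 have d: "cnorm (%t. psi n t - phi n t) < 1 / real (Suc n)" for n
  using cstar_norm_le_L1[of "%t. psi n t - phi n t"] i j psi(2)[of n] by (simp add: norm_minus_commute)
 have mem: "(%n t. psi n t - phi n t) : CstG"
 proof (rule full_cstarI[OF _ small_inverse_Suc small_inverse_Suc zero_le_one order_refl])
  show "intg (%t. psi n t - phi n t)" for n using i j by auto
  fix m n
  have "(%s. (-1) * (psi n s - phi n s) + (psi m s - phi m s)) = (%s. psi m s - phi m s - (psi n s - phi n s))"
   by (simp add: algebra_simps)
  thus "cnorm (%s. psi m s - phi m s - (psi n s - phi n s)) <= 1 * (1 / real (Suc m) + 1 / real (Suc n)) + 0 * (1 / real (Suc m) + 1 / real (Suc n))"
   using cstar_norm_combination[of "%s. psi n s - phi n s" "%s. psi m s - phi m s" "-1"] i j d[of m] d[of n] by simp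
 qed
 have e: "(%n t. 1 * phi n t + (psi n t - phi n t)) = psi" by auto
 have "pair psi u = pair phi u" if u: "u : BG" for u
 proof -
  have "pair (%n t. psi n t - phi n t) u = 0"
  proof (rule pairing_eqI[OF mem u])
   obtain K where K: "K > 0" "!!f. intg f ==> cmod (LI s. f s * u s) <= K * cnorm f"
    by (rule cmod_integral_mult_BG[OF u]) blast
   show "(%n. LI s. (psi n s - phi n s) * u s) \<longlonglongrightarrow> 0"
   proof (rule tendsto_if_norm_le[OF tendsto_mult_right_zero[OF tendsto_inverse_Suc, of K]])
    fix n
    have "cmod (LI s. (psi n s - phi n s) * u s) <= K * cnorm (%s. psi n s - phi n s)"
     by (rule K(2)) (use i j in auto)
    also have "... <= K * (1 / real (Suc n))" using d[of n] K(1) by (intro mult_left_mono) auto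
    finally show "norm ((LI s. (psi n s - phi n s) * u s) - 0) <= K * (1 / real (Suc n))" by simp
   qed
  qed
  thus ?thesis using full_cstar_combination(2)[OF phi mem u, of 1] unfolding e by simp
 qed
 with full_cstar_combination(1)[OF phi mem, of 1] psi(1) that show ?thesis unfolding e by blast
qed

subsection \<open>The modular function\<close>

lemma Cc_right_translate:
 assumes "Cc f"
 shows "Cc (%t. f (t + r))"
proof -
 obtain K where K: "compact K" "!!t. t ~: K ==> f t = 0" by (rule CcE[OF assms(1)]) blast
 show ?thesis
 proof (rule CcI)
  show "cont (%t. f (t + r))"
   by (rule continuous_on_compose2[OF Cc_continuous[OF assms]]) (auto intro!: continuous_intros)
  show "compact ((%t. t + - r) ` K)" by (rule compact_continuous_image[OF _ K(1)]) (auto intro!: continuous_intros)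
  show "f (t + r) = 0" if "t ~: (%t. t + - r) ` K" for t
  proof (rule K(2))
   show "t + r ~: K"
   proof
    assume "t + r : K"
    moreover have "t = (t + r) + - r" by (simp add: add.assoc)
    ultimately show False using that by blast
   qed
  qed
 qed
qed

text \<open>Weil's uniqueness argument, run for the two left invariant integrals \<open>\<integral> f\<close> and \<open>\<integral> f(t r) dt\<close>.\<close>

lemma double_integral_right_translate:
 fixes q g :: "'g => real"
 assumes q: "Cc q" and g: "Cc g"
 shows "(LI x. q (x + r) * (LI y. g (y + (x + r)))) = (LI y. q (- y)) * (LI x. g (x + r))"
proof -
 have qr: "Cc (%x. q (x + r))" and gr: "Cc (%x. g (x + r))" by (intro Cc_right_translate q g)+
 obtain K where K: "compact K" "!!t. t ~: K ==> q t = 0" by (rule CcE[OF q]) blast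
 obtain L where L: "compact L" "!!t. t ~: L ==> g t = 0" by (rule CcE[OF g]) blast
 obtain Kr where Kr: "compact Kr" "!!t. t ~: Kr ==> q (t + r) = 0" by (rule CcE[OF qr]) blast
 obtain Lr where Lr: "compact Lr" "!!t. t ~: Lr ==> g (t + r) = 0" by (rule CcE[OF gr]) blast
 let ?M = "(%p. fst p + - snd p) ` (L \<times> K)"
 have M: "compact ?M" by (intro compact_continuous_image compact_Times K L continuous_intros)
 have in_M: "y : ?M" if "z : L" "w : K" "y = z + - w" for y z w using that by force
 note c = continuous_on_compose2[OF Cc_continuous[OF q]] continuous_on_compose2[OF Cc_continuous[OF g]]
 have "(LI x. q (x + r) * (LI y. g (y + (x + r)))) = (LI x. LI y. q (x + r) * g (y + (x + r)))"
  by simp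
 also have "... = (LI y. LI x. q (x + r) * g (y + (x + r)))"
 proof (rule Fubini_Cc[OF _ Kr(1) _ M])
  show "q (x + r) * g (y + (x + r)) = 0" if "y ~: ?M" for x y
   using that in_M[of "y + (x + r)" "x + r" y] K(2) L(2) by (fastforce simp: add.assoc)
 qed (auto simp: Kr intro!: continuous_intros c)
 also have "... = (LI y. LI x. q (- y + (x + r)) * g (x + r))"
 proof (rule Bochner_Integration.integral_cong[OF refl])
  fix y
  have "(%x. q (x + r) * g (y + (x + r))) : Meas"
   by (intro borel_measurable_continuous_onI continuous_intros c) auto
  from integral_translate'[OF this, of y]
  show "(LI x. q (x + r) * g (y + (x + r))) = (LI x. q (- y + (x + r)) * g (x + r))"
   by (simp add: add.assoc[symmetric])
 qed
 also have "... = (LI x. LI y. q (- y + (x + r)) * g (x + r))"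
 proof (rule Fubini_Cc[OF _ M _ Lr(1)])
  show "q (- y + (x + r)) * g (x + r) = 0" if "y ~: ?M" for x y
  proof (rule ccontr)
   assume "~ ?thesis"
   hence "x + r : L" "- y + (x + r) : K" using K(2) L(2) by (metis mult_zero_left mult_zero_right)+
   from in_M[OF this, of y] that show False by (simp add: minus_add add.assoc diff_conv_add_uminus del: add_uminus_conv_diff)
  qed
 qed (auto simp: Lr intro!: continuous_intros c)
 also have "... = (LI x. LI y. q (- y) * g (x + r))"
 proof (rule Bochner_Integration.integral_cong[OF refl])
  fix x
  have "(%y. q (- y + (x + r)) * g (x + r)) : Meas"
   by (intro borel_measurable_continuous_onI continuous_intros c) auto
  moreover have "- (x + r + y) + (x + r) = - y" for y
   by (simp add: minus_add add.assoc diff_conv_add_uminus del: add_uminus_conv_diff)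
  ultimately show "(LI y. q (- y + (x + r)) * g (x + r)) = (LI y. q (- y) * g (x + r))"
   using integral_translate[of "%y. q (- y + (x + r)) * g (x + r)" "x + r"] by (simp only:)
 qed
 finally show ?thesis by simp
qed

lemma ex_Cc_integral_pos:
 obtains f :: "'g => real" where "Cc f" "!!t. 0 <= f t" "f 0 = 1" "0 < (LI t. f t)"
proof -
 have "compact {0::'g}" by simp
 then obtain k :: "'g => real" where k: "Cc k" "!!t. 0 <= k t" "!!t. t : {0} ==> k t = 1"
  by (rule Urysohn_Cc[OF _ open_UNIV subset_UNIV]) blast
 with integral_pos[OF Cc_continuous[OF k(1)] Cc_integrable[OF k(1)] k(2), of 0] show ?thesis by (intro that[of k]) auto
qed

text \<open>With \<open>D x\<close> the integral of \<open>g (y + x)\<close> over \<open>y\<close>,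
  the double integral identity is applied to \<open>q = f / D\<close> at \<open>r\<close> and at 0.
  The common factor, the integral of \<open>q (- y)\<close>, cancels, and the ratio is that of the
  integrals of the fixed function \<open>g\<close>.\<close>

lemma modular_function:
 obtains \<Delta> where "!!f::'g fn. Cc f ==> (LI t. f (t + r)) = of_real \<Delta> * (LI t. f t)"
proof -
 obtain g :: "'g => real" where g: "Cc g" "!!t. 0 <= g t" "g 0 = 1" "0 < (LI t. g t)"
  by (rule ex_Cc_integral_pos) blast
 define D where "D x = (LI y. g (y + x))" for x
 have D: "D x > 0" for x unfolding D_def
  by (rule integral_pos[OF Cc_continuous Cc_integrable, where x = "- x"]) (use g in "auto intro: Cc_right_translate")
 have real: "(LI t. f (t + r)) = (LI t. g (t + r)) / (LI t. g t) * (LI t. f t)" if f: "Cc f" for f :: "'g => real"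
 proof -
  obtain K where K: "compact K" "!!t. t ~: K ==> f t = 0" by (rule CcE[OF f]) blast
  obtain k :: "'g => real" where k: "Cc k" "!!t. 0 <= k t" "!!t. k t <= 1" "!!t. t : K ==> k t = 1"
   by (rule Urysohn_Cc[OF K(1) open_UNIV subset_UNIV]) blast
  obtain M where M: "compact M" "!!t. t ~: M ==> k t = 0" by (rule CcE[OF k(1)]) blast
  obtain L where L: "compact L" "!!t. t ~: L ==> g t = 0" by (rule CcE[OF g(1)]) blast
  \<comment> \<open>\<open>E\<close> is positive and continuous everywhere and equals
    \<open>D\<close> on the support of \<open>f\<close>. The cutoff \<open>k\<close> confines the
    integrands of \<open>k x * D x\<close> to one compact set of \<open>y\<close>, which gives
    continuity.\<close>
  define E where "E x = k x * D x + (1 - k x)" for x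
  have "cont (%x. LI y. k x * g (y + x))"
  proof (rule continuous_integral)
   show "compact ((%p. fst p + - snd p) ` (L \<times> M))"
    by (intro compact_continuous_image compact_Times M L continuous_intros)
   show "k x * g (y + x) = 0" if "y ~: (%p. fst p + - snd p) ` (L \<times> M)" for x y
   proof (rule ccontr)
    assume "k x * g (y + x) ~= 0"
    hence "(y + x, x) : L \<times> M" using L(2) M(2) by fastforce
    moreover have "y = fst (y + x, x) + - snd (y + x, x)" by (simp add: add.assoc)
    ultimately show False using that by blast
   qed
  qed (auto intro!: continuous_intros continuous_on_compose2[OF Cc_continuous[OF k(1)]]
    continuous_on_compose2[OF Cc_continuous[OF g(1)]])
  hence cE: "cont E"
   using continuous_on_add[OF _ continuous_on_diff[OF continuous_on_const[of _ 1] Cc_continuous[OF k(1)]]]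
   by (simp add: E_def[abs_def] D_def)
  have E: "E x > 0" for x
  proof (cases "k x = 0")
   case False
   hence "k x * D x > 0" using k(2)[of x] by (intro mult_pos_pos D) simp
   thus ?thesis using k(3)[of x] by (simp add: E_def)
  qed (simp add: E_def)
  have q: "Cc (%x. f x * inverse (E x))"
   by (rule Cc_mult_left[OF f]) (use E in "auto intro!: continuous_on_inverse cE simp: less_le")
  have fD: "f x * inverse (E x) * D x = f x" for x using K(2)[of x] k(4)[of x] D[of x] by (cases "x : K") (auto simp: E_def)
  show ?thesis
   using double_integral_right_translate[OF q g(1), of r] double_integral_right_translate[OF q g(1), of 0] g(4)
   unfolding D_def[symmetric] fD by (simp add: D_def)
 qed
 show ?thesis
 proof (rule that)
  fix f :: "'g fn" assume f: "Cc f"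
  have R: "Cc (%t. Re (f t))" "Cc (%t. Im (f t))"
   by (rule Cc_compose[OF f]; auto intro!: continuous_intros)+
  note i = Cc_integrable[OF f] Cc_integrable[OF Cc_right_translate[OF f, of r]]
  show "(LI t. f (t + r)) = of_real ((LI t. g (t + r)) / (LI t. g t)) * (LI t. f t)"
   using real[OF R(1)] real[OF R(2)] i by (simp add: complex_eq_iff)
 qed
qed

text \<open>The preadjoint of right translation on B(G): functions are translated back and
  multiplied by the modular factor \<open>\<Delta>\<close>. It is contractive because
  \<open>coef_ball\<close> is invariant under right translation.\<close>

lemma right_translate_pairing:
 assumes phi: "phi : CstG"
 obtains psi where "psi : CstG"
  "!!u. u : BG ==> pair psi u = pair phi (%s. u (s + r))"
proof -
 obtain rho where rho: "rho : CstG" "!!n. Cc (rho n)"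
  "!!u. u : BG ==> pair rho u = pair phi u"
  using full_cstar_approx_Cc[OF phi] by blast
 obtain \<Delta> where \<Delta>: "!!f::'g fn. Cc f ==> (LI t. f (t + r)) = of_real \<Delta> * (LI t. f t)"
  by (rule modular_function[of r]) blast
 define psi where "psi n s = of_real \<Delta> * rho n (s + - r)" for n s
 have tr: "(LI s. of_real \<Delta> * f (s + - r) * u s) = (LI s. f s * u (s + r))"
  if f: "Cc f" and u: "cont u" for f u :: "'g fn"
 proof -
  have "Cc (%s. f (s + - r) * u s)" by (rule Cc_mult_left[OF Cc_right_translate[OF f] u])
  from \<Delta>[OF this] show ?thesis by (simp add: mult.assoc add.assoc)
 qed
 have psi: "psi : CstG"
 proof (rule full_cstarI[OF _ full_cstarD(2)[OF rho(1)] full_cstarD(2)[OF rho(1)] zero_le_one order_refl])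
  show "intg (psi n)" for n
   unfolding psi_def[abs_def] using Cc_integrable[OF Cc_right_translate[OF rho(2)], of n "- r"] by auto
  fix m n
  have C: "Cc (%s. rho m s - rho n s)"
   using Cc_add[OF rho(2)[of m] Cc_compose[OF rho(2)[of n], of uminus]] by (simp add: continuous_intros)
  have "cnorm (%s. psi m s - psi n s) <= cnorm (%s. rho m s - rho n s)"
  proof (rule cstar_norm_le)
   fix u :: "'g fn" assume u: "u : coef_ball"
   have "(LI s. (psi m s - psi n s) * u s) = (LI s. (rho m s - rho n s) * u (s + r))"
    using tr[OF C coef_ball_continuous[OF u]] by (simp add: psi_def right_diff_distrib)
   thus "cmod (LI s. (psi m s - psi n s) * u s) <= cnorm (%s. rho m s - rho n s)"
    using cstar_norm_ge[OF Cc_integrable[OF C] coef_ball_right_translate[OF u, of r]] by simp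
  qed
  thus "cnorm (%s. psi m s - psi n s) <= 1 * cnorm (%s. rho m s - rho n s) + 0 * cnorm (%s. rho m s - rho n s)" by simp
 qed
 have "pair psi u = pair phi (%s. u (s + r))" if u: "u : BG" for u
 proof -
  have "pair psi u = pair rho (%s. u (s + r))"
   unfolding cstar_pairing_def psi_def tr[OF rho(2) BG_continuous[OF u]] ..
  thus ?thesis using rho(3)[OF BG_right_translate[OF u]] by simp
 qed
 with psi that show ?thesis by blast
qed

end

section \<open>The left regular representation\<close>

lemma cspan_lincomb:
 assumes "u : cspan S" "v : cspan S"
 shows "(%t. a * u t + b * v t) : cspan S"
proof -
 obtain A c where A: "finite A" "A \<subseteq> S" "u = (%t. SUM w:A. c w * w t)" using assms(1) by (auto simp: cspan_def)
 obtain B d where B: "finite B" "B \<subseteq> S" "v = (%t. SUM w:B. d w * w t)" using assms(2) by (auto simp: cspan_def)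
 define e where "e w = a * (if w : A then c w else 0) + b * (if w : B then d w else 0)" for w
 have "(SUM w:A. c w * w t) = (SUM w:A \<union> B. (if w : A then c w else 0) * w t)"
  "(SUM w:B. d w * w t) = (SUM w:A \<union> B. (if w : B then d w else 0) * w t)" for t
  using A(1) B(1) by (auto intro!: sum.mono_neutral_cong_left)
 hence "a * u t + b * v t = (SUM w:A \<union> B. e w * w t)" for t
  unfolding A(3) B(3) e_def by (simp add: sum_distrib_left sum.distrib distrib_right mult.assoc)
 thus ?thesis unfolding cspan_def using A B
  by (intro CollectI exI[of _ "A \<union> B"] exI[of _ e]) auto
qed

lemma zero_in_cspan: "(%_. 0) : cspan S"
 unfolding cspan_def by (rule CollectI, rule exI[of _ "{}"]) auto

section \<open>Square integrable functions and coefficients of the regular representation\<close>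

context haar
begin

text \<open>Functions rather than classes: a semi-inner product is enough for all estimates, and
  \<open>L2\<close> is met again only through the equality of coefficients.\<close>

definition l2fun :: "'g fn hspace" where
 "l2fun = \<lparr>hcarrier = {g. sq_int g}, hzero = (%_. 0), hadd = (%f g t. f t + g t), hscale = (%a f t. a * f t),
  hinner = (%f g. LI t. f t * cnj (g t))\<rparr>"

lemma l2fun_sel [simp]: "hcarrier l2fun = {g. sq_int g}" "hadd l2fun f g = (%t. f t + g t)"
  "hscale l2fun a f = (%t. a * f t)" "hinner l2fun f g = (LI t. f t * cnj (g t))"
 by (simp_all add: l2fun_def)

definition lreg :: "'g => 'g fn => 'g fn" where
 "lreg s f = (%t. f (- s + t))"

definition nm :: "'g fn => real" where
 "nm g = sqrt (LI t. (cmod (g t))^2)"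

lemma hnorm_l2fun: "hnorm l2fun g = nm g"
proof -
 have "(LI t. g t * cnj (g t)) = (LI t. of_real ((cmod (g t))^2))"
  by (simp only: complex_norm_square)
 thus ?thesis by (simp add: hnorm_def nm_def del: of_real_power)
qed

lemma semi_inner_l2fun: "semi_inner l2fun"
proof
 fix x y z assume x: "x : hcarrier l2fun" and y: "y : hcarrier l2fun"
 show "hadd l2fun x y : hcarrier l2fun" using x y sq_int_add by simp
 show "hinner l2fun (hscale l2fun a x) y = a * hinner l2fun x y" for a by (simp add: mult.assoc)
 have "(LI t. y t * cnj (x t)) = (LI t. cnj (x t * cnj (y t)))" by (simp add: mult.commute)
 also have "... = cnj (LI t. x t * cnj (y t))" by (rule Bochner_Integration.integral_cnj)
 finally show "hinner l2fun y x = cnj (hinner l2fun x y)" by simp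
 assume "z : hcarrier l2fun"
 thus "hinner l2fun (hadd l2fun x y) z = hinner l2fun x z + hinner l2fun y z"
  using x y sq_int_mult_integrable[of x z] sq_int_mult_integrable[of y z] by (simp add: distrib_right)
next
 fix x a assume "x : hcarrier l2fun"
 thus "hscale l2fun a x : hcarrier l2fun" using sq_int_scale by simp
 have "(LI t. x t * cnj (x t)) = (LI t. of_real ((cmod (x t))^2))"
  by (simp only: complex_norm_square)
 thus "0 <= Re (hinner l2fun x x)" by (simp del: of_real_power)
qed

lemma sq_int_lreg: "sq_int f ==> sq_int (lreg s f)"
 unfolding lreg_def by (rule sq_int_translate)

sublocale LR: semi_rep l2fun lreg
proof (intro semi_rep.intro semi_inner_l2fun semi_rep_axioms.intro)
 fix x y s t assume xy: "x : hcarrier l2fun" "y : hcarrier l2fun"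
 have m: "(%r. lreg s x r * cnj (lreg t y r)) : Meas"
  using sq_int_lreg[of x s] sq_int_lreg[of y t] xy by (auto simp: sq_int_def)
 have "lreg s x (t + r) * cnj (lreg t y (t + r)) = lreg (- t + s) x r * cnj (y r)" for r
  by (simp add: lreg_def minus_add add.assoc[symmetric])
 thus "hinner l2fun (lreg s x) (lreg t y) = hinner l2fun (lreg (- t + s) x) y"
  using integral_translate[OF m, of t] by simp
qed (auto simp: sq_int_lreg, auto simp: lreg_def)

definition lamc :: "'g fn => 'g fn => 'g fn" where
 "lamc g g' = coefficient l2fun lreg g g'"

lemma lamc_eq: "lamc g g' s = (LI t. g (- s + t) * cnj (g' t))"
 by (simp add: lamc_def coefficient_def lreg_def)

lemma nm_nonneg [simp]: "0 <= nm g"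
 by (simp add: nm_def)

lemma nm_lreg: "sq_int g ==> nm (lreg s g) = nm g"
 using LR.rep_inner_rep[of g g s s] LR.rep_zero_inner[of g g] by (simp add: hnorm_l2fun[symmetric] hnorm_def)

lemma lamc_bound: "sq_int g ==> sq_int g' ==> cmod (lamc g g' s) <= nm g * nm g'"
 using LR.Cauchy_Schwarz[of "lreg s g" g'] sq_int_lreg[of g s] nm_lreg[of g s]
 by (simp add: lamc_def coefficient_def hnorm_l2fun del: l2fun_sel(4))

lemma sq_int_diff: "sq_int g ==> sq_int h ==> sq_int (%t. g t - h t)"
 using sq_int_add[of g "%t. -1 * h t"] sq_int_scale[of h "-1"] by simp

lemma lamc_diff_bound:
 assumes "sq_int g" "sq_int g'" "sq_int h" "sq_int h'"
 shows "cmod (lamc g g' s - lamc h h' s) <= nm (%t. g t - h t) * nm g' + nm h * nm (%t. g' t - h' t)"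
proof -
 have "cmod (lamc g g' s - lamc h h' s) <= hnorm l2fun (hdiff l2fun (lreg s g) (lreg s h)) * hnorm l2fun g' +
   hnorm l2fun (lreg s h) * hnorm l2fun (hdiff l2fun g' h')"
  unfolding lamc_def coefficient_def by (rule LR.inner_diff2_le) (use assms sq_int_lreg in auto)
 moreover have "hdiff l2fun (lreg s g) (lreg s h) = lreg s (%t. g t - h t)" by (simp add: lreg_def)
 ultimately show ?thesis
  using nm_lreg[OF sq_int_diff[OF assms(1,3)]] nm_lreg[OF assms(3)] by (simp add: hnorm_l2fun)
qed

lemma Cc_dense_nm:
 assumes "sq_int g" "e > 0"
 obtains k where "Cc k" "nm (%t. g t - k t) < e"
proof -
 have "e^2 > 0" using assms(2) by simp
 then obtain k where k: "Cc k" "(LI t. (cmod (g t - k t))^2) < e^2"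
  using Cc_dense_L2[OF assms(1)] by blast
 have "nm (%t. g t - k t) < sqrt (e^2)" unfolding nm_def by (rule real_sqrt_less_mono[OF k(2)])
 thus ?thesis using that k(1) assms(2) by simp
qed

lemma Cc_sequence:
 assumes "sq_int g"
 obtains k where "!!n::nat. Cc (k n)" "(%n. nm (%t. g t - k n t)) \<longlonglongrightarrow> 0" "!!n. nm (k n) <= nm g + 1"
proof -
 have "EX k. Cc k & nm (%t. g t - k t) < 1 / real (Suc n)" for n
  using Cc_dense_nm[OF assms, of "1 / real (Suc n)"] by (metis of_nat_0_less_iff zero_less_Suc zero_less_divide_1_iff)
 then obtain k where k: "!!n. Cc (k n)" "!!n. nm (%t. g t - k n t) < 1 / real (Suc n)" by metis
 have "(%n. nm (%t. g t - k n t)) \<longlonglongrightarrow> 0"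
  by (rule tendsto_if_norm_le[OF tendsto_inverse_Suc]) (use k(2) in "simp add: less_imp_le")
 moreover have "nm (k n) <= nm g + 1" for n
 proof -
  have "nm (k n) <= nm g + nm (%t. k n t - g t)"
   using LR.hnorm_le_add_diff[of "k n" g] Cc_sq_int[OF k(1)] assms by (simp add: hnorm_l2fun)
  moreover have "nm (%t. k n t - g t) = nm (%t. g t - k n t)" by (simp add: nm_def norm_minus_commute)
  moreover have "1 / real (Suc n) <= 1" by simp
  ultimately show ?thesis using k(2)[of n] by linarith
 qed
 ultimately show ?thesis using k(1) that by blast
qed

text \<open>Translations are isometric, so approximation of the two vectors is uniform in
  \<open>s\<close> on the coefficients. The convergence of the norms is included because operator
  bounds are passed to the limit with it.\<close>

lemma lamc_uniform_limit:
 assumes "sq_int g" "sq_int g'"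
 obtains k k' where "!!n::nat. Cc (k n)" "!!n::nat. Cc (k' n)"
  "(%n. nm (k n)) \<longlonglongrightarrow> nm g" "(%n. nm (k' n)) \<longlonglongrightarrow> nm g'"
  "EX d. d \<longlonglongrightarrow> 0 & (ALL n s. cmod (lamc g g' s - lamc (k n) (k' n) s) <= d n)"
proof -
 obtain k where k: "!!n::nat. Cc (k n)" "(%n. nm (%t. g t - k n t)) \<longlonglongrightarrow> 0" "!!n. nm (k n) <= nm g + 1"
  using Cc_sequence[OF assms(1)] by blast
 obtain k' where k': "!!n::nat. Cc (k' n)" "(%n. nm (%t. g' t - k' n t)) \<longlonglongrightarrow> 0" "!!n. nm (k' n) <= nm g' + 1"
  using Cc_sequence[OF assms(2)] by blast
 have conv: "(%n. nm (l n)) \<longlonglongrightarrow> nm h" if "!!n::nat. Cc (l n)" "(%n. nm (%t. h t - l n t)) \<longlonglongrightarrow> 0" "sq_int h" for l h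
 proof (rule tendsto_if_norm_le[OF that(2)])
  fix n
  have "nm (l n) <= nm h + nm (%t. l n t - h t)" "nm h <= nm (l n) + nm (%t. h t - l n t)"
   using LR.hnorm_le_add_diff[of "l n" h] LR.hnorm_le_add_diff[of h "l n"] Cc_sq_int[OF that(1)] that(3)
   by (simp_all add: hnorm_l2fun)
  moreover have "nm (%t. l n t - h t) = nm (%t. h t - l n t)" by (simp add: nm_def norm_minus_commute)
  ultimately show "norm (nm (l n) - nm h) <= nm (%t. h t - l n t)" by simp
 qed
 define d where "d n = nm (%t. g t - k n t) * nm g' + (nm g + 1) * nm (%t. g' t - k' n t)" for n
 have "d \<longlonglongrightarrow> 0" unfolding d_def
  using tendsto_add[OF tendsto_mult_left_zero[OF k(2), of "nm g'"] tendsto_mult_right_zero[OF k'(2), of "nm g + 1"]] by simp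
 moreover have "cmod (lamc g g' s - lamc (k n) (k' n) s) <= d n" for n s
 proof -
  have "nm (k n) * nm (%t. g' t - k' n t) <= (nm g + 1) * nm (%t. g' t - k' n t)"
   using k(3) by (rule mult_right_mono) simp
  thus ?thesis unfolding d_def
   using lamc_diff_bound[OF assms Cc_sq_int[OF k(1)] Cc_sq_int[OF k'(1)], of s n n] by linarith
 qed
 ultimately show ?thesis
  using that[OF k(1) k'(1) conv[OF k(1,2) assms(1)] conv[OF k'(1,2) assms(2)]] by blast
qed

lemma lamc_Cc_continuous:
 assumes k: "Cc k" and k': "Cc k'"
 shows "cont (lamc k k')"
proof -
 obtain K where K: "compact K" "!!t. t ~: K ==> k' t = 0" by (rule CcE[OF k']) blast
 have "cont (%p. k (- fst p + snd p) * cnj (k' (snd p)))"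
  by (intro continuous_intros continuous_on_compose2[OF Cc_continuous[OF k]] continuous_on_compose2[OF Cc_continuous[OF k']]) auto
 from continuous_integral[OF this K(1)] K(2)
 have "cont (%s. LI t. k (- s + t) * cnj (k' t))" by simp
 thus ?thesis by (simp add: lamc_eq[abs_def])
qed

lemma lamc_continuous:
 assumes "sq_int g" "sq_int g'"
 shows "cont (lamc g g')"
proof -
 obtain k k' where k: "!!n::nat. Cc (k n)" "!!n::nat. Cc (k' n)"
  and "EX d. d \<longlonglongrightarrow> 0 & (ALL n s. cmod (lamc g g' s - lamc (k n) (k' n) s) <= d n)"
  using lamc_uniform_limit[OF assms] by metis
 then obtain d where d: "d \<longlonglongrightarrow> 0" "!!n s. cmod (lamc g g' s - lamc (k n) (k' n) s) <= d n" by blast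
 have "uniform_limit UNIV (%n. lamc (k n) (k' n)) (lamc g g') sequentially"
 proof (rule uniform_limitI)
  fix e :: real assume "e > 0"
  hence "\<forall>\<^sub>F n in sequentially. d n < e" by (rule order_tendstoD(2)[OF d(1)])
  thus "\<forall>\<^sub>F n in sequentially. ALL s:UNIV. dist (lamc (k n) (k' n) s) (lamc g g' s) < e"
   by eventually_elim (use d(2) in "auto simp: dist_norm norm_minus_commute intro: le_less_trans")
 qed
 thus ?thesis
  by (rule uniform_limit_theorem[rotated]) (auto intro!: always_eventually lamc_Cc_continuous k)
qed

lemma lamc_in_coef_ball:
 assumes "sq_int g" "sq_int g'" "nm g <= 1" "nm g' <= 1"
 shows "lamc g g' : coef_ball"
proof (rule coef_ballI)
 show pd: "posdef (lamc g g)" unfolding lamc_def by (rule LR.posdef_coefficient) (use assms in simp)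
 show "cont (lamc g g)" by (rule lamc_continuous[OF assms(1,1)])
 have "cmod (lamc g g 0) <= nm g * nm g" by (rule lamc_bound[OF assms(1,1)])
 thus "Re (lamc g g 0) <= 1"
  using complex_Re_le_cmod[of "lamc g g 0"] mult_le_one[OF assms(3) nm_nonneg assms(3)] by linarith
 show "dominated (lamc g g') (lamc g g) 1"
 proof (rule dominated_mono[OF pd _ assms(4)])
  show "dominated (lamc g g') (lamc g g) (nm g')"
   unfolding lamc_def hnorm_l2fun[symmetric] by (rule LR.dominated_coefficient) (use assms in simp_all)
 qed
qed

lemma lamc_scale: "lamc (%t. a * g t) (%t. b * g' t) = (%s. a * cnj b * lamc g g' s)"
proof
 fix s
 have "(LI t. a * g (- s + t) * cnj (b * g' t)) = (LI t. a * cnj b * (g (- s + t) * cnj (g' t)))"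
  by (simp add: mult_ac)
 thus "lamc (%t. a * g t) (%t. b * g' t) s = a * cnj b * lamc g g' s" by (simp add: lamc_eq)
qed

lemma nm_scale: "nm (%t. a * g t) = cmod a * nm g"
 by (simp add: nm_def norm_mult power_mult_distrib real_sqrt_mult)

lemma lamc_eq_scaled_coef_ball:
 assumes "sq_int g" "sq_int g'"
 obtains v where "v : coef_ball" "lamc g g' = (%s. of_real (nm g * nm g') * v s)"
proof (cases "nm g * nm g' = 0")
 case True
 hence "lamc g g' s = 0" for s using lamc_bound[OF assms, of s] by (simp only:) simp
 thus ?thesis using that[OF one_in_coef_ball] True by auto
next
 case False
 hence n: "nm g > 0" "nm g' > 0" using nm_nonneg[of g] nm_nonneg[of g'] by (auto simp: less_le)
 let ?g = "%t. of_real (1 / nm g) * g t" and ?g' = "%t. of_real (1 / nm g') * g' t"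
 have nn: "nm ?g = 1" "nm ?g' = 1" unfolding nm_scale using n by (auto simp: norm_divide)
 have "lamc ?g ?g' : coef_ball"
  by (rule lamc_in_coef_ball[OF sq_int_scale[OF assms(1)] sq_int_scale[OF assms(2)]]) (simp_all only: nn)
 moreover have "lamc g g' = (%s. of_real (nm g * nm g') * lamc ?g ?g' s)"
  unfolding lamc_scale using n by auto
 ultimately show ?thesis using that by blast
qed

lemma lamc_in_BG:
 assumes "sq_int g" "sq_int g'"
 shows "lamc g g' : BG"
proof -
 obtain v where "v : coef_ball" "lamc g g' = (%s. of_real (nm g * nm g') * v s)"
  using lamc_eq_scaled_coef_ball[OF assms] .
 thus ?thesis using coef_ball_subset_BG by metis
qed

section \<open>Comparison with the almost-everywhere classes\<close>

lemma AE_translate: "(AE t in \<mu>. P t) ==> (AE t in \<mu>. P (s + t))"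
 for P :: "'g => bool"
 by (rule AE_distrD[OF measurable_translate_haar[of s], of P]) (simp only: distr_translate)

lemma l2_class_cong:
 assumes "AE t in \<mu>. f t = g t"
 shows "l2_class \<mu> f = l2_class \<mu> g"
proof -
 have "(AE t in \<mu>. f t = h t) \<longleftrightarrow> (AE t in \<mu>. g t = h t)" for h
 proof
  show "AE t in \<mu>. g t = h t" if "AE t in \<mu>. f t = h t" using that assms by eventually_elim simp
  show "AE t in \<mu>. f t = h t" if "AE t in \<mu>. g t = h t" using that assms by eventually_elim simp
 qed
 thus ?thesis by (simp add: l2_class_def)
qed

lemma in_l2_class: "g : l2_class \<mu> f \<longleftrightarrow> g : Meas & (AE t in \<mu>. f t = g t)"
 by (simp add: l2_class_def)

lemma L2_inner:
 assumes "sq_int f" "sq_int g"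
 shows "hinner (L2 \<mu>) (l2_class \<mu> f) (l2_class \<mu> g) = (LI t. f t * cnj (g t))"
proof -
 have m: "f : Meas" "g : Meas" using assms by (auto simp: sq_int_def)
 have "(LI t. f' t * cnj (g' t)) = (LI t. f t * cnj (g t))"
  if "f' : l2_class \<mu> f" "g' : l2_class \<mu> g" for f' g'
 proof (rule integral_cong_AE)
  show "AE t in \<mu>. f' t * cnj (g' t) = f t * cnj (g t)"
   using that[unfolded in_l2_class, THEN conjunct2] by eventually_elim simp
 qed (use that m in "auto simp: in_l2_class")
 moreover have "f : l2_class \<mu> f" "g : l2_class \<mu> g" using m by (auto simp: in_l2_class)
 ultimately have "(\<Union>f'\<in>l2_class \<mu> f. \<Union>g'\<in>l2_class \<mu> g. {LI t. f' t * cnj (g' t)}) = {LI t. f t * cnj (g t)}"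
  by blast
 thus ?thesis by (simp add: L2_def)
qed

lemma left_regular_class:
 assumes "f : Meas"
 shows "left_regular \<mu> s (l2_class \<mu> f) = l2_class \<mu> (lreg s f)"
proof -
 have "l2_class \<mu> (%t. f' (- s + t)) = l2_class \<mu> (lreg s f)" if "f' : l2_class \<mu> f" for f'
 proof (rule l2_class_cong)
  have "AE t in \<mu>. f t = f' t" using that by (simp add: in_l2_class)
  from AE_translate[OF this, of "- s"] show "AE t in \<mu>. f' (- s + t) = lreg s f t"
   unfolding lreg_def by eventually_elim simp
 qed
 moreover have "f : l2_class \<mu> f" using assms by (auto simp: in_l2_class)
 ultimately show ?thesis unfolding left_regular_def by blast
qed

lemma L2_carrier: "hcarrier (L2 \<mu>) = {l2_class \<mu> f | f. sq_int f}"
 by (simp add: L2_def sq_int_def)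

lemma coefficient_L2:
 assumes "sq_int f" "sq_int g"
 shows "coefficient (L2 \<mu>) (left_regular \<mu>) (l2_class \<mu> f) (l2_class \<mu> g) = lamc f g"
proof
 fix s
 have m: "f : Meas" using assms by (simp add: sq_int_def)
 show "coefficient (L2 \<mu>) (left_regular \<mu>) (l2_class \<mu> f) (l2_class \<mu> g) s = lamc f g s"
  unfolding coefficient_def left_regular_class[OF m] L2_inner[OF sq_int_lreg[OF assms(1)] assms(2)]
  by (simp add: lamc_eq lreg_def)
qed

lemma F_space_L2: "F_space (L2 \<mu>) (left_regular \<mu>) = cspan {lamc f g | f g. sq_int f & sq_int g}"
proof -
 have "{coefficient (L2 \<mu>) (left_regular \<mu>) x y | x y. x : hcarrier (L2 \<mu>) & y : hcarrier (L2 \<mu>)}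
   = {lamc f g | f g. sq_int f & sq_int g}"
  unfolding L2_carrier using coefficient_L2 by (auto; metis)
 thus ?thesis unfolding F_space_def by simp
qed

section \<open>The reduced Fourier--Stieltjes algebra\<close>

abbreviation Br :: "'g fn set" where
 "Br \<equiv> B_space \<mu> (L2 \<mu>) (left_regular \<mu>)"

text \<open>The kernel of the regular representation on C*(G): the pairing with
  \<open>lamc f g\<close> is the matrix coefficient of the operator of \<open>phi\<close> between
  \<open>f\<close> and \<open>g\<close>.\<close>

definition kills_lambda :: "(nat => 'g fn) => bool" where
 "kills_lambda phi \<longleftrightarrow> phi : CstG & (ALL f g. sq_int f --> sq_int g --> pair phi (lamc f g) = 0)"

lemma F_space_L2_subset: "F_space (L2 \<mu>) (left_regular \<mu>) \<subseteq> BG"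
proof
 fix u assume "u : F_space (L2 \<mu>) (left_regular \<mu>)"
 thus "u : BG" unfolding F_space_L2
  by (induction rule: cspan_induct) (auto intro!: const_in_BG BG_add[OF BG_scale] lamc_in_BG)
qed

lemma kills_lambda_F_space:
 assumes phi: "kills_lambda phi" and u: "u : F_space (L2 \<mu>) (left_regular \<mu>)"
 shows "pair phi u = 0"
proof -
 have F: "phi : CstG" using phi by (simp add: kills_lambda_def)
 have "u : BG & pair phi u = 0" using u unfolding F_space_L2
 proof (induction rule: cspan_induct)
  case 1
  show ?case using const_in_BG[of 0] by (simp add: cstar_pairing_def)
 next
  case (2 v w c)
  hence v: "v : BG" "pair phi v = 0" using lamc_in_BG phi by (auto simp: kills_lambda_def)
  show ?case using BG_add[OF BG_scale[OF v(1), of c]] pairing_lincomb[OF F v(1), of w c 1] v(2) 2 by simp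
 qed
 thus ?thesis ..
qed

text \<open>The dual of a quotient C*-algebra is the annihilator of the kernel; here it comes from
  \<open>closure_of_eq_annihilator\<close> with pairings as functionals.\<close>

lemma Br_iff: "u : Br \<longleftrightarrow> u : BG & (ALL phi. kills_lambda phi --> pair phi u = 0)"
proof -
 let ?F = "F_space (L2 \<mu>) (left_regular \<mu>)"
 have "u : Br \<longleftrightarrow> u : BG &
   (ALL theta:pair ` CstG. (ALL v:?F. theta v = 0) --> theta u = 0)"
  unfolding B_space_def B_weak_star_def
 proof (rule closure_of_eq_annihilator[where L = "%a x b y t. a * x t + b * y t"])
  show "?F ~= {}" using zero_in_cspan unfolding F_space_def by blast
  show "?F \<subseteq> BG" by (rule F_space_L2_subset)
  show "(%t. a * x t + b * y t) : ?F" if "x : ?F" "y : ?F" for x y a b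
   using that cspan_lincomb unfolding F_space_def by blast
  show "theta (%t. a * x t + b * y t) = a * theta x + b * theta y"
   if "theta : pair ` CstG" "x : ?F" "y : ?F" for theta x y a b
  proof -
   from that(1) obtain phi where "phi : CstG" "theta = pair phi" by auto
   thus ?thesis using pairing_lincomb[of phi x y a b] subsetD[OF F_space_L2_subset] that(2,3) by simp
  qed
  show "EX theta:pair ` CstG. ALL x:BG. theta x = 0"
   using zero_in_full_cstar by blast
  fix theta theta' a assume "theta : pair ` CstG" "theta' : pair ` CstG"
  then obtain phi psi where F: "phi : CstG" "psi : CstG" "theta = pair phi" "theta' = pair psi"
   by blast
  show "EX eta:pair ` CstG. ALL x:BG. eta x = a * theta x + theta' x"
   by (rule bexI[OF _ imageI[OF full_cstar_combination(1)[OF F(1,2), of a]]])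
    (simp add: full_cstar_combination(2)[OF F(1,2)] F(3,4))
 qed
 moreover have "kills_lambda phi \<longleftrightarrow> phi : CstG & (ALL v:?F. pair phi v = 0)" for phi
 proof
  assume "phi : CstG & (ALL v:?F. pair phi v = 0)"
  moreover have "lamc f g : ?F" if "sq_int f" "sq_int g" for f g
   unfolding F_space_L2 by (rule cspan_single) (use that in blast)
  ultimately show "kills_lambda phi" by (simp add: kills_lambda_def)
 next
  assume k: "kills_lambda phi"
  show "phi : CstG & (ALL v:?F. pair phi v = 0)"
   using k kills_lambda_F_space[OF k] by (simp add: kills_lambda_def)
 qed
 ultimately show ?thesis by simp blast
qed

lemma Br_subset: "Br \<subseteq> BG"
 using Br_iff by blast

lemma BrI: "u : BG ==> (!!phi. kills_lambda phi ==> pair phi u = 0) ==> u : Br"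
 using Br_iff by blast

lemma Br_pairing: "u : Br ==> kills_lambda phi ==> pair phi u = 0"
 using Br_iff by blast

lemma kills_lambdaD: "kills_lambda phi ==> phi : CstG"
 by (simp add: kills_lambda_def)

lemma Br_lincomb: "u : Br ==> v : Br ==> (%t. a * u t + b * v t) : Br"
proof (rule BrI)
 assume uv: "u : Br" "v : Br"
 hence m: "u : BG" "v : BG" using Br_subset by auto
 thus "(%t. a * u t + b * v t) : BG"
  by (intro BG_add BG_scale)
 show "pair phi (%t. a * u t + b * v t) = 0" if "kills_lambda phi" for phi
  using pairing_lincomb[OF kills_lambdaD[OF that] m] Br_pairing[OF uv(1) that] Br_pairing[OF uv(2) that] by simp
qed

text \<open>This and the next two closure properties are proved dually: the preadjoint operation on
  C*(G) preserves the kernel of \<lambda>, because the operation carries coefficients of \<lambda>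
  to coefficients of \<lambda>.\<close>

lemma Br_cnj: "u : Br ==> (%t. cnj (u t)) : Br"
proof (rule BrI)
 assume u: "u : Br"
 hence m: "u : BG" using Br_subset by auto
 thus c: "(%t. cnj (u t)) : BG" by (rule BG_cnj)
 fix phi assume phi: "kills_lambda phi"
 note F = kills_lambdaD[OF phi]
 have "kills_lambda (%n s. cnj (phi n s))"
  unfolding kills_lambda_def
 proof (intro conjI allI impI)
  fix f g assume fg: "sq_int f" "sq_int g"
  have "(%s. cnj (lamc f g s)) = lamc (%t. cnj (f t)) (%t. cnj (g t))"
  proof
   fix s
   have "(LI t. cnj (f (- s + t)) * cnj (cnj (g t))) = (LI t. cnj (f (- s + t) * cnj (g t)))" by simp
   also have "... = cnj (LI t. f (- s + t) * cnj (g t))" by (rule Bochner_Integration.integral_cnj)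
   finally show "cnj (lamc f g s) = lamc (%t. cnj (f t)) (%t. cnj (g t)) s" by (simp add: lamc_eq)
  qed
  thus "pair (%n s. cnj (phi n s)) (lamc f g) = 0"
   using full_cstar_cnj(2)[OF F lamc_in_BG[OF fg]] phi sq_int_cnj[OF fg(1)] sq_int_cnj[OF fg(2)]
   by (simp add: kills_lambda_def)
 qed (rule full_cstar_cnj(1)[OF F])
 from Br_pairing[OF u this] full_cstar_cnj(2)[OF F m] show "pair phi (%t. cnj (u t)) = 0" by simp
qed

lemma Br_left_translate: "u : Br ==> (%t. u (r + t)) : Br"
proof (rule BrI)
 assume u: "u : Br"
 hence m: "u : BG" using Br_subset by auto
 thus "(%t. u (r + t)) : BG" by (rule BG_left_translate)
 fix phi assume phi: "kills_lambda phi"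
 note F = kills_lambdaD[OF phi]
 have "kills_lambda (%n s. phi n (- r + s))"
  unfolding kills_lambda_def
 proof (intro conjI allI impI)
  fix f g assume fg: "sq_int f" "sq_int g"
  have "(%s. lamc f g (r + s)) = lamc f (lreg (- r) g)"
  proof
   fix s
   have "(%t. f (- s + t) * cnj (g (r + t))) : Meas"
    using sq_int_translate[OF fg(1), of "- s"] sq_int_translate[OF fg(2), of r]
    by (intro borel_measurable_times measurable_cnj) (simp_all add: sq_int_def)
   from integral_translate[OF this, of "- r"]
   show "lamc f g (r + s) = lamc f (lreg (- r) g) s"
    by (simp add: lamc_eq lreg_def minus_add add.assoc[symmetric])
  qed
  thus "pair (%n s. phi n (- r + s)) (lamc f g) = 0"
   using full_cstar_translate(2)[OF F lamc_in_BG[OF fg], of r] phi fg(1) sq_int_lreg[OF fg(2), of "- r"]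
   by (simp add: kills_lambda_def)
 qed (rule full_cstar_translate(1)[OF F])
 from Br_pairing[OF u this] full_cstar_translate(2)[OF F m] show "pair phi (%t. u (r + t)) = 0" by simp
qed

lemma Br_right_translate: "u : Br ==> (%t. u (t + r)) : Br"
proof (rule BrI)
 assume u: "u : Br"
 hence m: "u : BG" using Br_subset by auto
 thus "(%t. u (t + r)) : BG" by (rule BG_right_translate)
 fix phi assume phi: "kills_lambda phi"
 obtain psi where psi: "psi : CstG"
  "!!u. u : BG ==> pair psi u = pair phi (%s. u (s + r))"
  by (rule right_translate_pairing[OF kills_lambdaD[OF phi], of r]) blast
 have "kills_lambda psi"
  unfolding kills_lambda_def
 proof (intro conjI allI impI psi(1))
  fix f g assume fg: "sq_int f" "sq_int g"
  have "(%s. lamc f g (s + r)) = lamc (lreg r f) g"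
   by (simp add: lamc_eq[abs_def] lreg_def minus_add add.assoc[symmetric])
  thus "pair psi (lamc f g) = 0"
   using psi(2)[OF lamc_in_BG[OF fg]] phi fg(2) sq_int_lreg[OF fg(1), of r]
   by (simp add: kills_lambda_def)
 qed
 from Br_pairing[OF u this] psi(2)[OF m] show "pair phi (%t. u (t + r)) = 0" by simp
qed

subsection \<open>Fell's absorption principle\<close>

text \<open>\<open>lam_bdd f c\<close> says that \<open>\<lambda>(f)\<close> has norm at most \<open>c\<close>.\<close>

definition lam_bdd :: "'g fn => real => bool" where
 "lam_bdd f c \<longleftrightarrow> (ALL g g'. sq_int g --> sq_int g' --> cmod (LI s. f s * lamc g g' s) <= c * nm g * nm g')"

lemma lam_bddD: "lam_bdd f c ==> sq_int g ==> sq_int g' ==> cmod (LI s. f s * lamc g g' s) <= c * nm g * nm g'"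
 by (simp add: lam_bdd_def)

lemma lam_bdd_cstar_norm:
 assumes f: "intg f"
 shows "lam_bdd f (cnorm f)"
 unfolding lam_bdd_def
proof (intro allI impI)
 fix g g' assume gg: "sq_int g" "sq_int g'"
 obtain v where v: "v : coef_ball" "lamc g g' = (%s. of_real (nm g * nm g') * v s)"
  using lamc_eq_scaled_coef_ball[OF gg] .
 have "(LI s. f s * lamc g g' s) = of_real (nm g * nm g') * (LI s. f s * v s)"
  unfolding v(2) integral_mult_right_zero[symmetric] by (simp only: mult.left_commute)
 hence "cmod (LI s. f s * lamc g g' s) = (nm g * nm g') * cmod (LI s. f s * v s)"
  by (simp only: norm_mult norm_of_real) simp
 also have "... <= (nm g * nm g') * cnorm f"
  by (rule mult_left_mono[OF cstar_norm_ge[OF f v(1)]]) simp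
 finally show "cmod (LI s. f s * lamc g g' s) <= cnorm f * nm g * nm g'" by (simp add: mult_ac)
qed

text \<open>The kernel condition is one equation per pair of vectors, yet the operator norms tend to
  0: they are Cauchy, being bounded by the C*-norm, and every coefficient of the limit
  vanishes.\<close>

lemma kills_lambda_lam_bdd:
 assumes phi: "kills_lambda phi" and e: "e > 0"
 shows "EX N. ALL n>=N. lam_bdd (phi n) e"
proof -
 note F = kills_lambdaD[OF phi] and i = full_cstarD(1)[OF kills_lambdaD[OF phi]]
 obtain N where N: "!!m n. m >= N ==> n >= N ==> cnorm (%s. phi m s - phi n s) < e"
  using full_cstarD(2)[OF F] e unfolding small_def by meson
 have "lam_bdd (phi n) e" if n: "n >= N" for n
  unfolding lam_bdd_def
 proof (intro allI impI)
  fix g g' assume gg: "sq_int g" "sq_int g'"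
  note l = lamc_in_BG[OF gg]
  have "(%m. (LI s. phi n s * lamc g g' s) - (LI s. phi m s * lamc g g' s)) \<longlonglongrightarrow>
    (LI s. phi n s * lamc g g' s) - pair phi (lamc g g')"
   by (intro tendsto_intros pairing_tendsto F l)
  hence "(%m. cmod ((LI s. phi n s * lamc g g' s) - (LI s. phi m s * lamc g g' s))) \<longlonglongrightarrow>
    cmod (LI s. phi n s * lamc g g' s)"
   using phi gg by (auto simp: kills_lambda_def dest: tendsto_norm)
  thus "cmod (LI s. phi n s * lamc g g' s) <= e * nm g * nm g'"
  proof (rule LIMSEQ_le_const2, intro exI allI impI)
   fix m assume m: "m >= N"
   have d: "intg (%s. phi n s - phi m s)" using i by auto
   have "(LI s. phi n s * lamc g g' s) - (LI s. phi m s * lamc g g' s) = (LI s. (phi n s - phi m s) * lamc g g' s)"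
    using integrable_mult_BG[OF i l] by (simp add: left_diff_distrib)
   hence "cmod ((LI s. phi n s * lamc g g' s) - (LI s. phi m s * lamc g g' s)) <=
     cnorm (%s. phi n s - phi m s) * nm g * nm g'"
    using lam_bddD[OF lam_bdd_cstar_norm[OF d] gg] by simp
   also have "... <= e * nm g * nm g'"
    using N[OF n m] by (intro mult_right_mono) auto
   finally show "cmod ((LI s. phi n s * lamc g g' s) - (LI s. phi m s * lamc g g' s)) <= e * nm g * nm g'" .
  qed
 qed
 thus ?thesis by blast
qed

text \<open>The criterion used for membership in \<open>Br\<close>: integration against
  \<open>u\<close> is bounded by the operator norm of \<open>\<lambda>(f)\<close>, so it vanishes in
  the limit on the kernel.\<close>

lemma pairing_zero_if_lam_bdd:
 assumes phi: "kills_lambda phi" and u: "u : BG" and C: "C >= 0"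
  and b: "!!f c. intg f ==> c > 0 ==> lam_bdd f c ==> cmod (LI s. f s * u s) <= c * C"
 shows "pair phi u = 0"
proof (rule pairing_eqI[OF kills_lambdaD[OF phi] u], rule LIMSEQ_I)
 fix e :: real assume e: "e > 0"
 define c where "c = e / (C + 1)"
 have c: "c > 0" using e C by (simp add: c_def)
 obtain N where N: "ALL n>=N. lam_bdd (phi n) c" using kills_lambda_lam_bdd[OF phi c] by blast
 have "cmod ((LI s. phi n s * u s) - 0) < e" if "n >= N" for n
 proof -
  have "cmod (LI s. phi n s * u s) <= c * C"
   using b[OF full_cstarD(1)[OF kills_lambdaD[OF phi]] c] N that by blast
  also have "... < e" using e C by (simp add: c_def pos_divide_less_eq add_nonneg_pos algebra_simps)
  finally show ?thesis by simp
 qed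
 thus "EX no. ALL n>=no. norm ((LI s. phi n s * u s) - 0) < e" by blast
qed

lemma lamc_abs_integral_le:
 assumes "sq_int g" "sq_int g'"
 shows "intg (%t. cmod (g (- s + t)) * cmod (g' t))"
  and "(LI t. cmod (g (- s + t)) * cmod (g' t)) <= nm g * nm g'"
proof -
 let ?g = "%t. complex_of_real (cmod (g t))" and ?g' = "%t. complex_of_real (cmod (g' t))"
 have a: "sq_int ?g" "sq_int ?g'" using assms by (auto simp: sq_int_def)
 have "intg (%t. lreg s ?g t * cnj (?g' t))"
  by (rule sq_int_mult_integrable[OF sq_int_lreg[OF a(1)] a(2)])
 thus i: "intg (%t. cmod (g (- s + t)) * cmod (g' t))"
  using integrable_norm[of \<mu> "%t. lreg s ?g t * cnj (?g' t)"] by (simp add: lreg_def norm_mult)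
 have "lamc ?g ?g' s = of_real (LI t. cmod (g (- s + t)) * cmod (g' t))"
 proof -
  have "lamc ?g ?g' s = (LI t. complex_of_real (cmod (g (- s + t)) * cmod (g' t)))" by (simp add: lamc_eq)
  also have "... = of_real (LI t. cmod (g (- s + t)) * cmod (g' t))" by (rule integral_complex_of_real)
  finally show ?thesis .
 qed
 moreover have "cmod (lamc ?g ?g' s) <= nm ?g * nm ?g'" by (rule lamc_bound[OF a])
 moreover have "nm ?g = nm g" "nm ?g' = nm g'" by (simp_all add: nm_def)
 ultimately show "(LI t. cmod (g (- s + t)) * cmod (g' t)) <= nm g * nm g'" by simp
qed

lemma sum_nm_mult_le:
 assumes "(SUM e:E. (nm (G e))^2) <= A^2" "(SUM e:E. (nm (G' e))^2) <= B^2" "A >= 0" "B >= 0"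
 shows "(SUM e:E. nm (G e) * nm (G' e)) <= A * B"
proof (rule power2_le_imp_le)
 have "(SUM e:E. nm (G e) * nm (G' e))^2 <= (SUM e:E. (nm (G e))^2) * (SUM e:E. (nm (G' e))^2)"
  by (rule Cauchy_Schwarz_ineq_sum)
 also have "... <= A^2 * B^2" using assms by (intro mult_mono) (auto intro: sum_nonneg)
 finally show "(SUM e:E. nm (G e) * nm (G' e))^2 <= (A * B)^2" by (simp add: power_mult_distrib)
qed (use assms in simp)

text \<open>
 By compactness \<open>\<pi>(-r)x\<close> stays near a finite dimensional space for \<open>r\<close> in the support of \<open>g\<close>, and
 \<open>\<langle>\<pi>(t - r)x|y\<rangle> = \<langle>\<pi>(-r)x|\<pi>(-t)y\<rangle>\<close> is expanded in an orthonormal basis of that space.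
\<close>

lemma Fell_Cc:
 assumes r: "unitary_rep H \<pi>" and x: "x : hcarrier H" "hnorm H x <= 1" and y: "y : hcarrier H" "hnorm H y <= 1"
  and f: "intg f" and c: "c > 0" "lam_bdd f c" and g: "Cc g" and g': "Cc g'" and e: "e > 0"
 shows "cmod (LI s. f s * coefficient H \<pi> x y s * lamc g g' s) <=
  c * nm g * nm g' + e * (nm g * nm g') * (LI s. cmod (f s))"
proof -
 interpret urep H \<pi> by standard (rule r)
 let ?u = "cf x y"
 obtain K where K: "compact K" "!!t. t ~: K ==> g t = 0" by (rule CcE[OF g]) blast
 have cu: "cont (uminus :: 'g => 'g)" by (intro continuous_intros)
 have "EX V. open V & r : V & (ALL t:V. hn (dif (\<pi> (- t) x) (\<pi> (- r) x)) < e)" for r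
 proof -
  obtain V where "open V" "- r : V" "!!t. t : V ==> hn (dif (\<pi> t x) (\<pi> (- r) x)) < e"
   using rep_continuous[OF x(1) e, of "- r"] by blast
  thus ?thesis using cu by (intro exI[of _ "uminus -` V"]) (auto simp: open_vimage)
 qed
 then obtain V where V: "!!r. open (V r)" "!!r. r : V r" "!!r t. t : V r ==> hn (dif (\<pi> (- t) x) (\<pi> (- r) x)) < e"
  by metis
 obtain S where S: "S \<subseteq> K" "finite S" "K \<subseteq> (\<Union>r\<in>S. V r)"
  by (rule compactE_image[OF K(1), of K V]) (use V in auto)
 let ?B = "(%r. \<pi> (- r) x) ` S"
 have B: "finite ?B" "?B \<subseteq> car" using S x by (auto simp: rep_closed)
 obtain F where F: "finite F" "F \<subseteq> car" "!!e f. e : F ==> f : F ==> inn e f = (if e = f then 1 else 0)"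
  and ex: "!!b z. b : ?B ==> z : car ==> inn b z = (SUM e:F. inn b e * inn e z)"
  using finite_orthonormal[OF B] by metis
 define X where "X z e t = inn (\<pi> (- t) z) e" for z e t
 have Xc: "cont (X z e)" if "z : car" "e : F" for z e
  using continuous_on_compose2[OF continuous_coefficient[OF that(1), of e] cu] that F(2)
  by (auto simp: X_def[abs_def] coefficient_def)
 have Xsq1: "(SUM e:F. (cmod (X z e t))^2) <= 1" if z: "z : {x, y}" for z t
 proof -
  have zc: "\<pi> (- t) z : car" "hn (\<pi> (- t) z) = hn z" "(hn z)^2 <= 1"
   using z x y hnorm_nonneg by (auto simp: rep_closed rep_norm power_le_one)
  obtain r where "(hn r)^2 + (SUM e:F. (cmod (X z e t))^2) = (hn (\<pi> (- t) z))^2"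
   using orthonormal_residual[OF F zc(1)] unfolding X_def by blast
  thus ?thesis using zc(3) zero_le_power2[of "hn r"] unfolding zc(2) by linarith
 qed
 \<comment> \<open>The functions \<open>G z k e\<close> are the coordinates of Fell's intertwiner,
   which sends \<open>z\<close> and \<open>k\<close> to the vector valued function
   \<open>t \<mapsto> k(t) \<pi>(-t) z\<close>. By Bessel their squared norms add up to at most that
   of \<open>k\<close>.\<close>
 define G where "G z k e t = X z e t * k t" for z e t and k :: "'g fn"
 have Gs: "sq_int (G z k e)" if "z : {x, y}" "e : F" "Cc k" for z k e
  unfolding G_def[abs_def] by (rule Cc_sq_int[OF Cc_mult_right[OF that(3) Xc]]) (use that x y in auto)
 have Gnm: "(SUM e:F. (nm (G z k e))^2) <= (nm k)^2" if "z : {x, y}" "Cc k" for z k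
 proof -
  have ii: "intg (%t. (cmod (G z k e t))^2)" if "e : F" for e
   using Gs[OF \<open>z : {x, y}\<close> that \<open>Cc k\<close>] by (simp add: sq_int_def)
  have "(SUM e:F. (nm (G z k e))^2) = (LI t. (SUM e:F. (cmod (G z k e t))^2))"
   using ii by (simp add: nm_def Bochner_Integration.integral_sum)
  also have "... <= (LI t. (cmod (k t))^2)"
  proof (rule integral_mono)
   show "intg (%t. SUM e:F. (cmod (G z k e t))^2)" using ii by auto
   show "intg (%t. (cmod (k t))^2)" using Cc_sq_int[OF that(2)] by (simp add: sq_int_def)
   fix t
   have "(SUM e:F. (cmod (G z k e t))^2) = (SUM e:F. (cmod (X z e t))^2) * (cmod (k t))^2"
    by (simp add: G_def norm_mult power_mult_distrib sum_distrib_right)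
   also have "... <= 1 * (cmod (k t))^2" by (rule mult_right_mono[OF Xsq1[OF that(1)]]) simp
   finally show "(SUM e:F. (cmod (G z k e t))^2) <= (cmod (k t))^2" by simp
  qed
  finally show ?thesis by (simp add: nm_def)
 qed
 let ?L = "%s. SUM e:F. lamc (G x g e) (G y g' e) s"
 have pt: "cmod (?u s * (g (- s + t) * cnj (g' t)) - (SUM e:F. G x g e (- s + t) * cnj (G y g' e t)))
   <= e * (cmod (g (- s + t)) * cmod (g' t))" for s t
 proof (cases "- s + t : K")
  case True
  define q where "q = - s + t"
  let ?v = "\<pi> (- q) x" and ?z = "\<pi> (- t) y"
  obtain a where a: "a : S" "q : V a" using True S(3) unfolding q_def by blast
  let ?b = "\<pi> (- a) x"
  have st: "s = t + - q" by (simp add: q_def minus_add add.assoc)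
  have us: "?u s = inn ?v ?z"
   unfolding coefficient_def st rep_mult[OF x(1)] by (rule rep_adjoint[OF rep_closed[OF x(1)] y(1)])
  have cl: "?v : car" "?z : car" "?b : car" "dif ?v ?b : car" using x y by (auto simp: inner_simps rep_closed)
  \<comment> \<open>\<open>\<pi>(-a) x\<close> lies in the span of \<open>F\<close> up to null
    vectors, so the part of \<open>\<pi>(-q) x\<close> orthogonal to \<open>F\<close> is that of the
    difference, whose norm is below \<open>e\<close>.\<close>
  obtain r where r: "r : car" "!!z. z : car ==> inn r z = inn (dif ?v ?b) z - (SUM e:F. inn (dif ?v ?b) e * inn e z)"
   "(hn r)^2 + (SUM e:F. (cmod (inn (dif ?v ?b) e))^2) = (hn (dif ?v ?b))^2"
   using orthonormal_residual[OF F cl(4)] by blast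
  have d: "inn (dif ?v ?b) z = inn ?v z - inn ?b z" if "z : car" for z using cl that by (simp add: inner_simps)
  have X: "inn ?v e * inn e ?z = X x e q * cnj (X y e t)" if "e : F" for e
   using inner_cnj[OF cl(2), of e] that F(2) by (auto simp: X_def)
  have "inn r ?z = inn ?v ?z - (SUM e:F. inn ?v e * inn e ?z)"
   using r(2)[OF cl(2)] ex[OF imageI[OF a(1)] cl(2)] F(2) d[OF cl(2)]
   by (simp add: d subsetD left_diff_distrib sum_subtractf cong: sum.cong)
  hence R: "inn r ?z = ?u s - (SUM e:F. X x e q * cnj (X y e t))" using X us by simp
  have "(hn r)^2 <= (hn (dif ?v ?b))^2" using r(3) sum_nonneg[of F "%e. (cmod (inn (dif ?v ?b) e))^2"] by simp
  hence "hn r <= e" using power2_le_imp_le[OF _ hnorm_nonneg[OF cl(4)]] V(3)[OF a(2)] by fastforce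
  moreover have "hn ?z <= 1" using y by (simp add: rep_norm)
  ultimately have "hn r * hn ?z <= e * 1" by (intro mult_mono) (use e hnorm_nonneg[OF cl(2)] in auto)
  hence n: "cmod (?u s - (SUM e:F. X x e q * cnj (X y e t))) <= e"
   using Cauchy_Schwarz[OF r(1) cl(2)] unfolding R by linarith
  have "?u s * (g q * cnj (g' t)) - (SUM e:F. G x g e q * cnj (G y g' e t)) =
    (?u s - (SUM e:F. X x e q * cnj (X y e t))) * (g q * cnj (g' t))"
   by (simp add: G_def left_diff_distrib right_diff_distrib sum_distrib_left sum_distrib_right mult_ac)
  thus ?thesis using mult_right_mono[OF n norm_ge_zero[of "g q * cnj (g' t)"]] by (simp add: norm_mult q_def)
 next
  case False
  thus ?thesis using K(2) by (simp add: G_def)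
 qed
 have Lc: "lamc (G x g e) (G y g' e) : BG" if "e : F" for e
  by (rule lamc_in_BG) (use Gs that g g' in auto)
 have dif: "cmod (?u s * lamc g g' s - ?L s) <= e * (nm g * nm g')" for s
 proof -
  have i1: "intg (%t. g (- s + t) * cnj (g' t))"
   using sq_int_mult_integrable[OF sq_int_translate[OF Cc_sq_int[OF g]] Cc_sq_int[OF g']] .
  have i2: "intg (%t. G x g e (- s + t) * cnj (G y g' e t))" if "e : F" for e
   using sq_int_mult_integrable[OF sq_int_translate[OF Gs[of x e g]] Gs[of y e g']] that g g' by simp
  have "?u s * lamc g g' s - ?L s = (LI t. ?u s * (g (- s + t) * cnj (g' t)) - (SUM e:F. G x g e (- s + t) * cnj (G y g' e t)))"
   unfolding lamc_eq using i1 i2 by (simp add: Bochner_Integration.integral_sum)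
  also have "cmod ... <= (LI t. cmod (?u s * (g (- s + t) * cnj (g' t)) - (SUM e:F. G x g e (- s + t) * cnj (G y g' e t))))"
   by (rule integral_norm_bound)
  also have "... <= (LI t. e * (cmod (g (- s + t)) * cmod (g' t)))"
   by (rule integral_mono[OF _ _ pt])
    (use i1 i2 lamc_abs_integral_le(1)[OF Cc_sq_int[OF g] Cc_sq_int[OF g'], of s] in auto)
  also have "... <= e * (nm g * nm g')"
   using lamc_abs_integral_le(2)[OF Cc_sq_int[OF g] Cc_sq_int[OF g'], of s] e by simp
  finally show ?thesis .
 qed
 have uF: "?u : BG"
  using coefficient_in_coef_ball[OF x(1) y(1) x(2) y(2)] by (rule coef_ball_in_BG)
 have uL: "(%s. ?u s * lamc g g' s) : BG"
  by (rule BG_mult[OF uF lamc_in_BG[OF Cc_sq_int[OF g] Cc_sq_int[OF g']]])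
 have LF: "?L : BG"
  using F(1) Lc by (induction F) (auto intro: BG_add const_in_BG)
 have "(LI s. f s * ?L s) = (SUM e:F. LI s. f s * lamc (G x g e) (G y g' e) s)"
  unfolding sum_distrib_left using integrable_mult_BG[OF f Lc] by (rule Bochner_Integration.integral_sum)
 also have "cmod ... <= (SUM e:F. c * nm (G x g e) * nm (G y g' e))"
  by (rule sum_norm_le, rule lam_bddD[OF c(2)]) (use Gs g g' in auto)
 also have "... = c * (SUM e:F. nm (G x g e) * nm (G y g' e))" by (simp add: sum_distrib_left mult.assoc)
 also have "... <= c * (nm g * nm g')"
  using c(1) by (intro mult_left_mono sum_nm_mult_le Gnm) (auto simp: g g')
 finally have 1: "cmod (LI s. f s * ?L s) <= c * nm g * nm g'" by (simp add: mult.assoc)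
 have "cmod (LI s. f s * (?u s * lamc g g' s - ?L s)) <= e * (nm g * nm g') * (LI s. cmod (f s))"
  by (rule cmod_integral_mult_le[OF f _ dif])
   (intro continuous_intros BG_continuous[OF uL] BG_continuous[OF LF])
 moreover have "(LI s. f s * (?u s * lamc g g' s - ?L s)) = (LI s. f s * (?u s * lamc g g' s)) - (LI s. f s * ?L s)"
  using integrable_mult_BG[OF f uL] integrable_mult_BG[OF f LF]
  by (simp add: right_diff_distrib)
 ultimately show ?thesis
  using 1 norm_triangle_ineq2[of "LI s. f s * (?u s * lamc g g' s)" "LI s. f s * ?L s"]
  by (simp add: mult.assoc)
qed

text \<open>The error in \<open>Fell_Cc\<close> vanishes with \<open>e\<close>, without loss in the
  constant \<open>c\<close>. General vectors follow by uniform approximation of the coefficient of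
  \<lambda>.\<close>

lemma Fell_absorption:
 assumes u: "u : coef_ball" and f: "intg f" and c: "c > 0" "lam_bdd f c"
 shows "lam_bdd (%s. f s * u s) c"
 unfolding lam_bdd_def
proof (intro allI impI)
 fix g g' assume gg: "sq_int g" "sq_int g'"
 obtain H :: "'g fn hspace" and \<pi> x y where r: "unitary_rep H \<pi>" "x : hcarrier H" "y : hcarrier H"
  "hnorm H x <= 1" "hnorm H y <= 1" "u = coefficient H \<pi> x y" using coef_ball_coefficient[OF u] .
 define A where "A = (LI s. cmod (f s))"
 have Cc: "cmod (LI s. f s * u s * lamc k k' s) <= c * nm k * nm k'" if k: "Cc k" "Cc k'" for k k'
 proof (rule le_if_le_add_mult[where C = "nm k * nm k' * A"])
  fix e :: real assume e: "e > 0"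
  show "cmod (LI s. f s * u s * lamc k k' s) <= c * nm k * nm k' + nm k * nm k' * A * e"
   using Fell_Cc[OF r(1,2,4,3,5) f c k e] unfolding r(6) A_def by (simp add: mult_ac)
 qed
 obtain k k' where k: "!!n::nat. Cc (k n)" "!!n::nat. Cc (k' n)"
  and kl: "(%n. nm (k n)) \<longlonglongrightarrow> nm g" "(%n. nm (k' n)) \<longlonglongrightarrow> nm g'"
  and "EX d. d \<longlonglongrightarrow> 0 & (ALL n s. cmod (lamc g g' s - lamc (k n) (k' n) s) <= d n)"
  by (rule lamc_uniform_limit[OF gg]) blast
 then obtain d where d: "d \<longlonglongrightarrow> 0" "!!n s. cmod (lamc g g' s - lamc (k n) (k' n) s) <= d n" by blast
 have fu: "intg (%s. f s * u s)"
  by (rule integrable_mult_BG[OF f coef_ball_in_BG[OF u]])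
 note l = lamc_in_BG[OF gg] lamc_in_BG[OF Cc_sq_int[OF k(1)] Cc_sq_int[OF k(2)]]
 have "norm ((LI s. f s * u s * lamc (k n) (k' n) s) - (LI s. f s * u s * lamc g g' s)) <= d n * (LI s. cmod (f s * u s))" for n
 proof -
  have "cmod (LI s. f s * u s * (lamc g g' s - lamc (k n) (k' n) s)) <= d n * (LI s. cmod (f s * u s))"
   by (rule cmod_integral_mult_le[OF fu _ d(2)]) (intro continuous_intros BG_continuous l)
  thus ?thesis using integrable_mult_BG[OF fu l(1)] integrable_mult_BG[OF fu l(2)]
   by (simp add: right_diff_distrib norm_minus_commute)
 qed
 from tendsto_if_norm_le[OF tendsto_mult_left_zero[OF d(1)] this]
 have "(%n. (LI s. f s * u s * lamc (k n) (k' n) s)) \<longlonglongrightarrow> (LI s. f s * u s * lamc g g' s)" .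
 from tendsto_norm[OF this] show "cmod (LI s. f s * u s * lamc g g' s) <= c * nm g * nm g'"
 proof (rule LIMSEQ_le)
  show "(%n. c * nm (k n) * nm (k' n)) \<longlonglongrightarrow> c * nm g * nm g'" by (intro tendsto_intros kl)
 qed (use Cc[OF k] in auto)
qed

text \<open>The kernel of \<lambda> is stable under multiplication by B(G): by Fell,
  \<open>\<lambda>(f u)\<close> is bounded by \<open>\<lambda>(f)\<close> up to the factor
  \<open>K\<close>, so \<open>pairing_zero_if_lam_bdd\<close> applies to \<open>u\<close> times a
  coefficient of \<lambda>.\<close>

lemma Br_ideal:
 assumes u: "u : BG" and w: "w : Br"
 shows "(%s. u s * w s) : Br"
proof (rule BrI)
 have wF: "w : BG" using w Br_subset by auto
 show "(%s. u s * w s) : BG" by (rule BG_mult[OF u wF])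
 fix phi assume phi: "kills_lambda phi"
 note F = kills_lambdaD[OF phi]
 obtain K v where K: "K > 0" "v : coef_ball" "u = (%s. of_real K * v s)" using BGE[OF u] .
 have "kills_lambda (%n s. phi n s * u s)"
  unfolding kills_lambda_def
 proof (intro conjI allI impI full_cstar_mult(1)[OF F u])
  fix g g' assume gg: "sq_int g" "sq_int g'"
  note l = lamc_in_BG[OF gg]
  have "pair phi (%s. u s * lamc g g' s) = 0"
  proof (rule pairing_zero_if_lam_bdd[OF phi BG_mult[OF u l]])
   show "0 <= K * nm g * nm g'" using K by simp
   fix f c assume f: "intg f" and c: "c > 0" "lam_bdd f c"
   have "(LI s. f s * (u s * lamc g g' s)) = of_real K * (LI s. f s * v s * lamc g g' s)"
    unfolding K(3) integral_mult_right_zero[symmetric] by (simp only: mult_ac)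
   hence "cmod (LI s. f s * (u s * lamc g g' s)) = K * cmod (LI s. f s * v s * lamc g g' s)"
    using K(1) by (simp add: norm_mult)
   also have "... <= K * (c * nm g * nm g')"
    using lam_bddD[OF Fell_absorption[OF K(2) f c] gg] K(1) by (intro mult_left_mono) auto
   finally show "cmod (LI s. f s * (u s * lamc g g' s)) <= c * (K * nm g * nm g')" by (simp add: mult_ac)
  qed
  thus "pair (%n s. phi n s * u s) (lamc g g') = 0" using full_cstar_mult(2)[OF F u l] by simp
 qed
 from Br_pairing[OF w this] show "pair phi (%s. u s * w s) = 0" using full_cstar_mult(2)[OF F u wF] by simp
qed

lemma Br_mult: "u : Br ==> w : Br ==> (%s. u s * w s) : Br"
 using Br_ideal Br_subset by blast

lemma Br_eq_BG:
 assumes one: "(%_. 1) : Br"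
 shows "Br = BG"
 using Br_ideal[OF _ one] Br_subset by auto

text \<open>Hulanicki's condition: the trivial representation is bounded by the norm of
  \<open>\<lambda>(f)\<close>.\<close>

lemma one_in_Br:
 assumes "!!f c. intg f ==> c > 0 ==> lam_bdd f c ==> cmod (LI s. f s) <= c"
 shows "(%_. 1) : Br"
proof (rule BrI[OF const_in_BG])
 fix phi assume phi: "kills_lambda phi"
 show "pair phi (%_. 1) = 0"
  by (rule pairing_zero_if_lam_bdd[OF phi const_in_BG, where C = 1]) (use assms in auto)
qed

end

section \<open>Functional calculus for a self-adjoint contraction\<close>

context semi_inner
begin

lemma positive_form_Cauchy_Schwarz:
 assumes A: "!!x. x : car ==> A x : car"
  and sym: "!!x y. x : car ==> y : car ==> inn (A x) y = inn x (A y)"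
  and pos: "!!x. x : car ==> 0 <= Re (inn (A x) x)"
  and xy: "x : car" "y : car"
 shows "(cmod (inn (A x) y))^2 <= Re (inn (A x) x) * Re (inn (A y) y)"
proof -
 let ?H = "H\<lparr>hinner := %x y. inn (A x) y\<rparr>"
 interpret A: semi_inner ?H
 proof
  fix x y assume xy: "x : hcarrier ?H" "y : hcarrier ?H"
  thus "hinner ?H y x = cnj (hinner ?H x y)" using sym inner_cnj[of x "A y"] A by simp
  show "hinner ?H (hscale ?H a x) y = a * hinner ?H x y" for a
   using xy A by (simp add: sym scale_closed inner_scale)
  fix z assume "z : hcarrier ?H"
  thus "hinner ?H (hadd ?H x y) z = hinner ?H x z + hinner ?H y z"
   using xy A by (simp add: sym add_closed inner_add)
 qed (use add_closed scale_closed pos in auto)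
 from A.Cauchy_Schwarz[of x y] xy
 have "(cmod (inn (A x) y))^2 <= (hnorm ?H x * hnorm ?H y)^2" by (intro power_mono) auto
 also have "... = (hnorm ?H x)^2 * (hnorm ?H y)^2" by (rule power_mult_distrib)
 also have "... = Re (inn (A x) x) * Re (inn (A y) y)" using xy pos by (simp add: hnorm_def)
 finally show ?thesis .
qed

lemma hnorm_le_if_inner_le:
 assumes v: "v : car" and K: "K >= 0" and b: "cmod (inn v v) <= K * hn v"
 shows "hn v <= K"
proof (cases "hn v = 0")
 case False
 have "hn v * hn v <= K * hn v" using b by (simp add: inner_self[OF v] norm_power power2_eq_square norm_mult)
 with False hnorm_nonneg[OF v] show ?thesis by simp
qed (use K in simp)

end

text \<open>
 The approximants \<open>Q\<^sub>n\<close> of \<open>1 - \<surd>(1 - Z)\<close> with \<open>Z = 1 - W\<^sup>2\<close> are polynomials with nonnegative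
 coefficients in \<open>Z\<close>, so that \<open>P\<^sub>n = 1 - Q\<^sub>n + W\<close> converges in norm to \<open>\<bar>W\<bar> + W\<close>, uniformly over all
 self-adjoint contractions \<open>W\<close>.
\<close>

definition wop :: "'h hspace => ('h => 'h) => real => 'h => 'h" where
 "wop H T c x = hscale H (1/2) (hadd H (T x) (hscale H (of_real (- c)) x))"

definition zop :: "'h hspace => ('h => 'h) => real => 'h => 'h" where
 "zop H T c x = hdiff H x (wop H T c (wop H T c x))"

primrec qop :: "'h hspace => ('h => 'h) => real => nat => 'h => 'h" where
 "qop H T c 0 x = hscale H 0 x"
| "qop H T c (Suc n) x = hscale H (1/2) (hadd H (zop H T c x) (qop H T c n (qop H T c n x)))"

definition pop :: "'h hspace => ('h => 'h) => real => nat => 'h => 'h" where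
 "pop H T c n x = hadd H (hdiff H x (qop H T c n x)) (wop H T c x)"

text \<open>The recursion of \<open>qop\<close> at the scalar value \<open>Z = 1\<close>.
  Polynomials with nonnegative coefficients in a positive contraction are bounded by their value
  there, so \<open>tq\<close> majorises \<open>Q n\<close> and its increments.\<close>

primrec tq :: "nat => real" where
 "tq 0 = 0"
| "tq (Suc n) = (1 + (tq n)^2) / 2"

lemma tq_bounds: "0 <= tq n" "tq n <= 1"
proof -
 have "0 <= tq n & tq n <= 1" by (induction n) (auto simp: power_le_one)
 thus "0 <= tq n" "tq n <= 1" by auto
qed

lemma tq_mono_Suc: "tq n <= tq (Suc n)"
 using sum_squares_bound[of "tq n" 1] by simp

lemma tq_convergent: "convergent tq"
 using Bseq_mono_convergent[of tq] BseqI'[of tq 1] tq_bounds incseq_SucI[of tq] tq_mono_Suc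
 by (auto simp: incseq_def simp del: tq.simps)

lemma small_tq: "small (%m n. \<bar>tq m - tq n\<bar>)"
 using convergent_Cauchy[OF tq_convergent] by (simp add: small_def Cauchy_def dist_real_def)

lemma tq_diff_tendsto: "(%n. tq (Suc n) - tq n) \<longlonglongrightarrow> 0"
 using tq_convergent LIMSEQ_Suc tendsto_diff unfolding convergent_def by fastforce

text \<open>\<open>W = (T - c) / 2\<close> is nonpositive where the form of \<open>T\<close> stays
  below \<open>c\<close>, and then \<open>P n\<close> tends to 0 by \<open>P_norm_le\<close>. In any
  other space \<open>P_lower\<close> keeps the form of \<open>P n\<close> above that of
  \<open>W\<close>. The same polynomial, evaluated in the regular and in the trivial representation,
  can thus tell them apart.\<close>

locale self_adjoint_contraction = semi_inner H for H :: "'h hspace" +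
 fixes T :: "'h => 'h" and c :: real
 assumes T_closed: "x : car ==> T x : car"
  and T_sym: "x : car ==> y : car ==> inn (T x) y = inn x (T y)"
  and T_le: "x : car ==> y : car ==> cmod (inn (T x) y) <= hn x * hn y"
  and c: "0 <= c" "c <= 1"
begin

abbreviation "W \<equiv> wop H T c"
abbreviation "Z \<equiv> zop H T c"
abbreviation "Q \<equiv> qop H T c"
abbreviation "P \<equiv> pop H T c"

lemma W_closed: "x : car ==> W x : car"
 by (simp add: wop_def add_closed scale_closed T_closed)

lemma Z_closed: "x : car ==> Z x : car"
 by (simp add: zop_def add_closed scale_closed W_closed)

lemma Q_closed: "x : car ==> Q n x : car"
 by (induction n arbitrary: x) (auto simp: add_closed scale_closed Z_closed)

lemma P_closed: "x : car ==> P n x : car"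
 by (simp add: pop_def add_closed scale_closed W_closed Q_closed)

lemma W_inner:
 assumes "x : car" "y : car"
 shows "inn (W x) y = (inn (T x) y - c * inn x y) / 2"
  and "inn x (W y) = (inn x (T y) - c * inn x y) / 2"
 using assms by (simp_all add: wop_def inner_simps T_closed)

lemma W_sym: "x : car ==> y : car ==> inn (W x) y = inn x (W y)"
 by (simp add: W_inner T_sym)

lemma W_le:
 assumes x: "x : car" and y: "y : car"
 shows "cmod (inn (W x) y) <= hn x * hn y"
proof -
 have "cmod (inn (T x) y - c * inn x y) <= cmod (inn (T x) y) + cmod (c * inn x y)"
  by (rule norm_triangle_ineq4)
 also have "cmod (c * inn x y) = c * cmod (inn x y)" using c(1) by (simp add: norm_mult)
 also have "... <= 1 * (hn x * hn y)"
  using c Cauchy_Schwarz[OF x y] by (intro mult_mono) auto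
 finally show ?thesis using T_le[OF x y] by (simp add: W_inner[OF x y] norm_divide)
qed

lemma W_norm: "x : car ==> hn (W x) <= hn x"
 using W_le[of x "W x"] by (intro hnorm_le_if_inner_le) (auto simp: W_closed hnorm_nonneg)

lemma Z_inner:
 assumes "x : car" "y : car"
 shows "inn (Z x) y = inn x y - inn (W x) (W y)"
  and "inn x (Z y) = inn x y - inn (W x) (W y)"
 using assms W_sym[of "W x" y] W_sym[of x "W y"] by (simp_all add: zop_def inner_simps W_closed)

lemma Z_sym: "x : car ==> y : car ==> inn (Z x) y = inn x (Z y)"
 by (simp add: Z_inner)

lemma Z_nonneg:
 assumes x: "x : car"
 shows "0 <= Re (inn (Z x) x)" "Re (inn (Z x) x) <= (hn x)^2"
 using W_norm[OF x] x by (simp_all add: Z_inner Re_inner_self W_closed hnorm_nonneg power_mono)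

lemma Z_le:
 assumes x: "x : car" and y: "y : car"
 shows "cmod (inn (Z x) y) <= hn x * hn y"
proof (rule power2_le_imp_le)
 have "(cmod (inn (Z x) y))^2 <= Re (inn (Z x) x) * Re (inn (Z y) y)"
  by (rule positive_form_Cauchy_Schwarz[OF Z_closed Z_sym Z_nonneg(1) x y])
 also have "... <= (hn x)^2 * (hn y)^2"
  using Z_nonneg[OF x] Z_nonneg[OF y] by (intro mult_mono) auto
 finally show "(cmod (inn (Z x) y))^2 <= (hn x * hn y)^2" by (simp add: power_mult_distrib)
qed (use hnorm_nonneg[OF x] hnorm_nonneg[OF y] in simp)

lemma Q_sym:
 assumes "x : car" "y : car"
 shows "inn (Q n x) y = inn x (Q n y)"
 using assms
proof (induction n arbitrary: x y)
 case (Suc n)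
 thus ?case by (simp add: inner_simps Z_closed Q_closed Z_inner)
qed (simp add: inner_simps)

lemma Q_Suc_inner:
 assumes "x : car" "y : car"
 shows "inn (Q (Suc n) x) y = (inn (Z x) y + inn (Q n x) (Q n y)) / 2"
 using assms Q_sym[of "Q n x" y n] by (simp add: inner_simps Z_closed Q_closed)

lemma Q_W_commute:
 assumes "x : car" "y : car"
 shows "inn (Q n x) (W y) = inn (W x) (Q n y)"
 using assms
proof (induction n arbitrary: x y)
 case (Suc n)
 have "inn (Q (Suc n) x) (W y) = (inn (Z x) (W y) + inn (Q n x) (Q n (W y))) / 2"
  using Suc.prems by (simp add: Q_Suc_inner W_closed del: qop.simps)
 also have "inn (Q n x) (Q n (W y)) = inn (Q n (Q n x)) (W y)"
  using Suc.prems by (simp add: Q_sym W_closed Q_closed)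
 also have "... = inn (W (Q n x)) (Q n y)" using Suc.IH[of "Q n x" y] Suc.prems by (simp add: Q_closed)
 also have "... = inn (Q n x) (W (Q n y))" using Suc.prems by (simp add: W_sym Q_closed)
 also have "... = inn (W x) (Q n (Q n y))" using Suc.IH[of x "Q n y"] Suc.prems by (simp add: Q_closed)
 also have "... = inn (Q n (W x)) (Q n y)" using Suc.prems by (simp add: Q_sym W_closed Q_closed)
 also have "inn (Z x) (W y) = inn (Z (W x)) y"
  using Suc.prems W_sym[of "W x" "W y"] by (simp add: Z_inner W_closed W_sym)
 also have "(inn (Z (W x)) y + inn (Q n (W x)) (Q n y)) / 2 = inn (W x) (Q (Suc n) y)"
  using Suc.prems by (simp only: Q_Suc_inner[symmetric] Q_sym W_closed)
 finally show ?case .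
qed (simp add: inner_simps W_closed)

lemma Q_le: "x : car ==> y : car ==> cmod (inn (Q n x) y) <= tq n * hn x * hn y"
 and Q_norm: "x : car ==> hn (Q n x) <= tq n * hn x"
proof -
 have n: "hn (Q n x) <= tq n * hn x"
  if x: "x : car" and le: "!!x y. x : car ==> y : car ==> cmod (inn (Q n x) y) <= tq n * hn x * hn y"
  for n x
  using le[OF x Q_closed[OF x]] by (intro hnorm_le_if_inner_le) (auto simp: Q_closed x hnorm_nonneg tq_bounds)
 have le: "cmod (inn (Q n x) y) <= tq n * hn x * hn y" if "x : car" "y : car" for x y n
  using that
 proof (induction n arbitrary: x y)
  case (Suc n)
  note xy = Suc.prems
  have "cmod (inn (Q n x) (Q n y)) <= hn (Q n x) * hn (Q n y)"
   using xy by (intro Cauchy_Schwarz Q_closed)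
  also have "... <= (tq n * hn x) * (tq n * hn y)"
   using xy by (intro mult_mono n Suc.IH) (auto simp: hnorm_nonneg Q_closed tq_bounds)
  finally have "cmod (inn (Z x) y + inn (Q n x) (Q n y)) <= hn x * hn y + (tq n)^2 * (hn x * hn y)"
   using Z_le[OF xy] norm_triangle_ineq[of "inn (Z x) y" "inn (Q n x) (Q n y)"]
   by (simp add: power2_eq_square mult_ac)
  thus ?case unfolding Q_Suc_inner[OF xy] tq.simps by (simp add: norm_divide field_simps)
 qed (simp add: inner_simps)
 show "x : car ==> y : car ==> cmod (inn (Q n x) y) <= tq n * hn x * hn y" by (rule le)
 show "x : car ==> hn (Q n x) <= tq n * hn x" by (rule n[OF _ le])
qed

text \<open>The increment of the squares is split as \<open>(Q' - Q) Q'\<close> plus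
  \<open>Q (Q' - Q)\<close>, and the bounds \<open>d tq (Suc n)\<close> and \<open>d tq n\<close>
  add up to the increment of \<open>(tq n)^2\<close>, that is to twice the next increment of
  \<open>tq\<close>.\<close>

lemma Q_step:
 assumes "x : car" "y : car"
 shows "cmod (inn (Q (Suc n) x) y - inn (Q n x) y) <= (tq (Suc n) - tq n) * hn x * hn y"
 using assms
proof (induction n arbitrary: x y)
 case 0
 thus ?case using Q_le[of x y 1] by (simp add: inner_simps Z_closed)
next
 case (Suc n)
 note xy = Suc.prems
 let ?d = "tq (Suc n) - tq n"
 have d: "?d >= 0" using tq_mono_Suc[of n] by (simp del: tq.simps)
 have 1: "cmod (inn (Q (Suc n) x) (Q (Suc n) y) - inn (Q n x) (Q (Suc n) y)) <= ?d * hn x * (tq (Suc n) * hn y)"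
  by (rule order_trans[OF Suc.IH[OF xy(1) Q_closed[OF xy(2)]]], rule mult_left_mono[OF Q_norm[OF xy(2)]])
   (use d hnorm_nonneg xy in auto)
 have "inn (Q n x) (Q m y) = cnj (inn (Q m y) (Q n x))" for m
  using xy by (intro inner_cnj Q_closed)
 hence 2: "cmod (inn (Q n x) (Q (Suc n) y) - inn (Q n x) (Q n y)) =
   cmod (inn (Q (Suc n) y) (Q n x) - inn (Q n y) (Q n x))"
  by (simp only: complex_cnj_diff[symmetric] complex_mod_cnj)
 also have "... <= ?d * hn y * (tq n * hn x)"
  by (rule order_trans[OF Suc.IH[OF xy(2) Q_closed[OF xy(1)]]], rule mult_left_mono[OF Q_norm[OF xy(1)]])
   (use d hnorm_nonneg xy in auto)
 finally have "cmod (inn (Q (Suc n) x) (Q (Suc n) y) - inn (Q n x) (Q n y)) <=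
   ?d * (tq (Suc n) + tq n) * (hn x * hn y)"
  using 1 norm_triangle_ineq[of "inn (Q (Suc n) x) (Q (Suc n) y) - inn (Q n x) (Q (Suc n) y)"
    "inn (Q n x) (Q (Suc n) y) - inn (Q n x) (Q n y)"]
  by (simp add: distrib_left distrib_right mult_ac del: tq.simps qop.simps)
 also have "?d * (tq (Suc n) + tq n) = 2 * (tq (Suc (Suc n)) - tq (Suc n))"
  by (simp add: tq.simps(2)[of "Suc n"] tq.simps(2)[of n] power2_eq_square field_simps)
 finally have "cmod ((inn (Q (Suc n) x) (Q (Suc n) y) - inn (Q n x) (Q n y)) / 2) <=
   (tq (Suc (Suc n)) - tq (Suc n)) * hn x * hn y"
  by (simp add: norm_divide mult_ac del: tq.simps qop.simps)
 thus ?case unfolding Q_Suc_inner[OF xy, of "Suc n"] unfolding Q_Suc_inner[OF xy, of n]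
  by (simp add: diff_divide_distrib[symmetric] del: tq.simps qop.simps)
qed

lemma P_inner:
 assumes "x : car" "y : car"
 shows "inn (P n x) y = inn x y - inn (Q n x) y + inn (W x) y"
 using assms by (simp add: pop_def inner_simps Q_closed W_closed)

lemma P_step:
 assumes xy: "x : car" "y : car" and mn: "m <= n"
 shows "cmod (inn (P n x) y - inn (P m x) y) <= (tq n - tq m) * hn x * hn y"
 using mn
proof (induction n rule: dec_induct)
 case (step n)
 have "inn (P (Suc n) x) y - inn (P m x) y =
   (inn (P n x) y - inn (P m x) y) - (inn (Q (Suc n) x) y - inn (Q n x) y)"
  by (simp add: P_inner xy del: qop.simps)
 also have "cmod ... <= (tq n - tq m) * hn x * hn y + (tq (Suc n) - tq n) * hn x * hn y"
  by (rule order_trans[OF norm_triangle_ineq4 add_mono[OF step.IH Q_step[OF xy]]])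
 finally show ?case by (simp add: left_diff_distrib del: tq.simps)
qed simp

lemma P_step_abs:
 assumes xy: "x : car" "y : car"
 shows "cmod (inn (P m x) y - inn (P n x) y) <= \<bar>tq m - tq n\<bar> * (hn x * hn y)"
proof -
 have le: "cmod (inn (P k x) y - inn (P l x) y) <= \<bar>tq k - tq l\<bar> * (hn x * hn y)" if "l <= k" for k l
  using P_step[OF xy that] mult_right_mono[OF abs_ge_self[of "tq k - tq l"], of "hn x * hn y"] hnorm_nonneg xy
  by (simp add: mult.assoc)
 show ?thesis using le[of n m] le[of m n] by (cases "n <= m") (simp_all add: norm_minus_commute abs_minus_commute)
qed

lemma P_lower:
 assumes x: "x : car"
 shows "Re (inn (W x) x) <= Re (inn (P n x) x)"
proof -
 have "Re (inn (Q n x) x) <= tq n * hn x * hn x"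
  by (rule order_trans[OF complex_Re_le_cmod Q_le[OF x x]])
 also have "... <= 1 * hn x * hn x"
  by (intro mult_right_mono tq_bounds hnorm_nonneg x)
 finally show ?thesis using x by (simp add: P_inner Re_inner_self power2_eq_square)
qed

text \<open>Here \<open>P n = S - V\<close> with \<open>S = 1 - Q n\<close> and
  \<open>V = - W\<close> both nonnegative. For \<open>y = P n x\<close> the form of
  \<open>S + V\<close> at \<open>y\<close> is a small quantity, so each of the two forms is small at
  \<open>y\<close>, and Cauchy-Schwarz for them bounds \<open>\<parallel>y\<parallel>^2\<close>, the
  difference of the two products with \<open>x\<close>. Two square roots account for the fourth
  powers.\<close>

lemma P_norm_le:
 assumes x: "x : car" and neg: "!!x. x : car ==> Re (inn (T x) x) <= c * (hn x)^2"
 shows "(hn (P n x)) ^ 4 <= 48 * (hn x) ^ 4 * (tq (Suc n) - tq n)"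
proof -
 let ?S = "%x. dif x (Q n x)" and ?V = "%x. hscale H (- 1) (W x)"
 define y where "y = P n x"
 have y: "y : car" unfolding y_def by (rule P_closed[OF x])
 have Sc: "?S z : car" if "z : car" for z using that by (simp add: add_closed scale_closed Q_closed)
 have Vc: "?V z : car" if "z : car" for z using that by (simp add: scale_closed W_closed)
 have Si: "inn (?S a) b = inn a b - inn (Q n a) b" "inn a (?S b) = inn a b - inn a (Q n b)"
  if "a : car" "b : car" for a b
  using that by (simp_all add: inner_simps Q_closed)
 have Ssym: "inn (?S a) b = inn a (?S b)" if "a : car" "b : car" for a b
  using that by (simp add: Si Q_sym)
 have Vi: "inn (?V a) b = - inn (W a) b" "inn a (?V b) = - inn a (W b)"
  if "a : car" "b : car" for a b
  using that by (simp_all add: inner_simps W_closed)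
 have Qle: "cmod (inn (Q n z) z) <= (hn z)^2" if z: "z : car" for z
  using Q_le[OF z z, of n] mult_right_mono[OF tq_bounds(2), of "hn z * hn z" n]
  by (simp add: power2_eq_square mult_ac)
 have Vsym: "inn (?V a) b = inn a (?V b)" if "a : car" "b : car" for a b
  using that by (simp add: Vi W_sym)
 have Sn: "0 <= Re (inn (?S z) z)" "Re (inn (?S z) z) <= 2 * (hn z)^2" if z: "z : car" for z
  using Qle[OF z] abs_Re_le_cmod[of "inn (Q n z) z"] z by (auto simp: Si Re_inner_self)
 have Vn: "0 <= Re (inn (?V z) z)" "Re (inn (?V z) z) <= (hn z)^2" if z: "z : car" for z
 proof -
  show "0 <= Re (inn (?V z) z)" using neg[OF z] by (simp add: Vi[OF z z] W_inner[OF z z] Re_inner_self[OF z])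
  show "Re (inn (?V z) z) <= (hn z)^2"
   using W_le[OF z z] abs_Re_le_cmod[of "inn (W z) z"] by (simp add: Vi[OF z z] power2_eq_square)
 qed
 have yn: "hn y <= 3 * hn x"
 proof -
  have "hn (?S x) <= 2 * hn x"
   using hnorm_triangle[OF x scale_closed[OF Q_closed[OF x]], of "- 1" n] hnorm_scale[OF Q_closed[OF x], of "- 1" n]
    Q_norm[OF x, of n] mult_right_mono[OF tq_bounds(2) hnorm_nonneg[OF x], of n] by simp
  thus ?thesis unfolding y_def pop_def using hnorm_triangle[OF Sc[OF x] W_closed[OF x]] W_norm[OF x] by simp
 qed
 define d where "d = tq (Suc n) - tq n"
 have d: "d >= 0" unfolding d_def using tq_mono_Suc[of n] by simp
 define h where "h = 6 * d * (hn x)^2"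
 \<comment> \<open>In operators: \<open>(S + V) (S - V) = S^2 - W^2 = Z + (Q n)^2 - 2 Q n = 2 (Q
   (Suc n) - Q n)\<close>.\<close>
 have key: "inn y (?S z) + inn y (?V z) = 2 * (inn (Q (Suc n) x) z - inn (Q n x) z)"
  if z: "z : car" for z
 proof -
  have yz: "inn y w = inn x w - inn (Q n x) w + inn (W x) w" if "w : car" for w
   unfolding y_def by (rule P_inner[OF x that])
  show ?thesis
   using x z y Q_W_commute[OF x z, of n] Q_Suc_inner[OF x z, of n] Q_sym[OF x z, of n] W_sym[OF x z]
   by (simp add: Si Vi yz Q_closed W_closed Z_inner field_simps del: qop.simps)
 qed
 have "cmod (inn y (?S y) + inn y (?V y)) <= 2 * (d * hn x * hn y)"
  unfolding key[OF y] norm_mult using Q_step[OF x y, of n] by (simp add: d_def del: qop.simps tq.simps)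
 also have "... <= 2 * (d * hn x * (3 * hn x))"
  by (intro mult_left_mono yn) (use d hnorm_nonneg[OF x] in auto)
 also have "... = h" by (simp add: h_def power2_eq_square)
 finally have "Re (inn y (?S y)) + Re (inn y (?V y)) <= h"
  using complex_Re_le_cmod[of "inn y (?S y) + inn y (?V y)"] by simp
 moreover have "inn y (?S y) = inn (?S y) y" "inn y (?V y) = inn (?V y) y"
  using y by (simp_all add: Si Vi Q_sym W_sym)
 ultimately have h: "Re (inn (?S y) y) <= h" "Re (inn (?V y) y) <= h" using Sn(1)[OF y] Vn(1)[OF y] by auto
 have "(cmod (inn (?S x) y))^2 <= Re (inn (?S x) x) * Re (inn (?S y) y)"
  by (rule positive_form_Cauchy_Schwarz[OF Sc Ssym Sn(1) x y])
 also have "... <= 2 * (hn x)^2 * h" using Sn[OF x] h(1) Sn(1)[OF y] by (intro mult_mono) auto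
 finally have s: "(cmod (inn (?S x) y))^2 <= 2 * (hn x)^2 * h" .
 have "(cmod (inn (?V x) y))^2 <= Re (inn (?V x) x) * Re (inn (?V y) y)"
  by (rule positive_form_Cauchy_Schwarz[OF Vc Vsym Vn(1) x y])
 also have "... <= (hn x)^2 * h" using Vn[OF x] h(2) Vn(1)[OF y] by (intro mult_mono) auto
 finally have v: "(cmod (inn (?V x) y))^2 <= (hn x)^2 * h" .
 have h0: "0 <= (hn x)^2 * h" using d by (simp add: h_def)
 have "inn y y = inn (?S x) y - inn (?V x) y"
  using P_inner[OF x y, of n] by (simp add: y_def[symmetric] Si[OF x y] Vi[OF x y])
 hence "cmod (inn y y) <= cmod (inn (?S x) y) + cmod (inn (?V x) y)"
  using norm_triangle_ineq4[of "inn (?S x) y" "inn (?V x) y"] by simp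
 hence "(hn y)^2 <= cmod (inn (?S x) y) + cmod (inn (?V x) y)"
  by (simp add: inner_self[OF y] norm_power)
 hence "((hn y)^2)^2 <= (cmod (inn (?S x) y) + cmod (inn (?V x) y))^2" by (intro power_mono) auto
 also have "... <= 2 * (cmod (inn (?S x) y))^2 + 2 * (cmod (inn (?V x) y))^2"
  using sum_squares_bound[of "cmod (inn (?S x) y)" "cmod (inn (?V x) y)"] by (simp add: power2_sum)
 also have "... <= 8 * ((hn x)^2 * h)" using s v h0 by simp
 also have "... = 48 * (hn x) ^ 4 * d" by (simp add: h_def power2_eq_square power4_eq_xxxx)
 finally show ?thesis by (simp add: y_def d_def)
qed

end

section \<open>From the reduced Fourier--Stieltjes algebra to an invariant mean\<close>

context haar
begin

text \<open>Closeness is measured by multiples of \<open>coef_ball\<close>, that is in the norm of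
  B(G), where elements of C*(G) act as bounded functionals. Uniform closeness would not do.\<close>

lemma Br_norm_closed:
 assumes v: "v : BG"
  and near: "!!e. e > 0 ==> EX w:Br. EX d:coef_ball. ALL s. v s = w s + of_real e * d s"
 shows "v : Br"
proof (rule BrI[OF v])
 fix phi assume phi: "kills_lambda phi"
 note F = kills_lambdaD[OF phi]
 note i = full_cstarD(1)[OF F]
 obtain N where N: "ALL m>=N. ALL n>=N. cnorm (%s. phi m s - phi n s) < 1"
  using full_cstarD(2)[OF F] unfolding small_def by (meson zero_less_one)
 define M where "M = 1 + cnorm (phi N)"
 have M: "cnorm (phi n) <= M" if "n >= N" for n
 proof -
  have "cnorm (%s. 1 * (phi n s - phi N s) + phi N s) <= cmod 1 * cnorm (%s. phi n s - phi N s) + cnorm (phi N)"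
   using i by (intro cstar_norm_combination) auto
  with N that show ?thesis by (force simp: M_def)
 qed
 have M0: "M > 0" using cstar_norm_nonneg[OF i, of N] by (simp add: M_def)
 have "cmod (pair phi v) <= 0 + e" if e: "e > 0" for e
 proof -
  obtain w d where w: "w : Br" "d : coef_ball" "!!s. v s = w s + of_real (e / M) * d s" using near[of "e / M"] e M0 by auto
  have d: "d : BG" by (rule coef_ball_in_BG[OF w(2)])
  have "pair phi v = of_real (e / M) * pair phi d"
  proof -
   have v': "v = (%s. 1 * w s + of_real (e / M) * d s)" by (rule ext) (simp add: w(3))
   show ?thesis unfolding v' pairing_lincomb[OF F subsetD[OF Br_subset w(1)] d] Br_pairing[OF w(1) phi] by simp
  qed
  moreover have "cmod (pair phi d) <= M"
   by (rule LIMSEQ_le_const2[OF tendsto_norm[OF pairing_tendsto[OF F d]]])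
    (use cstar_norm_ge[OF i w(2)] M in "blast intro: order_trans")
  ultimately have "cmod (pair phi v) <= e / M * M"
   using e M0 mult_left_mono[of _ M "e / M"]
   by (simp only: norm_mult norm_of_real) (simp add: abs_of_pos)
  thus ?thesis using M0 by simp
 qed
 thus "pair phi v = 0" using field_le_epsilon[of "cmod (pair phi v)" 0] by simp
qed

text \<open>The element of minimal norm of the convex set \<open>C\<close> below is invariant, hence has constant coefficients.\<close>

lemma one_in_Br_if_near_one:
 assumes u: "u : Br" and near: "!!s. cmod (u s - 1) <= 1/2"
 shows "(%_. 1) : Br"
proof -
 obtain K v where K: "K > 0" "v : coef_ball" "u = (%s. of_real K * v s)"
  using subsetD[OF Br_subset u] by (rule BGE)
 obtain H :: "'g fn hspace" and \<pi> x y where r: "unitary_rep H \<pi>" "x : hcarrier H" "y : hcarrier H"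
  "hnorm H x <= 1" "hnorm H y <= 1" "v = coefficient H \<pi> x y" using coef_ball_coefficient[OF K(2)] .
 interpret urep H \<pi> by unfold_locales (rule r(1))
 let ?v = "cf x"
 \<comment> \<open>The first vector \<open>x\<close> is fixed and the second varies: moving
   \<open>z\<close> by \<open>\<pi> s\<close> translates the coefficient. The lower bound survives
   midpoints and limits and keeps the final constant away from 0.\<close>
 define C where "C = {z : car. ?v z : Br & (ALL t. 1/2 <= K * Re (?v z t))}"
 have CH: "C \<subseteq> car" by (auto simp: C_def)
 have yC: "y : C"
 proof -
  have "(%s. of_real (1 / K) * u s + 0 * u s) : Br" by (rule Br_lincomb[OF u u])
  moreover have "1 - Re (u t) <= 1/2" for t
   using abs_Re_le_cmod[of "u t - 1"] near[of t] by simp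
  ultimately show ?thesis using r K(1) by (auto simp: C_def K(3) algebra_simps)
 qed
 have rot: "?v (\<pi> s z) = (%t. ?v z (- s + t))" if "z : car" for s z
  using rep_inner_rep[OF r(2) that] by (auto simp: coefficient_def)
 have rC: "\<pi> s z : C" if "z : C" for s z
  using that Br_left_translate[of "?v z" "- s"] by (auto simp: C_def rot rep_closed)
 have mid: "hscale H (1/2) (hadd H z w) : C" if "z : C" "w : C" for z w
 proof -
  have "?v (hscale H (1/2) (hadd H z w)) = (%t. 1/2 * ?v z t + 1/2 * ?v w t)"
   using that r(2) by (auto simp: C_def coefficient_def inner_simps rep_closed)
  moreover have "1/2 <= K * Re (1/2 * ?v z t + 1/2 * ?v w t)" for t
  proof -
   have "1/2 <= K * Re (?v z t)" "1/2 <= K * Re (?v w t)" using that by (auto simp: C_def)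
   thus ?thesis by (simp add: distrib_left)
  qed
  ultimately show ?thesis
   using that Br_lincomb[of "?v z" "?v w" "1/2" "1/2"] by (simp add: C_def inner_simps)
 qed
 let ?J = "%z. (hn z)^2"
 have "EX s. range s \<subseteq> C & hCauchy s & (ALL n. ALL z:C. ?J (s n) <= ?J z + 1 / real (Suc n))"
 proof (rule minimizing_sequence[OF CH _ mid])
  show "bdd_below (?J ` C)" by (rule bdd_belowI2[of _ 0]) simp
  show "(hn (dif z w))^2 / 2 <= ?J z + ?J w - 2 * ?J (hscale H (1 / 2) (hadd H z w))"
   if "z : C" "w : C" for z w using hnorm_midpoint[OF subsetD[OF CH that(1)] subsetD[OF CH that(2)]] by simp
 qed (use yC in auto)
 then obtain q where q: "range q \<subseteq> C" "hCauchy q" "!!n z. z : C ==> ?J (q n) <= ?J z + 1 / real (Suc n)" by blast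
 have qC: "q n : C" and qH: "q n : car" for n using q(1) CH by auto
 obtain z where z: "z : car" and lim: "(%n. hn (dif (q n) z)) \<longlonglongrightarrow> 0"
  using hCauchy_converges[OF q(2)] by blast
 have qlim: "(%n. ?v (q n) t) \<longlonglongrightarrow> ?v z t" for t
  unfolding coefficient_def by (rule inner_tendsto[OF qH z rep_closed[OF r(2)] lim])
 have "?v z (- s + t) = ?v z t" for s t
 proof -
  \<comment> \<open>The midpoint of \<open>q n\<close> and its translate lies in \<open>C\<close>,
    and both ends have the same norm; near-minimality and the parallelogram identity bound the
    displacement.\<close>
  have "norm ((hn (dif (\<pi> s (q n)) (q n)))^2 - 0) <= 4 * (1 / real (Suc n))" for n
  proof -
   have "?J (\<pi> s (q n)) = ?J (q n)" by (simp add: rep_norm[OF qH])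
   moreover have "?J (q n) <= ?J (hscale H (1/2) (hadd H (\<pi> s (q n)) (q n))) + 1 / real (Suc n)"
    by (rule q(3)[OF mid[OF rC[OF qC] qC]])
   ultimately have "(hn (dif (\<pi> s (q n)) (q n)))^2 <= 4 * (1 / real (Suc n))"
    using hnorm_midpoint[OF rep_closed[OF qH] qH, of s n n] by simp
   thus ?thesis by simp
  qed
  from tendsto_if_norm_le[OF tendsto_mult_right_zero[OF tendsto_inverse_Suc] this]
  have "(%n. hn (dif (\<pi> s (q n)) (q n))) \<longlonglongrightarrow> 0" by (simp add: power_tendsto_0_iff)
  from tendsto_mult_right_zero[OF this, of "hn x"] have "(%n. ?v (q n) (- s + t) - ?v (q n) t) \<longlonglongrightarrow> 0"
  proof (rule tendsto_if_norm_le)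
   fix n
   have "cmod (?v (\<pi> s (q n)) t - ?v (q n) t) <= hn x * hn (dif (\<pi> s (q n)) (q n))"
    using inner_diff_le[of "\<pi> s (q n)" "q n" "\<pi> t x"] rep_norm[OF r(2)] qH r(2) by (simp add: coefficient_def rep_closed)
   thus "norm (?v (q n) (- s + t) - ?v (q n) t - 0) <= hn x * hn (dif (\<pi> s (q n)) (q n))" by (simp add: rot qH)
  qed
  moreover have "(%n. ?v (q n) (- s + t) - ?v (q n) t) \<longlonglongrightarrow> ?v z (- s + t) - ?v z t" by (intro tendsto_diff qlim)
  ultimately show ?thesis using LIMSEQ_unique by fastforce
 qed
 from this[of "- t" 0 for t] have const: "?v z t = ?v z 0" for t by simp
 have "1/2 <= K * Re (?v z 0)"
  by (rule LIMSEQ_le_const[OF tendsto_mult_left[OF tendsto_Re[OF qlim]]]) (use qC in "auto simp: C_def")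
 hence nz: "?v z 0 ~= 0" by auto
 have vz: "?v z : Br"
 proof (rule Br_norm_closed)
  have "?v z = (%_. ?v z 0)" by (rule ext) (rule const)
  thus "?v z : BG" by (rule ssubst) (rule const_in_BG)
  fix e :: real assume e: "e > 0"
  obtain n where "norm (hn (dif (q n) z) - 0) < e" using LIMSEQ_D[OF lim e] by (meson order_refl)
  hence n: "hn (dif (q n) z) < e" by simp
  let ?d = "hscale H (of_real (1 / e)) (dif z (q n))"
  have dH: "?d : car" using z qH by (simp add: inner_simps)
  have "hn ?d = (1 / e) * hn (dif z (q n))"
   using z qH e by (simp add: hnorm_scale inner_simps norm_divide del: of_real_divide)
  also have "... <= 1" using n e hnorm_diff_commute[OF z qH, of n] by simp
  finally have "hn ?d <= 1" .
  from coefficient_in_coef_ball[OF r(2) dH r(4) this] have "?v ?d : coef_ball" .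
  moreover have "?v z s = ?v (q n) s + of_real e * ?v ?d s" for s
   using z qH r(2) e by (simp add: coefficient_def inner_simps rep_closed)
  ultimately show "EX w:Br. EX d:coef_ball. ALL s. ?v z s = w s + of_real e * d s" using qC by (auto simp: C_def)
 qed
 have "(%s. 1 / ?v z 0 * ?v z s + 0 * ?v z s) = (%_. 1)" using const nz by (simp add: fun_eq_iff)
 with Br_lincomb[OF vz vz, of "1 / ?v z 0" 0] show ?thesis by simp
qed

end

subsection \<open>Almost invariant vectors\<close>

text \<open>Each point is taken together with its inverse, so that the averaged operator is
  self-adjoint.\<close>

definition avg_list :: "'g::group_add list => (complex \<times> 'g) list" where
 "avg_list fs = map (%s. (1 / of_nat (2 * length fs), s)) (fs @ map uminus fs)"

lemma lin_avg_list: "lin u (avg_list fs) = (\<Sum>s\<leftarrow>fs. u s + u (- s)) / of_nat (2 * length fs)"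
proof -
 have "lin u (map (%s. (a, h s)) gs) = a * (\<Sum>s\<leftarrow>gs. u (h s))" for a gs and h :: "'a => 'a"
  by (induction gs) (auto simp: distrib_left)
 from this[of _ "%s. s"] this[of _ uminus] show ?thesis
  by (simp add: avg_list_def sum_list_addf o_def distrib_left add_divide_distrib)
qed

lemma lin_avg_list_uminus: "lin (%s. u (- s)) (avg_list fs) = lin u (avg_list fs)"
 by (simp add: lin_avg_list add.commute)

lemma cnj_lin_avg_list: "cnj (lin u (avg_list fs)) = lin (%s. cnj (u s)) (avg_list fs)"
proof -
 have "cnj (\<Sum>s\<leftarrow>fs. u s + u (- s)) = (\<Sum>s\<leftarrow>fs. cnj (u s) + cnj (u (- s)))" by (induction fs) auto
 thus ?thesis by (simp add: lin_avg_list)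
qed

lemma cmod_lin_avg_list_le:
 assumes "!!s. cmod (u s) <= B"
 shows "cmod (lin u (avg_list fs)) <= B"
proof (cases "fs = []")
 case True
 thus ?thesis using order_trans[OF norm_ge_zero assms] by (simp add: avg_list_def)
next
 case False
 have "cmod (\<Sum>s\<leftarrow>fs. u s + u (- s)) <= real (2 * length fs) * B"
 proof (induction fs)
  case (Cons s fs)
  have "cmod (u s + u (- s)) <= B + B" by (rule norm_triangle_mono[OF assms assms])
  from norm_triangle_mono[OF this Cons] show ?case by (simp add: algebra_simps)
 qed simp
 with False show ?thesis by (simp add: lin_avg_list norm_divide pos_divide_le_eq mult.commute)
qed

context semi_rep
begin

lemma rep_inner_left:
 assumes "x : car" "y : car"
 shows "inn x (\<pi> s y) = inn (\<pi> (- s) x) y"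
 using assms rep_inner_rep[of x y 0 s] rep_zero_inner[of x "\<pi> s y"] by (simp add: rep_closed)

lemma hnorm_rep: "x : car ==> hn (\<pi> s x) = hn x"
 using rep_inner_rep[of x x s s] rep_zero_inner[of x x] by (simp add: hnorm_def)

lemma coefficient_bound: "x : car ==> y : car ==> cmod (cf x y s) <= hn x * hn y"
 using Cauchy_Schwarz[of "\<pi> s x" y] by (simp add: coefficient_def rep_closed hnorm_rep)

abbreviation avg :: "'g list => 'h => 'h" where
 "avg fs x \<equiv> lincomb x (avg_list fs)"

lemma inner_avg_right:
 assumes x: "x : car" and y: "y : car"
 shows "inn x (avg fs y) = lin (%s. inn (\<pi> (- s) x) y) (avg_list fs)"
proof -
 have "inn x (avg fs y) = cnj (inn (avg fs y) x)" using x y by (intro inner_cnj lincomb_closed)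
 also have "... = lin (%s. cnj (inn (\<pi> s y) x)) (avg_list fs)"
  by (simp only: inner_lincomb[OF y x] cnj_lin_avg_list) (simp add: coefficient_def)
 also have "(%s. cnj (inn (\<pi> s y) x)) = (%s. inn (\<pi> (- s) x) y)"
  using inner_cnj[OF rep_closed[OF y] x] rep_inner_left[OF x y] by simp
 finally show ?thesis .
qed

lemma self_adjoint_contraction_avg:
 assumes c: "0 <= c" "c <= 1"
 shows "self_adjoint_contraction H (avg fs) c"
proof (intro self_adjoint_contraction.intro semi_inner_axioms self_adjoint_contraction_axioms.intro c)
 fix x y assume x: "x : car" and y: "y : car"
 show "inn (avg fs x) y = inn x (avg fs y)"
  unfolding inner_lincomb[OF x y] inner_avg_right[OF x y]
  using lin_avg_list_uminus[of "cf x y" fs] by (simp add: coefficient_def)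
 show "cmod (inn (avg fs x) y) <= hn x * hn y"
  unfolding inner_lincomb[OF x y] by (rule cmod_lin_avg_list_le) (rule coefficient_bound[OF x y])
qed (rule lincomb_closed)

end

text \<open>\<open>W\<close>, \<open>Z\<close>, \<open>Q n\<close> and \<open>P n\<close> arise from
  \<open>T\<close> by sums, compositions and real scalars, hence any sesquilinear \<open>B\<close>
  that intertwines \<open>T1\<close> with \<open>T2\<close> intertwines them too.\<close>

lemma pop_intertwine:
 assumes S1: "self_adjoint_contraction H1 T1 c" and S2: "self_adjoint_contraction H2 T2 c"
  and add1: "!!x x' y. x : hcarrier H1 ==> x' : hcarrier H1 ==> y : hcarrier H2 ==> B (hadd H1 x x') y = B x y + B x' y"
  and add2: "!!x y y'. x : hcarrier H1 ==> y : hcarrier H2 ==> y' : hcarrier H2 ==> B x (hadd H2 y y') = B x y + B x y'"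
  and scale1: "!!a x y. x : hcarrier H1 ==> y : hcarrier H2 ==> B (hscale H1 a x) y = a * B x y"
  and scale2: "!!a x y. x : hcarrier H1 ==> y : hcarrier H2 ==> B x (hscale H2 a y) = cnj a * B x y"
  and T: "!!x y. x : hcarrier H1 ==> y : hcarrier H2 ==> B (T1 x) y = B x (T2 y)"
  and xy: "x : hcarrier H1" "y : hcarrier H2"
 shows "B (pop H1 T1 c n x) y = (B x (pop H2 T2 c n y) :: complex)"
proof -
 interpret A: self_adjoint_contraction H1 T1 c by (rule S1)
 interpret C: self_adjoint_contraction H2 T2 c by (rule S2)
 note cl = A.add_closed A.scale_closed A.T_closed A.W_closed A.Q_closed A.Z_closed
  C.add_closed C.scale_closed C.T_closed C.W_closed C.Q_closed C.Z_closed
 have W: "B (A.W x) y = B x (C.W y)" if "x : hcarrier H1" "y : hcarrier H2" for x y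
  using that by (simp add: wop_def cl add1 add2 scale1 scale2 T)
 have Z: "B (A.Z x) y = B x (C.Z y)" if "x : hcarrier H1" "y : hcarrier H2" for x y
  using that by (simp add: zop_def cl add1 add2 scale1 scale2 W)
 have Q: "B (A.Q n x) y = B x (C.Q n y)" if "x : hcarrier H1" "y : hcarrier H2" for x y
  using that by (induction n arbitrary: x y) (simp_all add: cl add1 add2 scale1 scale2 Z)
 show ?thesis using xy by (simp add: pop_def cl add1 add2 scale1 scale2 W Q)
qed

lemma ch_sel: "hcarrier complex_hspace = UNIV" "hinner complex_hspace z w = z * cnj w"
 by (simp_all add: complex_hspace_def)

lemma bounded_borel_lincomb:
 assumes f: "f : bounded_borel" and g: "g : bounded_borel"
 shows "(%t. a * f t + b * g t) : bounded_borel"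
proof -
 obtain B where B: "!!t. cmod (f t) <= B" using f by (auto simp: bounded_borel_def bounded_iff)
 obtain C where C: "!!t. cmod (g t) <= C" using g by (auto simp: bounded_borel_def bounded_iff)
 have "cmod (a * f t + b * g t) <= cmod a * B + cmod b * C" for t
  by (rule norm_triangle_mono) (auto simp: norm_mult intro!: mult_left_mono B C)
 with f g show ?thesis unfolding bounded_borel_def bounded_iff by auto
qed

section \<open>Averaged translations of integrable functions\<close>

context haar
begin

text \<open>Only the linear structure and the translations matter, so the inner product is taken to
  be 0; this makes the polynomials \<open>pop\<close> available on integrable functions.\<close>

definition fsp :: "'g fn hspace" where
 "fsp = \<lparr>hcarrier = {f. intg f}, hzero = (%_. 0), hadd = (%f g t. f t + g t), hscale = (%a f t. a * f t),
  hinner = (%_ _. 0)\<rparr>"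

lemma fsp_sel [simp]: "hcarrier fsp = {f. intg f}" "hadd fsp f g = (%t. f t + g t)"
  "hscale fsp a f = (%t. a * f t)" "hinner fsp f g = 0"
 by (simp_all add: fsp_def)

sublocale FS: semi_rep fsp lreg
 by unfold_locales (auto simp: lreg_def[abs_def] intro: integrable_translate)

lemma lreg_apply: "lreg s f t = f (- s + t)"
 by (simp add: lreg_def)

lemma FS_lincomb: "FS.lincomb f d t = lin (%s. f (- s + t)) d"
proof (induction d)
 case (Cons p d)
 obtain a s where "p = (a, s)" by force
 with Cons lreg_apply[of s f t] show ?case by simp
qed simp

lemma lin_mult_right: "lin (%s. u s * a) d = lin u d * a"
 using lin_const_mult[of a u d] by (simp add: mult.commute)

lemma integral_lin:
 assumes "!!s. intg (h s)"
 shows "intg (%t. lin (%s. h s t) d) & (LI t. lin (%s. h s t) d) = lin (%s. LI t. h s t) d"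
proof (induction d)
 case (Cons p d)
 obtain a s where "p = (a, s)" by force
 with Cons assms show ?case by simp
qed simp

text \<open>A representing sequence for \<open>(\<bar>W\<bar> + W) f\<close> in C*(G). The averages
  of translations are multipliers of C*(G) and not elements of it, whence the integrable function
  \<open>f\<close> to which they are applied.\<close>

definition pseq :: "'g list => real => 'g fn => nat => 'g fn" where
 "pseq fs c f n = pop fsp (FS.avg fs) c n f"

lemma pseq_integrable:
 assumes "0 <= c" "c <= 1" "intg f"
 shows "intg (pseq fs c f n)"
proof -
 interpret S: self_adjoint_contraction fsp "FS.avg fs" c by (rule FS.self_adjoint_contraction_avg[OF assms(1,2)])
 show ?thesis using S.P_closed[of f n] assms(3) by (simp add: pseq_def)
qed

text \<open>An average over a set closed under inverses can be moved from \<open>f\<close> to the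
  second vector of the coefficient, and the polynomial follows by
  \<open>pop_intertwine\<close>.\<close>

lemma pseq_pairing:
 assumes r: "semi_rep H \<pi>" and cont: "!!x y. x : hcarrier H ==> y : hcarrier H ==> cont (coefficient H \<pi> x y)"
  and x: "x : hcarrier H" and y: "y : hcarrier H" and f: "intg f" and c: "0 <= c" "c <= 1"
 shows "(LI t. pseq fs c f n t * coefficient H \<pi> x y t) =
  (LI t. f t * coefficient H \<pi> x (pop H (semi_rep.avg H \<pi> fs) c n y) t)"
proof -
 interpret R: semi_rep H \<pi> by (rule r)
 have i: "intg (%t. f t * coefficient H \<pi> x y t)" if "intg f" "y : hcarrier H" for f y
  by (rule integrable_mult_continuous[OF that(1) cont[OF x that(2)] R.coefficient_bound[OF x that(2)]])
 define B where "B f y = (LI t. f t * coefficient H \<pi> x y t)" for f y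
 have "B (pop fsp (FS.avg fs) c n f) y = B f (pop H (R.avg fs) c n y)"
 proof (rule pop_intertwine[where B = B and ?H1.0 = fsp and ?H2.0 = H])
  fix f y assume f: "f : hcarrier fsp" and y: "y : hcarrier H"
  let ?u = "coefficient H \<pi> x y"
  have "B (FS.avg fs f) y = (LI t. lin (%s. f (- s + t) * ?u t) (avg_list fs))"
   unfolding B_def FS_lincomb by (simp only: lin_mult_right)
  also have "... = lin (%s. LI t. f (- s + t) * ?u t) (avg_list fs)"
   by (rule conjunct2[OF integral_lin], rule i) (use f y integrable_translate[of f "- s" for s] in auto)
  also have "(%s. LI t. f (- s + t) * ?u t) = (%s. LI t. f t * ?u (s + t))"
  proof
   fix s
   have "(%t. f t * ?u (s + t)) : Meas"
    using f borel_measurable_continuous_onI[OF cont[OF x y]] measurable_comp_translate[of ?u s]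
     borel_measurable_integrable[of \<mu> f] by simp
   from integral_translate'[OF this, of s] show "(LI t. f (- s + t) * ?u t) = (LI t. f t * ?u (s + t))"
    by (simp add: add.assoc[symmetric])
  qed
  also have "lin (%s. LI t. f t * ?u (s + t)) (avg_list fs) = lin (%s. LI t. f t * ?u (- s + t)) (avg_list fs)"
   by (rule lin_avg_list_uminus[symmetric])
  also have "... = (LI t. lin (%s. f t * ?u (- s + t)) (avg_list fs))"
  proof (rule conjunct2[OF integral_lin, symmetric])
   fix s
   have "?u (- s + t) = coefficient H \<pi> x (\<pi> s y) t" for t
    using R.rep_inner_rep[OF x y] by (simp add: coefficient_def)
   thus "intg (%t. f t * ?u (- s + t))" using i[of f "\<pi> s y"] f R.rep_closed[OF y] by simp
  qed
  also have "... = B f (R.avg fs y)"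
  proof -
   have "coefficient H \<pi> x (R.avg fs y) t = lin (%s. ?u (- s + t)) (avg_list fs)" for t
   proof -
    have "hinner H (\<pi> (- s) (\<pi> t x)) y = hinner H (\<pi> (- s + t) x) y" for s
     using R.rep_inner_left[OF R.rep_closed[OF x] y, of t s] R.rep_inner_rep[OF x y, of t s] by simp
    thus ?thesis using R.inner_avg_right[OF R.rep_closed[OF x] y] by (simp add: coefficient_def)
   qed
   thus ?thesis by (simp add: B_def lin_const_mult)
  qed
  finally show "B (FS.avg fs f) y = B f (R.avg fs y)" .
 next
  fix f y y' assume "f : hcarrier fsp" "y : hcarrier H" "y' : hcarrier H"
  thus "B f (hadd H y y') = B f y + B f y'"
   using i[of f y] i[of f y'] x by (simp add: B_def coefficient_def R.inner_simps R.rep_closed distrib_left)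
 next
  fix f g y assume "f : hcarrier fsp" "g : hcarrier fsp" "y : hcarrier H"
  thus "B (hadd fsp f g) y = B f y + B g y" using i[of f y] i[of g y] by (simp add: B_def distrib_right)
 next
  fix a f y assume "f : hcarrier fsp" "y : hcarrier H"
  thus "B (hscale fsp a f) y = a * B f y" "B f (hscale H a y) = cnj a * B f y"
   using x by (simp_all add: B_def coefficient_def R.inner_simps R.rep_closed mult.assoc mult.left_commute[of _ "cnj a"])
 qed (use y f c in "auto intro: FS.self_adjoint_contraction_avg R.self_adjoint_contraction_avg")
 thus ?thesis by (simp add: B_def pseq_def)
qed

text \<open>The rate in \<open>P_step_abs\<close> is the same in every representation, as the
  C*-norm requires.\<close>

lemma pseq_full_cstar:
 assumes f: "intg f" and c: "0 <= c" "c <= 1"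
 shows "pseq fs c f : CstG"
proof (rule full_cstarI[OF _ small_tq small_tq _ order_refl])
 show int: "intg (pseq fs c f n)" for n by (rule pseq_integrable[OF c f])
 fix m n
 have "cnorm (%s. pseq fs c f m s - pseq fs c f n s) <= \<bar>tq m - tq n\<bar> * (LI t. cmod (f t))"
 proof (rule cstar_norm_le)
  fix u :: "'g fn" assume "u : coef_ball"
  then obtain H :: "'g fn hspace" and \<pi> x y where r: "unitary_rep H \<pi>" "x : hcarrier H" "y : hcarrier H"
   "hnorm H x <= 1" "hnorm H y <= 1" "u = coefficient H \<pi> x y" by (rule coef_ball_coefficient)
  interpret R: urep H \<pi> by unfold_locales (rule r(1))
  interpret S: self_adjoint_contraction H "R.avg fs" c by (rule R.self_adjoint_contraction_avg[OF c])
  have u: "u : BG" using \<open>u : coef_ball\<close> by (rule coef_ball_in_BG)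
  define d where "d t = R.cf x (S.P m y) t - R.cf x (S.P n y) t" for t
  have P: "S.P m y : R.car" for m using r(3) by (rule S.P_closed)
  have i: "intg (%t. f t * R.cf x (S.P m y) t)" for m
   by (rule integrable_mult_continuous[OF f R.continuous_coefficient[OF r(2) P] R.coefficient_bound[OF r(2) P]])
  have db: "cmod (d t) <= \<bar>tq m - tq n\<bar>" for t
  proof -
   have z: "\<pi> t x : R.car" by (rule R.rep_closed[OF r(2)])
   have "cmod (d t) = cmod (R.inn (S.P m y) (\<pi> t x) - R.inn (S.P n y) (\<pi> t x))"
    unfolding d_def coefficient_def
    by (simp only: R.inner_cnj[OF P z] complex_cnj_diff[symmetric] complex_mod_cnj)
   also have "... <= \<bar>tq m - tq n\<bar> * (R.hn y * R.hn (\<pi> t x))" by (rule S.P_step_abs[OF r(3) z])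
   also have "... <= \<bar>tq m - tq n\<bar> * (1 * 1)"
    using r R.rep_norm[OF r(2)] R.hnorm_nonneg by (intro mult_left_mono mult_mono) auto
   finally show ?thesis by simp
  qed
  have "(LI s. (pseq fs c f m s - pseq fs c f n s) * u s) =
    (LI s. pseq fs c f m s * u s) - (LI s. pseq fs c f n s * u s)"
   using integrable_mult_BG[OF int u] by (simp add: left_diff_distrib)
  also have "... = (LI s. f s * coefficient H \<pi> x (S.P m y) s) - (LI s. f s * coefficient H \<pi> x (S.P n y) s)"
   unfolding r(6) by (simp only: pseq_pairing[OF R.semi_rep_axioms R.continuous_coefficient r(2,3) f c])
  also have "... = (LI s. f s * d s)" using i by (simp add: d_def right_diff_distrib)
  finally show "cmod (LI s. (pseq fs c f m s - pseq fs c f n s) * u s) <= \<bar>tq m - tq n\<bar> * (LI s. cmod (f s))"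
   using cmod_integral_mult_le[OF f _ db] R.continuous_coefficient[OF r(2) P]
   by (simp add: d_def[abs_def] continuous_on_diff)
 qed
 thus "cnorm (%s. pseq fs c f m s - pseq fs c f n s) <= (LI t. cmod (f t)) * \<bar>tq m - tq n\<bar> + 0 * \<bar>tq m - tq n\<bar>"
  by (simp add: mult.commute)
qed simp

text \<open>If the numerical range of the average on \<open>L\<^sup>2\<close> does not exceed
  \<open>c\<close>, then \<open>P n g'\<close> tends to 0 in norm, and with it every
  coefficient.\<close>

lemma pseq_kills_lambda:
 assumes f: "intg f" and c: "0 <= c" "c <= 1"
  and neg: "!!g. sq_int g ==> Re (hinner l2fun (LR.avg fs g) g) <= c * (nm g)^2"
 shows "kills_lambda (pseq fs c f)"
 unfolding kills_lambda_def
proof (intro conjI allI impI)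
 show F: "pseq fs c f : CstG" by (rule pseq_full_cstar[OF f c])
 fix g g' assume g: "sq_int g" and g': "sq_int g'"
 interpret S: self_adjoint_contraction l2fun "LR.avg fs" c by (rule LR.self_adjoint_contraction_avg[OF c])
 define p where "p n = nm (S.P n g')" for n
 have "(%n. 48 * nm g' ^ 4 * (tq (Suc n) - tq n)) \<longlonglongrightarrow> 48 * nm g' ^ 4 * 0"
  by (intro tendsto_mult_left tq_diff_tendsto)
 hence l: "(%n. 48 * nm g' ^ 4 * (tq (Suc n) - tq n)) \<longlonglongrightarrow> 0" by simp
 have p: "p n >= 0" "p n ^ 4 <= 48 * nm g' ^ 4 * (tq (Suc n) - tq n)" for n
  unfolding p_def using S.P_norm_le[of g' n] g' neg by (simp_all add: hnorm_l2fun del: tq.simps l2fun_sel(4))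
 have "(%n. p n ^ 4) \<longlonglongrightarrow> 0"
  by (rule Lim_null_comparison[OF _ l]) (use p(2) in "simp add: power_abs del: tq.simps")
 hence "(%n. root 4 (p n ^ 4)) \<longlonglongrightarrow> root 4 0" by (rule tendsto_real_root)
 hence p0: "p \<longlonglongrightarrow> 0" using p(1) by (simp add: real_root_power_cancel)
 have sq: "sq_int (S.P n g')" for n using S.P_closed[of g' n] g' by simp
 have "cmod (LI s. pseq fs c f n s * lamc g g' s) <= nm g * p n * (LI s. cmod (f s))" for n
 proof -
  have "(LI s. pseq fs c f n s * lamc g g' s) = (LI s. f s * lamc g (S.P n g') s)"
   unfolding lamc_def
   by (rule pseq_pairing[OF LR.semi_rep_axioms _ _ _ f c]) (use g g' lamc_continuous in "auto simp: lamc_def")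
  thus ?thesis
   using cmod_integral_mult_le[OF f lamc_continuous[OF g sq] lamc_bound[OF g sq]] by (simp add: p_def)
 qed
 moreover have "(%n. nm g * p n * (LI s. cmod (f s))) \<longlonglongrightarrow> nm g * 0 * (LI s. cmod (f s))"
  by (intro tendsto_intros p0)
 ultimately have "(%n. LI s. pseq fs c f n s * lamc g g' s) \<longlonglongrightarrow> 0"
  by (auto intro: Lim_null_comparison[OF always_eventually, of _ "%n. nm g * p n * (LI s. cmod (f s))"])
 from pairing_eqI[OF F lamc_in_BG[OF g g'] this] show "pair (pseq fs c f) (lamc g g') = 0" .
qed

interpretation TR: semi_rep complex_hspace "trivial_rep :: 'g => _"
 by unfold_locales (auto simp: complex_hspace_def trivial_rep_def algebra_simps)

text \<open>Otherwise \<open>pseq\<close> lies in the kernel of \<lambda>, so the constant 1 in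
  \<open>Br\<close> must pair with it to 0. But averages act as 1 in the trivial representation,
  where \<open>P n\<close> stays above \<open>(1 - c) / 2\<close>.\<close>

lemma ex_almost_fixed:
 assumes one: "(%_. 1) : Br" and c: "0 <= c" "c < 1" and fs: "fs ~= []"
 shows "EX g. sq_int g & c * (nm g)^2 < Re (hinner l2fun (LR.avg fs g) g)"
proof (rule ccontr)
 assume "\<nexists>g. sq_int g & c * (nm g)^2 < Re (hinner l2fun (LR.avg fs g) g)"
 hence neg: "!!g. sq_int g ==> Re (hinner l2fun (LR.avg fs g) g) <= c * (nm g)^2" by (meson not_le)
 have c1: "c <= 1" using c by simp
 obtain f0 :: "'g => real" where f0: "Cc f0" "!!t. 0 <= f0 t" "0 < (LI t. f0 t)" by (rule ex_Cc_integral_pos) blast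
 define f where "f t = complex_of_real (f0 t)" for t
 have f: "intg f" unfolding f_def[abs_def] using Cc_integrable[OF f0(1)] by simp
 have K: "kills_lambda (pseq fs c f)" by (rule pseq_kills_lambda[OF f c(1) c1 neg])
 interpret S: self_adjoint_contraction complex_hspace "TR.avg fs" c by (rule TR.self_adjoint_contraction_avg[OF c(1) c1])
 have u: "coefficient complex_hspace trivial_rep 1 1 = (%_::'g. 1)"
  by (simp add: coefficient_def complex_hspace_def trivial_rep_def)
 have T1: "hinner complex_hspace (TR.avg fs 1) 1 = 1"
  using TR.inner_lincomb[of 1 1 "avg_list fs"] fs
  by (simp add: u lin_avg_list sum_list_triv) (simp add: complex_hspace_def)
 have P: "(1 - c) / 2 <= Re (S.P n 1)" for n
 proof -
  have "hinner complex_hspace (S.W 1) 1 = of_real ((1 - c) / 2)"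
   using S.W_inner(1)[of 1 1] unfolding T1 by (simp add: ch_sel)
  hence "Re (hinner complex_hspace (S.W 1) 1) = (1 - c) / 2" by (simp only: Re_complex_of_real)
  thus ?thesis using S.P_lower[of 1 n] by (simp add: ch_sel)
 qed
 let ?I = "LI t. f0 t"
 have "(1 - c) / 2 * ?I <= cmod (LI s. pseq fs c f n s * 1)" for n
 proof -
  have "(LI s. pseq fs c f n s * coefficient complex_hspace trivial_rep 1 1 s) =
    (LI s. f s * coefficient complex_hspace trivial_rep 1 (S.P n 1) s)"
   by (rule pseq_pairing[OF TR.semi_rep_axioms _ _ _ f c(1) c1])
    (simp_all add: coefficient_def[abs_def] complex_hspace_def trivial_rep_def)
  also have "... = (LI s. f s) * cnj (S.P n 1)"
   by (simp add: coefficient_def complex_hspace_def trivial_rep_def)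
  also have "(LI s. f s) = of_real ?I" by (simp add: f_def)
  finally have "(LI s. pseq fs c f n s * 1) = of_real ?I * cnj (S.P n 1)" by (simp add: u)
  hence "cmod (LI s. pseq fs c f n s * 1) = ?I * cmod (S.P n 1)" using f0(3) by (simp add: norm_mult)
  moreover have "(1 - c) / 2 <= cmod (S.P n 1)" by (rule order_trans[OF P complex_Re_le_cmod])
  ultimately show ?thesis using f0(3) by (simp add: mult.commute mult_left_mono)
 qed
 moreover have "(%n. cmod (LI s. pseq fs c f n s * 1)) \<longlonglongrightarrow> cmod 0"
  using pairing_tendsto[OF kills_lambdaD[OF K] subsetD[OF Br_subset one]] Br_pairing[OF one K] by (intro tendsto_norm) simp
 ultimately have "(1 - c) / 2 * ?I <= cmod 0" by (intro LIMSEQ_le_const) auto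
 moreover have "0 < (1 - c) / 2 * ?I" using c f0(3) by simp
 ultimately show False by simp
qed

lemma ex_almost_invariant:
 assumes one: "(%_. 1) : Br" and F: "finite F" and e: "e > 0"
 shows "EX \<xi>. sq_int \<xi> & nm \<xi> = 1 & (ALL s:F. nm (%t. \<xi> (s + t) - \<xi> t) <= e)"
proof -
 obtain gs where gs: "set gs = insert 0 F" using finite_list[of "insert 0 F"] F by auto
 define N where "N = real (2 * length gs)"
 have ne: "gs ~= []" using gs by auto
 hence N: "N >= 1" by (cases gs) (auto simp: N_def)
 \<comment> \<open>The defects \<open>h s\<close> are nonnegative and their sum over the list and
   its inverses is below \<open>(1 - c) N <= e^2 / 2\<close>, so each single one is; the squared
   displacement of the unit vector by one translation is twice such a defect.\<close>
 define c where "c = max 0 (1 - e^2 / (2 * N))"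
 have c: "0 <= c" "c < 1" "1 - c <= e^2 / (2 * N)" using e N by (auto simp: c_def)
 obtain g where g: "sq_int g" "c * (nm g)^2 < Re (hinner l2fun (LR.avg gs g) g)"
  using ex_almost_fixed[OF one c(1,2) ne] by blast
 have "nm g ~= 0"
 proof
  assume "nm g = 0"
  hence "cmod (hinner l2fun (LR.avg gs g) g) <= 0"
   using LR.Cauchy_Schwarz[of "LR.avg gs g" g] LR.lincomb_closed[of g] g(1) by (simp add: hnorm_l2fun del: l2fun_sel(4))
  with g(2) \<open>nm g = 0\<close> show False by (simp del: l2fun_sel(4))
 qed
 hence n: "nm g > 0" using nm_nonneg[of g] by linarith
 define \<xi> where "\<xi> t = of_real (1 / nm g) * g t" for t
 have \<xi>: "sq_int \<xi>" unfolding \<xi>_def[abs_def] by (rule sq_int_scale[OF g(1)])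
 have n1: "nm \<xi> = 1" unfolding \<xi>_def[abs_def] nm_scale using n by (simp add: norm_divide)
 have "\<xi> = hscale l2fun (of_real (1 / nm g)) g" by (simp add: \<xi>_def[abs_def])
 define h where "h s = 1 - Re (lamc \<xi> \<xi> s)" for s
 have h0: "h s >= 0" for s
  using lamc_bound[OF \<xi> \<xi>, of s] complex_Re_le_cmod[of "lamc \<xi> \<xi> s"] n1 by (simp add: h_def)
 have "lin (lamc g g) (avg_list gs) = hinner l2fun (LR.avg gs g) g"
  using LR.inner_lincomb[of g g "avg_list gs"] g(1) by (simp add: lamc_def del: l2fun_sel(4))
 with g(2) have "c * (nm g)^2 < Re (lin (lamc g g) (avg_list gs))" by simp
 moreover have "lamc \<xi> \<xi> = (%s. of_real (1 / (nm g)^2) * lamc g g s)"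
  unfolding \<xi>_def[abs_def] lamc_scale using n by (simp add: power2_eq_square)
 hence "lin (lamc \<xi> \<xi>) (avg_list gs) = of_real (1 / (nm g)^2) * lin (lamc g g) (avg_list gs)" by (simp only: lin_const_mult)
 hence "Re (lin (lamc \<xi> \<xi>) (avg_list gs)) = Re (lin (lamc g g) (avg_list gs)) / (nm g)^2"
  by (simp del: of_real_divide of_real_power)
 ultimately have "c < Re (lin (lamc \<xi> \<xi>) (avg_list gs))" using n by (simp add: pos_less_divide_eq)
 also have "Re (lin (lamc \<xi> \<xi>) (avg_list gs)) = 1 - (\<Sum>s\<leftarrow>gs. h s + h (- s)) / N"
 proof -
  have "Re (\<Sum>s\<leftarrow>fs. lamc \<xi> \<xi> s + lamc \<xi> \<xi> (- s)) = real (2 * length fs) - (\<Sum>s\<leftarrow>fs. h s + h (- s))" for fs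
   by (induction fs) (auto simp: h_def)
  moreover have "Re (z / of_nat k) = Re z / real k" for z k by (metis Re_divide_of_real of_real_of_nat_eq)
  ultimately show ?thesis using ne by (simp add: lin_avg_list N_def diff_divide_distrib del: of_nat_mult)
 qed
 finally have "(\<Sum>s\<leftarrow>gs. h s + h (- s)) < (1 - c) * N" using N by (simp add: field_simps)
 also have "... <= e^2 / (2 * N) * N" by (rule mult_right_mono[OF c(3)]) (use N in simp)
 finally have S: "(\<Sum>s\<leftarrow>gs. h s + h (- s)) < e^2 / 2" using N by simp
 have "nm (%t. \<xi> (s + t) - \<xi> t) <= e" if s: "s : F" for s
 proof (rule power2_le_imp_le)
  have "h (- s) <= h s + h (- s)" using h0[of s] by simp
  also have "... <= (\<Sum>s\<leftarrow>gs. h s + h (- s))"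
   by (rule member_le_sum_list) (use s gs h0 in "auto intro: add_nonneg_nonneg")
  finally have hs: "h (- s) < e^2 / 2" using S by simp
  have l: "lreg (- s) \<xi> = (%t. \<xi> (s + t))" by (simp add: lreg_def)
  have d: "hdiff l2fun (lreg (- s) \<xi>) \<xi> = (%t. \<xi> (s + t) - \<xi> t)" by (simp add: l)
  have "(hnorm l2fun (hdiff l2fun (lreg (- s) \<xi>) \<xi>))^2 = (hnorm l2fun (lreg (- s) \<xi>))^2 +
    2 * Re (hinner l2fun (lreg (- s) \<xi>) (hscale l2fun (- 1) \<xi>)) + (hnorm l2fun (hscale l2fun (- 1) \<xi>))^2"
   by (rule LR.hnorm_add_square) (use \<xi> sq_int_lreg[OF \<xi>] sq_int_scale[OF \<xi>, of "- 1"] in auto)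
  also have "hinner l2fun (lreg (- s) \<xi>) (hscale l2fun (- 1) \<xi>) = - lamc \<xi> \<xi> (- s)"
   by (simp add: lamc_eq l)
  also have "hnorm l2fun (hscale l2fun (- 1) \<xi>) = 1"
   using LR.hnorm_scale[of \<xi> "- 1"] \<xi> n1 by (simp add: hnorm_l2fun)
  also have "hnorm l2fun (lreg (- s) \<xi>) = 1" using nm_lreg[OF \<xi>] n1 by (simp add: hnorm_l2fun)
  finally show "(nm (%t. \<xi> (s + t) - \<xi> t))^2 <= e^2" using hs unfolding d hnorm_l2fun by (simp add: h_def)
 qed (use e in simp)
 with \<xi> n1 show ?thesis by blast
qed

subsection \<open>The mean\<close>

lemma sq_int_bounded_mult:
 assumes f: "f : Meas" "!!t. cmod (f t) <= B" and g: "sq_int g"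
 shows "sq_int (%t. f t * g t)" "nm (%t. f t * g t) <= B * nm g"
proof -
 have B: "B >= 0" using order_trans[OF norm_ge_zero f(2)] .
 have le: "(cmod (f t * g t))^2 <= B^2 * (cmod (g t))^2" for t
  unfolding norm_mult power_mult_distrib by (intro mult_right_mono power_mono f) auto
 have m: "(%t. f t * g t) : Meas" using f(1) g by (auto simp: sq_int_def)
 have ig: "intg (%t. B^2 * (cmod (g t))^2)" using g by (simp add: sq_int_def)
 have i: "intg (%t. (cmod (f t * g t))^2)"
  by (rule Bochner_Integration.integrable_bound[OF ig]) (use m le in "auto intro!: AE_I2 simp: abs_of_nonneg")
 with m show "sq_int (%t. f t * g t)" by (simp add: sq_int_def)
 have "(LI t. (cmod (f t * g t))^2) <= B^2 * (LI t. (cmod (g t))^2)"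
  using integral_mono[OF i ig le] by simp
 hence "sqrt (LI t. (cmod (f t * g t))^2) <= sqrt (B^2 * (LI t. (cmod (g t))^2))" by (rule real_sqrt_le_mono)
 thus "nm (%t. f t * g t) <= B * nm g" using B by (simp add: nm_def real_sqrt_mult)
qed

lemma cmod_integral_cnj_le:
 assumes "sq_int f" "sq_int g"
 shows "cmod (LI t. f t * cnj (g t)) <= nm f * nm g"
 using LR.Cauchy_Schwarz[of f g] assms by (simp add: hnorm_l2fun)

definition vstate :: "'g fn => 'g fn => complex" where
 "vstate \<xi> f = (LI t. f t * \<xi> t * cnj (\<xi> t))"

lemma bounded_borelE:
 assumes "f : bounded_borel"
 obtains B where "f : Meas" "!!t. cmod (f t) <= B"
proof -
 obtain B where "ALL x:range f. norm x <= B" using assms unfolding bounded_borel_def bounded_iff by auto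
 hence "!!t. cmod (f t) <= B" by auto
 with assms show ?thesis by (intro that[of B]) (auto simp: bounded_borel_def)
qed

lemma vstate_linear:
 assumes \<xi>: "sq_int \<xi>" and f: "f : bounded_borel" and g: "g : bounded_borel"
 shows "vstate \<xi> (%t. a * f t + b * g t) = a * vstate \<xi> f + b * vstate \<xi> g"
proof -
 have "intg (%t. f t * \<xi> t * cnj (\<xi> t))" if f: "f : bounded_borel" for f
 proof -
  obtain B where "f : Meas" "!!t. cmod (f t) <= B" by (rule bounded_borelE[OF f]) blast
  from sq_int_mult_integrable[OF sq_int_bounded_mult(1)[OF this \<xi>] \<xi>] show ?thesis .
 qed
 from this[OF f] this[OF g] show ?thesis by (simp add: vstate_def distrib_right mult.assoc)
qed

lemma vstate_one: "sq_int \<xi> ==> nm \<xi> = 1 ==> vstate \<xi> (%t. 1) = 1"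
 using LR.inner_self[of \<xi>] by (simp add: vstate_def hnorm_l2fun)

text \<open>Vector states do not charge locally null sets: the density is integrable, hence within
  any \<open>e\<close> in mean of a function of compact support, and on a compact set the
  exceptional set is null.\<close>

lemma vstate_le:
 assumes \<xi>: "sq_int \<xi>" "nm \<xi> = 1" and f: "f : Meas" and c: "locally_null \<mu> {t. cmod (f t) > c}"
 shows "cmod (vstate \<xi> f) <= c"
proof -
 let ?A = "{t. cmod (f t) > c}" and ?p = "%t. \<xi> t * cnj (\<xi> t)"
 have A: "?A : sets borel" "!!K. compact K ==> emeasure \<mu> (?A \<inter> K) = 0" using c by (auto simp: locally_null_def)
 have p: "intg ?p" by (rule sq_int_mult_integrable[OF \<xi>(1) \<xi>(1)])
 have cp: "cmod (?p t) = (cmod (\<xi> t))^2" for t by (simp add: norm_mult power2_eq_square)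
 have ip: "intg (%t. (cmod (\<xi> t))^2)" using \<xi>(1) by (simp add: sq_int_def)
 have "(LI t. indicator ?A t * (cmod (\<xi> t))^2) <= 0 + e" if e: "e > 0" for e
 proof -
  obtain k where k: "Cc k" "(LI t. cmod (?p t - k t)) < e" using Cc_dense_L1[OF p e] by blast
  obtain K where K: "compact K" "!!t. t ~: K ==> k t = 0" by (rule CcE[OF k(1)]) blast
  have "AE t in \<mu>. t ~: ?A \<inter> K"
   by (rule AE_not_in) (use A K(1) borel_compact in "auto simp: null_sets_def")
  hence ae: "AE t in \<mu>. indicator ?A t * (cmod (\<xi> t))^2 <= cmod (?p t - k t)"
  proof eventually_elim
   case (elim t)
   thus ?case using K(2)[of t] cp[of t] by (auto simp: indicator_def)
  qed
  have "(LI t. indicator ?A t * (cmod (\<xi> t))^2) <= (LI t. cmod (?p t - k t))"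
   by (rule integral_mono_AE[OF _ _ ae])
    (use p Cc_integrable[OF k(1)] integrable_mult_indicator[OF _ ip, of ?A] A(1) in auto)
  with k(2) show ?thesis by simp
 qed
 hence "(LI t. indicator ?A t * (cmod (\<xi> t))^2) <= 0" by (rule field_le_epsilon)
 moreover have "(LI t. indicator ?A t * (cmod (\<xi> t))^2) >= 0" by (rule Bochner_Integration.integral_nonneg) simp
 ultimately have "(LI t. indicator ?A t * (cmod (\<xi> t))^2) = 0" by simp
 hence "AE t in \<mu>. indicator ?A t * (cmod (\<xi> t))^2 = 0"
  using integral_nonneg_eq_0_iff_AE[of \<mu> "%t. indicator ?A t * (cmod (\<xi> t))^2"]
   integrable_mult_indicator[OF _ ip, of ?A] A(1) by simp
 hence ae: "AE t in \<mu>. cmod (f t * \<xi> t * cnj (\<xi> t)) <= c * (cmod (\<xi> t))^2"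
 proof eventually_elim
  case (elim t)
  show ?case
  proof (cases "t : ?A")
   case False
   hence "cmod (f t) * (cmod (\<xi> t))^2 <= c * (cmod (\<xi> t))^2" by (intro mult_right_mono) auto
   thus ?thesis by (simp add: norm_mult power2_eq_square mult.assoc)
  qed (use elim in auto)
 qed
 have ic: "intg (%t. c * (cmod (\<xi> t))^2)" using ip by simp
 have m: "(%t. f t * \<xi> t * cnj (\<xi> t)) : borel_measurable \<mu>" using f \<xi>(1) by (auto simp: sq_int_def)
 have "intg (%t. f t * \<xi> t * cnj (\<xi> t))"
  by (rule Bochner_Integration.integrable_bound[OF ic m]) (use ae in "eventually_elim, auto")
 hence "cmod (vstate \<xi> f) <= (LI t. c * (cmod (\<xi> t))^2)"
  unfolding vstate_def by (intro order_trans[OF integral_norm_bound integral_mono_AE[OF integrable_norm ic ae]])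
 also have "... = c" using \<xi>(2) by (simp add: nm_def)
 finally show ?thesis .
qed

lemma vstate_invariant:
 assumes \<xi>: "sq_int \<xi>" "nm \<xi> = 1" and f: "f : Meas" "!!t. cmod (f t) <= B"
 shows "cmod (vstate \<xi> (%t. f (- s + t)) - vstate \<xi> f) <= 2 * B * nm (%t. \<xi> (s + t) - \<xi> t)"
proof -
 let ?eta = "%t. \<xi> (s + t)"
 have eta: "sq_int ?eta" by (rule sq_int_translate[OF \<xi>(1)])
 have n: "nm ?eta = 1" using nm_lreg[OF \<xi>(1), of "- s"] \<xi>(2) by (simp add: lreg_def)
 have d: "sq_int (%t. ?eta t - \<xi> t)" by (rule sq_int_diff[OF eta \<xi>(1)])
 note b = sq_int_bounded_mult[OF f]
 have m: "(%t. f t * ?eta t * cnj (?eta t)) : Meas" using f(1) eta by (auto simp: sq_int_def)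
 have "vstate \<xi> (%t. f (- s + t)) = (LI t. f t * ?eta t * cnj (?eta t))"
  using integral_translate'[OF m, of s] by (simp add: vstate_def add.assoc[symmetric])
 hence "vstate \<xi> (%t. f (- s + t)) - vstate \<xi> f =
   (LI t. f t * ?eta t * cnj (?eta t)) - (LI t. f t * \<xi> t * cnj (\<xi> t))" by (simp add: vstate_def)
 also have "... = (LI t. f t * ?eta t * cnj (?eta t) - f t * \<xi> t * cnj (\<xi> t))"
  by (rule Bochner_Integration.integral_diff[symmetric]; rule sq_int_mult_integrable[OF b(1)]; fact)
 also have "... = (LI t. f t * (?eta t - \<xi> t) * cnj (?eta t) + f t * \<xi> t * cnj (?eta t - \<xi> t))"
  by (simp add: algebra_simps)
 also have "... = (LI t. f t * (?eta t - \<xi> t) * cnj (?eta t)) + (LI t. f t * \<xi> t * cnj (?eta t - \<xi> t))"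
  by (rule Bochner_Integration.integral_add; rule sq_int_mult_integrable[OF b(1)]; fact)
 also have "cmod ... <= B * nm (%t. ?eta t - \<xi> t) * nm ?eta + B * nm \<xi> * nm (%t. ?eta t - \<xi> t)"
  by (rule norm_triangle_mono; rule order_trans[OF cmod_integral_cnj_le[OF b(1)] mult_right_mono[OF b(2)]])
   (use \<xi> eta d in auto)
 finally show ?thesis using n \<xi>(2) by simp
qed

text \<open>A mean is a cluster point of vector states in a product of discs.\<close>

lemma amenable_if_one_in_Br:
 assumes one: "(%_. 1) : Br"
 shows "amenable \<mu>"
proof -
 let ?X = "bounded_borel :: 'g fn set"
 define bd where "bd f = (SUP t. cmod (f t))" for f :: "'g fn"
 have bd: "cmod (f t) <= bd f" if f: "f : ?X" for f t
 proof -
  obtain B where "!!t. cmod (f t) <= B" by (rule bounded_borelE[OF f]) blast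
  thus ?thesis unfolding bd_def by (intro cSUP_upper bdd_aboveI2) auto
 qed
 have XC: "f : Meas" if "f : ?X" for f using that by (simp add: bounded_borel_def)
 have bd0: "0 <= bd f" if "f : ?X" for f using order_trans[OF norm_ge_zero bd[OF that]] by blast
 note lc = bounded_borel_lincomb
 have oneX: "(%t. 1) : ?X" by (simp add: bounded_borel_def)
 have tr: "(%t. f (- s + t)) : ?X" if "f : ?X" for f s
  using that measurable_comp_translate[of f "- s"] unfolding bounded_borel_def bounded_iff by auto
 \<comment> \<open>Off \<open>bounded_borel\<close> the disc has radius 0 and the states are set to
   0, so that all functions may index one compact product.\<close>
 define K where "K = Pi\<^sub>E UNIV (%f. cball (0::complex) (if f : ?X then bd f else 0))"
 have K: "compact K"
  using compactin_PiE[of "%_. euclidean :: complex topology" UNIV "%f. cball (0::complex) (if f : ?X then bd f else 0)"]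
  by (simp add: K_def euclidean_product_topology)
 have "EX \<xi>. sq_int \<xi> & nm \<xi> = 1 & (finite F --> (ALL s:F. nm (%t. \<xi> (s + t) - \<xi> t) <= 1 / real (Suc n)))" for F n
  using ex_almost_invariant[OF one, of F "1 / real (Suc n)"] ex_almost_invariant[OF one, of "{}" 1] by (cases "finite F") auto
 then obtain \<xi> where \<xi>: "!!F n. sq_int (\<xi> F n)" "!!F n. nm (\<xi> F n) = 1"
  "!!F n s. finite F ==> s : F ==> nm (%t. \<xi> F n (s + t) - \<xi> F n t) <= 1 / real (Suc n)" by metis
 define v where "v p f = (if f : ?X then vstate (\<xi> (fst p) (snd p)) f else 0)" for p f
 have b: "cmod (v p f) <= c" if "f : ?X" "locally_null \<mu> {t. cmod (f t) > c}" for p f c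
  using that vstate_le[OF \<xi>(1,2) XC] by (simp add: v_def)
 have "cmod (v p f) <= bd f" if f: "f : ?X" for p f
  by (rule b[OF f]) (use bd[OF f] in "simp add: locally_null_def not_less[symmetric]")
 hence vK: "v p : K" for p by (simp add: K_def v_def PiE_iff)
 \<comment> \<open>The states are indexed by a finite set of translations and a precision; along
   this filter every translation is eventually included and the precision improves.\<close>
 define Phi where "Phi = filtermap v (finite_subsets_at_top UNIV \<times>\<^sub>F sequentially)"
 have "Phi ~= bot" by (simp add: Phi_def filtermap_bot_iff prod_filter_eq_bot)
 moreover have "eventually (%x. x : K) Phi" by (simp add: Phi_def eventually_filtermap vK)
 ultimately obtain m where m: "inf (nhds m) Phi ~= bot" using K unfolding compact_filter by meson
 define Psi where "Psi = inf (nhds m) Phi"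
 have nb: "Psi ~= bot" using m by (simp add: Psi_def)
 have ev: "eventually P Psi" if "eventually (%p. P (v p)) (finite_subsets_at_top UNIV \<times>\<^sub>F sequentially)" for P
  using that filter_leD[of Psi Phi P] by (simp add: Psi_def Phi_def eventually_filtermap)
 have lim: "((%n. n f) \<longlongrightarrow> m f) Psi" for f
 proof (rule topological_tendstoI)
  fix S assume "open S" "m f : S"
  hence "eventually (%n. n : (%n. n f) -` S) (nhds m)"
   by (intro eventually_nhds_in_open open_vimage continuous_on_product_coordinates) auto
  thus "eventually (%n. n f : S) Psi" using filter_leD[of Psi "nhds m"] by (simp add: Psi_def)
 qed
 have "m (%t. a * f t + b * g t) = a * m f + b * m g" if fg: "f : ?X" "g : ?X" for f g a b
 proof (rule tendsto_unique[OF nb lim])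
  have e: "eventually (%n. a * n f + b * n g = n (%t. a * f t + b * g t)) Psi"
   by (rule ev) (use fg in \<open>simp add: v_def lc vstate_linear \<xi>\<close>)
  have "((%n. a * n f + b * n g) \<longlongrightarrow> a * m f + b * m g) Psi" by (intro tendsto_intros lim)
  thus "((%n. n (%t. a * f t + b * g t)) \<longlongrightarrow> a * m f + b * m g) Psi" by (rule Lim_transform_eventually[OF _ e])
 qed
 moreover have "m (%t. 1) = 1"
 proof (rule tendsto_unique[OF nb lim tendsto_eventually])
  show "eventually (%n. n (%t. 1) = 1) Psi" by (rule ev) (simp add: v_def oneX vstate_one \<xi>)
 qed
 moreover have "cmod (m f) <= c" if "f : ?X" "locally_null \<mu> {t. cmod (f t) > c}" for f c
  by (rule tendsto_upperbound[OF tendsto_norm[OF lim] _ nb], rule ev) (simp add: b that)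
 moreover have "m (%t. f (- s + t)) = m f" if f: "f : ?X" for f s
 proof -
  have "cmod (m (%t. f (- s + t)) - m f) <= 0 + d" if d: "d > 0" for d
  proof (rule tendsto_upperbound[OF tendsto_norm[OF tendsto_diff[OF lim lim]] _ nb], rule ev)
   have "eventually (%n. 2 * bd f * (1 / real (Suc n)) < d) sequentially"
    using order_tendstoD(2)[OF tendsto_mult_right_zero[OF tendsto_inverse_Suc] d] by blast
   moreover have "eventually (%F. finite F & s : F) (finite_subsets_at_top UNIV)"
    unfolding eventually_finite_subsets_at_top by (rule exI[of _ "{s}"]) auto
   ultimately have "eventually (%p. (finite (fst p) & s : fst p) & 2 * bd f * (1 / real (Suc (snd p))) < d)
     (finite_subsets_at_top UNIV \<times>\<^sub>F sequentially)" by (rule eventually_prodI[rotated])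
   thus "eventually (%p. cmod (v p (%t. f (- s + t)) - v p f) <= 0 + d) (finite_subsets_at_top UNIV \<times>\<^sub>F sequentially)"
   proof eventually_elim
    case (elim p)
    have "cmod (v p (%t. f (- s + t)) - v p f) <= 2 * bd f * (1 / real (Suc (snd p)))"
     using order_trans[OF vstate_invariant[OF \<xi>(1,2) XC[OF f] bd[OF f]] mult_left_mono[OF \<xi>(3)]] elim bd0[OF f] f tr[OF f]
     by (simp add: v_def)
    with elim show ?case by linarith
   qed
  qed
  thus ?thesis using field_le_epsilon[of "cmod (m (%t. f (- s + t)) - m f)" 0] by simp
 qed
 ultimately show ?thesis unfolding amenable_def left_invariant_mean_def by blast
qed

end

section \<open>From an invariant mean to the reduced Fourier--Stieltjes algebra\<close>

context haar
begin

text \<open>The operator \<open>\<lambda>(a)\<close> on real functions; \<open>cv' a\<close> is its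
  adjoint, as \<open>integral_cv\<close> shows.\<close>

definition cv :: "('g => real) => ('g => real) => 'g => real" where
 "cv a F t = (LI s. a s * F (- s + t))"

definition cv' :: "('g => real) => ('g => real) => 'g => real" where
 "cv' a F t = (LI r. a r * F (r + t))"

lemma compact_sum: "compact K ==> compact L ==> compact {x + y | x y. x : K & y : L}"
 for K L :: "'g set"
proof -
 assume "compact K" "compact L"
 hence "compact ((%p. fst p + snd p) ` (K \<times> L))"
  by (intro compact_continuous_image compact_Times continuous_intros)
 moreover have "(%p. fst p + snd p) ` (K \<times> L) = {x + y | x y. x : K & y : L}" by force
 ultimately show ?thesis by simp
qed

lemma compact_uminus: "compact K ==> compact (uminus ` K)" for K :: "'g set"
 by (intro compact_continuous_image continuous_intros)

lemma continuous_cont: "cont F ==> cont g ==> cont (%x. F (g x))"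
 by (rule continuous_on_compose2[where t = UNIV]) auto

lemma
 fixes a F :: "'g => real"
 assumes a: "Cc a" and F: "cont F"
 shows cv_continuous: "cont (cv a F)" and cv'_continuous: "cont (cv' a F)"
  and cv_integrable: "intg (%s. a s * F (- s + t))" and cv'_integrable: "intg (%r. a r * F (r + t))"
proof -
 obtain K where K: "compact K" "!!t. t ~: K ==> a t = 0" by (rule CcE[OF a]) blast
 note c = continuous_cont[OF Cc_continuous[OF a]] continuous_cont[OF F]
 show "cont (cv a F)" unfolding cv_def[abs_def]
  by (rule continuous_integral[OF _ K(1)]) (use K(2) in "auto intro!: continuous_intros c")
 show "cont (cv' a F)" unfolding cv'_def[abs_def]
  by (rule continuous_integral[OF _ K(1)]) (use K(2) in "auto intro!: continuous_intros c")
 show "intg (%s. a s * F (- s + t))"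
  by (rule Cc_integrable[OF Cc_mult_left[OF a]]) (intro c continuous_intros)
 show "intg (%r. a r * F (r + t))"
  by (rule Cc_integrable[OF Cc_mult_left[OF a]]) (intro c continuous_intros)
qed

lemma
 fixes a F :: "'g => real"
 assumes a: "Cc a" and F: "Cc F"
 shows Cc_cv: "Cc (cv a F)" and Cc_cv': "Cc (cv' a F)"
proof -
 obtain K where K: "compact K" "!!t. t ~: K ==> a t = 0" by (rule CcE[OF a]) blast
 obtain L where L: "compact L" "!!t. t ~: L ==> F t = 0" by (rule CcE[OF F]) blast
 show "Cc (cv a F)"
 proof (rule CcI[OF cv_continuous[OF a Cc_continuous[OF F]] compact_sum[OF K(1) L(1)]])
  fix t assume t: "t ~: {x + y |x y. x : K & y : L}"
  have "a s * F (- s + t) = 0" for s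
  proof (cases "s : K & - s + t : L")
   case True
   hence "s + (- s + t) : {x + y |x y. x : K & y : L}" by blast
   with t show ?thesis by (simp only: add_minus_cancel minus_add_cancel)
  qed (use K L in auto)
  thus "cv a F t = 0" by (simp only: cv_def Bochner_Integration.integral_zero)
 qed
 show "Cc (cv' a F)"
 proof (rule CcI[OF cv'_continuous[OF a Cc_continuous[OF F]] compact_sum[OF compact_uminus[OF K(1)] L(1)]])
  fix t assume t: "t ~: {x + y |x y. x : uminus ` K & y : L}"
  have "a r * F (r + t) = 0" for r
  proof (cases "r : K & r + t : L")
   case True
   hence "- r + (r + t) : {x + y |x y. x : uminus ` K & y : L}" by blast
   with t show ?thesis by (simp only: add_minus_cancel minus_add_cancel)
  qed (use K L in auto)
  thus "cv' a F t = 0" by (simp only: cv'_def Bochner_Integration.integral_zero)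
 qed
qed

lemma cv_add:
 assumes "Cc a" "Cc b" "cont F"
 shows "cv (%t. a t + b t) F t = cv a F t + cv b F t"
 using assms cv_integrable by (simp add: cv_def distrib_right)

lemma cv_scale: "cv (%t. r * a t) F t = r * cv a F t"
 by (simp add: cv_def mult.assoc)

lemma cv_nonneg: "(!!t. 0 <= a t) ==> (!!t. 0 <= F t) ==> 0 <= cv a F t"
 by (simp add: cv_def Bochner_Integration.integral_nonneg)

lemma cv'_nonneg: "(!!t. 0 <= a t) ==> (!!t. 0 <= F t) ==> 0 <= cv' a F t"
 by (simp add: cv'_def Bochner_Integration.integral_nonneg)

lemma cv_mono:
 assumes "Cc a" "Cc b" "cont F" "!!t. a t <= b t" "!!t. 0 <= F t"
 shows "cv a F t <= cv b F t"
 unfolding cv_def by (intro integral_mono cv_integrable assms mult_right_mono)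

lemma cv_translate:
 assumes "Cc a" "cont F"
 shows "cv a F (- q + t) = cv (%s. a (- q + s)) F t"
proof -
 have "(%s. a (- q + s) * F (- s + t)) : Meas"
  by (intro borel_measurable_continuous_onI continuous_intros continuous_cont[OF Cc_continuous[OF assms(1)]] continuous_cont[OF assms(2)])
 from integral_translate[OF this, of q] show ?thesis by (simp add: cv_def minus_add add.assoc[symmetric])
qed

lemma Cc_cmult: "Cc F ==> Cc (%t. r * F t)" for F :: "'g => real"
 by (rule Cc_mult_right) auto

lemma integral_cv:
 assumes a: "Cc a" and F: "Cc F" and H: "cont H"
 shows "(LI t. cv a F t * H t) = (LI s. a s * (LI t. F (- s + t) * H t))" (is "?A = ?B")
  and "(LI t. cv a F t * H t) = (LI t. F t * cv' a H t)"
proof -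
 obtain K where K: "compact K" "!!t. t ~: K ==> a t = 0" by (rule CcE[OF a]) blast
 obtain L where L: "compact L" "!!t. t ~: L ==> F t = 0" by (rule CcE[OF F]) blast
 note c = continuous_cont[OF Cc_continuous[OF a]] continuous_cont[OF Cc_continuous[OF F]] continuous_cont[OF H]
 have "(LI t. cv a F t * H t) = (LI t. LI s. a s * F (- s + t) * H t)"
  unfolding cv_def by (simp only: integral_mult_left_zero)
 also have "... = (LI s. LI t. a s * F (- s + t) * H t)"
 proof (rule Fubini_Cc[OF _ compact_sum[OF K(1) L(1)] _ K(1)])
  show "a s * F (- s + t) * H t = 0" if "t ~: {x + y |x y. x : K & y : L}" for t s
  proof (cases "s : K & - s + t : L")
   case True
   hence "s + (- s + t) : {x + y |x y. x : K & y : L}" by blast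
   with that show ?thesis by (simp only: add_minus_cancel minus_add_cancel)
  qed (use K L in auto)
 qed (use K in "auto intro!: continuous_intros c")
 finally show 1: "?A = ?B" by (simp add: mult.assoc)
 have "(LI t. F (- s + t) * H t) = (LI t. F t * H (s + t))" for s
 proof -
  have "(%t. F (- s + t) * H t) : Meas"
   by (intro borel_measurable_continuous_onI continuous_intros c)
  from integral_translate[OF this, of s] show ?thesis by simp
 qed
 hence "?B = (LI s. LI t. a s * (F t * H (s + t)))" by simp
 also have "... = (LI t. LI s. a s * (F t * H (s + t)))"
  by (rule Fubini_Cc[OF _ K(1) _ L(1)]) (use K L in "auto intro!: continuous_intros c")
 also have "... = (LI t. F t * cv' a H t)"
  unfolding cv'_def by (simp only: mult.left_commute integral_mult_right_zero)
 finally show "?A = (LI t. F t * cv' a H t)" using 1 by simp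
qed

lemma cv_assoc:
 assumes f: "Cc f" and k: "Cc k" and F: "cont F"
 shows "cv (cv f k) F t = cv f (cv k F) t"
proof -
 have c: "cont (%s. F (- s + t))" by (intro continuous_cont[OF F] continuous_intros)
 have "(LI s. k (- u + s) * F (- s + t)) = cv k F (- u + t)" for u
  using cv_translate[OF k F, of u t] by (simp add: cv_def)
 thus ?thesis using integral_cv(1)[OF f k c] by (simp add: cv_def)
qed

lemma cv'_cv:
 assumes f: "Cc f" and k: "Cc k" and F: "cont F"
 shows "cv (cv' f k) F t = cv' f (cv k F) t"
proof -
 obtain K where K: "compact K" "!!t. t ~: K ==> f t = 0" by (rule CcE[OF f]) blast
 obtain L where L: "compact L" "!!t. t ~: L ==> k t = 0" by (rule CcE[OF k]) blast
 note c = continuous_cont[OF Cc_continuous[OF f]] continuous_cont[OF Cc_continuous[OF k]] continuous_cont[OF F]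
 have "cv (cv' f k) F t = (LI s. LI r. f r * k (r + s) * F (- s + t))"
  unfolding cv_def cv'_def by (simp only: integral_mult_left_zero)
 also have "... = (LI r. LI s. f r * k (r + s) * F (- s + t))"
 proof (rule Fubini_Cc[OF _ compact_sum[OF compact_uminus[OF K(1)] L(1)] _ K(1)])
  show "f r * k (r + s) * F (- s + t) = 0" if "s ~: {x + y |x y. x : uminus ` K & y : L}" for r s
  proof (cases "r : K & r + s : L")
   case True
   hence "- r + (r + s) : {x + y |x y. x : uminus ` K & y : L}" by blast
   with that show ?thesis by (simp only: add_minus_cancel minus_add_cancel)
  qed (use K L in auto)
 qed (use K in "auto intro!: continuous_intros c")
 also have "... = (LI r. f r * cv k F (r + t))"
  using cv_translate[OF k F, of "- r" t for r] by (simp add: mult.assoc cv_def)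
 finally show ?thesis by (simp add: cv'_def)
qed

definition n2 :: "('g => real) => real" where
 "n2 F = sqrt (LI t. (F t)^2)"

lemma n2_eq_nm: "n2 F = nm (%t. of_real (F t))"
 by (simp add: n2_def nm_def)

lemma Cc_of_real: "Cc F ==> Cc (%t. complex_of_real (F t))"
 by (rule Cc_compose) (auto intro!: continuous_intros)

lemma lamc_of_real: "lamc (%t. of_real (F t)) (%t. of_real (H t)) s = of_real (LI t. F (- s + t) * H t)"
 unfolding lamc_eq by (simp flip: of_real_mult)

lemma n2_nonneg [simp]: "0 <= n2 F"
 by (simp add: n2_def)

lemma n2_square: "(n2 F)^2 = (LI t. F t * F t)"
 by (simp add: n2_def power2_eq_square[symmetric] Bochner_Integration.integral_nonneg)

lemma inner_le_n2:
 assumes "Cc F" "Cc H"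
 shows "\<bar>LI t. F (- s + t) * H t\<bar> <= n2 F * n2 H"
 using lamc_bound[OF Cc_sq_int[OF Cc_of_real[OF assms(1)]] Cc_sq_int[OF Cc_of_real[OF assms(2)]], of s]
 by (simp only: lamc_of_real n2_eq_nm norm_of_real)

lemma cv_inner_le:
 assumes f: "Cc f" "!!t. 0 <= f t" and F: "Cc F" and H: "Cc H"
 shows "\<bar>LI t. cv f F t * H t\<bar> <= (LI s. f s) * (n2 F * n2 H)"
proof -
 have c: "cont (%s. LI t. F (- s + t) * H t)"
  using lamc_continuous[OF Cc_sq_int[OF Cc_of_real[OF F]] Cc_sq_int[OF Cc_of_real[OF H]]]
  unfolding lamc_of_real[abs_def] by (drule_tac continuous_on_Re) simp
 have "\<bar>LI t. cv f F t * H t\<bar> <= (LI s. \<bar>f s * (LI t. F (- s + t) * H t)\<bar>)"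
  unfolding integral_cv(1)[OF f(1) F Cc_continuous[OF H]] by (rule integral_abs_bound)
 also have "... <= (LI s. f s * (n2 F * n2 H))"
  by (rule integral_mono[OF integrable_abs[OF Cc_integrable[OF Cc_mult_left[OF f(1) c]]]])
   (use Cc_integrable[OF f(1)] f(2) inner_le_n2[OF F H] in "auto simp: abs_mult intro!: mult_left_mono")
 finally show ?thesis by simp
qed

lemma n2_le_if_inner_le:
 assumes "0 <= M" "\<bar>LI t. F t * F t\<bar> <= M * n2 F"
 shows "n2 F <= M"
proof (cases "n2 F = 0")
 case False
 have "n2 F * n2 F <= M * n2 F" using assms(2) by (simp add: n2_square[symmetric] power2_eq_square)
 with False n2_nonneg[of F] show ?thesis by (metis mult_le_cancel_right_pos less_eq_real_def)
qed (use assms in simp)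

lemma n2_cv_le:
 assumes f: "Cc f" "!!t. 0 <= f t" "(LI s. f s) = 1" and F: "Cc F"
 shows "n2 (cv f F) <= n2 F"
 using cv_inner_le[OF f(1,2) F Cc_cv[OF f(1) F]] f(3) by (intro n2_le_if_inner_le) auto

text \<open>A bound of the numerical range of \<open>\<lambda>(f)\<close> becomes a bound of the norm of \<open>(1 + \<lambda>(f))/2\<close>.\<close>

lemma n2_gap:
 assumes f: "Cc f" "!!t. 0 <= f t" "(LI s. f s) = 1"
  and gap: "!!F. Cc F ==> (LI t. cv f F t * F t) <= (1 - e) * (n2 F)^2"
  and k: "Cc k" "!!t. 0 <= k t" "(LI s. k s) = 1"
  and a: "a = (%t. 1/2 * (k t + cv f k t))" and F: "Cc F" and e: "e <= 1"
 shows "(n2 (cv a F))^2 <= (1 - e / 2) * (n2 F)^2"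
proof -
 \<comment> \<open>The identity is not convolution with a function. After smoothing by
   \<open>k\<close> the operator \<open>(1 + \<lambda>(f)) / 2\<close> becomes
   \<open>\<lambda>(a)\<close>.\<close>
 let ?G = "cv k F"
 have G: "Cc ?G" and fG: "Cc (cv f ?G)" using k f F by (auto intro!: Cc_cv)
 have aF: "cv a F = (%t. 1/2 * (?G t + cv f ?G t))"
  unfolding a cv_scale[abs_def]
  by (simp add: fun_eq_iff cv_scale cv_add[OF k(1) Cc_cv[OF f(1) k(1)] Cc_continuous[OF F]] cv_assoc[OF f(1) k(1) Cc_continuous[OF F]])
 have i: "intg (%t. P t * Q t)" if "Cc P" "Cc Q" for P Q :: "'g => real"
  by (rule Cc_integrable[OF Cc_mult_left[OF that(1) Cc_continuous[OF that(2)]]])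
 have "(n2 (cv a F))^2 = (LI t. 1/4 * (?G t * ?G t + 2 * (cv f ?G t * ?G t) + cv f ?G t * cv f ?G t))"
  unfolding n2_square aF by (rule Bochner_Integration.integral_cong) (auto simp: algebra_simps)
 also have "... = 1/4 * ((n2 ?G)^2 + 2 * (LI t. cv f ?G t * ?G t) + (n2 (cv f ?G))^2)"
  using i[OF G G] i[OF fG G] i[OF fG fG] by (simp add: n2_square)
 also have "... <= 1/4 * ((n2 ?G)^2 + 2 * ((1 - e) * (n2 ?G)^2) + (n2 ?G)^2)"
  by (intro mult_left_mono add_mono gap[OF G] power_mono[OF n2_cv_le[OF f G] n2_nonneg]) auto
 also have "... = (1 - e / 2) * (n2 ?G)^2" by (simp add: algebra_simps)
 finally have 1: "(n2 (cv a F))^2 <= (1 - e / 2) * (n2 ?G)^2" .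
 show ?thesis
  by (rule order_trans[OF 1 mult_left_mono[OF power_mono[OF n2_cv_le[OF k F] n2_nonneg]]]) (use e in simp)
qed

end

section \<open>A strictly superharmonic function from a spectral gap\<close>

locale spectral_gap = haar \<mu> for \<mu> :: "'g::{topological_group_add,t2_space} measure" +
 fixes a :: "'g => real" and c :: real
 assumes a: "Cc a" "0 <= a t" "(LI s. a s) = 1"
  and c: "0 < c" "c < 1"
  and gap: "Cc F ==> (n2 (cv a F))^2 <= c * (n2 F)^2"
begin

text \<open>\<open>\<lambda>(a)\<close> times its adjoint, of norm at most \<open>c\<close>. It
  averages \<open>F\<close> over the points \<open>r - s + t\<close> with \<open>r\<close> and
  \<open>s\<close> independent of density \<open>a\<close>, so its law is invariant under
  inversion.\<close>

definition N :: "('g => real) => 'g => real" where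
 "N F = cv a (cv' a F)"

definition y :: "nat => 'g => real" where
 "y n = (N ^^ Suc n) a"

text \<open>Above \<open>c\<close>, so that the series for \<open>h\<close> converges against
  \<open>y 0\<close>; below 1, so that \<open>h\<close> is strictly superharmonic.\<close>

definition theta :: real where
 "theta = (1 + c) / 2"

lemma theta: "c < theta" "0 < theta" "theta < 1"
 using c by (auto simp: theta_def)

text \<open>A positive \<open>N\<close>-superharmonic function; its logarithm will have a bounded coboundary.\<close>

definition h :: "'g => ennreal" where
 "h t = (\<Sum>n. ennreal (y n t / theta ^ n))"

lemma N_Cc: "Cc F ==> Cc (N F)"
 unfolding N_def by (intro Cc_cv Cc_cv' a)

lemma N_nonneg: "(!!t. 0 <= F t) ==> 0 <= N F t"
 unfolding N_def by (intro cv_nonneg cv'_nonneg a)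

lemma Npow: "Cc ((N ^^ n) a)" "0 <= (N ^^ n) a t"
proof -
 have "Cc ((N ^^ n) a) & (ALL t. 0 <= (N ^^ n) a t)" by (induction n) (auto simp: a intro!: N_Cc N_nonneg)
 thus "Cc ((N ^^ n) a)" "0 <= (N ^^ n) a t" by auto
qed

lemma y_Cc: "Cc (y n)" and y_nonneg: "0 <= y n t"
 unfolding y_def by (rule Npow)+

lemma y_Suc: "y (Suc n) = N (y n)"
 by (simp add: y_def)

lemma n2_cv: assumes "Cc F" shows "n2 (cv a F) <= sqrt c * n2 F"
proof (rule power2_le_imp_le)
 have "(sqrt c * n2 F)^2 = c * (n2 F)^2" using c by (simp add: power_mult_distrib)
 with gap[OF assms] show "(n2 (cv a F))^2 <= (sqrt c * n2 F)^2" by simp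
qed (use c in simp)

lemma n2_cv': assumes F: "Cc F" shows "n2 (cv' a F) <= sqrt c * n2 F"
proof (rule n2_le_if_inner_le)
 let ?G = "cv' a F"
 have G: "Cc ?G" by (intro Cc_cv' a F)
 have "(LI t. ?G t * ?G t) = (LI t. cv a ?G t * F t)"
  by (rule integral_cv(2)[OF a(1) G Cc_continuous[OF F], symmetric])
 hence "\<bar>LI t. ?G t * ?G t\<bar> <= n2 (cv a ?G) * n2 F"
  using inner_le_n2[OF Cc_cv[OF a(1) G] F, of 0] by simp
 also have "... <= (sqrt c * n2 ?G) * n2 F" by (rule mult_right_mono[OF n2_cv[OF G]]) simp
 finally show "\<bar>LI t. ?G t * ?G t\<bar> <= sqrt c * n2 F * n2 ?G" by (simp add: mult_ac)
qed (use c in simp)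

lemma n2_y: "n2 (y n) <= c ^ n * n2 (y 0)"
proof (induction n)
 case (Suc n)
 have "n2 (y (Suc n)) <= sqrt c * n2 (cv' a (y n))"
  unfolding y_Suc N_def by (intro n2_cv Cc_cv' a y_Cc)
 also have "... <= sqrt c * (sqrt c * n2 (y n))" using n2_cv'[OF y_Cc] c by (intro mult_left_mono) auto
 also have "... = c * n2 (y n)" using c by (simp flip: mult.assoc)
 also have "... <= c * (c ^ n * n2 (y 0))" using Suc c by (intro mult_left_mono) auto
 finally show ?case by simp
qed simp

lemma h_measurable [measurable]: "h : Meas"
 unfolding h_def[abs_def] using Cc_measurable[OF y_Cc] by measurable

text \<open>Convergence holds in the mean only, by \<open>n2_y\<close> and a geometric series of
  ratio \<open>c / theta\<close>. It yields a single point where \<open>h\<close> is finite, which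
  is all that is used.\<close>

lemma integral_h_finite: "(\<integral>\<^sup>+t. h t * ennreal (y 0 t) \<partial>\<mu>) ~= \<infinity>"
proof -
 note [measurable] = Cc_measurable[OF y_Cc]
 have "(\<integral>\<^sup>+t. h t * ennreal (y 0 t) \<partial>\<mu>) = (\<Sum>n. \<integral>\<^sup>+t. ennreal (y n t / theta ^ n) * ennreal (y 0 t) \<partial>\<mu>)"
  unfolding h_def ennreal_suminf_multc[symmetric] by (rule nn_integral_suminf) simp
 also have "... <= (\<Sum>n. ennreal ((c / theta) ^ n * (n2 (y 0))^2))"
 proof (rule suminf_le)
  fix n
  have i: "intg (%t. y n t * y 0 t)"
   by (rule Cc_integrable[OF Cc_mult_left[OF y_Cc Cc_continuous[OF y_Cc]]])
  have "(\<integral>\<^sup>+t. ennreal (y n t / theta ^ n) * ennreal (y 0 t) \<partial>\<mu>) = (\<integral>\<^sup>+t. ennreal (1 / theta ^ n * (y n t * y 0 t)) \<partial>\<mu>)"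
   using y_nonneg theta by (simp add: ennreal_mult''[symmetric])
  also have "... = ennreal (1 / theta ^ n * (LI t. y n t * y 0 t))"
   using i y_nonneg theta by (subst nn_integral_eq_integral) auto
  also have "... <= ennreal (1 / theta ^ n * (c ^ n * n2 (y 0) * n2 (y 0)))"
  proof (intro ennreal_leI mult_left_mono)
   have "(LI t. y n t * y 0 t) <= n2 (y n) * n2 (y 0)" using inner_le_n2[OF y_Cc y_Cc, of n 0 0] by simp
   also have "... <= c ^ n * n2 (y 0) * n2 (y 0)" by (rule mult_right_mono[OF n2_y]) simp
   finally show "(LI t. y n t * y 0 t) <= c ^ n * n2 (y 0) * n2 (y 0)" .
  qed (use theta in auto)
  finally show "(\<integral>\<^sup>+t. ennreal (y n t / theta ^ n) * ennreal (y 0 t) \<partial>\<mu>) <= ennreal ((c / theta) ^ n * (n2 (y 0))^2)"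
   by (simp add: power_divide power2_eq_square mult_ac)
 qed auto
 also have "... < top"
  using c theta by (intro ennreal_suminf_neq_top[THEN top.not_eq_extremum[THEN iffD1]] summable_mult2 summable_geometric) auto
 finally show ?thesis by simp
qed

definition U :: "'g set" where
 "U = {t. 0 < a t}"

lemma open_U: "open U"
 unfolding U_def using Cc_continuous[OF a(1)] by (intro open_Collect_less continuous_intros)

lemma U_nonempty: "U ~= {}"
proof
 assume "U = {}"
 hence "a = (%_. 0)" using a(2) by (auto simp: U_def fun_eq_iff not_less intro: antisym)
 thus False using a(3) by simp
qed

lemma compact_closure_U: "compact (closure U)"
proof -
 obtain K where K: "compact K" "!!t. t ~: K ==> a t = 0" by (rule CcE[OF a(1)]) blast
 have "U \<subseteq> K" using K(2) by (force simp: U_def)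
 hence "closure U \<subseteq> K" using compact_imp_closed[OF K(1)] by (intro closure_minimal)
 thus ?thesis using compact_Int_closed[OF K(1) closed_closure, of U] by (simp add: inf.absorb2)
qed

text \<open>\<open>y 0 t\<close> is the double integral of \<open>a s * a r * a (r - s + t)\<close>.
  For \<open>t\<close> in the closure pick \<open>s\<close> in \<open>U\<close> so near to
  \<open>t\<close> that \<open>r - s + t\<close> remains in \<open>U\<close> next to
  \<open>r\<close>.\<close>

lemma y0_pos:
 assumes t: "t : closure U"
 shows "0 < y 0 t"
proof -
 obtain r where r: "r : U" using U_nonempty by blast
 have op: "open {s. r + (- s + t) : U}"
  using open_vimage[OF open_U, of "%s. r + (- s + t)"] by (simp add: vimage_def continuous_intros)
 have "t : {s. r + (- s + t) : U}" using r by simp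
 with t have "{s. r + (- s + t) : U} \<inter> closure U ~= {}" by blast
 then obtain s where s: "s : U" "r + (- s + t) : U"
  using open_Int_closure_eq_empty[OF op, of U] by auto
 have "0 < cv' a a (- s + t)"
  unfolding cv'_def
  by (rule integral_pos[where x = r]) (use r s a Cc_continuous[OF a(1)] cv'_integrable[OF a(1) Cc_continuous[OF a(1)]] in
   \<open>auto simp: U_def intro!: continuous_intros continuous_cont[OF Cc_continuous[OF a(1)]]\<close>)
 hence "0 < cv a (cv' a a) t"
  unfolding cv_def
  by (intro integral_pos[where x = s])
   (use s a cv'_nonneg[of a a] cv_integrable[OF a(1) cv'_continuous[OF a(1) Cc_continuous[OF a(1)]]] in
   \<open>auto simp: U_def intro!: continuous_intros continuous_cont[OF cv'_continuous[OF a(1) Cc_continuous[OF a(1)]]] Cc_continuous[OF a(1)]\<close>)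
 thus ?thesis by (simp add: y_def N_def)
qed

lemma ex_h_finite: "EX t. 0 < h t & h t < \<infinity>"
proof -
 have fin: "AE t in \<mu>. h t * ennreal (y 0 t) ~= \<infinity>"
  by (rule nn_integral_PInf_AE[OF _ integral_h_finite]) (use Cc_measurable[OF y_Cc] in measurable)
 have "EX t:U. h t * ennreal (y 0 t) ~= \<infinity>"
 proof (rule ccontr)
  assume "~ (EX t:U. h t * ennreal (y 0 t) ~= \<infinity>)"
  with fin have "AE t in \<mu>. t ~: U" by auto
  hence "emeasure \<mu> U = 0" using AE_iff_measurable[of U \<mu> "%t. t ~: U"] open_U by simp
  with emeasure_open_pos[OF open_U U_nonempty] show False by simp
 qed
 then obtain t where t: "t : U" "h t * ennreal (y 0 t) ~= \<infinity>" by blast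
 have y: "0 < y 0 t" using y0_pos t(1) closure_subset by blast
 have "ennreal (y 0 t / theta ^ 0) <= h t"
  unfolding h_def by (rule sum_le_suminf[of _ "{0}", simplified]) auto
 hence "ennreal (y 0 t) <= h t" by simp
 moreover have "0 < ennreal (y 0 t)" using y by simp
 ultimately have "0 < h t" by (rule less_le_trans[rotated])
 moreover have "h t < \<infinity>" using t(2) y by (auto simp: ennreal_mult_eq_top_iff less_top)
 ultimately show ?thesis by blast
qed

text \<open>Convolution with \<open>y 0\<close> is \<open>\<lambda>(a)\<close>, its adjoint and
  \<open>\<lambda>(a)\<close> in succession, so replacing the outer kernel \<open>a\<close> of
  \<open>y n\<close> by \<open>y 0\<close> advances the index by one.\<close>

lemma N_y: "cv (y 0) (cv' a ((N ^^ n) a)) = y (Suc n)"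
proof -
 let ?z = "cv' a ((N ^^ n) a)"
 have z: "Cc ?z" by (intro Cc_cv' a Npow)
 have 1: "cv (cv a (cv' a a)) ?z = cv a (cv (cv' a a) ?z)"
  by (rule ext) (rule cv_assoc[OF a(1) Cc_cv'[OF a(1) a(1)] Cc_continuous[OF z]])
 have 2: "cv (cv' a a) ?z = cv' a (cv a ?z)"
  by (rule ext) (rule cv'_cv[OF a(1) a(1) Cc_continuous[OF z]])
 show ?thesis using 1 unfolding 2 by (simp add: y_def N_def)
qed

text \<open>A small translation changes the kernel \<open>a\<close> by at most
  \<open>e * y 0\<close>, because \<open>y 0\<close> is bounded below on the closure of
  \<open>U\<close>. In \<open>y n\<close> this costs \<open>e * y (Suc n)\<close> by
  \<open>N_y\<close>, and since \<open>theta < 1\<close> the weighted sum of these costs is at most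
  \<open>e * h\<close>.\<close>

lemma Harnack:
 assumes e: "e > 0"
 obtains V where "open V" "0 : V" "!!q t. q : V ==> h (- q + t) <= ennreal (1 + e) * h t"
proof -
 let ?K = "closure U"
 note ca = Cc_continuous[OF a(1)] and cy = Cc_continuous[OF y_Cc]
 have ne: "?K ~= {}" using U_nonempty by simp
 obtain x where x: "x : ?K" "!!t. t : ?K ==> y 0 x <= y 0 t"
  using continuous_attains_inf[OF compact_closure_U ne continuous_on_subset[OF cy]] by blast
 \<comment> \<open>Half the minimum of \<open>y 0\<close> on the compact closure: after a
   translation that moves \<open>y 0\<close> by at most \<open>b\<close>, the value is still at
   least \<open>b\<close>.\<close>
 define b where "b = y 0 x / 2"
 have b: "b > 0" using y0_pos[OF x(1)] by (simp add: b_def)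
 have c1: "cont (%p. y 0 (fst p + snd p))" "cont (%p. a (fst p + snd p))"
  by (intro continuous_cont[OF cy] continuous_cont[OF ca] continuous_intros)+
 obtain V where V: "open V" "0 : V" "!!q t. q : V ==> t : ?K ==> norm (y 0 (q + t) - y 0 (0 + t)) <= b"
  by (rule near_on_compact[OF c1(1) compact_closure_U b, of 0]) blast
 obtain V' where V': "open V'" "0 : V'" "!!q t. q : V' ==> t : ?K ==> norm (a (q + t) - a (0 + t)) <= e * b"
  by (rule near_on_compact[OF c1(2) compact_closure_U, of "e * b" 0]) (use e b in auto)
 have step: "a (- q + t) <= a t + e * y 0 t" if q: "q : V \<inter> V'" for q t
 proof (cases "- q + t : ?K")
  case True
  have "2 * b <= y 0 (- q + t)" using x(2)[OF True] by (simp add: b_def)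
  moreover have "\<bar>y 0 t - y 0 (- q + t)\<bar> <= b" using V(3)[of q "- q + t"] True q by simp
  ultimately have "e * b <= e * y 0 t" using e by (intro mult_left_mono) auto
  moreover have "\<bar>a t - a (- q + t)\<bar> <= e * b" using V'(3)[of q "- q + t"] True q by simp
  ultimately show ?thesis by simp
 next
  case False
  hence "- q + t ~: U" using closure_subset by blast
  hence "a (- q + t) = 0" using a(2)[of "- q + t"] by (simp add: U_def)
  thus ?thesis using a(2)[of t] y_nonneg[of 0 t] e by simp
 qed
 have yn: "y n (- q + t) <= y n t + e * y (Suc n) t" if q: "q : V \<inter> V'" for q t n
 proof -
  let ?z = "cv' a ((N ^^ n) a)"
  have z: "Cc ?z" by (intro Cc_cv' a Npow)
  have yz: "y n = cv a ?z" by (simp add: y_def N_def)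
  have "y n (- q + t) = cv (%s. a (- q + s)) ?z t" unfolding yz by (rule cv_translate[OF a(1) Cc_continuous[OF z]])
  also have "... <= cv (%s. a s + e * y 0 s) ?z t"
   by (intro cv_mono Cc_translate Cc_add Cc_cmult a y_Cc Cc_continuous[OF z] step q cv'_nonneg Npow)
  also have "... = cv a ?z t + e * cv (y 0) ?z t"
   by (simp add: cv_add[OF a(1) Cc_cmult[OF y_Cc] Cc_continuous[OF z]] cv_scale)
  finally show ?thesis by (simp add: N_y yz)
 qed
 have "h (- q + t) <= ennreal (1 + e) * h t" if q: "q : V \<inter> V'" for q t
 proof -
  let ?f = "%n. ennreal (y n t / theta ^ n)"
  have "h (- q + t) <= (\<Sum>n. ?f n + ennreal e * ?f (Suc n))"
   unfolding h_def
  proof (rule suminf_le)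
   fix n
   have "y n (- q + t) / theta ^ n <= y n t / theta ^ n + e * (y (Suc n) t / theta ^ n)"
    using divide_right_mono[OF yn[OF q, of n t], of "theta ^ n"] theta by (simp add: add_divide_distrib)
   also have "y (Suc n) t / theta ^ n <= y (Suc n) t / theta ^ Suc n"
    using theta y_nonneg by (intro divide_left_mono) (auto simp: mult_left_le_one_le)
   finally have "y n (- q + t) / theta ^ n <= y n t / theta ^ n + e * (y (Suc n) t / theta ^ Suc n)" using e by simp
   thus "ennreal (y n (- q + t) / theta ^ n) <= ?f n + ennreal e * ?f (Suc n)"
    using e y_nonneg theta by (simp flip: ennreal_plus ennreal_mult' del: power_Suc add: ennreal_leI)
  qed auto
  also have "... = h t + ennreal e * (\<Sum>n. ?f (Suc n))"
   by (subst suminf_add[symmetric]) (auto simp: h_def)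
  also have "... <= h t + ennreal e * h t"
   using suminf_offset[of ?f 1] by (intro add_left_mono mult_left_mono) (auto simp: h_def)
  also have "... = ennreal (1 + e) * h t" using e by (simp add: distrib_right)
  finally show ?thesis .
 qed
 with V V' show ?thesis by (intro that[of "V \<inter> V'"]) auto
qed

text \<open>The operator \<open>N\<close> shifts the series by one index, which yields the factor
  \<open>theta\<close> and loses the first term.\<close>

lemma superharmonic:
 "(\<integral>\<^sup>+s. ennreal (a s) * (\<integral>\<^sup>+r. ennreal (a r) * h (r + (- s + t)) \<partial>\<mu>) \<partial>\<mu>) <= ennreal theta * h t"
proof -
 note [measurable] = Cc_measurable[OF a(1)]
 have nn: "(\<integral>\<^sup>+s. ennreal (a s) * (\<Sum>n. ennreal (F n (g s) / theta ^ n)) \<partial>\<mu>) = (\<Sum>n. ennreal ((LI s. a s * F n (g s)) / theta ^ n))"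
  if F: "!!n. cont (F n)" "!!n t. 0 <= F n t" and g: "cont g" for F :: "nat => 'g => real" and g
 proof -
  have cg: "cont (%s. F n (g s))" for n by (rule continuous_cont[OF F(1) g])
  note [measurable] = borel_measurable_continuous_onI[OF cg]
  have "(\<integral>\<^sup>+s. ennreal (a s) * (\<Sum>n. ennreal (F n (g s) / theta ^ n)) \<partial>\<mu>) =
    (\<Sum>n. \<integral>\<^sup>+s. ennreal (a s) * ennreal (F n (g s) / theta ^ n) \<partial>\<mu>)"
   unfolding ennreal_suminf_cmult[symmetric] by (rule nn_integral_suminf) simp
  also have "... = (\<Sum>n. ennreal ((LI s. a s * F n (g s)) / theta ^ n))"
  proof (intro arg_cong[where f = suminf] ext)
   fix n
   have i: "intg (%s. a s * F n (g s) / theta ^ n)"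
    using Cc_integrable[OF Cc_mult_left[OF a(1) cg]] by simp
   have "(\<integral>\<^sup>+s. ennreal (a s) * ennreal (F n (g s) / theta ^ n) \<partial>\<mu>) = (\<integral>\<^sup>+s. ennreal (a s * F n (g s) / theta ^ n) \<partial>\<mu>)"
    using a(2) F(2) theta by (simp add: ennreal_mult'[symmetric])
   also have "... = ennreal ((LI s. a s * F n (g s)) / theta ^ n)"
    using a(2) F(2) theta by (subst nn_integral_eq_integral[OF i]) auto
   finally show "(\<integral>\<^sup>+s. ennreal (a s) * ennreal (F n (g s) / theta ^ n) \<partial>\<mu>) = ennreal ((LI s. a s * F n (g s)) / theta ^ n)" .
  qed
  finally show ?thesis .
 qed
 have "(\<integral>\<^sup>+r. ennreal (a r) * h (r + x) \<partial>\<mu>) = (\<Sum>n. ennreal (cv' a (y n) x / theta ^ n))" for x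
  unfolding h_def cv'_def by (rule nn) (intro Cc_continuous y_Cc y_nonneg continuous_intros)+
 hence "(\<integral>\<^sup>+s. ennreal (a s) * (\<integral>\<^sup>+r. ennreal (a r) * h (r + (- s + t)) \<partial>\<mu>) \<partial>\<mu>) =
   (\<integral>\<^sup>+s. ennreal (a s) * (\<Sum>n. ennreal (cv' a (y n) (- s + t) / theta ^ n)) \<partial>\<mu>)" by simp
 also have "... = (\<Sum>n. ennreal ((LI s. a s * cv' a (y n) (- s + t)) / theta ^ n))"
  by (rule nn) (intro Cc_continuous Cc_cv' y_Cc cv'_nonneg a y_nonneg continuous_intros)+
 also have "... = (\<Sum>n. ennreal theta * ennreal (y (Suc n) t / theta ^ Suc n))"
  using theta y_nonneg by (simp add: ennreal_mult'[symmetric] y_Suc N_def cv_def)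
 also have "... <= ennreal theta * h t"
  using suminf_offset[of "%n. ennreal (y n t / theta ^ n)" 1] unfolding ennreal_suminf_cmult by (intro mult_left_mono) (auto simp: h_def)
 finally show ?thesis .
qed

end

section \<open>The subgroup of comparable translates and the logarithm of \<open>h\<close>\<close>

context spectral_gap
begin

text \<open>The translations under which \<open>h\<close> stays comparable to itself.
  \<open>Harnack\<close> supplies a neighbourhood of the neutral element, and superharmonicity the
  differences of points of \<open>U\<close>.\<close>

definition Gd :: "'g set" where
 "Gd = {q. EX C. ALL t. h (q + t) <= ennreal C * h t & h (- q + t) <= ennreal C * h t}"

lemma GdI: "(!!t. h (q + t) <= ennreal C * h t) ==> (!!t. h (- q + t) <= ennreal D * h t) ==> q : Gd"
 unfolding Gd_def by (intro CollectI exI[of _ "max C D"])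
  (meson ennreal_leI max.cobounded1 max.cobounded2 mult_right_mono order_trans zero_le)

lemma Gd_uminus: "q : Gd ==> - q : Gd"
 by (auto simp: Gd_def)

lemma Gd_zero: "0 : Gd"
 by (rule GdI[of _ 1 1]) auto

lemma Gd_add:
 assumes "p : Gd" "q : Gd"
 shows "p + q : Gd"
proof -
 obtain C where C: "h (p + t) <= ennreal C * h t" "h (- p + t) <= ennreal C * h t" for t using assms(1) by (auto simp: Gd_def)
 obtain D where D: "h (q + t) <= ennreal D * h t" "h (- q + t) <= ennreal D * h t" for t using assms(2) by (auto simp: Gd_def)
 define M where "M = max (max C D) 0"
 have M: "ennreal C <= ennreal M" "ennreal D <= ennreal M" "M >= 0" by (auto simp: M_def intro!: ennreal_leI)
 have "h (p + (q + t)) <= ennreal M * (ennreal M * h t)" "h (- q + (- p + t)) <= ennreal M * (ennreal M * h t)" for t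
  using C(1)[of "q + t"] D(1)[of t] C(2)[of t] D(2)[of "- p + t"] M(1,2)
  by (meson mult_left_mono mult_right_mono order_trans zero_le)+
 thus ?thesis
  using M(3) by (intro GdI[of _ "M * M" "M * M"]; simp only: ennreal_mult' mult.assoc add.assoc minus_add)
qed

lemma Gd_diff: "p : Gd ==> q : Gd ==> p - q : Gd"
 using Gd_add[of p "- q"] Gd_uminus by simp

lemma Harnack_symmetric:
 assumes e: "e > 0"
 obtains V where "open V" "0 : V" "V \<subseteq> Gd" "!!q t. q : V ==> h (q + t) <= ennreal (1 + e) * h t"
  "!!q t. q : V ==> h (- q + t) <= ennreal (1 + e) * h t"
proof -
 obtain V where V: "open V" "0 : V" "!!q t. q : V ==> h (- q + t) <= ennreal (1 + e) * h t"
  by (rule Harnack[OF e]) blast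
 have "open (V \<inter> uminus -` V)" using V(1) by (intro open_Int open_vimage) (auto intro: continuous_intros)
 moreover have 1: "h (q + t) <= ennreal (1 + e) * h t" if "- q : V" for q t using V(3)[OF that] by simp
 moreover have "V \<inter> uminus -` V \<subseteq> Gd"
 proof
  fix x assume "x : V \<inter> uminus -` V"
  thus "x : Gd" by (intro GdI[of x "1 + e" "1 + e"] 1 V(3)) auto
 qed
 ultimately show ?thesis using V(2,3) by (intro that[of "V \<inter> uminus -` V"]) auto
qed

lemma alpha_pos:
 assumes "open R" "r : R" "r : U"
 shows "0 < (\<integral>\<^sup>+s. ennreal (a s) * indicator R s \<partial>\<mu>)"
proof (rule ccontr)
 assume "~ ?thesis"
 hence "(\<integral>\<^sup>+s. ennreal (a s) * indicator R s \<partial>\<mu>) = 0" by simp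
 hence "AE s in \<mu>. ennreal (a s) * indicator R s = 0"
  using Cc_measurable[OF a(1)] assms(1) by (subst (asm) nn_integral_0_iff_AE) auto
 hence "AE s in \<mu>. s ~: R \<inter> U" by eventually_elim (auto simp: U_def indicator_def)
 hence "emeasure \<mu> (R \<inter> U) = 0" using AE_iff_measurable[of "R \<inter> U" \<mu> "%t. t ~: R \<inter> U"] open_U assms(1) by auto
 with emeasure_open_pos[of "R \<inter> U"] open_U assms show False by (auto simp: open_Int)
qed

lemma alpha_finite: "(\<integral>\<^sup>+s. ennreal (a s) * indicator R s \<partial>\<mu>) <= 1"
proof -
 have "(\<integral>\<^sup>+s. ennreal (a s) * indicator R s \<partial>\<mu>) <= (\<integral>\<^sup>+s. ennreal (a s) \<partial>\<mu>)"
  by (rule nn_integral_mono) (auto simp: indicator_def)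
 also have "... = 1" using Cc_integrable[OF a(1)] a by (subst nn_integral_eq_integral) auto
 finally show ?thesis .
qed

text \<open>For \<open>r\<close> near \<open>p\<close> and \<open>s\<close> near \<open>q\<close>,
  \<open>Harnack\<close> with \<open>e = 1\<close> gives
  \<open>h (p - q + t) <= 2 * h (r - s + t)\<close>. Averaging over these neighbourhoods, which have
  positive mass under \<open>a\<close>, and \<open>superharmonic\<close> bound the left side by a
  multiple of \<open>h t\<close>.\<close>

lemma U_diff: assumes "p : U" "q : U" shows "p - q : Gd"
proof -
 have *: "EX C. ALL t. h (p - q + t) <= ennreal C * h t" if p: "p : U" and q: "q : U" for p q
 proof -
  obtain V where V: "open V" "0 : V" "!!v t. v : V ==> h (- v + t) <= ennreal (1 + 1) * h t"
   by (rule Harnack[of 1]) auto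
  have "open ((%z. fst z - snd z + q - p) -` V)"
   using V(1) by (intro open_vimage) (auto intro!: continuous_intros)
  moreover have "(p, q) : (%z. fst z - snd z + q - p) -` V" using V(2) by simp
  ultimately obtain R S where RS: "open R" "open S" "p : R" "q : S" "R \<times> S \<subseteq> (%z. fst z - snd z + q - p) -` V"
   by (auto elim!: open_prod_elim)
  note [measurable] = Cc_measurable[OF a(1)] borel_open[OF RS(1)] borel_open[OF RS(2)]
  define alpha where "alpha R = (\<integral>\<^sup>+s. ennreal (a s) * indicator R s \<partial>\<mu>)" for R
  let ?X = "%t. ennreal (1/2) * h (p - q + t)"
  have pt: "indicator R r * indicator S s * ?X t <= h (r + (- s + t))" for r s t
  proof (cases "r : R & s : S")
   case True
   hence "r - s + q - p : V" using RS(5) by auto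
   from V(3)[OF this, of "r + (- s + t)"] have "h (p - q + t) <= ennreal 2 * h (r + (- s + t))"
    by (simp add: minus_add add.assoc diff_conv_add_uminus del: add_uminus_conv_diff)
   hence "?X t <= ennreal (1/2) * (ennreal 2 * h (r + (- s + t)))" by (intro mult_left_mono) auto
   moreover have "ennreal (1/2) * ennreal 2 = 1" by (subst ennreal_mult'[symmetric]) auto
   ultimately show ?thesis using True by (simp only: mult.assoc[symmetric]) (simp add: mult.assoc)
  qed auto
  have bound: "alpha S * alpha R * ?X t <= ennreal theta * h t" for t
  proof -
   have "alpha S * alpha R * ?X t = (\<integral>\<^sup>+s. ennreal (a s) * (\<integral>\<^sup>+r. ennreal (a r) * (indicator R r * indicator S s * ?X t) \<partial>\<mu>) \<partial>\<mu>)"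
   proof -
    have "(\<integral>\<^sup>+r. ennreal (a r) * (indicator R r * indicator S s * ?X t) \<partial>\<mu>) = alpha R * (indicator S s * ?X t)" for s
     unfolding alpha_def by (subst nn_integral_multc[symmetric]) (auto simp: mult_ac)
    thus ?thesis
     unfolding alpha_def[of S] by (simp add: mult.assoc) (subst nn_integral_multc[symmetric], auto simp: mult_ac)
   qed
   also have "... <= (\<integral>\<^sup>+s. ennreal (a s) * (\<integral>\<^sup>+r. ennreal (a r) * h (r + (- s + t)) \<partial>\<mu>) \<partial>\<mu>)"
    by (intro nn_integral_mono mult_left_mono pt) auto
   finally show ?thesis using superharmonic[of t] by (rule order_trans)
  qed
  have "0 < alpha S * alpha R" "alpha S * alpha R < \<infinity>"
   using alpha_pos[OF RS(1,3) p] alpha_pos[OF RS(2,4) q] alpha_finite[of R] alpha_finite[of S]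
   by (auto simp: alpha_def ennreal_zero_less_mult_iff ennreal_mult_less_top intro: le_less_trans[OF _ ennreal_one_less_top])
  then obtain beta where beta: "alpha S * alpha R = ennreal beta" "beta > 0" by (cases "alpha S * alpha R") auto
  have "h (p - q + t) <= ennreal (2 / beta * theta) * h t" for t
  proof -
   have "ennreal (2 / beta) * (ennreal beta * ?X t) <= ennreal (2 / beta) * (ennreal theta * h t)"
    using bound[of t] unfolding beta(1) by (intro mult_left_mono) auto
   moreover have "ennreal (2 / beta) * (ennreal beta * ennreal (1/2)) = ennreal (2 / beta * (beta * (1/2)))"
    using beta(2) by (subst ennreal_mult', simp, subst ennreal_mult') simp_all
   moreover have "2 / beta * (beta * (1/2)) = 1" using beta(2) by simp
   moreover have "ennreal (2 / beta * theta) = ennreal (2 / beta) * ennreal theta" using beta(2) by (intro ennreal_mult') simp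
   ultimately show ?thesis by (simp only: mult.assoc[symmetric] ennreal_1) (simp only: mult.assoc mult_1)
  qed
  thus ?thesis by blast
 qed
 obtain C where "!!t. h (p - q + t) <= ennreal C * h t" using *[OF assms] by auto
 moreover obtain D where "!!t. h (q - p + t) <= ennreal D * h t" using *[OF assms(2,1)] by auto
 ultimately show ?thesis by (intro GdI) auto
qed

text \<open>Each point of the closure differs from a point of \<open>U\<close> by an element of an
  open neighbourhood inside the group \<open>Gd\<close>.\<close>

lemma closure_U_diff:
 assumes "p : closure U" "q : closure U"
 shows "p - q : Gd"
proof -
 obtain V where V: "open V" "0 : V" "V \<subseteq> Gd" by (rule Harnack_symmetric[of 1]) auto
 have *: "EX u:U. p - u : Gd" if p: "p : closure U" for p
 proof -
  have op: "open ((%u. p - u) -` V)" using V(1) by (intro open_vimage) (auto intro!: continuous_intros)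
  have "p : (%u. p - u) -` V" using V(2) by simp
  with p have "(%u. p - u) -` V \<inter> closure U ~= {}" by blast
  thus ?thesis using open_Int_closure_eq_empty[OF op, of U] V(3) by auto
 qed
 obtain u v where uv: "u : U" "v : U" "p - u : Gd" "q - v : Gd" using *[OF assms(1)] *[OF assms(2)] by blast
 have "(p - u) + (u - v) - (q - v) : Gd" by (intro Gd_diff Gd_add uv U_diff)
 thus ?thesis by (simp add: diff_conv_add_uminus minus_add add.assoc del: add_uminus_conv_diff)
qed

definition base :: 'g where
 "base = (SOME t. 0 < h t & h t < \<infinity>)"

lemma base: "0 < h base" "h base < \<infinity>"
 using someI_ex[OF ex_h_finite] by (auto simp: base_def)

text \<open>\<open>\<gamma> t\<close> is the \<open>Gd\<close>-component of \<open>t\<close> for a choice of representatives of the right cosets of \<open>Gd\<close>.\<close>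

definition \<gamma> :: "'g => 'g" where
 "\<gamma> t = t - (SOME x. t - x : Gd)"

lemma \<gamma>_in: "\<gamma> t : Gd"
proof -
 have "t - t : Gd" using Gd_zero by simp
 thus ?thesis unfolding \<gamma>_def by (rule someI)
qed

lemma \<gamma>_add: assumes "g : Gd" shows "\<gamma> (g + t) = g + \<gamma> t"
proof -
 have "g + t - x : Gd \<longleftrightarrow> t - x : Gd" for x
  using Gd_add[OF assms, of "t - x"] Gd_add[OF Gd_uminus[OF assms], of "g + t - x"]
  by (auto simp: diff_conv_add_uminus add.assoc[symmetric] simp del: add_uminus_conv_diff)
 thus ?thesis by (simp add: \<gamma>_def add_diff_eq)
qed

text \<open>On whole cosets of \<open>Gd\<close> the function \<open>h\<close> may be 0 or infinite.
  The logarithm is therefore taken on the coset of \<open>base\<close>, where \<open>h\<close> is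
  positive and finite, and copied to every other coset compatibly with left translation by
  \<open>Gd\<close>.\<close>

definition l :: "'g => real" where
 "l t = ln (enn2real (h (\<gamma> t + base)))"

lemma h_base: assumes "g : Gd" shows "0 < h (g + base)" "h (g + base) < \<infinity>"
proof -
 obtain C where C: "h (g + t) <= ennreal C * h t" "h (- g + t) <= ennreal C * h t" for t using assms by (auto simp: Gd_def)
 have "h base <= ennreal C * h (g + base)" using C(2)[of "g + base"] by (simp add: add.assoc[symmetric])
 with base(1) show "0 < h (g + base)" by (cases "h (g + base) = 0") (auto simp: zero_less_iff_neq_zero)
 show "h (g + base) < \<infinity>" by (rule le_less_trans[OF C(1)]) (use base(2) in "simp add: ennreal_mult_less_top")
qed

lemma exp_l: "ennreal (exp (l t)) = h (\<gamma> t + base)"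
 using h_base[OF \<gamma>_in[of t]] by (simp add: l_def enn2real_positive_iff)

lemma l_le:
 assumes "g : Gd" "h (g + (\<gamma> t + base)) <= ennreal C * h (\<gamma> t + base)"
 shows "0 < C" "l (g + t) <= l t + ln C"
proof -
 have "ennreal (exp (l (g + t))) <= ennreal C * ennreal (exp (l t))"
  using assms by (simp add: exp_l \<gamma>_add add.assoc)
 also have "... = ennreal (C * exp (l t))" by (simp add: ennreal_mult'')
 finally have le: "exp (l (g + t)) <= C * exp (l t)"
  by (cases "C * exp (l t) >= 0") (auto simp: ennreal_neg)
 hence "0 < C * exp (l t)" using exp_gt_zero less_le_trans by blast
 thus C: "0 < C" by (simp add: zero_less_mult_iff)
 have "exp (l (g + t)) <= exp (l t + ln C)" using le C by (simp add: exp_add mult.commute)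
 thus "l (g + t) <= l t + ln C" by simp
qed

lemma l_uniform:
 assumes e: "e > 0"
 obtains V where "open V" "0 : V" "!!v t. v : V ==> \<bar>l (v + t) - l t\<bar> <= e"
proof -
 obtain V where V: "open V" "0 : V" "V \<subseteq> Gd" "!!q t. q : V ==> h (q + t) <= ennreal (1 + e) * h t"
  "!!q t. q : V ==> h (- q + t) <= ennreal (1 + e) * h t"
  by (rule Harnack_symmetric[OF e]) blast
 have ln: "ln (1 + e) <= e" using e by (intro ln_add_one_self_le_self) simp
 have "\<bar>l (v + t) - l t\<bar> <= e" if v: "v : V" for v t
 proof -
  have g: "v : Gd" using v V(3) by blast
  have "l (v + t) <= l t + ln (1 + e)" by (rule l_le(2)[OF g V(4)[OF v]])
  moreover have "l (- v + (v + t)) <= l (v + t) + ln (1 + e)" by (rule l_le(2)[OF Gd_uminus[OF g] V(5)[OF v]])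
  ultimately show ?thesis using ln by (simp add: add.assoc[symmetric])
 qed
 with V show ?thesis by (intro that)
qed

lemma l_bounded:
 assumes "g : Gd"
 shows "EX B. ALL t. \<bar>l (g + t) - l t\<bar> <= B"
proof -
 obtain C where C: "h (g + t) <= ennreal C * h t" "h (- g + t) <= ennreal C * h t" for t using assms by (auto simp: Gd_def)
 have "l (g + t) <= l t + ln C" "l (- g + (g + t)) <= l (g + t) + ln C" for t
  by (rule l_le(2)[OF assms C(1)]) (rule l_le(2)[OF Gd_uminus[OF assms] C(2)])
 hence "\<bar>l (g + t) - l t\<bar> <= ln C" for t by (simp add: add.assoc[symmetric] abs_le_iff diff_le_eq add.commute)
 thus ?thesis by blast
qed

lemma l_continuous: "cont l"
 unfolding continuous_on_eq_continuous_at[OF open_UNIV] isCont_def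
proof (intro ballI tendstoI)
 fix t and e :: real assume "e > 0"
 then obtain V where V: "open V" "0 : V" "!!v t. v : V ==> \<bar>l (v + t) - l t\<bar> <= e / 2"
  by (rule l_uniform[of "e / 2", OF half_gt_zero]) blast
 have "open ((%x. x - t) -` V)" using V(1) by (intro open_vimage) (auto intro!: continuous_intros)
 moreover have "dist (l x) (l t) < e" if "x : (%x. x - t) -` V" for x
  using V(3)[of "x - t" t] that \<open>e > 0\<close> by (simp add: dist_real_def)
 ultimately show "\<forall>\<^sub>F x in at t. dist (l x) (l t) < e"
  unfolding eventually_at_topological using V(2) by (intro exI[of _ "(%x. x - t) -` V"]) auto
qed

lemma exp_l_continuous: "cont (%t. exp (l t))"
 by (intro continuous_intros l_continuous)

lemma N_exp_l: "N (%t. exp (l t)) t <= theta * exp (l t)"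
proof -
 let ?E = "%t. exp (l t)"
 have 1: "(\<integral>\<^sup>+r. ennreal (a r) * ennreal (?E (r + x)) \<partial>\<mu>) = ennreal (cv' a ?E x)" for x
  unfolding cv'_def using cv'_integrable[OF a(1) exp_l_continuous] a(2)
  by (subst nn_integral_eq_integral[symmetric]) (auto simp: ennreal_mult'[symmetric])
 have c: "cont (cv' a ?E)" by (rule cv'_continuous[OF a(1) exp_l_continuous])
 have "ennreal (N ?E t) = (\<integral>\<^sup>+s. ennreal (a s) * ennreal (cv' a ?E (- s + t)) \<partial>\<mu>)"
  unfolding N_def cv_def using cv_integrable[OF a(1) c] a(2)
  by (subst nn_integral_eq_integral[symmetric]) (auto simp: ennreal_mult'[symmetric] cv'_nonneg)
 also have "... = (\<integral>\<^sup>+s. ennreal (a s) * (\<integral>\<^sup>+r. ennreal (a r) * ennreal (?E (r + (- s + t))) \<partial>\<mu>) \<partial>\<mu>)"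
  by (simp only: 1)
 also have "... = (\<integral>\<^sup>+s. ennreal (a s) * (\<integral>\<^sup>+r. ennreal (a r) * h (r + (- s + (\<gamma> t + base))) \<partial>\<mu>) \<partial>\<mu>)"
 proof -
  \<comment> \<open>Where \<open>a r\<close> and \<open>a s\<close> do not vanish,
    \<open>r - s\<close> lies in \<open>Gd\<close>, so the integral stays within the coset of
    \<open>t\<close> and transports to that of \<open>base\<close>.\<close>
  have "ennreal (?E (r + (- s + t))) = h (r + (- s + (\<gamma> t + base)))" if "r : U" "s : U" for r s
   unfolding exp_l using \<gamma>_add[OF U_diff[OF that], of t]
   by (simp add: diff_conv_add_uminus add.assoc del: add_uminus_conv_diff)
  hence "ennreal (a s) * (ennreal (a r) * ennreal (?E (r + (- s + t)))) = ennreal (a s) * (ennreal (a r) * h (r + (- s + (\<gamma> t + base))))" for r s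
   using a(2)[of r] a(2)[of s] by (cases "r : U & s : U") (auto simp: U_def not_less)
  hence "ennreal (a s) = 0 \<or> (%r. ennreal (a r) * ennreal (?E (r + (- s + t)))) = (%r. ennreal (a r) * h (r + (- s + (\<gamma> t + base))))" for s
   by (auto simp: fun_eq_iff ennreal_mult_cancel_left)
  hence alt: "ennreal (a s) = 0 \<or> (%r. ennreal (a r) * ennreal (?E (r + (- s + t)))) = (%r. ennreal (a r) * h (r + (- s + (\<gamma> t + base))))" for s
   by blast
  have "ennreal (a s) * (\<integral>\<^sup>+r. ennreal (a r) * ennreal (?E (r + (- s + t))) \<partial>\<mu>) =
    ennreal (a s) * (\<integral>\<^sup>+r. ennreal (a r) * h (r + (- s + (\<gamma> t + base))) \<partial>\<mu>)" for s
   using alt[of s] by (elim disjE) (simp_all only: mult_zero_left)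
  thus ?thesis by simp
 qed
 also have "... <= ennreal theta * ennreal (?E t)" unfolding exp_l by (rule superharmonic)
 also have "... = ennreal (theta * ?E t)" by (simp add: ennreal_mult'')
 finally show ?thesis using theta by (simp add: ennreal_le_iff)
qed

text \<open>Jensen by a supporting line: \<open>?F\<close> is the tangent of the logarithm at
  \<open>theta * exp (l t)\<close>, and \<open>N\<close> respects affine combinations because it
  fixes constants.\<close>

lemma N_l: "N l t <= l t + ln theta"
proof -
 define k d where "k = 1 / (theta * exp (l t))" and "d = ln theta + l t - 1"
 let ?F = "%x. k * exp (l x) + d"
 have le: "l x <= ?F x" for x
 proof -
  have "ln (exp (l x - l t) / theta) <= exp (l x - l t) / theta - 1" using theta by (intro ln_le_minus_one) simp
  moreover have "ln (exp (l x - l t) / theta) = l x - l t - ln theta" using theta by (simp add: ln_div)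
  ultimately show ?thesis by (simp add: k_def d_def exp_diff mult.commute)
 qed
 have cF: "cont ?F" by (intro continuous_intros l_continuous)
 note i = cv_integrable[OF a(1)] cv'_integrable[OF a(1)] and ia = Cc_integrable[OF a(1)]
 have F': "cv' a ?F x = k * cv' a (%x. exp (l x)) x + d" for x
  using i(2)[OF exp_l_continuous, of x] ia a(3) by (simp add: cv'_def distrib_left mult.left_commute[of _ k])
 have F: "N ?F t = k * N (%x. exp (l x)) t + d"
  using i(1)[OF cv'_continuous[OF a(1) exp_l_continuous], of t] ia a(3)
  by (simp add: N_def F' cv_def distrib_left mult.left_commute[of _ k])
 have "cv' a l x <= cv' a ?F x" for x
  unfolding cv'_def by (intro integral_mono i l_continuous cF mult_left_mono le a)
 hence "N l t <= N ?F t"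
  unfolding N_def cv_def[of a] by (intro integral_mono i cv'_continuous l_continuous cF mult_left_mono a) auto
 also have "... <= k * (theta * exp (l t)) + d"
  unfolding F using N_exp_l[of t] theta by (intro add_right_mono mult_left_mono) (auto simp: k_def)
 also have "... = l t + ln theta" using theta by (simp add: k_def d_def)
 finally show ?thesis .
qed

text \<open>An invariant mean kills the antisymmetric discretisation of \<open>N l - l\<close>, which is bounded above by a negative number.\<close>

lemma not_amenable: "~ amenable \<mu>"
proof
 assume "amenable \<mu>"
 then obtain m where m: "left_invariant_mean \<mu> m" unfolding amenable_def by blast
 \<comment> \<open>By \<open>N_l\<close> the function \<open>N l - l\<close> is at most
   \<open>- 2 * e\<close>; one \<open>e\<close> is spent on the discretisation and one is left for
   the contradiction.\<close>
 define e where "e = - ln theta / 2"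
 have e: "e > 0" using theta by (simp add: e_def)
 let ?K = "closure U"
 obtain V where V: "open V" "0 : V" "!!v t. v : V ==> \<bar>l (v + t) - l t\<bar> <= e / 2"
  by (rule l_uniform[of "e / 2"]) (use e in auto)
 \<comment> \<open>In \<open>r - s + t\<close> the middle point sits behind another factor, so
   replacing \<open>s\<close> by \<open>j\<close> produces a conjugate of \<open>j - s\<close> by
   \<open>i - j\<close>. The bump \<open>k\<close> turns the demand that conjugates by a compact set
   stay in \<open>V\<close> into uniform continuity on that set.\<close>
 obtain k :: "'g => real" where k: "Cc k" "k 0 = 1" "!!t. t ~: V ==> k t = 0"
  by (rule Urysohn_Cc[of "{0}" V]) (use V in auto)
 have cD: "compact {p + q | p q. p : ?K & q : uminus ` ?K}"
  by (intro compact_sum compact_uminus compact_closure_U)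
 have ck: "cont (%p. k (snd p + fst p - snd p))"
  by (intro continuous_cont[OF Cc_continuous[OF k(1)]] continuous_intros)
 obtain V' where V': "open V'" "0 : V'"
  "!!w g. w : V' ==> g : {p + q | p q. p : ?K & q : uminus ` ?K} ==> norm (k (g + w - g) - k (g + 0 - g)) <= 1/2"
  by (rule near_on_compact[OF ck cD, of "1/2" 0]) auto
 have conj: "p - q + w - (p - q) : V" if "w : V'" "p : ?K" "q : ?K" for w p q
 proof (rule ccontr)
  assume "~ ?thesis"
  hence "k (p - q + w - (p - q)) = 0" by (rule k(3))
  moreover have "p - q : {p + q | p q. p : ?K & q : uminus ` ?K}" using that by force
  ultimately show False using V'(3)[OF that(1), of "p - q"] k(2) by simp
 qed
 define P where "P x = {z. z - x : V & x - z : V'}" for x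
 have near: "\<bar>l (r - s + t) - l (i - j + t)\<bar> <= e" if "r : P i" "s : P j" "i : ?K" "j : ?K" for r s i j t
 proof -
  have v: "r - i : V" "j - s : V'" using that by (auto simp: P_def)
  have eq: "r - s + t = (r - i) + ((i - j + (j - s) - (i - j)) + (i - j + t))"
   by (simp add: diff_conv_add_uminus minus_add add.assoc del: add_uminus_conv_diff)
  show ?thesis unfolding eq
   using V(3)[OF v(1), of "(i - j + (j - s) - (i - j)) + (i - j + t)"] V(3)[OF conj[OF v(2) that(3,4)], of "i - j + t"] by linarith
 qed
 have oP: "open (P x)" for x
 proof -
  have "P x = (%z. z - x) -` V \<inter> (%z. x - z) -` V'" by (auto simp: P_def)
  thus ?thesis using V(1) V'(1) by (auto intro!: open_Int open_vimage continuous_intros)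
 qed
 obtain S E where SE: "finite S" "S \<subseteq> ?K" "!!x. x : S ==> E x : sets borel" "!!x. x : S ==> E x \<subseteq> P x"
  "disjoint_family_on E S" "(\<Union>x\<in>S. E x) = ?K"
  by (rule compact_Borel_partition[OF compact_closure_U, of P]) (use oP V(2) V'(2) in "auto simp: P_def")
 define alpha where "alpha x = (LI r. a r * indicator (E x) r)" for x
 have iE: "intg (%r. a r * indicator (E x) r)" if "x : S" for x
  using integrable_mult_indicator[OF _ Cc_integrable[OF a(1)], of "E x"] SE(3)[OF that] by (simp add: mult.commute)
 have one: "(SUM x:S. indicator (E x) r :: real) = 1" if r: "r : ?K" for r
 proof -
  obtain x where x: "x : S" "r : E x" using r SE(6) by blast
  have "(SUM z:S. indicator (E z) r :: real) = (SUM z:S. if z = x then 1 else 0)"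
   using SE(5) x by (intro sum.cong) (auto simp: indicator_def disjoint_family_on_def)
  thus ?thesis using x(1) SE(1) by simp
 qed
 have a0: "a r = 0" if "r ~: ?K" for r
  using that closure_subset[of U] a(2)[of r] by (force simp: U_def)
 have step: "(SUM x:S. alpha x * beta x) <= (LI r. a r * F r)"
  if i: "intg (%r. a r * F r)" and le: "!!x r. x : S ==> r : E x ==> beta x <= F r" for F beta
 proof -
  have "(SUM x:S. alpha x * beta x) = (LI r. (SUM x:S. a r * indicator (E x) r * beta x))"
   unfolding alpha_def using iE by (subst Bochner_Integration.integral_sum) auto
  also have "... <= (LI r. a r * F r)"
  proof (rule integral_mono[OF _ i])
   show "intg (%r. SUM x:S. a r * indicator (E x) r * beta x)" using iE by auto
   fix r
   have "(SUM x:S. a r * indicator (E x) r * beta x) <= (SUM x:S. a r * indicator (E x) r * F r)"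
    using le a(2) by (intro sum_mono) (auto simp: indicator_def intro!: mult_left_mono)
   also have "... = a r * F r * (SUM x:S. indicator (E x) r)" by (simp add: sum_distrib_left mult_ac)
   also have "... = a r * F r" using one[of r] a0[of r] by (cases "r : ?K") auto
   finally show "(SUM x:S. a r * indicator (E x) r * beta x) <= a r * F r" .
  qed
  finally show ?thesis .
 qed
 \<comment> \<open>\<open>step\<close> is an inequality; constants of both signs give the
   equality.\<close>
 have a1: "(SUM x:S. alpha x) = 1"
  using step[of "%_. 1" "%_. 1"] step[of "%_. - 1" "%_. - 1"] Cc_integrable[OF a(1)] a(3) by (simp add: sum_negf)
 define phi where "phi g t = complex_of_real (l (g + t) - l t)" for g t
 have S_Gd: "i - j : Gd" if "i : S" "j : S" for i j using closure_U_diff that SE(2) by blast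
 have phi_bb: "phi g : bounded_borel" if g: "g : Gd" for g
 proof -
  have "cont (phi g)"
   unfolding phi_def[abs_def] by (intro continuous_intros l_continuous continuous_cont[OF l_continuous])
  moreover obtain B where "!!t. \<bar>l (g + t) - l t\<bar> <= B" using l_bounded[OF g] by blast
  hence "bounded (range (phi g))" unfolding bounded_iff phi_def by (auto simp del: of_real_diff)
  ultimately show ?thesis by (simp add: bounded_borel_def borel_measurable_continuous_onI)
 qed
 let ?x = "%p. complex_of_real (alpha (fst p) * alpha (snd p))" and ?F = "%p. phi (fst p - snd p)"
 \<comment> \<open>The discretisation of \<open>N l - l\<close>. The weights
   \<open>alpha i * alpha j\<close> are symmetric while the means of \<open>phi (i - j)\<close> are
   antisymmetric, so the mean of \<open>f\<close> will be 0.\<close>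
 define f where "f t = (SUM p:S \<times> S. ?x p * ?F p t)" for t
 have f_le: "f t = of_real (Re (f t))" "Re (f t) <= - e" for t
 proof -
  have re: "f t = of_real (SUM i:S. SUM j:S. alpha i * alpha j * (l (i - j + t) - l t))" by (simp add: f_def phi_def sum.cartesian_product case_prod_unfold)
  thus "f t = of_real (Re (f t))" by simp
  have "(SUM i:S. alpha i * (l (i - j + t) - e)) <= cv' a l (- s + t)" if "j : S" "s : E j" for j s
   unfolding cv'_def
  proof (rule step[OF cv'_integrable[OF a(1) l_continuous]])
   fix i r assume ir: "i : S" "r : E i"
   have "r - s + t = r + (- s + t)" by (simp add: diff_conv_add_uminus add.assoc del: add_uminus_conv_diff)
   moreover have "\<bar>l (r - s + t) - l (i - j + t)\<bar> <= e"
    by (rule near) (use ir that SE(2) subsetD[OF SE(4)] in auto)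
   ultimately show "l (i - j + t) - e <= l (r + (- s + t))" by simp
  qed
  hence "(SUM j:S. alpha j * (SUM i:S. alpha i * (l (i - j + t) - e))) <= N l t"
   unfolding N_def cv_def by (intro step cv_integrable[OF a(1) cv'_continuous[OF a(1) l_continuous]]) auto
  also have "... <= l t - 2 * e" using N_l[of t] by (simp add: e_def)
  finally have 1: "(SUM j:S. alpha j * (SUM i:S. alpha i * (l (i - j + t) - e))) <= l t - 2 * e" .
  have "(SUM i:S. SUM j:S. alpha i * alpha j * (l (i - j + t) - l t)) =
   (SUM i:S. SUM j:S. alpha j * (alpha i * (l (i - j + t) - e))) + (SUM i:S. SUM j:S. (e - l t) * (alpha i * alpha j))"
   unfolding sum.distrib[symmetric] by (intro sum.cong refl) (simp add: algebra_simps)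
  also have "(SUM i:S. SUM j:S. alpha j * (alpha i * (l (i - j + t) - e))) = (SUM j:S. alpha j * (SUM i:S. alpha i * (l (i - j + t) - e)))"
   unfolding sum_distrib_left by (rule sum.swap)
  also have "(SUM i:S. SUM j:S. (e - l t) * (alpha i * alpha j)) = e - l t" by (simp only: sum_distrib_left[symmetric] a1 mult_1_right)
  finally show "Re (f t) <= - e" using 1 by (simp add: re)
 qed
 note M = m[unfolded left_invariant_mean_def]
 have lin: "m (%t. a * f t + b * g t) = a * m f + b * m g" if "f : bounded_borel" "g : bounded_borel" for f g a b
  using M that by blast
 have le: "cmod (m f) <= c" if "f : bounded_borel" "locally_null \<mu> {t. cmod (f t) > c}" for f c
  using M that by blast
 have zero: "(%_. 0) : bounded_borel" and one_bb: "(%_. 1) : bounded_borel" by (auto simp: bounded_borel_def)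
 have m0: "m (%_. 0) = 0" using lin[OF zero zero, of 0 0] by simp
 note comb = bounded_borel_lincomb
 have msum: "(%t. SUM i:I. x i * F i t) : bounded_borel & m (%t. SUM i:I. x i * F i t) = (SUM i:I. x i * m (F i))"
  if "finite I" "!!i. i : I ==> F i : bounded_borel" for I :: "('g \<times> 'g) set" and F x
  using that
 proof (induction I)
  case empty
  thus ?case using zero m0 by simp
 next
  case (insert i I)
  hence IH: "(%t. SUM i:I. x i * F i t) : bounded_borel" "m (%t. SUM i:I. x i * F i t) = (SUM i:I. x i * m (F i))"
   and Fi: "F i : bounded_borel" by auto
  from comb[OF Fi IH(1), of "x i" 1] lin[OF Fi IH(1), of "x i" 1] insert.hyps IH(2) show ?case by simp
 qed
 have f_bb: "f : bounded_borel" and mf: "m f = (SUM p:S \<times> S. ?x p * m (?F p))"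
  using msum[of "S \<times> S" ?F ?x] SE(1) phi_bb S_Gd unfolding f_def[abs_def] by auto
 have anti: "m (phi (j - i)) = - m (phi (i - j))" if "i : S" "j : S" for i j
 proof -
  let ?g = "i - j"
  have g: "phi ?g : bounded_borel" by (rule phi_bb[OF S_Gd[OF that]])
  have "(%t. phi ?g (- ?g + t)) : bounded_borel"
   using g measurable_comp_translate[of "phi ?g" "- ?g"] unfolding bounded_borel_def bounded_iff by auto
  from lin[OF this this, of "- 1" 0] have "m (%t. - 1 * phi ?g (- ?g + t) + 0 * phi ?g (- ?g + t)) = - m (%t. phi ?g (- ?g + t))" by simp
  moreover have "(%t. - 1 * phi ?g (- ?g + t) + 0 * phi ?g (- ?g + t)) = phi (- ?g)"
   unfolding phi_def fun_eq_iff add.assoc[symmetric] right_minus by simp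
  moreover have "m (%t. phi ?g (- ?g + t)) = m (phi ?g)" using M g by blast
  ultimately show ?thesis by simp
 qed
 have "m f = - m f"
  unfolding mf sum_negf[symmetric]
 proof (rule sum.reindex_bij_witness[of _ prod.swap prod.swap])
  fix p assume "p : S \<times> S"
  thus "- (?x (prod.swap p) * m (?F (prod.swap p))) = ?x p * m (?F p)"
   using anti[of "fst p" "snd p"] by (simp add: mem_Times_iff mult.commute)
 qed auto
 hence mf0: "m f = 0" by simp
 obtain B where B: "!!t. cmod (f t) <= B" by (rule bounded_borelE[OF f_bb]) blast
 \<comment> \<open>A mean is controlled by the essential supremum of the modulus. The real function
   \<open>f\<close> has values in \<open>[- B, - e]\<close>; shifting it by \<open>B\<close> gives
   modulus at most \<open>B - e\<close> but mean \<open>B\<close>.\<close>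
 have "cmod (f t + of_real B) <= B - e" for t
 proof -
  have "- B <= Re (f t)" using B[of t] abs_Re_le_cmod[of "f t"] by simp
  hence "\<bar>Re (f t) + B\<bar> <= B - e" using f_le(2)[of t] by simp
  thus ?thesis using f_le(1)[of t] by (metis norm_of_real of_real_add)
 qed
 hence "locally_null \<mu> {t. cmod (1 * f t + of_real B * 1) > B - e}" by (simp add: locally_null_def not_less[symmetric])
 moreover have "(%t. 1 * f t + of_real B * 1) : bounded_borel" by (rule comb[OF f_bb one_bb])
 ultimately have "cmod (m (%t. 1 * f t + of_real B * 1)) <= B - e" by (intro le)
 moreover have "m (%t. 1 * f t + of_real B * 1) = of_real B" using lin[OF f_bb one_bb, of 1 "of_real B"] mf0 M by simp
 moreover have "B >= 0" using order_trans[OF norm_ge_zero B] .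
 ultimately show False using e by simp
qed

end

section \<open>Almost fixed functions and the trivial representation\<close>

context haar
begin

text \<open>Otherwise \<open>n2_gap\<close> with \<open>k = f\<close> produces a kernel
  \<open>a\<close>, again of integral 1, with the spectral gap \<open>1 - e / 2\<close>, which
  excludes an invariant mean.\<close>

lemma ex_kernel_almost_fixed:
 assumes am: "amenable \<mu>" and f: "Cc f" "!!t. 0 <= f t" "(LI s. f s) = 1" and e: "0 < e" "e <= 1"
 shows "EX F. Cc F & (1 - e) * (n2 F)^2 < (LI t. cv f F t * F t)"
proof (rule ccontr)
 assume "\<nexists>F. Cc F & (1 - e) * (n2 F)^2 < (LI t. cv f F t * F t)"
 hence gap: "!!F. Cc F ==> (LI t. cv f F t * F t) <= (1 - e) * (n2 F)^2" by (meson not_le)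
 define a where "a = (%t. 1/2 * (f t + cv f f t))"
 have ff: "Cc (cv f f)" by (intro Cc_cv f)
 have 1: "Cc a" unfolding a_def by (intro Cc_cmult Cc_add f ff)
 have "(LI t. cv f f t) = (LI s. f s * (LI t. f (- s + t)))"
  using integral_cv(1)[OF f(1,1), of "%_. 1"] by simp
 also have "... = 1" using integral_translate'[OF Cc_measurable[OF f(1)]] f(3) by simp
 finally have 2: "(LI s. a s) = 1"
  using Cc_integrable[OF f(1)] Cc_integrable[OF ff] f(3) by (simp add: a_def)
 interpret spectral_gap \<mu> a "1 - e / 2"
  by unfold_locales (use 1 2 e f cv_nonneg[of f f] n2_gap[OF f gap f a_def] in "auto simp: a_def")
 from not_amenable am show False by contradiction
qed

text \<open>If the normalised modulus of \<open>g\<close> almost fixes a unit vector, the diagonal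
  coefficient \<open>u\<close> of that vector is close to 1 in mean against the modulus of
  \<open>g\<close>. The integral of \<open>g\<close> is then close to that of \<open>g u\<close>, a
  coefficient of \<open>\<lambda>(g)\<close> and hence almost bounded by \<open>c\<close>.\<close>

lemma one_in_Br_if_amenable:
 assumes am: "amenable \<mu>"
 shows "(%_. 1) : Br"
proof (rule one_in_Br)
 fix f c assume f: "intg f" and c: "c > 0" and lb: "lam_bdd f c"
 show "cmod (LI s. f s) <= c"
 proof (rule field_le_epsilon)
  fix d :: real assume d: "d > 0"
  obtain g where g: "Cc g" "(LI t. cmod (f t - g t)) < d / 3" using Cc_dense_L1[OF f, of "d / 3"] d by auto
  have ig: "intg g" by (rule Cc_integrable[OF g(1)])
  define I where "I = (LI t. cmod (g t))"
  have fg: "cmod (LI t. (f t - g t) * u t) <= d / 3" if "cont u" "!!s. cmod (u s) <= 1" for u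
   using cmod_integral_mult_le[of "%t. f t - g t" u 1] f ig that g(2) by simp
  have "cmod (LI s. g s) <= c + 2 * (d / 3)"
  proof (cases "I = 0")
   case True
   thus ?thesis using integral_norm_bound[of \<mu> g] c d by (simp add: I_def)
  next
   case False
   moreover have "I >= 0" unfolding I_def by (rule Bochner_Integration.integral_nonneg) simp
   ultimately have I: "I > 0" by simp
   \<comment> \<open>The deviation of \<open>u\<close> from 1, integrated against the modulus of
     \<open>g\<close>, is at most \<open>I * eta\<close>, one third of the allowed error; the bound
     1 is required by \<open>ex_kernel_almost_fixed\<close>.\<close>
   define eta where "eta = min 1 (d / (3 * I))"
   have eta: "0 < eta" "eta <= 1" "eta * I <= d / 3" using I d by (auto simp: eta_def min_def field_simps)
   define k where "k t = 1 / I * cmod (g t)" for t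
   have k: "Cc k" unfolding k_def[abs_def] by (intro Cc_cmult Cc_compose[OF g(1)]) (auto intro: continuous_intros)
   have k': "0 <= k t" "(LI s. k s) = 1" for t using I by (simp_all add: k_def I_def)
   obtain F where F: "Cc F" "(1 - eta) * (n2 F)^2 < (LI t. cv k F t * F t)"
    using ex_kernel_almost_fixed[OF am k k', of eta] eta by auto
   have "n2 F ~= 0"
   proof
    assume "n2 F = 0"
    with F(2) cv_inner_le[OF k k'(1) F(1) F(1)] show False by simp
   qed
   hence n: "n2 F > 0" using n2_nonneg[of F] by linarith
   define \<xi> where "\<xi> t = complex_of_real (1 / n2 F * F t)" for t
   have \<xi>: "sq_int \<xi>" unfolding \<xi>_def[abs_def] by (intro Cc_sq_int Cc_of_real Cc_cmult F)
   have n1: "nm \<xi> = 1"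
    using nm_scale[of "of_real (1 / n2 F)" "%t. of_real (F t)"] n by (simp add: \<xi>_def[abs_def] n2_eq_nm norm_divide)
   define u where "u s = 1 / (n2 F)^2 * (LI t. F (- s + t) * F t)" for s
   have lu: "lamc \<xi> \<xi> s = of_real (u s)" for s
    unfolding \<xi>_def[abs_def] lamc_of_real u_def by (simp add: power2_eq_square mult_ac)
   have ub: "\<bar>u s\<bar> <= 1" for s using lamc_bound[OF \<xi> \<xi>, of s] n1 by (simp add: lu)
   have cu: "cont u"
    using lamc_continuous[OF \<xi> \<xi>] unfolding lu[abs_def] by (drule_tac continuous_on_Re) simp
   have iu: "intg (%s. cmod (g s) * u s)"
    by (rule Cc_integrable[OF Cc_mult_left[OF Cc_compose[OF g(1)] cu]]) (auto intro: continuous_intros)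
   have "(LI s. k s * u s) = 1 / (n2 F)^2 * (LI t. cv k F t * F t)"
    unfolding integral_cv(1)[OF k F(1) Cc_continuous[OF F(1)]] u_def integral_mult_right_zero[symmetric]
    by (rule Bochner_Integration.integral_cong) simp_all
   also have "... > 1 - eta" using F(2) n by (simp add: pos_less_divide_eq)
   finally have ku: "(LI s. cmod (g s) * u s) > I * (1 - eta)"
    using I by (simp add: k_def mult.assoc pos_less_divide_eq mult.commute)
   have "cmod (LI s. g s * (1 - of_real (u s))) <= (LI s. cmod (g s) * (1 - u s))"
   proof -
    have "cmod (g s * (1 - of_real (u s))) = cmod (g s) * (1 - u s)" for s
     using ub[of s] norm_of_real[of "1 - u s", where ?'a = complex] unfolding norm_mult by (simp add: abs_le_iff)
    thus ?thesis using integral_norm_bound[of \<mu> "%s. g s * (1 - of_real (u s))"] by simp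
   qed
   also have "... = I - (LI s. cmod (g s) * u s)" using ig iu by (simp add: right_diff_distrib I_def)
   also have "... <= I * (eta)" using ku by (simp add: right_diff_distrib)
   finally have A: "cmod (LI s. g s * (1 - of_real (u s))) <= d / 3" using eta(3) by (simp add: mult.commute)
   have cu': "cont (%s. complex_of_real (u s))" by (intro continuous_intros cu)
   have "cmod (LI s. f s * of_real (u s)) <= c"
    using lam_bddD[OF lb \<xi> \<xi>] n1 by (simp add: lu)
   moreover have "(LI s. g s) = (LI s. g s * (1 - of_real (u s))) - (LI s. (f s - g s) * of_real (u s)) + (LI s. f s * of_real (u s))"
    using integrable_mult_continuous[OF f cu', of 1] integrable_mult_continuous[OF ig cu', of 1] ub ig
    by (simp add: left_diff_distrib right_diff_distrib)
   ultimately show ?thesis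
    using A fg[OF cu'] ub norm_triangle_ineq[of "(LI s. g s * (1 - of_real (u s))) - (LI s. (f s - g s) * of_real (u s))" "LI s. f s * of_real (u s)"]
     norm_triangle_ineq4[of "LI s. g s * (1 - of_real (u s))" "LI s. (f s - g s) * of_real (u s)"] by simp
  qed
  moreover have "(LI s. f s) = (LI s. (f s - g s) * 1) + (LI s. g s)" using f ig by simp
  ultimately show "cmod (LI s. f s) <= c + d"
   using fg[of "%_. 1"] norm_triangle_ineq[of "LI s. (f s - g s) * 1" "LI s. g s"] by simp
 qed
qed

end

section \<open>Eberlein algebras and their duals\<close>

lemma uniform_closure_iff: "f : uniform_closure A \<longleftrightarrow> (ALL e>0. EX g:A. ALL t. cmod (f t - g t) < e)"
proof
 assume "f : uniform_closure A"
 then obtain g where g: "!!n::nat. g n : A" "uniform_limit UNIV g f sequentially" by (auto simp: uniform_closure_def)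
 show "ALL e>0. EX g:A. ALL t. cmod (f t - g t) < e"
 proof (intro allI impI)
  fix e :: real assume "e > 0"
  from uniform_limitD[OF g(2) this] obtain n where "ALL t. dist (g n t) (f t) < e" by (auto simp: eventually_sequentially)
  with g(1) show "EX g:A. ALL t. cmod (f t - g t) < e" by (intro bexI[of _ "g n"]) (auto simp: dist_norm norm_minus_commute)
 qed
next
 assume "ALL e>0. EX g:A. ALL t. cmod (f t - g t) < e"
 hence "ALL n::nat. EX g:A. ALL t. cmod (f t - g t) < inverse (real (Suc n))" by simp
 then obtain g where g: "!!n. g n : A" "!!n t. cmod (f t - g n t) < inverse (real (Suc n))" by metis
 have "uniform_limit UNIV g f sequentially"
 proof (rule uniform_limitI)
  fix e :: real assume "e > 0"
  hence "\<forall>\<^sub>F n in sequentially. inverse (real (Suc n)) < e" by (rule order_tendstoD(2)[OF LIMSEQ_inverse_real_of_nat])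
  thus "\<forall>\<^sub>F n in sequentially. ALL t:UNIV. dist (g n t) (f t) < e"
   by eventually_elim (use g(2) in "auto simp: dist_norm norm_minus_commute intro: less_trans")
 qed
 with g(1) show "f : uniform_closure A" by (auto simp: uniform_closure_def)
qed

lemma uniform_closure_subset: "A \<subseteq> uniform_closure A"
 unfolding subset_iff uniform_closure_iff by (auto intro!: bexI)

lemma uniform_closure_map:
 assumes f: "f : uniform_closure A" and T: "!!g. g : A ==> T g : A"
  and d: "!!g e. (!!t. cmod (f t - g t) < e) ==> (!!t. cmod (T f t - T g t) < e)"
 shows "T f : uniform_closure A"
 using f T d unfolding uniform_closure_iff by meson

lemma uniform_closure_lincomb:
 assumes A: "!!f g. f : A ==> g : A ==> (%t. a * f t + b * g t) : A"
  and f: "f : uniform_closure A" and g: "g : uniform_closure A"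
 shows "(%t. a * f t + b * g t) : uniform_closure A"
 unfolding uniform_closure_iff
proof (intro allI impI)
 fix e :: real assume e: "e > 0"
 define c where "c = cmod a + cmod b + 1"
 have c: "c > 0" unfolding c_def by (simp add: add_nonneg_pos)
 obtain f' where f': "f' : A" "!!t. cmod (f t - f' t) < e / c" using f e c unfolding uniform_closure_iff by (meson divide_pos_pos)
 obtain g' where g': "g' : A" "!!t. cmod (g t - g' t) < e / c" using g e c unfolding uniform_closure_iff by (meson divide_pos_pos)
 have "cmod ((a * f t + b * g t) - (a * f' t + b * g' t)) < e" for t
 proof -
  have "(a * f t + b * g t) - (a * f' t + b * g' t) = a * (f t - f' t) + b * (g t - g' t)" by (simp add: algebra_simps)
  also have "cmod ... <= cmod a * (e / c) + cmod b * (e / c)"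
   by (intro norm_triangle_mono; simp only: norm_mult; intro mult_left_mono less_imp_le f'(2) g'(2) norm_ge_zero)
  also have "... = e * ((cmod a + cmod b) / c)" by (simp add: distrib_left add_divide_distrib mult.commute)
  also have "... < e * 1" using e c by (intro mult_strict_left_mono) (simp_all add: c_def)
  finally show ?thesis by simp
 qed
 with A[OF f'(1) g'(1)] show "EX h:A. ALL t. cmod ((a * f t + b * g t) - h t) < e" by (intro bexI[of _ "%t. a * f' t + b * g' t"]) auto
qed

lemma uniform_closure_bounded:
 assumes "!!g. g : A ==> EX B. ALL t. cmod (g t) <= B" and f: "f : uniform_closure A"
 shows "EX B. ALL t. cmod (f t) <= B"
proof -
 obtain g where g: "g : A" "!!t. cmod (f t - g t) < 1" using f unfolding uniform_closure_iff by (meson zero_less_one)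
 obtain B where B: "!!t. cmod (g t) <= B" using assms(1)[OF g(1)] by blast
 have "cmod (f t) <= 1 + B" for t using norm_triangle_ineq2[of "f t" "g t"] g(2)[of t] B[of t] by simp
 thus ?thesis by blast
qed

lemma uniform_closure_mult:
 assumes A: "!!f g. f : A ==> g : A ==> (%t. f t * g t) : A" and bd: "!!g. g : A ==> EX B. ALL t. cmod (g t) <= B"
  and f: "f : uniform_closure A" and g: "g : uniform_closure A"
 shows "(%t. f t * g t) : uniform_closure A"
 unfolding uniform_closure_iff
proof (intro allI impI)
 fix e :: real assume e: "e > 0"
 obtain B where B: "!!t. cmod (g t) <= B" using uniform_closure_bounded[OF bd g] by blast
 define c where "c = \<bar>B\<bar> + 1"
 have c: "c > 0" by (simp add: c_def add_nonneg_pos)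
 obtain f' where f': "f' : A" "!!t. cmod (f t - f' t) < e / (2 * c)" using f e c unfolding uniform_closure_iff by (meson divide_pos_pos mult_pos_pos zero_less_numeral)
 obtain C where C: "!!t. cmod (f' t) <= C" using bd[OF f'(1)] by blast
 define d where "d = \<bar>C\<bar> + 1"
 have d: "d > 0" by (simp add: d_def add_nonneg_pos)
 obtain g' where g': "g' : A" "!!t. cmod (g t - g' t) < e / (2 * d)" using g e d unfolding uniform_closure_iff by (meson divide_pos_pos mult_pos_pos zero_less_numeral)
 have "cmod (f t * g t - f' t * g' t) < e" for t
 proof -
  have "f t * g t - f' t * g' t = (f t - f' t) * g t + f' t * (g t - g' t)" by (simp add: algebra_simps)
  also have "cmod ... <= e / (2 * c) * \<bar>B\<bar> + \<bar>C\<bar> * (e / (2 * d))"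
   by (intro norm_triangle_mono; simp only: norm_mult;
     intro mult_mono less_imp_le[OF f'(2)] less_imp_le[OF g'(2)] order_trans[OF B abs_ge_self] order_trans[OF C abs_ge_self])
    (use e c d in auto)
  also have "... < e / (2 * c) * c + d * (e / (2 * d))"
   using e c d by (intro add_strict_mono mult_strict_left_mono mult_strict_right_mono) (auto simp: c_def d_def add_nonneg_pos)
  also have "... = e" using c d by simp
  finally show ?thesis .
 qed
 with A[OF f'(1) g'(1)] show "EX h:A. ALL t. cmod (f t * g t - h t) < e" by (intro bexI[of _ "%t. f' t * g' t"]) auto
qed

section \<open>Translation invariant function spaces, their duals and compactifications\<close>

locale fspace =
 fixes X :: "('g::group_add => complex) set"
 assumes X_lin: "f : X ==> g : X ==> (%t. a * f t + b * g t) : X"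
  and X_zero: "(%_. 0) : X"
  and X_bounded: "f : X ==> EX B. ALL t. cmod (f t) <= B"
  and X_left: "f : X ==> (%t. f (s + t)) : X"
  and X_right: "f : X ==> (%t. f (t + s)) : X"
begin

lemma fspace_uniform_closure: "fspace (uniform_closure X)"
proof
 show "(%t. f (s + t)) : uniform_closure X" "(%t. f (t + s)) : uniform_closure X" if "f : uniform_closure X" for f s
  by (rule uniform_closure_map[OF that, of "%f t. f (s + t)"] uniform_closure_map[OF that, of "%f t. f (t + s)"];
   use X_left X_right in blast)+
qed (use uniform_closure_lincomb[of X] X_lin uniform_closure_subset X_zero uniform_closure_bounded X_bounded in blast)+

lemma evaluation_apply [simp]: "f : X ==> evaluation X s f = f s"
 by (simp add: evaluation_def)

lemma cmod_le_SUP: "f : X ==> cmod (f t) <= (SUP t. cmod (f t))"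
 using X_bounded[of f] by (intro cSUP_upper) auto

lemma evaluation_in_dual: "evaluation X s : dual_space X"
 unfolding dual_space_def by (auto simp: X_lin evaluation_def intro!: exI[of _ 1] cmod_le_SUP)

lemma zero_in_dual: "restrict (%_. 0) X : dual_space X"
 unfolding dual_space_def by (auto simp: X_lin intro!: exI[of _ 0])

lemma dual_lin: "m : dual_space X ==> f : X ==> g : X ==> m (%t. a * f t + b * g t) = a * m f + b * m g"
 by (simp add: dual_space_def)

lemma dual_bound:
 assumes "m : dual_space X"
 obtains C where "C >= 0" "!!f B. f : X ==> (!!t. cmod (f t) <= B) ==> cmod (m f) <= C * B"
proof -
 obtain C where "ALL f:X. cmod (m f) <= C * (SUP t. cmod (f t))" using assms by (auto simp: dual_space_def)
 note C = bspec[OF this]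
 have "cmod (m f) <= \<bar>C\<bar> * B" if f: "f : X" and B: "!!t. cmod (f t) <= B" for f B
 proof -
  have "0 <= (SUP t. cmod (f t))" using order_trans[OF norm_ge_zero cmod_le_SUP[OF f, of 0]] .
  hence "C * (SUP t. cmod (f t)) <= \<bar>C\<bar> * (SUP t. cmod (f t))" by (intro mult_right_mono) auto
  also have "... <= \<bar>C\<bar> * B" by (intro mult_left_mono cSUP_least B) auto
  finally show ?thesis using C[OF f] by simp
 qed
 thus ?thesis by (intro that[of "\<bar>C\<bar>"]) auto
qed

lemma dual_eqI: "m : dual_space X ==> n : dual_space X ==> (!!f. f : X ==> m f = n f) ==> m = n"
 by (rule extensionalityI[of _ X]) (auto simp: dual_space_def)

lemma dual_lincomb_in_dual:
 assumes m: "m : dual_space X" and n: "n : dual_space X"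
 shows "dual_lincomb X a m b n : dual_space X"
proof -
 obtain C where "ALL f:X. cmod (m f) <= C * (SUP t. cmod (f t))" using m by (auto simp: dual_space_def)
 note C = bspec[OF this]
 obtain D where "ALL f:X. cmod (n f) <= D * (SUP t. cmod (f t))" using n by (auto simp: dual_space_def)
 note D = bspec[OF this]
 have "cmod (a * m f + b * n f) <= (cmod a * C + cmod b * D) * (SUP t. cmod (f t))" if "f : X" for f
 proof -
  have "cmod (a * m f + b * n f) <= cmod a * (C * (SUP t. cmod (f t))) + cmod b * (D * (SUP t. cmod (f t)))"
   by (rule norm_triangle_mono) (auto simp: norm_mult intro!: mult_left_mono C D that)
  thus ?thesis by (simp add: distrib_right mult.assoc)
 qed
 thus ?thesis
  using X_lin dual_lin[OF m] dual_lin[OF n] unfolding dual_space_def dual_lincomb_def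
  by (auto simp: distrib_left mult.left_commute intro!: exI[of _ "cmod a * C + cmod b * D"])
qed

lemma arens_evaluation: "f : X ==> arens X m (evaluation X s) f = m (%t. f (t + s))"
 by (simp add: arens_def X_left)

lemma arens_evaluation_in_dual:
 assumes m: "m : dual_space X"
 shows "arens X m (evaluation X s) : dual_space X"
proof -
 obtain C where C: "C >= 0" "!!f B. f : X ==> (!!t. cmod (f t) <= B) ==> cmod (m f) <= C * B"
  by (rule dual_bound[OF m]) blast
 have "cmod (arens X m (evaluation X s) f) <= C * (SUP t. cmod (f t))" if "f : X" for f
  unfolding arens_evaluation[OF that] by (rule C(2)[OF X_right cmod_le_SUP]) (rule that)+
 thus ?thesis
  using dual_lin[OF m X_right X_right] unfolding dual_space_def
  by (auto simp: arens_evaluation X_lin) (simp add: arens_def)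
qed

abbreviation cpt :: "('g fn => complex) set" where
 "cpt \<equiv> dual_weak_star X closure_of range (evaluation X)"

lemma in_cpt_iff:
 "m : cpt \<longleftrightarrow> m : dual_space X & (ALL F e. finite F --> F \<subseteq> X --> e > 0 --> (EX t. ALL f:F. cmod (f t - m f) < e))"
proof -
 let ?e = "%f m. m f"
 have Phi: "{%m. m f | f. f : X} = ?e ` X" by auto
 note cl = in_closure_of_initial_topology[of m "dual_space X" "?e ` X" "range (evaluation X)"]
 show ?thesis unfolding dual_weak_star_def Phi
 proof (intro iffI conjI allI impI)
  assume m: "m : initial_topology (dual_space X) (?e ` X) closure_of range (evaluation X)"
  thus "m : dual_space X" unfolding cl by simp
  fix F and e :: real assume F: "finite F" "F \<subseteq> X" "e > 0"
  have "finite (?e ` F) & ?e ` F \<subseteq> ?e ` X & e > 0" using F by blast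
  from conjunct2[OF m[unfolded cl], rule_format, OF this]
  obtain t where t: "ALL phi:?e ` F. cmod (phi (evaluation X t) - phi m) < e" by auto
  have "cmod (f t - m f) < e" if "f : F" for f using bspec[OF t imageI[OF that]] F(2) that by (simp add: subset_iff)
  thus "EX t. ALL f:F. cmod (f t - m f) < e" by blast
 next
  assume m: "m : dual_space X & (ALL F e. finite F --> F \<subseteq> X --> e > 0 --> (EX t. ALL f:F. cmod (f t - m f) < e))"
  have "EX v:range (evaluation X) \<inter> dual_space X. ALL phi:Psi. cmod (phi v - phi m) < e"
   if Psi: "finite Psi" "Psi \<subseteq> ?e ` X" and e: "e > 0" for Psi e
  proof -
   obtain F where F: "finite F" "F \<subseteq> X" "Psi = ?e ` F" using finite_subset_image[OF Psi] by blast
   then obtain t where "ALL f:F. cmod (f t - m f) < e" using m e by blast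
   thus ?thesis using F(2) evaluation_in_dual[of t] unfolding F(3)
    by (intro bexI[of _ "evaluation X t"]) (auto simp: subset_iff)
  qed
  with m show "m : initial_topology (dual_space X) (?e ` X) closure_of range (evaluation X)" unfolding cl by simp
 qed
qed

lemma arens_evaluation_in_cpt:
 assumes m: "m : cpt"
 shows "arens X m (evaluation X s) : cpt"
 unfolding in_cpt_iff
proof (intro conjI allI impI)
 show "arens X m (evaluation X s) : dual_space X" using m arens_evaluation_in_dual by (simp add: in_cpt_iff)
 fix F and e :: real assume F: "finite F" "F \<subseteq> X" "e > 0"
 have "finite ((%f t. f (t + s)) ` F)" "(%f t. f (t + s)) ` F \<subseteq> X" using F X_right by auto
 then obtain t where "ALL g:(%f t. f (t + s)) ` F. cmod (g t - m g) < e" using m F(3) unfolding in_cpt_iff by blast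
 thus "EX t. ALL f:F. cmod (f t - arens X m (evaluation X s) f) < e"
  using F(2) by (intro exI[of _ "t + s"]) (auto simp: arens_evaluation subset_iff)
qed

text \<open>A weak* continuous functional is below 1 on a set given by finitely many evaluations; by
  scaling it vanishes where these vanish, so it is a combination of them and thus evaluation at one
  element of \<open>X\<close>.\<close>

lemma weak_star_functional:
 assumes omega: "continuous_map (dual_weak_star X) euclidean omega"
  and lin: "!!m n a b. m : dual_space X ==> n : dual_space X ==> omega (dual_lincomb X a m b n) = a * omega m + b * (omega n :: complex)"
 shows "EX f:X. ALL m:dual_space X. omega m = m f"
proof -
 let ?D = "dual_space X" and ?z = "restrict (%_. 0) X"
 have z0: "omega ?z = 0"
  using lin[OF zero_in_dual zero_in_dual, of 0 0] by (simp add: dual_lincomb_def cong: restrict_cong)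
 have "openin (dual_weak_star X) {m : ?D. omega m : ball 0 1}"
  using openin_continuous_map_preimage[OF omega, of "ball 0 1"] by (simp add: dual_weak_star_def)
 moreover have "?z : {m : ?D. omega m : ball 0 1}" using z0 zero_in_dual by simp
 ultimately obtain Psi e where Psi: "finite Psi" "Psi \<subseteq> {%m. m f | f. f : X}" "e > 0"
  "{v : ?D. ALL phi:Psi. cmod (phi v - phi ?z) < e} \<subseteq> {m : ?D. omega m : ball 0 1}"
  unfolding dual_weak_star_def by (rule initial_topology_nhdE)
 have PsiX: "EX f:X. phi = (%m. m f)" if "phi : Psi" for phi using Psi(2) that by auto
 have "EX c. ALL m:?D. omega m = (SUM phi:Psi. c phi * phi m)"
 proof (rule functional_in_span[OF Psi(1), where L = "%a m b n. dual_lincomb X a m b n"])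
  show "phi (dual_lincomb X a m b n) = a * phi m + b * phi n" if "phi : insert omega Psi" "m : ?D" "n : ?D" for phi m n a b
  proof (cases "phi : Psi")
   case True
   obtain f where "f : X" "phi = (%m. m f)" using PsiX[OF True] by blast
   thus ?thesis by (simp add: dual_lincomb_def)
  qed (use that lin in auto)
  fix m assume m: "m : ?D" and m0: "!!phi. phi : Psi ==> phi m = 0"
  show "omega m = 0"
  proof (rule ccontr)
   assume nz: "omega m ~= 0"
   let ?m = "dual_lincomb X (1 / omega m) m 0 m"
   have "cmod (phi ?m - phi ?z) < e" if "phi : Psi" for phi
    using PsiX[OF that] m0[OF that] Psi(3) by (auto simp: dual_lincomb_def)
   hence "omega ?m : ball 0 1" using Psi(4) dual_lincomb_in_dual[OF m m] by blast
   thus False using lin[OF m m] nz by simp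
  qed
 qed (rule dual_lincomb_in_dual)
 then obtain c where c: "!!m. m : ?D ==> omega m = (SUM phi:Psi. c phi * phi m)" by blast
 define g where "g phi = (SOME f. f : X & phi = (%m. m f))" for phi :: "('g fn => complex) => complex"
 have g: "g phi : X" "phi = (%m. m (g phi))" if "phi : Psi" for phi
  using someI_ex[of "%f. f : X & phi = (%m. m f)"] PsiX[OF that] unfolding g_def by blast+
 have "finite A ==> A \<subseteq> Psi ==> (%t. SUM phi:A. c phi * g phi t) : X & (ALL m:?D. m (%t. SUM phi:A. c phi * g phi t) = (SUM phi:A. c phi * phi m))" for A
 proof (induction A rule: finite_induct)
  case empty
  thus ?case using X_zero dual_lin[OF _ X_zero X_zero, of _ 0 0] by simp
 next
  case (insert phi A)
  let ?s = "%t. SUM phi:A. c phi * g phi t"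
  have IH: "?s : X" "!!m. m : ?D ==> m ?s = (SUM phi:A. c phi * phi m)" using insert by auto
  have gX: "g phi : X" "phi m = m (g phi)" for m using g[of phi] insert.prems by (auto dest: fun_cong)
  show ?case using X_lin[OF gX(1) IH(1), of "c phi" 1] dual_lin[OF _ gX(1) IH(1), of _ "c phi" 1] IH(2) insert.hyps gX(2) by simp
 qed
 from this[OF Psi(1) subset_refl] c show ?thesis by (intro bexI[of _ "%t. SUM phi:Psi. c phi * g phi t"]) auto
qed

end

section \<open>Finite-dimensional and trivial representations\<close>

context hilbert_space
begin

lemma inner_zero: "z : car ==> inn (hzero H) z = 0" "z : car ==> inn z (hzero H) = 0"
proof -
 assume z: "z : car"
 show 1: "inn (hzero H) z = 0" using inner_add[OF zero_closed zero_closed z] by (simp add: add_zero zero_closed)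
 show "inn z (hzero H) = 0" using inner_cnj[OF zero_closed z] 1 by simp
qed

lemma orthonormal_basis:
 assumes "hfinite_dim H"
 obtains E where "finite E" "E \<subseteq> car" "!!x. x : car ==> (SUM e:E. (cmod (inn x e))^2) = (hn x)^2"
proof -
 obtain B where B: "finite B" "B \<subseteq> car" "hsubspace H hull B = car" using assms unfolding hfinite_dim_def by blast
 obtain E where E: "finite E" "E \<subseteq> car"
  "ALL b:B. ALL z:car. inn b z = (SUM e:E. inn b e * inn e z)"
  using finite_orthonormal[OF B(1,2)] by blast
 define V where "V = {x : car. ALL z:car. inn x z = (SUM e:E. inn x e * inn e z)}"
 have i: "e : car" if "e : E" for e using that E(2) by blast
 have "hsubspace H V"
  unfolding hsubspace_def
 proof (intro conjI ballI allI)
  show "hzero H : V" by (simp add: V_def zero_closed inner_zero i)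
  show "hadd H x y : V" if "x : V" "y : V" for x y
   using that i unfolding V_def by (auto simp: inner_simps distrib_right sum.distrib)
  show "hscale H a x : V" if "x : V" for x a
   using that i unfolding V_def by (auto simp: inner_simps mult.assoc sum_distrib_left[symmetric])
 qed (auto simp: V_def)
 moreover have "B \<subseteq> V" using E(3) B(2) by (auto simp: V_def)
 ultimately have "car \<subseteq> V" unfolding B(3)[symmetric] by (intro hull_minimal)
 hence "(SUM e:E. (cmod (inn x e))^2) = (hn x)^2" if "x : car" for x
  using that by (intro sum_cmod_inner_square[OF E(2) that]) (auto simp: V_def)
 with E(1,2) show ?thesis by (rule that)
qed

end

text \<open>On finitely many coordinates \<open>\<pi> t (\<pi> s x - x)\<close> can be made small,
  since both terms have the same limit under \<open>B\<close>. In finite dimension these coordinates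
  give the whole norm, which does not depend on \<open>t\<close>; hence it is 0.\<close>

lemma (in urep) trivial_if_invariant_limit:
 assumes fd: "hfinite_dim H"
  and lim: "!!P e. finite P ==> P \<subseteq> car \<times> car ==> e > 0 ==>
   EX t. ALL p:P. cmod (cf (fst p) (snd p) t - B (fst p) (snd p)) < e"
  and inv: "!!x y s. x : car ==> y : car ==> B (\<pi> s x) y = B x y"
  and x: "x : car"
 shows "\<pi> s x = x"
proof -
 obtain E where E: "finite E" "E \<subseteq> car" "!!x. x : car ==> (SUM e:E. (cmod (inn x e))^2) = (hn x)^2"
  by (rule orthonormal_basis[OF fd]) blast
 let ?w = "dif (\<pi> s x) x"
 have sx: "\<pi> s x : car" by (rule rep_closed[OF x])
 have w: "?w : car" using x sx by (simp add: inner_simps)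
 have "(hn ?w)^2 <= 0 + e" if e: "e > 0" for e
 proof -
  define N where "N = 4 * (real (card E) + 1)"
  have N: "N > 0" by (simp add: N_def add_nonneg_pos)
  define d where "d = min 1 (e / N)"
  have d: "d > 0" "d <= 1" "d <= e / N" using e N by (auto simp: d_def)
  let ?P = "(%e. (\<pi> s x, e)) ` E \<union> (%e. (x, e)) ` E"
  obtain t where t: "ALL p:?P. cmod (cf (fst p) (snd p) t - B (fst p) (snd p)) < d"
   using lim[of ?P d] E(1,2) x sx d(1) by auto
  have "(cmod (inn (\<pi> t ?w) f))^2 <= 4 * d" if f: "f : E" for f
  proof -
   have fH: "f : car" using f E(2) by blast
   have "cmod (cf (\<pi> s x) f t - B x f) < d" "cmod (cf x f t - B x f) < d"
    using bspec[OF t, of "(\<pi> s x, f)"] bspec[OF t, of "(x, f)"] f inv[OF x fH] by auto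
   hence "cmod (cf (\<pi> s x) f t - cf x f t) <= 2 * d"
    using norm_triangle_ineq4[of "cf (\<pi> s x) f t - B x f" "cf x f t - B x f"] by simp
   moreover have "inn (\<pi> t ?w) f = cf (\<pi> s x) f t - cf x f t"
    using x sx fH by (simp add: coefficient_def rep_add rep_scale inner_simps rep_closed)
   ultimately have "cmod (inn (\<pi> t ?w) f) <= 2 * d" by simp
   hence "(cmod (inn (\<pi> t ?w) f))^2 <= (2 * d)^2" by (rule power_mono) simp
   also have "... <= 4 * d" using d by (simp add: power2_eq_square mult_left_le)
   finally show ?thesis .
  qed
  hence "(SUM f:E. (cmod (inn (\<pi> t ?w) f))^2) <= real (card E) * (4 * d)" by (rule sum_bounded_above)
  also have "... <= N * d" using d by (simp add: N_def algebra_simps)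
  also have "... <= N * (e / N)" by (rule mult_left_mono) (use d N in auto)
  finally show ?thesis using N E(3)[OF rep_closed[OF w]] rep_norm[OF w] by simp
 qed
 hence "(hn ?w)^2 <= 0" by (rule field_le_epsilon)
 hence "?w = hzero H" by (intro hnorm_eq_0[OF w]) simp
 thus ?thesis by (rule hdiff_eq_0[OF sx x])
qed

text \<open>Under a trivial action every closed subspace is invariant, so irreducibility leaves one
  dimension.\<close>

lemma trivial_irreducible:
 assumes irr: "irreducible_rep H sg" and triv: "!!s x. x : hcarrier H ==> sg s x = x"
 shows "rep_equiv H sg complex_hspace trivial_rep"
proof -
 interpret urep H sg by unfold_locales (use irr in "simp add: irreducible_rep_def")
 obtain x where x: "x : car" "x ~= hzero H" using irr zero_closed unfolding irreducible_rep_def by blast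
 have n: "hn x > 0" using hnorm_nonneg[OF x(1)] hnorm_eq_0[OF x(1)] x(2) by fastforce
 define e where "e = hscale H (of_real (1 / hn x)) x"
 have e: "e : car" unfolding e_def by (rule scale_closed[OF x(1)])
 have "hn e = 1" using n unfolding e_def hnorm_scale[OF x(1)] by (simp add: norm_divide)
 hence ee: "inn e e = 1" by (simp add: inner_self[OF e])
 \<comment> \<open>The line through \<open>e\<close> as a double orthogonal complement, a form in
   which closedness is immediate.\<close>
 define V where "V = {y : car. ALL z:car. inn z e = 0 --> inn y z = 0}"
 have eV: "e : V" using e inner_cnj[OF _ e] by (simp add: V_def)
 interpret M: Metric_space "car" "hdist H" by (rule Metric_space_hdist)
 have "V = car"
 proof -
  have "hsubspace H V" unfolding hsubspace_def V_def by (auto simp: zero_closed inner_zero inner_simps)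
  moreover have "closedin (htopology H) V"
   unfolding htopology_def M.metric_closedin_iff_sequentially_closed
  proof (intro conjI allI impI)
   fix s y assume s: "range s \<subseteq> V & limitin M.mtopology s y sequentially"
   hence sV: "s n : V" and sH: "s n : car" for n by (auto simp: V_def)
   have y: "y : car" and d: "(%n. hdist H (s n) y) \<longlonglongrightarrow> 0"
    using s unfolding M.limitin_metric_dist_null by auto
   have "inn y z = 0" if z: "z : car" "inn z e = 0" for z
   proof -
    have "(%n. hn (dif (s n) y)) \<longlonglongrightarrow> 0" using d y sH by (simp add: hdist_def)
    from inner_tendsto[OF sH y z(1) this] have "(%n. inn z (s n)) \<longlonglongrightarrow> inn z y" .
    moreover have "inn z (s n) = 0" for n using inner_cnj[OF sH z(1), of n] sV[of n] z by (simp add: V_def)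
    ultimately have "(%_. 0) \<longlonglongrightarrow> inn z y" by simp
    from LIMSEQ_unique[OF this tendsto_const] have "inn z y = 0" by simp
    thus ?thesis using inner_cnj[OF z(1) y] by simp
   qed
   thus "y : V" using y by (simp add: V_def)
  qed (auto simp: V_def)
  moreover have "sg s ` V \<subseteq> V" for s using triv by (auto simp: V_def)
  moreover have "V ~= {hzero H}" using eV ee inner_zero(1)[OF e] by auto
  ultimately show ?thesis using irr unfolding irreducible_rep_def by blast
 qed
 have span: "y = hscale H (inn y e) e" if y: "y : car" for y
 proof -
  let ?d = "dif y (hscale H (inn y e) e)"
  have d: "?d : car" using y e by (simp add: inner_simps)
  have de: "inn ?d e = 0" using y e by (simp add: inner_simps ee)
  have yd: "inn y ?d = 0" using y \<open>V = car\<close> d de unfolding V_def by blast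
  have ed: "inn e ?d = 0" using inner_cnj[OF d e] de by simp
  have se: "hscale H (inn y e) e : car" by (rule scale_closed[OF e])
  have "inn ?d ?d = inn y ?d + - 1 * (inn y e * inn e ?d)"
   by (simp only: inner_add[OF y scale_closed[OF se] d] inner_scale[OF se d] inner_scale[OF e d])
  hence "?d = hzero H" using yd ed by (intro inner_definite[OF d]) simp
  thus ?thesis by (rule hdiff_eq_0[OF y se])
 qed
 have "hunitary H complex_hspace (%y. inn y e)"
  unfolding hunitary_def hlinear_def
 proof (intro conjI ballI allI)
  have "c : (%y. inn y e) ` car" for c
   by (rule image_eqI[of _ _ "hscale H c e"]) (simp_all add: e ee inner_simps)
  thus "(%y. inn y e) ` car = hcarrier complex_hspace" by (auto simp: ch_sel)
  fix x y assume xy: "x : car" "y : car"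
  have "inn x y = inn x (hscale H (inn y e) e)" using span[OF xy(2)] by simp
  also have "... = cnj (inn y e) * inn x e" by (rule inner_scale_right[OF e xy(1)])
  finally show "hinner complex_hspace (inn x e) (inn y e) = inn x y" by (simp add: ch_sel mult.commute)
 qed (auto simp: complex_hspace_def inner_simps e)
 thus ?thesis unfolding rep_equiv_def using triv
  by (intro exI[of _ "%y. inn y e"]) (auto simp: trivial_rep_def)
qed

text \<open>The conditions over \<open>fd_irreps\<close> need a member with carrier in the given
  type; the complex line is transported along \<open>i\<close>.\<close>

lemma ex_trivial_irreducible:
 assumes "inj (i :: complex => 'h)"
 shows "EX (H :: 'h hspace) sg. (H, sg :: 'g::{topological_group_add,t2_space} => 'h => 'h) : fd_irreps"
proof -
 define k where "k = inv i"
 have ki [simp]: "k (i z) = z" for z unfolding k_def by (rule inv_f_f[OF assms])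
 define H where "H = \<lparr>hcarrier = range i, hzero = i 0, hadd = (%x y. i (k x + k y)), hscale = (%a x. i (a * k x)),
  hinner = (%x y. k x * cnj (k y))\<rparr>"
 have sel [simp]: "hcarrier H = range i" "hzero H = i 0" "hadd H x y = i (k x + k y)" "hscale H a x = i (a * k x)"
  "hinner H x y = k x * cnj (k y)" for x y a by (simp_all add: H_def)
 have nrm: "hnorm H x = cmod (k x)" for x by (simp add: hnorm_def complex_mult_cnj cmod_def)
 interpret semi_inner H by unfold_locales (auto simp: algebra_simps)
 have sep: "x = y" if "x : car" "y : car" "hn (dif x y) = 0" for x y
  using that by (auto simp: nrm)
 have lim: "EX y:car. (%n. hn (dif (s n) y)) \<longlonglongrightarrow> 0" if s: "hCauchy s" for s
 proof -
  have "Cauchy (%n. k (s n))" using s unfolding hCauchy_def small_def Cauchy_def by (simp add: nrm dist_norm)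
  then obtain L where "(%n. k (s n)) \<longlonglongrightarrow> L" by (auto simp: Cauchy_convergent_iff convergent_def)
  hence "(%n. cmod (k (s n) - L)) \<longlonglongrightarrow> 0" by (simp add: LIM_zero tendsto_norm_zero)
  thus ?thesis by (intro bexI[of _ "i L"]) (auto simp: nrm)
 qed
 have "Metric_space.mcomplete (car) (hdist H)" by (rule mcomplete_hdistI[OF sep lim])
 then interpret hilbert_space H by unfold_locales (auto simp: algebra_simps)
 interpret M: Metric_space "car" "hdist H" by (rule Metric_space_hdist)
 let ?sg = "%(s :: 'g) x. x :: 'h"
 have "unitary_rep H ?sg"
  unfolding unitary_rep_def hunitary_def hlinear_def htopology_def
  using hilbert_space_axioms by (auto simp del: sel simp: inner_simps)
 moreover have "V = {hzero H} \<or> V = car" if V: "hsubspace H V" for V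
 proof (cases "V \<subseteq> {hzero H}")
  case False
  then obtain v where v: "v : V" "v ~= i 0" by auto
  have "k v ~= 0" using v V by (auto simp: hsubspace_def)
  hence "i z = hscale H (z / k v) v" for z by simp
  hence "i z : V" for z using V v(1) unfolding hsubspace_def by metis
  thus ?thesis using V by (auto simp: hsubspace_def)
 qed (use V in "auto simp: hsubspace_def")
 moreover have "hfinite_dim H"
  unfolding hfinite_dim_def
 proof (intro exI conjI)
  show "hsubspace H hull {i 1} = car"
  proof (rule antisym)
   show "hsubspace H hull {i 1} \<subseteq> car" by (rule hull_minimal) (auto simp: hsubspace_def)
   have "i z : t" if "hsubspace H t" "i 1 : t" for z t
   proof -
    have "hscale H z (i 1) : t" using that unfolding hsubspace_def by blast
    thus ?thesis by simp
   qed
   thus "car \<subseteq> hsubspace H hull {i 1}" by (auto simp: hull_def)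
  qed
 qed auto
 moreover have "i 1 : car" "i 1 ~= hzero H" using inj_eq[OF assms, of 1 0] by simp_all
 hence "car ~= {hzero H}" by blast
 ultimately have "(H, ?sg) : fd_irreps" by (auto simp: fd_irreps_def irreducible_rep_def)
 thus ?thesis by blast
qed

section \<open>The equivalences\<close>

lemma dual_algebra_iso_refl: "dual_algebra_iso X X"
 unfolding dual_algebra_iso_def by (rule exI[of _ id]) (auto simp: bij_betw_def)

lemma cp_iso_refl: "cp_iso S S"
 unfolding cp_iso_def cp_hom_def by (rule exI[of _ id]) simp

context haar
begin

abbreviation Er :: "'g fn set" where
 "Er \<equiv> reduced_eberlein \<mu>"

sublocale B: fspace "BG :: 'g fn set"
 by unfold_locales (use const_in_BG[of 0] in
  \<open>auto intro: BG_add BG_scale BG_bounded BG_left_translate BG_right_translate\<close>)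

lemma zero_in_Br: "(%_. 0) : Br"
 by (rule BrI) (use const_in_BG[of 0] in "auto simp: cstar_pairing_def")

lemma fspace_Br: "fspace Br"
 by unfold_locales (use Br_lincomb zero_in_Br Br_left_translate Br_right_translate subsetD[OF Br_subset] BG_bounded in blast)+

sublocale E: fspace "eberlein :: 'g fn set"
 unfolding eberlein_def by (rule B.fspace_uniform_closure)

sublocale Er: fspace Er
 unfolding reduced_eberlein_def by (rule fspace.fspace_uniform_closure[OF fspace_Br])

lemma Er_mult: "f : Er ==> g : Er ==> (%t. f t * g t) : Er"
 unfolding reduced_eberlein_def
 by (rule uniform_closure_mult[OF Br_mult]) (use fspace.X_bounded[OF fspace_Br] in auto)

lemma Er_cnj: "f : Er ==> (%t. cnj (f t)) : Er"
 unfolding reduced_eberlein_def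
 by (rule uniform_closure_map[of f Br "%f t. cnj (f t)"]) (simp_all add: Br_cnj flip: complex_cnj_diff)

lemma one_in_E: "(%_. 1) : (eberlein :: 'g fn set)"
 unfolding eberlein_def using const_in_BG uniform_closure_subset by blast

lemma coefficient_in_B:
 assumes "unitary_rep H \<pi>" "x : hcarrier H" "y : hcarrier H"
 shows "coefficient H \<pi> x y : (BG :: 'g fn set)"
 using subsetD[OF F_space_subset_BG[OF assms(1)], OF subsetD[OF _ cspan_single]] assms
 unfolding F_space_def by blast

lemma amenable_iff: "amenable \<mu> \<longleftrightarrow> (%_. 1) : Br"
 using amenable_if_one_in_Br one_in_Br_if_amenable by blast

lemma Er_eq_E: "amenable \<mu> ==> Er = eberlein"
 unfolding amenable_iff reduced_eberlein_def eberlein_def by (drule Br_eq_BG) simp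

lemma amenable_if_near_one:
 assumes u: "u : Er" "!!t. cmod (u t - 1) <= 1/4"
 shows "amenable \<mu>"
proof -
 obtain g where g: "g : Br" "!!t. cmod (u t - g t) < 1/4"
  using u(1) unfolding reduced_eberlein_def uniform_closure_iff by (meson zero_less_divide_1_iff zero_less_numeral)
 have "cmod (g t - 1) <= 1/2" for t
  using norm_triangle_ineq4[of "u t - 1" "u t - g t"] u(2)[of t] g(2)[of t] by simp
 thus ?thesis unfolding amenable_iff by (rule one_in_Br_if_near_one[OF g(1)])
qed

lemma amenable_if_one_in_Er: "(%_. 1) : Er ==> amenable \<mu>"
 by (rule amenable_if_near_one) auto

text \<open>Fell's principle makes \<open>Br\<close> a subalgebra, and it is closed under
  conjugation, so generating an algebra from it adds nothing before the uniform closure.\<close>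

lemma weak_eberlein_L2: "weak_eberlein \<mu> (L2 \<mu>) (left_regular \<mu>) = Er"
proof -
 let ?S = "{%t. u t + cnj (v t) | u v. u : Br & v : Br}"
 have lc: "(%t. u t + v t) : Br" "(%t. a * u t) : Br" if "u : Br" "v : Br" for u v a
  using Br_lincomb[OF that, of 1 1] Br_lincomb[OF that, of a 0] by simp_all
 have "fun_subalgebra hull ?S = Br"
 proof (rule antisym)
  show "fun_subalgebra hull ?S \<subseteq> Br"
   by (rule hull_minimal) (auto simp: fun_subalgebra_def zero_in_Br Br_mult intro: lc Br_cnj)
  have "u : ?S" if "u : Br" for u using that zero_in_Br by (intro CollectI exI[of _ u] exI[of _ "%_. 0"]) auto
  thus "Br \<subseteq> fun_subalgebra hull ?S" by (blast intro: hull_inc)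
 qed
 thus ?thesis unfolding weak_eberlein_def reduced_eberlein_def by simp
qed

lemma we_contained_if_amenable: "amenable \<mu> ==> unitary_rep H \<pi> ==> we_contained \<mu> H \<pi> (L2 \<mu>) (left_regular \<mu>)"
 unfolding we_contained_def weak_eberlein_L2
 using F_space_subset_BG[of H \<pi>] uniform_closure_subset Er_eq_E unfolding eberlein_def by blast

text \<open>Over an orthonormal basis the squared moduli of the coefficients of one orbit add up to
  the constant \<open>(hn x)^2\<close>, so a nonzero constant lies in \<open>Er\<close>.\<close>

lemma amenable_if_we_contained:
 assumes s: "(H, sg) : fd_irreps" and we: "we_contained \<mu> H sg (L2 \<mu>) (left_regular \<mu>)"
 shows "amenable \<mu>"
proof -
 have irr: "irreducible_rep H sg" "hfinite_dim H" using s by (auto simp: fd_irreps_def)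
 interpret urep H sg by unfold_locales (use irr in "simp add: irreducible_rep_def")
 obtain x where x: "x : car" "x ~= hzero H" using irr(1) zero_closed unfolding irreducible_rep_def by blast
 obtain E where E: "finite E" "E \<subseteq> car" "!!x. x : car ==> (SUM e:E. (cmod (inn x e))^2) = (hn x)^2"
  by (rule orthonormal_basis[OF irr(2)]) blast
 have co: "coefficient H sg x e : Er" if "e : E" for e
 proof -
  have "coefficient H sg x e : F_space H sg" unfolding F_space_def using x(1) that E(2) by (intro cspan_single) blast
  thus ?thesis using we unfolding we_contained_def weak_eberlein_L2 by blast
 qed
 have "finite A ==> A \<subseteq> E ==> (%t. SUM e:A. coefficient H sg x e t * cnj (coefficient H sg x e t)) : Er" for A
 proof (induction A rule: finite_induct)
  case (insert e A)
  hence IH: "(%t. SUM e:A. coefficient H sg x e t * cnj (coefficient H sg x e t)) : Er" and e: "coefficient H sg x e : Er" using co by auto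
  from Er.X_lin[OF Er_mult[OF e Er_cnj[OF e]] IH, of 1 1] insert.hyps show ?case by simp
 qed (simp add: Er.X_zero)
 from this[OF E(1) subset_refl] have "(%t. SUM e:E. coefficient H sg x e t * cnj (coefficient H sg x e t)) : Er" .
 moreover have "(SUM e:E. coefficient H sg x e t * cnj (coefficient H sg x e t)) = of_real ((hn x)^2)" for t
  using E(3)[OF rep_closed[OF x(1)], of t] rep_norm[OF x(1), of t]
  by (simp add: coefficient_def complex_norm_square[symmetric] flip: of_real_power of_real_sum)
 ultimately have "(%t. of_real ((hn x)^2)) : Er" by simp
 moreover have "hn x ~= 0" using hnorm_eq_0[OF x(1)] x(2) by blast
 ultimately have "(%t. 1) : Er"
  using Er.X_lin[of "%t. of_real ((hn x)^2)" "%t. of_real ((hn x)^2)" "of_real (1 / (hn x)^2)" 0]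
  by (simp flip: of_real_mult)
 thus ?thesis by (rule amenable_if_one_in_Er)
qed

text \<open>A basic neighbourhood of 0 that misses the group is given by finitely many functions, of
  which at every point one is at least \<open>e\<close> in modulus. The sum \<open>p\<close> of
  their squared moduli is thus bounded below, and 1 is approximated by polynomials in
  \<open>p\<close>.\<close>

lemma amenable_if_zero_isolated:
 assumes "restrict (%_. 0) Er ~: Er.cpt"
 shows "amenable \<mu>"
proof -
 obtain F e where F: "finite F" "F \<subseteq> Er" "e > 0" and no: "~ (EX t. ALL f:F. cmod (f t - restrict (%_. 0) Er f) < e)"
  using assms Er.zero_in_dual unfolding Er.in_cpt_iff by meson
 have F4: "EX f:F. e <= cmod (f t)" for t
 proof -
  obtain f where "f : F" "~ cmod (f t - restrict (%_. 0) Er f) < e" using no by meson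
  with F(2) show ?thesis by (intro bexI[of _ f]) (auto simp: subset_iff)
 qed
 define p where "p t = (SUM f:F. (cmod (f t))^2)" for t
 have pE: "(%t. of_real (p t)) : Er"
 proof -
  have "finite A ==> A \<subseteq> F ==> (%t. SUM f:A. f t * cnj (f t)) : Er" for A
  proof (induction A rule: finite_induct)
   case (insert f A)
   hence IH: "(%t. SUM f:A. f t * cnj (f t)) : Er" and f: "f : Er" using F(2) by auto
   from Er.X_lin[OF Er_mult[OF f Er_cnj[OF f]] IH, of 1 1] insert.hyps show ?case by simp
  qed (simp add: Er.X_zero)
  from this[OF F(1) subset_refl] show ?thesis by (simp add: p_def complex_norm_square[symmetric])
 qed
 have pe: "e^2 <= p t" for t
 proof -
  obtain f where f: "f : F" "e <= cmod (f t)" using F4 by blast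
  have "e^2 <= (cmod (f t))^2" using f(2) F(3) by (intro power_mono) auto
  also have "... <= p t" unfolding p_def by (rule member_le_sum[OF f(1)]) (use F(1) in auto)
  finally show ?thesis .
 qed
 obtain M where M: "!!t. p t <= M"
  using Er.X_bounded[OF pE] by (auto simp: abs_le_iff)
 have e2: "0 < e^2" using F(3) by simp
 have M0: "M > 0" using e2 pe[of 0] M[of 0] by linarith
 define q where "q = 1 - e^2 / M"
 have "e^2 <= M" using pe[of 0] M[of 0] by linarith
 hence q: "0 <= q" "q < 1" using e2 M0 by (auto simp: q_def)
 \<comment> \<open>Polynomials in \<open>p\<close> without constant term, so they stay in
   \<open>Er\<close> although 1 is not known to be there; they tend to 1 uniformly because
   \<open>1 - p / M\<close> has values in \<open>[0, q]\<close>.\<close>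
 define g where "g n t = 1 - complex_of_real ((1 - p t / M) ^ n)" for n :: nat and t
 have "g n : Er" for n
 proof (induction n)
  case 0
  thus ?case by (simp add: g_def Er.X_zero)
 next
  case (Suc n)
  have eq: "g (Suc n) = (%t. 1 * (1 * g n t + of_real (1 / M) * of_real (p t)) + of_real (- 1 / M) * (of_real (p t) * g n t))"
   by (rule ext) (simp add: g_def algebra_simps)
  show ?case unfolding eq by (intro Er.X_lin Er_mult pE Suc)
 qed
 moreover obtain n where n: "q ^ n < 1/4" using real_arch_pow_inv[of "1/4" q] q by auto
 have "cmod (g n t - 1) <= 1/4" for t
 proof -
  have "0 <= 1 - p t / M" "1 - p t / M <= q" using M[of t] pe[of t] M0 by (auto simp: q_def divide_right_mono)
  hence "\<bar>(1 - p t / M) ^ n\<bar> <= q ^ n" by (simp add: power_mono)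
  thus ?thesis using n unfolding g_def by (simp del: of_real_power of_real_diff of_real_divide)
 qed
 ultimately show ?thesis by (rule amenable_if_near_one)
qed

lemma arens_zero: "arens Er (restrict (%_. 0) Er) (evaluation Er s) = restrict (%_. 0) Er"
 by (rule Er.dual_eqI) (auto simp: Er.arens_evaluation Er.X_right Er.zero_in_dual Er.arens_evaluation_in_dual)

text \<open>Applied to point evaluations, multiplicativity makes the representing \<open>f\<close> a
  homomorphism, and boundedness makes it unimodular. A continuous unimodular character belongs to
  B(G), and so does its conjugate; multiplying a near element of \<open>Br\<close> by the conjugate
  stays in \<open>Br\<close> and comes near 1.\<close>

lemma amenable_if_character:
 assumes omega: "dual_character Er omega" "continuous_map (dual_weak_star Er) euclidean omega"
 shows "amenable \<mu>"
proof -
 obtain f where f: "f : Er" "!!m. m : dual_space Er ==> omega m = m f"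
  using Er.weak_star_functional[OF omega(2)] omega(1) unfolding dual_character_def by blast
 have mult: "f (s + t) = f s * f t" for s t
 proof -
  let ?s = "evaluation Er s" and ?t = "evaluation Er t"
  have "omega (arens Er ?s ?t) = omega ?s * omega ?t"
   using omega(1) Er.evaluation_in_dual unfolding dual_character_def by blast
  thus ?thesis
   using f(1) by (simp add: f(2) Er.evaluation_in_dual Er.arens_evaluation_in_dual Er.arens_evaluation Er.X_right)
 qed
 obtain m where m: "m : dual_space Er" "omega m ~= 0" using omega(1) unfolding dual_character_def by blast
 have "f 0 ~= 0"
 proof
  assume "f 0 = 0"
  hence "f = (%_. 0)" using mult[of 0] by (auto simp: fun_eq_iff)
  thus False using m f Er.dual_lin[OF m(1) Er.X_zero Er.X_zero, of 0 0] by simp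
 qed
 hence f0: "f 0 = 1" using mult[of 0 0] by simp
 obtain B where B: "!!t. cmod (f t) <= B" using Er.X_bounded[OF f(1)] by blast
 have le: "cmod (f s) <= 1" for s
 proof (rule ccontr)
  assume "~ ?thesis"
  then obtain n where n: "B < cmod (f s) ^ n" using real_arch_pow[of "cmod (f s)" B] by auto
  have "f (((+) s ^^ n) 0) = f s ^ n" by (induction n) (auto simp: mult f0)
  thus False using B[of "((+) s ^^ n) 0"] n by (simp add: norm_power)
 qed
 have n1: "cmod (f s) = 1" for s
 proof -
  have "cmod (f s) * cmod (f (- s)) = 1" using mult[of s "- s"] f0 by (simp flip: norm_mult)
  moreover have "cmod (f s) * cmod (f (- s)) <= cmod (f s) * 1" by (rule mult_left_mono[OF le]) simp
  ultimately show ?thesis using le[of s] by simp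
 qed
 obtain u where u: "!!n::nat. u n : Br" "uniform_limit UNIV u f sequentially"
  using f(1) unfolding reduced_eberlein_def uniform_closure_def by blast
 have "cont f"
  by (rule uniform_limit_theorem[OF always_eventually u(2)])
   (use u(1) in "auto intro: BG_continuous subsetD[OF Br_subset]")
 hence fb: "f : coef_ball" by (intro coef_ball_character mult n1)
 obtain g where g: "g : Br" "!!t. cmod (f t - g t) < 1/4"
  using f(1) unfolding reduced_eberlein_def uniform_closure_iff by (meson zero_less_divide_1_iff zero_less_numeral)
 have "(%s. cnj (f s) * g s) : Br"
  by (rule Br_ideal[OF BG_cnj[OF coef_ball_in_BG[OF fb]] g(1)])
 hence "(%s. cnj (f s) * g s) : Er" unfolding reduced_eberlein_def using uniform_closure_subset by blast
 moreover have "cmod (cnj (f t) * g t - 1) <= 1/4" for t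
 proof -
  have "cnj (f t) * f t = 1" using n1[of t] complex_norm_square[of "f t"] by (simp add: mult.commute)
  hence "cnj (f t) * g t - 1 = cnj (f t) * (g t - f t)" by (simp add: right_diff_distrib)
  thus ?thesis using g(2)[of t] n1[of t] by (simp add: norm_mult norm_minus_commute)
 qed
 ultimately show ?thesis by (rule amenable_if_near_one)
qed

text \<open>On the dual of \<open>eberlein\<close>, evaluation at the constant 1 is a weak*
  continuous character; it is pulled back along the isomorphism.\<close>

lemma character_if_iso:
 assumes "dual_algebra_iso Er (eberlein :: 'g fn set)"
 shows "EX omega. dual_character Er omega & continuous_map (dual_weak_star Er) euclidean omega"
proof -
 let ?E = "eberlein :: 'g fn set"
 obtain Phi where Phi: "bij_betw Phi (dual_space Er) (dual_space ?E)"
  "!!m n a b. m : dual_space Er ==> n : dual_space Er ==> Phi (dual_lincomb Er a m b n) = dual_lincomb ?E a (Phi m) b (Phi n)"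
  "!!m n. m : dual_space Er ==> n : dual_space Er ==> Phi (arens Er m n) = arens ?E (Phi m) (Phi n)"
  "homeomorphic_map (dual_weak_star Er) (dual_weak_star ?E) Phi"
  using assms unfolding dual_algebra_iso_def by blast
 let ?omega = "%m. Phi m (%_. 1)"
 have d: "Phi m : dual_space ?E" if "m : dual_space Er" for m using Phi(1) that by (auto simp: bij_betw_def)
 have "dual_character Er ?omega"
  unfolding dual_character_def
 proof (intro conjI ballI allI)
  fix m n assume mn: "m : dual_space Er" "n : dual_space Er"
  show "?omega (dual_lincomb Er a m b n) = a * ?omega m + b * ?omega n" for a b
   unfolding Phi(2)[OF mn] using one_in_E by (simp add: dual_lincomb_def)
  show "?omega (arens Er m n) = ?omega m * ?omega n"
   unfolding Phi(3)[OF mn] using one_in_E E.dual_lin[OF d[OF mn(1)] one_in_E one_in_E, of "?omega n" 0]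
   by (simp add: arens_def mult.commute)
 next
  obtain m where "m : dual_space Er" "Phi m = evaluation ?E 0"
   using Phi(1) E.evaluation_in_dual[of 0] unfolding bij_betw_def by (metis imageE)
  thus "EX m:dual_space Er. ?omega m ~= 0" using one_in_E by (intro bexI[of _ m]) simp_all
 qed
 moreover have "continuous_map (dual_weak_star Er) euclidean ?omega"
 proof -
  have "continuous_map (dual_weak_star ?E) euclidean (%m. m (%_. 1))"
   unfolding dual_weak_star_def by (rule continuous_map_initial_topology) (use one_in_E in blast)
  from continuous_map_compose[OF homeomorphic_imp_continuous_map[OF Phi(4)] this] show ?thesis by (simp add: o_def)
 qed
 ultimately show ?thesis by (intro exI conjI)
qed

section \<open>Morphisms of compactifications\<close>

lemma no_invariant_limit:
 assumes s: "(H, sg) : fd_irreps_nontriv"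
  and lim: "!!P e. finite P ==> P \<subseteq> hcarrier H \<times> hcarrier H ==> e > 0 ==>
   EX t::'g. ALL p:P. cmod (coefficient H sg (fst p) (snd p) t - B (fst p) (snd p)) < e"
  and inv: "!!x y s. x : hcarrier H ==> y : hcarrier H ==> B (sg s x) y = B x y"
 shows False
proof -
 have irr: "irreducible_rep H sg" "hfinite_dim H" "~ rep_equiv H sg complex_hspace trivial_rep"
  using s by (auto simp: fd_irreps_def fd_irreps_nontriv_def)
 interpret urep H sg by unfold_locales (use irr in "simp add: irreducible_rep_def")
 have "sg s x = x" if "x : car" for s x by (rule trivial_if_invariant_limit[OF irr(2) lim inv that])
 from trivial_irreducible[OF irr(1) this] irr(3) show False by blast
qed

text \<open>The morphism starts at the larger compactification, so 0 is pulled back rather than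
  pushed forward: its preimage \<zeta> absorbs the group by injectivity and provides the invariant
  limit of the coefficients.\<close>

lemma amenable_if_cp_iso:
 assumes s: "(H, sg :: 'g => _) : fd_irreps_nontriv"
  and iso: "cp_iso (evaluation_compactification Er) (evaluation_compactification (eberlein :: 'g fn set))"
 shows "amenable \<mu>"
proof (rule ccontr)
 let ?E = "eberlein :: 'g fn set" and ?z = "restrict (%_. 0) Er"
 assume "~ amenable \<mu>"
 hence z: "?z : Er.cpt" using amenable_if_zero_isolated by blast
 let ?T = "subtopology (dual_weak_star ?E) E.cpt" and ?S = "subtopology (dual_weak_star Er) Er.cpt"
 obtain theta where theta: "homeomorphic_map ?T ?S theta" "!!s. theta (evaluation ?E s) = evaluation Er s"
  "!!x y. x : topspace ?T ==> y : topspace ?T ==> theta (arens ?E x y) = arens Er (theta x) (theta y)"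
  using iso unfolding cp_iso_def cp_hom_def by (auto simp: evaluation_compactification_def)
 have top: "topspace ?T = E.cpt" "topspace ?S = Er.cpt"
  using closure_of_subset_topspace[of "dual_weak_star ?E"] closure_of_subset_topspace[of "dual_weak_star Er"] by auto
 have evE: "evaluation ?E s : E.cpt" for s using E.evaluation_in_dual by (auto simp: E.in_cpt_iff subset_iff intro!: exI[of _ s])
 have "?z : theta ` E.cpt" using homeomorphic_imp_surjective_map[OF theta(1)] z unfolding top by simp
 then obtain \<zeta> where z': "?z = theta \<zeta>" and \<zeta>1: "\<zeta> : E.cpt" by (rule imageE)
 note \<zeta> = \<zeta>1 z'[symmetric]
 \<comment> \<open>Both sides have image 0 under \<open>theta\<close>, by
   \<open>arens_zero\<close>.\<close>
 have inv: "arens ?E \<zeta> (evaluation ?E s) = \<zeta>" for s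
 proof (rule inj_onD[OF homeomorphic_imp_injective_map[OF theta(1)], unfolded top])
  show "theta (arens ?E \<zeta> (evaluation ?E s)) = theta \<zeta>" using theta(3)[unfolded top, OF \<zeta>(1) evE] by (simp add: \<zeta>(2) theta(2) arens_zero)
 qed (use \<zeta>(1) E.arens_evaluation_in_cpt in auto)
 have ur: "unitary_rep H sg" using s by (auto simp: fd_irreps_nontriv_def fd_irreps_def irreducible_rep_def)
 interpret urep H sg by unfold_locales (rule ur)
 have cE: "coefficient H sg x y : ?E" if "x : car" "y : car" for x y
  using coefficient_in_B[OF ur that] uniform_closure_subset unfolding eberlein_def by blast
 show False
 proof (rule no_invariant_limit[OF s, of "%x y. \<zeta> (coefficient H sg x y)"])
  fix P and e :: real assume P: "finite P" "P \<subseteq> car \<times> car" "e > 0"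
  have "(%p. coefficient H sg (fst p) (snd p)) ` P \<subseteq> ?E" using P(2) cE by auto
  thus "EX t. ALL p:P. cmod (coefficient H sg (fst p) (snd p) t - \<zeta> (coefficient H sg (fst p) (snd p))) < e"
   using \<zeta>(1) P(1,3) unfolding E.in_cpt_iff by (force dest: spec[of _ "(%p. coefficient H sg (fst p) (snd p)) ` P"])
 next
  fix x y s assume xy: "x : car" "y : car"
  have "coefficient H sg (sg s x) y = (%t. coefficient H sg x y (t + s))" using rep_mult[OF xy(1)] by (simp add: coefficient_def)
  thus "\<zeta> (coefficient H sg (sg s x) y) = \<zeta> (coefficient H sg x y)"
   using E.arens_evaluation[OF cE[OF xy], of \<zeta> s] inv by simp
 qed
qed

lemma in_ops_closure:
 assumes H: "hilbert_space H" and z: "z : ops_weak_star H closure_of range (%s. restrict (sg s) (hcarrier H))"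
  and P: "finite P" "P \<subseteq> hcarrier H \<times> hcarrier H" "e > 0"
 shows "EX t::'g. ALL p:P. cmod (coefficient H sg (fst p) (snd p) t - hinner H (z (fst p)) (snd p)) < e"
proof -
 interpret hilbert_space H by (rule H)
 define Phi where "Phi = {%T. \<Sum>n. inn (T (x n)) (y n) | (x :: nat => _) (y :: nat => _).
    range x \<subseteq> car & range y \<subseteq> car &
    summable (%n. (hn (x n))^2) & summable (%n. (hn (y n))^2)}"
 \<comment> \<open>Sequences concentrated at index 0 reduce the trace class functionals to single
   matrix coefficients.\<close>
 define g where "g p = (%T. \<Sum>n::nat. inn (T (if n = 0 then fst p else hzero H)) (if n = 0 then snd p else hzero H))" for p
 have g: "g p : Phi" "!!T. T : bounded_ops H ==> g p T = inn (T (fst p)) (snd p)"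
  if p: "fst p : car" "snd p : car" for p
 proof -
  have s: "summable (%n. (hn (if n = 0 then x else hzero H))^2)" for x
   by (rule summable_finite[of "{0}"]) (auto simp: hnorm_def inner_zero zero_closed)
  show "g p : Phi" unfolding g_def Phi_def
   by (intro CollectI exI[of _ "%n. if n = 0 then fst p else hzero H"] exI[of _ "%n. if n = 0 then snd p else hzero H"])
    (use p s zero_closed in auto)
  fix T assume "T : bounded_ops H"
  hence "T (hzero H) : car" using zero_closed by (auto simp: bounded_ops_def hlinear_def)
  hence "g p T = (SUM n:{0::nat}. inn (T (if n = 0 then fst p else hzero H)) (if n = 0 then snd p else hzero H))"
   unfolding g_def by (intro suminf_finite) (auto simp: inner_zero)
  thus "g p T = inn (T (fst p)) (snd p)" by simp
 qed
 have "z : initial_topology (bounded_ops H) Phi closure_of range (%s. restrict (sg s) (car))"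
  using z unfolding ops_weak_star_def Phi_def .
 note cl = this[unfolded in_closure_of_initial_topology]
 have "finite (g ` P) & g ` P \<subseteq> Phi & e > 0" using P g(1) by (auto simp: subset_iff mem_Times_iff)
 from conjunct2[OF cl, rule_format, OF this]
 obtain t where t: "restrict (sg t) (car) : bounded_ops H"
  "ALL phi:g ` P. cmod (phi (restrict (sg t) (car)) - phi z) < e" by auto
 have "cmod (coefficient H sg (fst p) (snd p) t - inn (z (fst p)) (snd p)) < e" if p: "p : P" for p
 proof -
  have pH: "fst p : car" "snd p : car" using P(2) p by auto
  show ?thesis using bspec[OF t(2) imageI[OF p]] pH by (simp add: g(2)[OF pH] t(1) conjunct1[OF cl] coefficient_def)
 qed
 thus ?thesis by blast
qed

text \<open>If 0 belongs to the compactification, it absorbs evaluations, so its image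
  \<open>theta ?z\<close> satisfies \<open>theta ?z (sg s x) = theta ?z x\<close>; being a limit of
  the operators of the group, it gives an invariant limit of coefficients.\<close>

lemma amenable_if_cp_le:
 assumes s: "(H, sg :: 'g => _) : fd_irreps_nontriv"
  and le: "cp_le (rep_compactification H sg) (evaluation_compactification Er)"
 shows "amenable \<mu>"
proof (rule ccontr)
 let ?z = "restrict (%_. 0) Er" and ?r = "%s. restrict (sg s) (hcarrier H)"
 assume "~ amenable \<mu>"
 hence z: "?z : Er.cpt" using amenable_if_zero_isolated by blast
 let ?S = "subtopology (dual_weak_star Er) Er.cpt" and ?O = "ops_weak_star H closure_of range ?r"
 obtain theta where theta: "continuous_map ?S (subtopology (ops_weak_star H) ?O) theta" "!!s. theta (evaluation Er s) = ?r s"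
  "!!x y. x : topspace ?S ==> y : topspace ?S ==> theta (arens Er x y) = compose (hcarrier H) (theta x) (theta y)"
  using le unfolding cp_le_def cp_hom_def by (auto simp: evaluation_compactification_def rep_compactification_def Let_def)
 have top: "topspace ?S = Er.cpt" using closure_of_subset_topspace[of "dual_weak_star Er"] by auto
 have ev: "evaluation Er s : Er.cpt" for s using Er.evaluation_in_dual by (auto simp: Er.in_cpt_iff subset_iff intro!: exI[of _ s])
 have zO: "theta ?z : ?O" using theta(1) z unfolding continuous_map_in_subtopology top by auto
 have ur: "unitary_rep H sg" using s by (auto simp: fd_irreps_nontriv_def fd_irreps_def irreducible_rep_def)
 interpret urep H sg by unfold_locales (rule ur)
 show False
 proof (rule no_invariant_limit[OF s, of "%x y. inn (theta ?z x) y"])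
  show "EX t. ALL p:P. cmod (coefficient H sg (fst p) (snd p) t - inn (theta ?z (fst p)) (snd p)) < e"
   if "finite P" "P \<subseteq> car \<times> car" "e > 0" for P e
   by (rule in_ops_closure[OF hilbert_space_axioms zO that])
  fix x y s assume xy: "x : car" "y : car"
  have "theta ?z = compose (car) (theta ?z) (?r s)"
   using theta(3)[unfolded top, OF z ev[of s]] by (simp only: arens_zero theta(2))
  hence "theta ?z x = compose (car) (theta ?z) (?r s) x" by simp
  thus "inn (theta ?z (sg s x)) y = inn (theta ?z x) y" using xy by (simp add: compose_eq)
 qed
qed

text \<open>The operator with matrix coefficients \<open>n(\<langle>\<pi>(\<cdot>)x|y\<rangle>)\<close> exists by Riesz; this is the morphism onto \<open>G\<^sup>\<pi>\<close>.\<close>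

lemma cp_le_eberlein:
 assumes ur: "unitary_rep H (\<pi> :: 'g => _)"
 shows "cp_le (rep_compactification H \<pi>) (evaluation_compactification (eberlein :: 'g fn set))"
proof -
 let ?E = "eberlein :: 'g fn set" and ?C = "hcarrier H" and ?r = "%s. restrict (\<pi> s) (hcarrier H)"
 interpret urep H \<pi> by unfold_locales (rule ur)
 let ?c = "cf"
 have cE: "?c x y : ?E" if "x : ?C" "y : ?C" for x y
  using coefficient_in_B[OF ur that] uniform_closure_subset unfolding eberlein_def by blast
 have ladd: "?c (hadd H x x') y = (%t. 1 * ?c x y t + 1 * ?c x' y t)" "?c y (hadd H x x') = (%t. 1 * ?c y x t + 1 * ?c y x' t)"
  "?c (hscale H a x) y = (%t. a * ?c x y t + 0 * ?c x y t)" "?c y (hscale H a x) = (%t. cnj a * ?c y x t + 0 * ?c y x t)"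
  if "x : ?C" "x' : ?C" "y : ?C" for x x' y a
  using that by (simp_all add: coefficient_def fun_eq_iff rep_add rep_scale inner_simps rep_closed)
 have ex: "EX v:?C. ALL y:?C. n (?c x y) = inn v y" if n: "n : dual_space ?E" and x: "x : ?C" for n x
 proof -
  obtain K where K: "K >= 0" "!!f B. f : ?E ==> (!!t. cmod (f t) <= B) ==> cmod (n f) <= K * B"
   by (rule E.dual_bound[OF n]) blast
  note L = E.dual_lin[OF n cE[OF x] cE[OF x]]
  have "EX v:?C. ALL y:?C. cnj (n (?c x y)) = inn y v"
  proof (rule Riesz[of _ "K * hn x"])
   fix y z a assume y: "y : ?C"
   show "cnj (n (?c x (hscale H a y))) = a * cnj (n (?c x y))" unfolding ladd(4)[OF y y x] L[OF y y] by simp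
   show "cmod (cnj (n (?c x y))) <= K * hn x * hn y"
    using K(2)[OF cE[OF x y] coefficient_bound[OF x y]] by (simp add: mult.assoc)
   assume z: "z : ?C"
   show "cnj (n (?c x (hadd H y z))) = cnj (n (?c x y)) + cnj (n (?c x z))" unfolding ladd(2)[OF y z x] L[OF y z] by simp
  qed
  then obtain v where v: "v : ?C" "!!y. y : ?C ==> cnj (n (?c x y)) = inn y v" by blast
  have "n (?c x y) = inn v y" if "y : ?C" for y
   using v(2)[OF that] inner_cnj[OF that v(1)] by (metis complex_cnj_cnj)
  thus ?thesis using v(1) by blast
 qed
 \<comment> \<open>The choice is forced by \<open>eq_if_inner_eq\<close>; the restriction to the
   carrier makes the operator extensional, as elements of \<open>bounded_ops\<close> must
   be.\<close>
 define psi where "psi n = restrict (%x. SOME v. v : ?C & (ALL y:?C. n (?c x y) = inn v y)) ?C" for n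
 have psiI: "psi n x = v" if "x : ?C" "v : ?C" "!!y. y : ?C ==> n (?c x y) = inn v y" for n x v
  unfolding psi_def restrict_apply'[OF that(1)] by (rule some_equality) (use that eq_if_inner_eq in auto)
 have psi: "psi n x : ?C" "!!y. y : ?C ==> inn (psi n x) y = n (?c x y)" if n: "n : dual_space ?E" and x: "x : ?C" for n x
  using ex[OF n x] psiI[OF x] by auto
 have ext: "psi n : extensional ?C" for n by (simp add: psi_def)
 have eq: "S = T" if "S : extensional ?C" "T : extensional ?C" "!!x. x : ?C ==> S x : ?C" "!!x. x : ?C ==> T x : ?C"
  "!!x y. x : ?C ==> y : ?C ==> inn (S x) y = inn (T x) y" for S T
  by (rule extensionalityI[OF that(1,2)]) (rule eq_if_inner_eq[OF that(3,4,5)])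
 have bo: "psi n : bounded_ops H" if n: "n : dual_space ?E" for n
 proof -
  obtain K where K: "K >= 0" "!!f B. f : ?E ==> (!!t. cmod (f t) <= B) ==> cmod (n f) <= K * B"
   by (rule E.dual_bound[OF n]) blast
  note p = psi(1)[OF n] and q = psi(2)[OF n] and L = E.dual_lin[OF n cE cE]
  have nl: "n (?c (hscale H a x) y) = a * n (?c x y)" "n (?c (hadd H x x') y) = n (?c x y) + n (?c x' y)"
   if "x : ?C" "x' : ?C" "y : ?C" for x x' y a
   unfolding ladd(1,3)[OF that] L[OF that(1,3) that(1,3)] L[OF that(1,3) that(2,3)] by simp_all
  have "hlinear H H (psi n)"
   unfolding hlinear_def
  proof (intro conjI ballI allI p)
   fix x y a assume x: "x : ?C"
   show "psi n (hscale H a x) = hscale H a (psi n x)"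
    by (rule eq_if_inner_eq) (use x in "simp_all add: p q inner_simps nl")
   assume y: "y : ?C"
   show "psi n (hadd H x y) = hadd H (psi n x) (psi n y)"
    by (rule eq_if_inner_eq) (use x y in "simp_all add: p q inner_simps nl")
  qed
  moreover have "hn (psi n x) <= K * hn x" if x: "x : ?C" for x
   using K(2)[OF cE[OF x p[OF x]] coefficient_bound[OF x p[OF x]]] q[OF x p[OF x]] K(1) hnorm_nonneg[OF x]
   by (intro hnorm_le_if_inner_le p x) (simp_all add: mult.assoc)
  ultimately show ?thesis using ext by (auto simp: bounded_ops_def)
 qed
 have ev: "psi (evaluation ?E s) = ?r s" for s
  by (rule eq[OF ext], auto simp: psi E.evaluation_in_dual rep_closed cE) (simp add: coefficient_def)
 have arens: "psi (arens ?E m n) = compose ?C (psi m) (psi n)"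
  if m: "m : dual_space ?E" and n: "n : dual_space ?E" for m n
 proof (rule extensionalityI[OF ext compose_extensional])
  fix x assume x: "x : ?C"
  have val: "arens ?E m n (?c x y) = inn (psi m (psi n x)) y" if y: "y : ?C" for y
  proof -
   have "n (%t. ?c x y (s + t)) = ?c (psi n x) y s" for s
   proof -
    have "(%t. ?c x y (s + t)) = ?c x (\<pi> (- s) y)"
     using x y by (simp add: coefficient_def fun_eq_iff rep_mult rep_adjoint[of _ y s] rep_closed)
    thus ?thesis using psi[OF n x] rep_adjoint[OF psi(1)[OF n x] y, of s] y by (simp add: rep_closed coefficient_def)
   qed
   thus ?thesis using cE[OF x y] y by (simp add: arens_def psi(2)[OF m psi(1)[OF n x]])
  qed
  show "psi (arens ?E m n) x = compose ?C (psi m) (psi n) x"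
   using psiI[OF x psi(1)[OF m psi(1)[OF n x]] val] x by (simp add: compose_eq)
 qed
 let ?S = "subtopology (dual_weak_star ?E) E.cpt" and ?O = "ops_weak_star H closure_of range ?r"
 have cont: "continuous_map (dual_weak_star ?E) (ops_weak_star H) psi"
  unfolding ops_weak_star_def
 proof (rule continuous_map_into_initial_topology)
  show "psi n : bounded_ops H" if "n : topspace (dual_weak_star ?E)" for n using bo that by (simp add: dual_weak_star_def)
  fix phi assume "phi : {%T. \<Sum>n. inn (T (x n)) (y n) | (x :: nat => _) (y :: nat => _).
    range x \<subseteq> ?C & range y \<subseteq> ?C & summable (%n. (hn (x n))^2) & summable (%n. (hn (y n))^2)}"
  then obtain x y :: "nat => _" where xy: "phi = (%T. \<Sum>n. inn (T (x n)) (y n))" "!!n. x n : ?C" "!!n. y n : ?C"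
   "summable (%n. (hn (x n))^2)" "summable (%n. (hn (y n))^2)" by blast
  \<comment> \<open>A trace class functional composed with \<open>psi\<close> is evaluation at the
    series \<open>f\<close> of coefficients. The series converges uniformly, so \<open>f\<close>
    lies in the Eberlein algebra and the evaluation is weak* continuous.\<close>
  define F where "F N t = (\<Sum>n<N. ?c (x n) (y n) t)" for N t
  define f where "f t = (\<Sum>n. ?c (x n) (y n) t)" for t
  have b: "cmod (?c (x n) (y n) t) <= (hn (x n))^2 + (hn (y n))^2" for n t
  proof -
   have "cmod (?c (x n) (y n) t) <= hn (x n) * hn (y n)" by (rule coefficient_bound[OF xy(2,3)])
   also have "... <= (hn (x n))^2 + (hn (y n))^2"
    using sum_squares_bound[of "hn (x n)" "hn (y n)"] mult_nonneg_nonneg[OF hnorm_nonneg[OF xy(2)] hnorm_nonneg[OF xy(3)], of n n] by simp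
   finally show ?thesis .
  qed
  have ul: "uniform_limit UNIV F f sequentially"
   unfolding F_def[abs_def] f_def[abs_def] by (rule Weierstrass_m_test[OF b summable_add[OF xy(4,5)]])
  have FE: "F N : BG" for N
   unfolding F_def[abs_def]
   by (induction N) (auto intro: BG_add coefficient_in_B[OF ur xy(2,3)] const_in_BG)
  have fE: "f : ?E" unfolding eberlein_def uniform_closure_def using FE ul by blast
  have phif: "phi (psi n) = n f" if n: "n : dual_space ?E" for n
  proof -
   obtain K where K: "K >= 0" "!!f B. f : ?E ==> (!!t. cmod (f t) <= B) ==> cmod (n f) <= K * B"
    by (rule E.dual_bound[OF n]) blast
   have FE': "F N : ?E" for N using FE uniform_closure_subset unfolding eberlein_def by blast
   have nF: "n (F N) = (\<Sum>k<N. inn (psi n (x k)) (y k))" for N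
   proof (induction N)
    case 0
    have "F 0 = (%t. 0 * F 0 t + 0 * F 0 t)" by (simp add: F_def fun_eq_iff)
    thus ?case using E.dual_lin[OF n FE' FE', of 0 0 0 0] by simp
   next
    case (Suc N)
    have "F (Suc N) = (%t. 1 * F N t + 1 * ?c (x N) (y N) t)" by (simp add: F_def fun_eq_iff)
    thus ?case using E.dual_lin[OF n FE' cE[OF xy(2,3)], of 1 N 1 N N] Suc by (simp add: psi[OF n xy(2)] xy(3))
   qed
   have "(%N. n (F N)) \<longlonglongrightarrow> n f"
   proof (rule LIMSEQ_I)
    fix e :: real assume e: "e > 0"
    have "e / (K + 1) > 0" using e K(1) by simp
    from uniform_limitD[OF ul this] obtain M where M: "!!N t. N >= M ==> dist (F N t) (f t) < e / (K + 1)"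
     unfolding eventually_sequentially by blast
    have "norm (n (F N) - n f) < e" if "N >= M" for N
    proof -
     have "n (%t. 1 * F N t + - 1 * f t) = n (F N) - n f" using E.dual_lin[OF n FE' fE, of 1 N "- 1"] by simp
     moreover have "cmod (n (%t. 1 * F N t + - 1 * f t)) <= K * (e / (K + 1))"
      by (rule K(2)[OF E.X_lin[OF FE' fE]]) (use less_imp_le[OF M[OF that]] in "simp add: dist_norm")
     moreover have "K * (e / (K + 1)) < (K + 1) * (e / (K + 1))" using e K(1) by (intro mult_strict_right_mono) auto
     ultimately show ?thesis using K(1) by simp
    qed
    thus "EX no. ALL N>=no. norm (n (F N) - n f) < e" by blast
   qed
   hence "(%k. inn (psi n (x k)) (y k)) sums n f" by (simp add: sums_def nF)
   thus ?thesis unfolding xy(1) by (rule sums_unique[symmetric])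
  qed
  have "continuous_map (dual_weak_star ?E) euclidean (%n. n f)"
   unfolding dual_weak_star_def by (rule continuous_map_initial_topology) (use fE in blast)
  thus "continuous_map (dual_weak_star ?E) euclidean (%n. phi (psi n))"
   by (rule continuous_map_eq) (simp add: dual_weak_star_def phif)
 qed
 have top: "topspace ?S = E.cpt" using closure_of_subset_topspace[of "dual_weak_star ?E"] by auto
 have cptD: "m : dual_space ?E" if "m : E.cpt" for m using that by (simp add: E.in_cpt_iff)
 have img: "psi ` E.cpt \<subseteq> ?O"
 proof -
  have "psi ` range (evaluation ?E) = range ?r" using ev by (auto simp: image_image)
  thus ?thesis using continuous_map_image_closure_subset[OF cont, of "range (evaluation ?E)"] by simp
 qed
 have "cp_hom (evaluation_compactification ?E) (rep_compactification H \<pi>) psi"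
  unfolding cp_hom_def evaluation_compactification_def rep_compactification_def Let_def compactification.simps top
 proof (intro conjI ballI allI ev)
  show "continuous_map ?S (subtopology (ops_weak_star H) ?O) psi"
   using continuous_map_from_subtopology[OF cont, of E.cpt] img top by (simp add: continuous_map_in_subtopology image_subset_iff_funcset)
  show "psi (arens ?E m n) = compose ?C (psi m) (psi n)" if "m : E.cpt" "n : E.cpt" for m n
   by (rule arens[OF that[THEN cptD]])
 qed
 thus ?thesis unfolding cp_le_def by blast
qed

end

theorem theorem3p13:
  fixes \<mu> :: "'g::{topological_group_add,t2_space} measure"
  assumes "locally_compact_space (euclidean :: 'g topology)"
    and "left_haar_measure \<mu>"
    and universe: "(UNIV :: ('g \<Rightarrow> complex) set) \<lesssim> (UNIV :: 'h set)"
  shows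
   "(amenable \<mu> \<longleftrightarrow> reduced_eberlein \<mu> = eberlein) \<and>
    (amenable \<mu> \<longleftrightarrow> (\<lambda>t. 1) \<in> reduced_eberlein \<mu>) \<and>
    (amenable \<mu> \<longleftrightarrow> dual_algebra_iso (reduced_eberlein \<mu>) (eberlein :: ('g \<Rightarrow> complex) set)) \<and>
    (amenable \<mu> \<longleftrightarrow>
       (\<exists>\<omega>. dual_character (reduced_eberlein \<mu>) \<omega> \<and>
            continuous_map (dual_weak_star (reduced_eberlein \<mu>)) euclidean \<omega>)) \<and>
    (amenable \<mu> \<longleftrightarrow>
       (\<exists>(H :: 'h hspace, \<sigma>) \<in> fd_irreps. we_contained \<mu> H \<sigma> (L2 \<mu>) (left_regular \<mu>))) \<and>
    (amenable \<mu> \<longleftrightarrow>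
       (\<forall>(H :: 'h hspace) \<pi>. unitary_rep H \<pi> \<longrightarrow> we_contained \<mu> H \<pi> (L2 \<mu>) (left_regular \<mu>))) \<and>
    ((fd_irreps_nontriv :: ('h hspace \<times> ('g \<Rightarrow> 'h \<Rightarrow> 'h)) set) \<noteq> {} \<longrightarrow>
      (amenable \<mu> \<longleftrightarrow>
         (\<exists>(H :: 'h hspace, \<sigma>) \<in> fd_irreps_nontriv.
            cp_le (rep_compactification H \<sigma>)
                  (evaluation_compactification (reduced_eberlein \<mu>)))) \<and>
      (amenable \<mu> \<longleftrightarrow>
         (\<forall>(H :: 'h hspace) \<pi>. unitary_rep H \<pi> \<longrightarrow>
            cp_le (rep_compactification H \<pi>)
                  (evaluation_compactification (reduced_eberlein \<mu>)))) \<and>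
      (amenable \<mu> \<longleftrightarrow>
         cp_iso (evaluation_compactification (reduced_eberlein \<mu>))
                (evaluation_compactification (eberlein :: ('g \<Rightarrow> complex) set))))"
proof -
 interpret haar \<mu> by unfold_locales (fact assms)+
 let ?E = "eberlein :: 'g fn set"
 obtain j :: "'g fn => 'h" where j: "inj j" using universe by (auto simp: lepoll_def)
 \<comment> \<open>Constant functions embed the complex numbers into the carrier type, which yields
   the one-dimensional member of \<open>fd_irreps\<close> that serves as witness.\<close>
 have "inj (%z. j (%_. z))" using j by (auto simp: inj_def fun_eq_iff)
 then obtain K :: "'h hspace" and \<tau> :: "'g => 'h => 'h" where K: "(K, \<tau>) : fd_irreps" using ex_trivial_irreducible by blast
 have fd: "unitary_rep H sg" if "(H, sg) : fd_irreps" for H :: "'h hspace" and sg :: "'g => 'h => 'h"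
  using that by (simp add: fd_irreps_def irreducible_rep_def)
 have nt: "unitary_rep H sg" if "(H, sg) : fd_irreps_nontriv" for H :: "'h hspace" and sg :: "'g => 'h => 'h"
  using that fd by (simp add: fd_irreps_nontriv_def)
 have ii: "amenable \<mu> \<longleftrightarrow> Er = ?E" using Er_eq_E one_in_E amenable_if_one_in_Er by metis
 have iii: "amenable \<mu> \<longleftrightarrow> (%t. 1) : Er" using ii one_in_E amenable_if_one_in_Er by metis
 have v: "amenable \<mu> \<longleftrightarrow> (EX omega. dual_character Er omega & continuous_map (dual_weak_star Er) euclidean omega)"
  and iv: "amenable \<mu> \<longleftrightarrow> dual_algebra_iso Er ?E"
  using ii dual_algebra_iso_refl[of ?E] character_if_iso amenable_if_character by metis+
 have vii: "amenable \<mu> \<longleftrightarrow> (ALL (H :: 'h hspace) \<pi>. unitary_rep H \<pi> --> we_contained \<mu> H \<pi> (L2 \<mu>) (left_regular \<mu>))"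
  using we_contained_if_amenable amenable_if_we_contained[OF K] fd[OF K] by blast
 have vi: "amenable \<mu> \<longleftrightarrow> (EX (H :: 'h hspace, sg) : fd_irreps. we_contained \<mu> H sg (L2 \<mu>) (left_regular \<mu>))"
  using we_contained_if_amenable[OF _ fd[OF K]] amenable_if_we_contained K by (auto simp: Bex_def)
 have rest: "(amenable \<mu> \<longleftrightarrow> (EX (H :: 'h hspace, sg) : fd_irreps_nontriv. cp_le (rep_compactification H sg) (evaluation_compactification Er))) &
   (amenable \<mu> \<longleftrightarrow> (ALL (H :: 'h hspace) \<pi>. unitary_rep H \<pi> --> cp_le (rep_compactification H \<pi>) (evaluation_compactification Er))) &
   (amenable \<mu> \<longleftrightarrow> cp_iso (evaluation_compactification Er) (evaluation_compactification ?E))"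
  if "(fd_irreps_nontriv :: ('h hspace \<times> ('g => 'h => 'h)) set) ~= {}"
 proof -
  from that obtain L :: "'h hspace" and rho :: "'g => 'h => 'h" where L: "(L, rho) : fd_irreps_nontriv" by auto
  have ix: "amenable \<mu> ==> unitary_rep H \<pi> ==> cp_le (rep_compactification H \<pi>) (evaluation_compactification Er)" for H :: "'h hspace" and \<pi>
   using cp_le_eberlein ii by simp
  show ?thesis
  proof (intro conjI iffI allI impI)
   show "amenable \<mu>" if "ALL (H :: 'h hspace) \<pi>. unitary_rep H \<pi> --> cp_le (rep_compactification H \<pi>) (evaluation_compactification Er)"
    using amenable_if_cp_le[OF L] nt[OF L] that by blast
   show "amenable \<mu>" if "EX (H :: 'h hspace, sg) : fd_irreps_nontriv. cp_le (rep_compactification H sg) (evaluation_compactification Er)"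
    using amenable_if_cp_le that by auto
   show "EX (H :: 'h hspace, sg) : fd_irreps_nontriv. cp_le (rep_compactification H sg) (evaluation_compactification Er)" if "amenable \<mu>"
    using ix[OF that nt[OF L]] L by blast
   show "cp_iso (evaluation_compactification Er) (evaluation_compactification ?E)" if "amenable \<mu>"
    using that ii cp_iso_refl by metis
  qed (use ix amenable_if_cp_iso[OF L] in blast)+
 qed
 show ?thesis using ii iii iv v vi vii rest by (intro conjI impI) blast+
qed

end
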